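(* Let $f$ and $\mu_f$ be as in the context. Suppose there are finite subsets $A_1\subset A_2\subset\cdots$ of $\mathbb Z$ with $\bigcup_n A_n=\mathbb Z$. Define $$d_{j,k}:=\frac1{2\sqrt2\,\pi}\int_{[-\pi,\pi]^2}e^{-\mathrm i(jx+ky)}\sqrt{f(x,y)+f(y,x)}\,dx\,dy,\quad j,k\in\mathbb Z.$$ If $\sum_{k,l\in\mathbb Z}d_{k,l}d_{j+k,l}\mathbf 1(k,l,j+k\in A_n)=0$ for all $j\in\mathbb Z\setminus\{0\}$ and all $n\ge1$, then $\mu_f=WSL(2\|f\|_1)$, where $\|f\|_1=\int_{[-\pi,\pi]^2}f$.
   Context: $\{X_{j,k}\}_{j,k\in\mathbb Z}$ is a real mean-zero stationary Gaussian process with positive variance whose spectral measure $\nu$ (defined by $E(X_{0,0}X_{u,v})=\int_{(-\pi,\pi]^2}e^{\mathrm i(ux+vy)}\nu(dx,dy)$) has no continuous singular part, $\nu=\nu_{ac}+\nu_d$, with $\nu_{ac}(dx,dy)=f(x,y)dxdy$. $\mu_f$ is the deterministic weak-in-probability limit of the empirical eigenvalue distribution of $W_N/\sqrt N$, $W_N(i,j)=X_{i,j}+X_{j,i}$, $1\le i,j\le N$. $WSL(\gamma)$ is the Wigner semicircle law with variance $\gamma$, with density $\frac1{2\pi\sqrt\gamma}\sqrt{4-x^2/\gamma}\,\mathbf 1(|x|\le2\sqrt\gamma)$. *)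

theory Defs
  imports "HOL-Probability.Probability" "Jordan_Normal_Form.Char_Poly"
begin

text \<open>The random matrix W_N(i,j) = X_{i,j} + X_{j,i}, 1 <= i,j <= N (JNF indices shifted by one).\<close>
definition W_mat :: "(int \<Rightarrow> int \<Rightarrow> 'a \<Rightarrow> real) \<Rightarrow> nat \<Rightarrow> 'a \<Rightarrow> real mat" where
  "W_mat X N \<omega> = mat N N (\<lambda>(i,j). X (int i + 1) (int j + 1) \<omega> + X (int j + 1) (int i + 1) \<omega>)"

text \<open>Integral of g against the empirical eigenvalue distribution of a real N x N matrix B,
  i.e. (1/N) times the sum of g over the eigenvalues counted with (algebraic) multiplicity.\<close>
definition esd_integral :: "nat \<Rightarrow> real mat \<Rightarrow> (real \<Rightarrow> real) \<Rightarrow> real" where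
  "esd_integral N B g =
     (\<Sum>t\<in>{t. poly (char_poly B) t = 0}. real (order t (char_poly B)) * g t) / real N"

definition esd_W :: "(int \<Rightarrow> int \<Rightarrow> 'a \<Rightarrow> real) \<Rightarrow> nat \<Rightarrow> 'a \<Rightarrow> (real \<Rightarrow> real) \<Rightarrow> real" where
  "esd_W X N \<omega> g = esd_integral N ((1 / sqrt (real N)) \<cdot>\<^sub>m W_mat X N \<omega>) g"

definition esd_weak_limit_in_prob ::
    "'a measure \<Rightarrow> (int \<Rightarrow> int \<Rightarrow> 'a \<Rightarrow> real) \<Rightarrow> real measure \<Rightarrow> bool" where
  "esd_weak_limit_in_prob M X \<mu> \<longleftrightarrow>
     (\<forall>g :: real \<Rightarrow> real. continuous_on UNIV g \<longrightarrow> bounded (range g) \<longrightarrow>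
        (\<forall>\<epsilon>>0. (\<lambda>N. measure M {\<omega>\<in>space M. \<bar>esd_W X N \<omega> g - (\<integral>x. g x \<partial>\<mu>)\<bar> > \<epsilon>})
                  \<longlonglongrightarrow> 0))"

definition centered_gaussian_rv :: "'a measure \<Rightarrow> ('a \<Rightarrow> real) \<Rightarrow> bool" where
  "centered_gaussian_rv M Y \<longleftrightarrow>
     Y \<in> borel_measurable M \<and>
     ((\<exists>\<sigma>>0. distributed M lborel Y (normal_density 0 \<sigma>)) \<or> (AE \<omega> in M. Y \<omega> = 0))"

definition centered_gaussian_field :: "'a measure \<Rightarrow> (int \<Rightarrow> int \<Rightarrow> 'a \<Rightarrow> real) \<Rightarrow> bool" where
  "centered_gaussian_field M X \<longleftrightarrow>
     (\<forall>S c. finite S \<longrightarrow>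
        centered_gaussian_rv M (\<lambda>\<omega>. \<Sum>p\<in>S. c p * X (fst p) (snd p) \<omega>))"

definition spec_box :: "(real \<times> real) set" where
  "spec_box = {-pi<..pi} \<times> {-pi<..pi}"

definition is_spectral_measure ::
    "'a measure \<Rightarrow> (int \<Rightarrow> int \<Rightarrow> 'a \<Rightarrow> real) \<Rightarrow> (real \<times> real) measure \<Rightarrow> bool" where
  "is_spectral_measure M X \<nu> \<longleftrightarrow>
     finite_measure \<nu> \<and> sets \<nu> = sets borel \<and> emeasure \<nu> (UNIV - spec_box) = 0 \<and>
     (\<forall>j k u v. complex_of_real (prob_space.expectation M (\<lambda>\<omega>. X j k \<omega> * X (j+u) (k+v) \<omega>)) =
        (\<integral>z. cis (real_of_int u * fst z + real_of_int v * snd z) \<partial>\<nu>))"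

definition ac_plus_discrete :: "(real \<times> real) measure \<Rightarrow> (real \<times> real \<Rightarrow> real) \<Rightarrow> bool" where
  "ac_plus_discrete \<nu> f \<longleftrightarrow>
     (\<forall>z. 0 \<le> f z) \<and> f \<in> borel_measurable borel \<and>
     (\<exists>\<nu>d D. sets \<nu>d = sets borel \<and> countable D \<and> emeasure \<nu>d (UNIV - D) = 0 \<and>
        (\<forall>A\<in>sets borel. emeasure \<nu> A =
            (\<integral>\<^sup>+z. ennreal (f z) * indicator (A \<inter> spec_box) z \<partial>lborel) + emeasure \<nu>d A))"

definition dcoef :: "(real \<times> real \<Rightarrow> real) \<Rightarrow> int \<Rightarrow> int \<Rightarrow> complex" where
  "dcoef f j k = (1 / (2 * sqrt 2 * pi)) *
     (\<integral>z. indicator ({-pi..pi} \<times> {-pi..pi}) z *\<^sub>R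
          (cis (- (real_of_int j * fst z + real_of_int k * snd z)) *
           complex_of_real (sqrt (f (fst z, snd z) + f (snd z, fst z)))) \<partial>lborel)"

definition L1_norm_box :: "(real \<times> real \<Rightarrow> real) \<Rightarrow> real" where
  "L1_norm_box f = (\<integral>z. indicator ({-pi..pi} \<times> {-pi..pi}) z * f z \<partial>lborel)"

definition WSL :: "real \<Rightarrow> real measure" where
  "WSL \<gamma> = (if \<gamma> = 0 then return borel 0 else
     density lborel (\<lambda>x. ennreal (1 / (2 * pi * sqrt \<gamma>) * sqrt (4 - x^2 / \<gamma>) *
                                  indicator {-(2 * sqrt \<gamma>)..2 * sqrt \<gamma>} x)))"

end

theory Submission
  imports Defs
begin

text \<open>
  Put \<open>H = W / sqrt N\<close>, \<open>G = (H - i \<eta>)\<inverse>\<close> for large \<open>\<eta>\<close>, and let \<open>\<alpha>\<close> be the value at \<open>i \<eta>\<close> of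
  the Stieltjes transform of the semicircle law, so \<open>1 + i \<eta> \<alpha> + \<gamma> \<alpha>^2 = 0\<close>. Averaging the conjugate of
  \<open>G - \<alpha>\<close> along diagonals gives a Toeplitz matrix \<open>B\<close> with \<open>tr ((G - \<alpha>) B) / N = J\<close>, a sum of squares
  which dominates \<open>|tr G / N - \<alpha>|^2\<close>. Gaussian integration by parts turns \<open>E tr (H G B) / N\<close> into the
  integral over \<open>\<nu>\<close> of a kernel in which only the diagonal Fourier modes of \<open>G\<close> survive as \<open>N\<close> grows.
  The hypothesis on the coefficients \<open>d\<close> says, by Parseval, that the marginals of the symmetrised
  density are uniform: hence the contribution of the constant mode \<open>\<alpha>\<close> is exactly \<open>- \<gamma> \<alpha> tr (G B) / N\<close>, while
  Parseval and Cauchy-Schwarz bound all other modes by \<open>(\<gamma> / \<eta>) J\<close>. For \<open>\<eta>^2 > \<gamma>\<close> this forces \<open>E J\<close> to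
  tend to 0. Atoms of \<open>\<nu>\<close> affect \<open>H\<close> by bounded rank up to a small error, and are removed
  by inserting a contraction \<open>P\<close> of bounded corank that kills the plane waves of finitely many atoms.
\<close>

text \<open>Testing against a matrix built from \<open>G\<close> itself makes a separate
  concentration argument unnecessary: the expectation that is controlled is that of a nonnegative
  quantity dominating the squared deviation of the normalised trace, so the mean and the
  fluctuations are settled together. The price is that the derivative also falls on
  \<open>B\<close>. That extra term, like the terms in which \<open>G\<close> connects two different
  frequencies, is of order 1/N in mean square with respect to Lebesgue measure on the box, while the
  density is merely integrable; hence the density is cut at a fixed height and its tail is paid for
  by a uniform bound on the kernel. The condition on \<open>\<eta>\<close> comes from comparing two
  multiples of \<open>J\<close>. The quadratic equation gives
  \<open>H G + \<gamma> \<alpha> G = - (G - \<alpha>) / \<alpha>\<close>, so one side contains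
  \<open>J / |\<alpha>|\<close>, which is at least \<open>\<eta> J\<close>, against
  \<open>(\<gamma> / \<eta>) J\<close> on the other. Large \<open>\<eta>\<close> suffices because a
  probability law is determined by its Stieltjes transform on a half-line of the imaginary
  axis.\<close>

abbreviation cx :: "real \<Rightarrow> complex" where "cx \<equiv> complex_of_real"

section \<open>Gaussian integration by parts\<close>

lemma borel_measurable_cis[measurable]: "cis \<in> borel_measurable borel"
  by (intro borel_measurable_continuous_onI continuous_intros)

text \<open>\<open>V\<close> acts as a signed density. The hypothesis says that its positive and
  negative parts, pushed forward along \<open>Z\<close>, have the same Fourier transform; at
  \<open>t = 0\<close> this equates their masses, so after normalisation Levy's uniqueness theorem
  applies and the two push-forwards agree on \<open>B\<close>.\<close>

lemma char_eq_0_imp_indicator_eq_0_real: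
  fixes V Z :: "'a \<Rightarrow> real"
  assumes M: "prob_space M" and V: "integrable M V" and Z[measurable]: "Z \<in> borel_measurable M"
    and ch: "\<And>t. (\<integral>\<omega>. cx (V \<omega>) * cis (t * Z \<omega>) \<partial>M) = 0"
    and B[measurable]: "B \<in> sets borel"
  shows "(\<integral>\<omega>. V \<omega> * indicator B (Z \<omega>) \<partial>M) = 0"
proof -
  interpret prob_space M by fact
  have Vm[measurable]: "V \<in> borel_measurable M" using V by auto
  define p where "p = (\<lambda>\<omega>. max (V \<omega>) 0)"
  define q where "q = (\<lambda>\<omega>. max (- V \<omega>) 0)"
  have [measurable]: "p \<in> borel_measurable M" "q \<in> borel_measurable M" unfolding p_def q_def by auto
  have ip: "integrable M p" "integrable M q" unfolding p_def q_def using V by auto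
  have pq: "V \<omega> = p \<omega> - q \<omega>" "p \<omega> \<ge> 0" "q \<omega> \<ge> 0" for \<omega> unfolding p_def q_def by auto
  have iB: "integrable M (\<lambda>\<omega>. r \<omega> * indicator B (Z \<omega>))" if "integrable M r" for r :: "'a \<Rightarrow> real"
    using that by (intro Bochner_Integration.integrable_bound[OF that]) (auto simp: indicator_def)
  have iC: "integrable M (\<lambda>\<omega>. cx (r \<omega>) * cis (t * Z \<omega>))" if "integrable M r" for r t
    using that by (intro Bochner_Integration.integrable_bound[OF that]) (auto simp: norm_mult)
  have eqc: "(\<integral>\<omega>. cx (p \<omega>) * cis (t * Z \<omega>) \<partial>M) = (\<integral>\<omega>. cx (q \<omega>) * cis (t * Z \<omega>) \<partial>M)" for t
    using ch[of t] iC[OF ip(1), of t] iC[OF ip(2), of t] by (simp add: pq(1) algebra_simps)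
  define c where "c = (\<integral>\<omega>. p \<omega> \<partial>M)"
  have cq: "c = (\<integral>\<omega>. q \<omega> \<partial>M)"
    using eqc[of 0] unfolding c_def by simp
  have c0: "c \<ge> 0" unfolding c_def using pq by (intro integral_nonneg_AE) auto
  show ?thesis
  proof (cases "c = 0")
    case True
    have "AE \<omega> in M. p \<omega> = 0" using True ip pq unfolding c_def
      by (subst (asm) integral_nonneg_eq_0_iff_AE) auto
    moreover have "AE \<omega> in M. q \<omega> = 0"
    proof -
      have "(\<integral>\<omega>. q \<omega> \<partial>M) = 0" using cq True by metis
      then show ?thesis by (subst (asm) integral_nonneg_eq_0_iff_AE[OF ip(2)]) (auto simp: pq(3))
    qed
    ultimately have "AE \<omega> in M. V \<omega> * indicator B (Z \<omega>) = 0" by eventually_elim (simp add: pq(1))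
    then show ?thesis by (subst integral_cong_AE[where g="\<lambda>_. 0"]) auto
  next
    case False
    with c0 have c: "c > 0" by simp
    define D where "D r = distr (density M (\<lambda>\<omega>. ennreal (r \<omega> / c))) borel Z" for r
    have rd: "real_distribution (D r)" if "integrable M r" "\<And>\<omega>. r \<omega> \<ge> 0" "(\<integral>\<omega>. r \<omega> \<partial>M) = c" for r
    proof -
      have [measurable]: "r \<in> borel_measurable M" using that by auto
      have "emeasure (density M (\<lambda>\<omega>. ennreal (r \<omega> / c))) (space M) = (\<integral>\<^sup>+\<omega>. ennreal (r \<omega> / c) \<partial>M)"
        by (subst emeasure_density) (auto intro!: nn_integral_cong)
      also have "\<dots> = ennreal (\<integral>\<omega>. r \<omega> / c \<partial>M)"
        using that c by (intro nn_integral_eq_integral) auto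
      also have "\<dots> = 1" using that c by simp
      finally interpret d: prob_space "density M (\<lambda>\<omega>. ennreal (r \<omega> / c))" by (intro prob_spaceI) simp
      interpret e: prob_space "D r" unfolding D_def by (rule d.prob_space_distr) simp
      show ?thesis by (intro real_distribution.intro e.prob_space_axioms real_distribution_axioms.intro) (simp add: D_def)
    qed
    have chD: "char (D r) t = (\<integral>\<omega>. cx (r \<omega>) * cis (t * Z \<omega>) \<partial>M) / c"
      if "integrable M r" "\<And>\<omega>. r \<omega> \<ge> 0" for r t
    proof -
      have [measurable]: "r \<in> borel_measurable M" using that by auto
      have "char (D r) t = (\<integral>\<omega>. (r \<omega> / c) *\<^sub>R cis (t * Z \<omega>) \<partial>M)"
        unfolding char_def D_def using that c
        by (subst integral_distr, simp, simp, subst integral_density) (auto simp: cis_conv_exp)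
      also have "\<dots> = (\<integral>\<omega>. (cx (r \<omega>) * cis (t * Z \<omega>)) / c \<partial>M)"
        by (intro Bochner_Integration.integral_cong) (auto simp: scaleR_conv_of_real)
      finally show ?thesis by simp
    qed
    have "D p = D q"
    proof (rule Levy_uniqueness)
      show "real_distribution (D p)" "real_distribution (D q)"
        using rd[OF ip(1)] rd[OF ip(2)] pq c_def cq by auto
      show "char (D p) = char (D q)"
        by (intro ext) (simp add: chD ip pq eqc)
    qed
    moreover have "measure (D r) B = (\<integral>\<omega>. r \<omega> * indicator B (Z \<omega>) \<partial>M) / c"
      if "integrable M r" "\<And>\<omega>. r \<omega> \<ge> 0" for r
    proof -
      have [measurable]: "r \<in> borel_measurable M" using that by auto
      have "emeasure (D r) B = (\<integral>\<^sup>+\<omega>. ennreal (r \<omega> * indicator B (Z \<omega>) / c) \<partial>M)"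
        unfolding D_def using that c
        by (subst emeasure_distr, simp, simp, subst emeasure_density)
           (auto intro!: nn_integral_cong simp: indicator_def split: if_splits)
      also have "\<dots> = ennreal (\<integral>\<omega>. r \<omega> * indicator B (Z \<omega>) / c \<partial>M)"
        using that c iB[OF that(1)] by (intro nn_integral_eq_integral) (auto simp: indicator_def)
      finally show ?thesis using that c
        by (simp add: measure_def enn2real_ennreal indicator_def integral_nonneg_AE)
    qed
    ultimately have "(\<integral>\<omega>. p \<omega> * indicator B (Z \<omega>) \<partial>M) = (\<integral>\<omega>. q \<omega> * indicator B (Z \<omega>) \<partial>M)"
      using ip pq c by (metis (no_types, lifting) divide_cancel_right less_numeral_extra(3))
    then show ?thesis using iB[OF ip(1)] iB[OF ip(2)] by (simp add: pq(1) left_diff_distrib)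
  qed
qed

text \<open>Conjugating the hypothesis replaces \<open>t\<close> by \<open>- t\<close>, so it holds
  for \<open>cnj V\<close> as well and therefore for the real and imaginary parts of
  \<open>V\<close>.\<close>

lemma char_eq_0_imp_indicator_eq_0:
  fixes V :: "'a \<Rightarrow> complex" and Z :: "'a \<Rightarrow> real"
  assumes M: "prob_space M" and V: "integrable M V" and Z[measurable]: "Z \<in> borel_measurable M"
    and ch: "\<And>t. (\<integral>\<omega>. V \<omega> * cis (t * Z \<omega>) \<partial>M) = 0"
    and B[measurable]: "B \<in> sets borel"
  shows "(\<integral>\<omega>. V \<omega> * indicator B (Z \<omega>) \<partial>M) = 0"
proof -
  interpret prob_space M by fact
  have [measurable]: "V \<in> borel_measurable M" using V by auto
  have iV: "integrable M (\<lambda>\<omega>. V \<omega> * cis (t * Z \<omega>))" for t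
    by (intro Bochner_Integration.integrable_bound[OF V]) (auto simp: norm_mult)
  have [measurable]: "(\<lambda>\<omega>. cnj (V \<omega>)) \<in> borel_measurable M"
    by (rule measurable_compose[of V M borel cnj]) (auto intro: borel_measurable_continuous_onI continuous_on_cnj continuous_on_id)
  have iV': "integrable M (\<lambda>\<omega>. cnj (V \<omega>) * cis (t * Z \<omega>))" for t
    by (intro Bochner_Integration.integrable_bound[OF V]) (auto simp: norm_mult)
  have ch': "(\<integral>\<omega>. cnj (V \<omega>) * cis (t * Z \<omega>) \<partial>M) = 0" for t
  proof -
    have "(\<integral>\<omega>. cnj (V \<omega>) * cis (t * Z \<omega>) \<partial>M) = (\<integral>\<omega>. cnj (V \<omega> * cis ((-t) * Z \<omega>)) \<partial>M)"
      by (intro Bochner_Integration.integral_cong) (auto simp: cis_cnj)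
    also have "\<dots> = 0" using ch[of "-t"] by (simp del: complex_cnj_mult mult_minus_left)
    finally show ?thesis .
  qed
  have re: "(\<integral>\<omega>. cx (Re (V \<omega>)) * cis (t * Z \<omega>) \<partial>M) = 0" for t
  proof -
    have "(\<integral>\<omega>. cx (Re (V \<omega>)) * cis (t * Z \<omega>) \<partial>M)
       = (\<integral>\<omega>. (V \<omega> * cis (t * Z \<omega>) + cnj (V \<omega>) * cis (t * Z \<omega>)) / 2 \<partial>M)"
      by (intro Bochner_Integration.integral_cong refl) (simp add: complex_eq_iff algebra_simps)
    then show ?thesis using iV iV' by (simp add: ch ch' del: complex_cnj_mult)
  qed
  have im: "(\<integral>\<omega>. cx (Im (V \<omega>)) * cis (t * Z \<omega>) \<partial>M) = 0" for t
  proof -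
    have "(\<integral>\<omega>. cx (Im (V \<omega>)) * cis (t * Z \<omega>) \<partial>M)
       = (\<integral>\<omega>. (V \<omega> * cis (t * Z \<omega>) - cnj (V \<omega>) * cis (t * Z \<omega>)) / (2 * \<i>) \<partial>M)"
      by (intro Bochner_Integration.integral_cong refl) (simp add: complex_eq_iff algebra_simps Re_divide Im_divide power2_eq_square)
    then show ?thesis using iV iV' by (simp add: ch ch' del: complex_cnj_mult)
  qed
  have iR: "integrable M (\<lambda>\<omega>. Re (V \<omega>))" "integrable M (\<lambda>\<omega>. Im (V \<omega>))" using V by auto
  have "(\<integral>\<omega>. Re (V \<omega>) * indicator B (Z \<omega>) \<partial>M) = 0"
    by (rule char_eq_0_imp_indicator_eq_0_real[OF M iR(1) Z re B])
  moreover have "(\<integral>\<omega>. Im (V \<omega>) * indicator B (Z \<omega>) \<partial>M) = 0"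
    by (rule char_eq_0_imp_indicator_eq_0_real[OF M iR(2) Z im B])
  moreover have iB: "integrable M (\<lambda>\<omega>. V \<omega> * indicator B (Z \<omega>))"
    by (intro Bochner_Integration.integrable_bound[OF V]) (auto simp: norm_mult indicator_def)
  moreover have "(\<lambda>\<omega>. Re (V \<omega> * indicator B (Z \<omega>))) = (\<lambda>\<omega>. Re (V \<omega>) * indicator B (Z \<omega>))"
    "(\<lambda>\<omega>. Im (V \<omega> * indicator B (Z \<omega>))) = (\<lambda>\<omega>. Im (V \<omega>) * indicator B (Z \<omega>))"
    by (auto simp: indicator_def fun_eq_iff)
  ultimately show ?thesis
    using integral_Re[OF iB] integral_Im[OF iB] by (simp only: complex_eq_iff) simp
qed

text \<open>A multivariate uniqueness theorem is replaced by one-dimensional exchanges: if the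
  integrals against every character of one coordinate vanish, so do those against indicators of that
  coordinate. Doing this coordinate by coordinate turns factorising characters into factorising
  rectangles. The conclusion is an equality of measures because Fubini is applied to it
  afterwards.\<close>

lemma indep_var_of_char:
  fixes Y :: "'a \<Rightarrow> real" and Z :: "'i \<Rightarrow> 'a \<Rightarrow> real"
  assumes M: "prob_space M" and I: "finite I"
    and Y[measurable]: "Y \<in> borel_measurable M" and Z: "\<And>i. i \<in> I \<Longrightarrow> Z i \<in> borel_measurable M"
    and fac: "\<And>s t. (\<integral>\<omega>. cis (s * Y \<omega>) * cis (\<Sum>i\<in>I. t i * Z i \<omega>) \<partial>M)
        = (\<integral>\<omega>. cis (s * Y \<omega>) \<partial>M) * (\<integral>\<omega>. cis (\<Sum>i\<in>I. t i * Z i \<omega>) \<partial>M)"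
  shows "distr M (borel \<Otimes>\<^sub>M PiM I (\<lambda>_. borel)) (\<lambda>\<omega>. (Y \<omega>, \<lambda>i\<in>I. Z i \<omega>))
      = distr M borel Y \<Otimes>\<^sub>M distr M (PiM I (\<lambda>_. borel)) (\<lambda>\<omega>. \<lambda>i\<in>I. Z i \<omega>)"
proof -
  interpret prob_space M by fact
  note Z[measurable]
  let ?Pi = "PiM I (\<lambda>_. borel :: real measure)"
  define R where "R J A \<omega> = (\<Prod>i\<in>J. indicator (A i) (Z i \<omega>) :: complex)" for J and A :: "'i \<Rightarrow> real set" and \<omega>
  define E where "E J t \<omega> = cis (\<Sum>i\<in>I-J. t i * Z i \<omega>)" for J and t :: "'i \<Rightarrow> real" and \<omega>
  define V0 where "V0 s \<omega> = cis (s * Y \<omega>) - (\<integral>\<omega>. cis (s * Y \<omega>) \<partial>M)" for s \<omega>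
  have R1: "norm (R J A \<omega>) \<le> 1" for J A \<omega>
    unfolding R_def prod_norm[symmetric] by (intro prod_le_1) (auto simp: indicator_def)
  have Rm: "R J A \<in> borel_measurable M" if "J \<subseteq> I" "\<And>i. i \<in> I \<Longrightarrow> A i \<in> sets borel" for J A
  proof -
    have "(\<lambda>\<omega>. indicator (A i) (Z i \<omega>) :: complex) \<in> borel_measurable M" if "i \<in> J" for i
      using that \<open>J \<subseteq> I\<close> \<open>\<And>i. i \<in> I \<Longrightarrow> A i \<in> sets borel\<close> Z
      by (intro measurable_compose[OF Z borel_measurable_indicator]) auto
    then show ?thesis unfolding R_def by (intro borel_measurable_prod) auto
  qed
  have Em[measurable]: "E J t \<in> borel_measurable M" for J t
    unfolding E_def by measurable
  have cisY[measurable]: "(\<lambda>\<omega>. cis (s * Y \<omega>)) \<in> borel_measurable M" for s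
    by measurable
  have E1: "norm (E J t \<omega>) = 1" for J t \<omega> unfolding E_def by simp
  have V0m[measurable]: "V0 s \<in> borel_measurable M" for s unfolding V0_def by measurable
  have V0b: "norm (V0 s \<omega>) \<le> 2" for s \<omega>
  proof -
    have "norm (\<integral>\<omega>. cis (s * Y \<omega>) \<partial>M) \<le> (\<integral>\<omega>. norm (cis (s * Y \<omega>)) \<partial>M)" by (rule integral_norm_bound)
    then have "norm (\<integral>\<omega>. cis (s * Y \<omega>) \<partial>M) \<le> 1" by (simp add: prob_space)
    then show ?thesis unfolding V0_def
      by (smt (verit) norm_cis norm_triangle_ineq4)
  qed
  \<comment> \<open>\<open>J\<close> is the set of coordinates already carrying an indicator; the
    others still carry a character. The frequencies \<open>t\<close> stay arbitrary in the
    induction, since the frequency of the coordinate being exchanged is the variable of the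
    one-dimensional lemma.\<close>
  have key: "(\<integral>\<omega>. V0 s \<omega> * R J A \<omega> * E J t \<omega> \<partial>M) = 0"
    if "J \<subseteq> I" "\<And>i. i \<in> I \<Longrightarrow> A i \<in> sets borel" for J s A t
    using finite_subset[OF that(1) I] that(1)
  proof (induction J arbitrary: t rule: finite_induct)
    case empty
    have i1: "integrable M (\<lambda>\<omega>. cis (s * Y \<omega>) * E {} t \<omega>)"
      by (rule integrable_const_bound[where B=1]) (auto simp: norm_mult E1)
    have i2: "integrable M (\<lambda>\<omega>. E {} t \<omega>)"
      by (rule integrable_const_bound[where B=1]) (auto simp: norm_mult E1)
    have "(\<integral>\<omega>. V0 s \<omega> * R {} A \<omega> * E {} t \<omega> \<partial>M)
       = (\<integral>\<omega>. cis (s * Y \<omega>) * E {} t \<omega> \<partial>M) - (\<integral>\<omega>. cis (s * Y \<omega>) \<partial>M) * (\<integral>\<omega>. E {} t \<omega> \<partial>M)"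
      unfolding V0_def R_def using i1 i2 by (simp add: algebra_simps)
    also have "\<dots> = 0" using fac[of s t] unfolding E_def by simp
    finally show ?case .
  next
    case (insert j J)
    have jI: "j \<in> I" using insert by auto
    let ?V = "\<lambda>\<omega>. V0 s \<omega> * R J A \<omega> * E (insert j J) t \<omega>"
    have Rmj: "R J A \<in> borel_measurable M" using insert that by (intro Rm) auto
    have "integrable M ?V"
    proof (rule integrable_const_bound[where B=2])
      have "norm (?V \<omega>) \<le> 2 * 1 * 1" for \<omega> unfolding norm_mult
        by (intro mult_mono V0b R1) (auto simp: E_def)
      then show "AE \<omega> in M. norm (?V \<omega>) \<le> 2" by simp
    qed (use Rmj in measurable)
    moreover have "(\<integral>\<omega>. ?V \<omega> * cis (u * Z j \<omega>) \<partial>M) = 0" for u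
    proof -
      have "E (insert j J) t \<omega> * cis (u * Z j \<omega>) = E J (t(j := u)) \<omega>" for \<omega>
      proof -
        have IJ: "I - J - {j} = I - insert j J" by auto
        have "(\<Sum>i\<in>I-J. (t(j := u)) i * Z i \<omega>) = u * Z j \<omega> + (\<Sum>i\<in>I-insert j J. (t(j := u)) i * Z i \<omega>)"
          using sum.remove[of "I - J" j "\<lambda>i. (t(j := u)) i * Z i \<omega>"] I jI insert.hyps(2) unfolding IJ by simp
        also have "(\<Sum>i\<in>I-insert j J. (t(j := u)) i * Z i \<omega>) = (\<Sum>i\<in>I-insert j J. t i * Z i \<omega>)"
          by (intro sum.cong) auto
        finally show ?thesis unfolding E_def by (simp add: cis_mult add.commute)
      qed
      then show ?thesis using insert.IH[of "t(j := u)"] insert.prems by (simp add: mult.assoc del: fun_upd_apply)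
    qed
    ultimately have "(\<integral>\<omega>. ?V \<omega> * indicator (A j) (Z j \<omega>) \<partial>M) = 0"
      using Z jI that by (intro char_eq_0_imp_indicator_eq_0[OF M]) auto
    moreover have "R (insert j J) A \<omega> = R J A \<omega> * indicator (A j) (Z j \<omega>)" for \<omega>
      unfolding R_def using insert by (simp add: mult.commute)
    ultimately show ?case by (simp add: mult_ac)
  qed
  have prodB: "prob (Y -` B \<inter> space M \<inter> ((\<lambda>\<omega>. \<lambda>i\<in>I. Z i \<omega>) -` (PiE I A) \<inter> space M))
      = prob (Y -` B \<inter> space M) * prob ((\<lambda>\<omega>. \<lambda>i\<in>I. Z i \<omega>) -` (PiE I A) \<inter> space M)"
    if A: "\<And>i. i \<in> I \<Longrightarrow> A i \<in> sets borel" and B[measurable]: "B \<in> sets borel" for A B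
  proof -
    have Rm'[measurable]: "R I A \<in> borel_measurable M" using A by (intro Rm) auto
    let ?S = "(\<lambda>\<omega>. \<lambda>i\<in>I. Z i \<omega>) -` (PiE I A) \<inter> space M"
    have Req: "R I A \<omega> = indicator ?S \<omega>" if "\<omega> \<in> space M" for \<omega>
    proof (cases "\<forall>i\<in>I. Z i \<omega> \<in> A i")
      case True then show ?thesis using that by (auto simp: R_def indicator_def PiE_iff)
    next
      case False then show ?thesis using that I by (auto simp: R_def indicator_def PiE_iff prod_zero_iff)
    qed
    have Sm[measurable]: "?S \<in> sets M"
    proof -
      have "(\<lambda>\<omega>. \<lambda>i\<in>I. Z i \<omega>) \<in> measurable M ?Pi" using Z by (intro measurable_restrict) auto
      moreover have "PiE I A \<in> sets ?Pi" using A I by (intro sets_PiM_I_finite) auto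
      ultimately show ?thesis by (rule measurable_sets)
    qed
    define p where "p = (\<integral>\<omega>. R I A \<omega> \<partial>M)"
    have pe: "p = prob ?S"
    proof -
      have "p = (\<integral>\<omega>. cx (indicator ?S \<omega>) \<partial>M)" unfolding p_def
        by (intro Bochner_Integration.integral_cong refl) (auto simp: Req indicator_def)
      also have "\<dots> = prob ?S"
        by (subst integral_of_real) (auto intro!: integrable_real_indicator simp: less_top[symmetric])
      finally show ?thesis .
    qed
    have iR: "integrable M (R I A)" by (rule integrable_const_bound[where B=1]) (auto simp: R1)
    have iRs: "integrable M (\<lambda>\<omega>. cis (s * Y \<omega>) * R I A \<omega>)" for s
      by (rule integrable_const_bound[where B=1]) (auto simp: R1 norm_mult)
    have ic: "integrable M (\<lambda>\<omega>. cis (s * Y \<omega>))" for s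
      by (rule integrable_const_bound[where B=1]) (auto simp: R1 norm_mult)
    have "(\<integral>\<omega>. (R I A \<omega> - p) * cis (s * Y \<omega>) \<partial>M) = 0" for s
    proof -
      have "0 = (\<integral>\<omega>. V0 s \<omega> * R I A \<omega> * E I (\<lambda>_. 0) \<omega> \<partial>M)" using key[of I A s] A by simp
      also have "\<dots> = (\<integral>\<omega>. cis (s * Y \<omega>) * R I A \<omega> \<partial>M) - (\<integral>\<omega>. cis (s * Y \<omega>) \<partial>M) * p"
        unfolding V0_def E_def p_def using iR iRs by (simp add: left_diff_distrib)
      also have "\<dots> = (\<integral>\<omega>. (R I A \<omega> - p) * cis (s * Y \<omega>) \<partial>M)"
      proof -
        have "(\<integral>\<omega>. (R I A \<omega> - p) * cis (s * Y \<omega>) \<partial>M) = (\<integral>\<omega>. cis (s * Y \<omega>) * R I A \<omega> - cis (s * Y \<omega>) * p \<partial>M)"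
          by (intro Bochner_Integration.integral_cong refl) (simp add: algebra_simps)
        then show ?thesis
          using Bochner_Integration.integral_diff[OF iRs[of s] integrable_mult_left[of p, OF ic[of s]]] by simp
      qed
      finally show ?thesis by simp
    qed
    \<comment> \<open>With all coordinates of \<open>Z\<close> exchanged, the same lemma is used
      once more for \<open>Y\<close>, the weight being the centred indicator
      \<open>R I A - p\<close>.\<close>
    then have "(\<integral>\<omega>. (R I A \<omega> - p) * indicator B (Y \<omega>) \<partial>M) = 0"
      using iR by (intro char_eq_0_imp_indicator_eq_0[OF M _ Y _ B]) auto
    moreover have "(\<integral>\<omega>. (R I A \<omega> - p) * indicator B (Y \<omega>) \<partial>M)
       = (\<integral>\<omega>. cx (indicator (Y -` B \<inter> space M \<inter> ?S) \<omega> - prob ?S * indicator (Y -` B \<inter> space M) \<omega>) \<partial>M)"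
      by (intro Bochner_Integration.integral_cong refl) (auto simp: Req pe indicator_def)
    moreover have "\<dots> = cx (prob (Y -` B \<inter> space M \<inter> ?S) - prob ?S * prob (Y -` B \<inter> space M))"
    proof -
      have i: "integrable M (indicat_real X)" if "X \<in> sets M" for X
        using that by (intro integrable_real_indicator) (auto simp: less_top[symmetric])
      have j: "integrable M (\<lambda>\<omega>. indicat_real (Y -` B \<inter> space M \<inter> ?S) \<omega> - prob ?S * indicat_real (Y -` B \<inter> space M) \<omega>)"
        by (intro Bochner_Integration.integrable_diff integrable_mult_right i) measurable
      have "(\<integral>\<omega>. indicat_real (Y -` B \<inter> space M \<inter> ?S) \<omega> - prob ?S * indicat_real (Y -` B \<inter> space M) \<omega> \<partial>M)
         = prob (Y -` B \<inter> space M \<inter> ?S) - prob ?S * prob (Y -` B \<inter> space M)"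
        by (subst Bochner_Integration.integral_diff) (auto intro!: i)
      then show ?thesis using integral_of_real[OF j] by simp
    qed
    ultimately show ?thesis by (simp del: of_real_diff of_real_mult)
  qed
  let ?Z = "\<lambda>\<omega>. \<lambda>i\<in>I. Z i \<omega>"
  let ?GA = "{Y -` B \<inter> space M | B. B \<in> sets borel}"
  let ?GB = "{?Z -` B \<inter> space M | B. B \<in> prod_algebra I (\<lambda>_. borel :: real measure)}"
  have Zm: "?Z \<in> measurable M ?Pi" using Z by (intro measurable_restrict) auto
  have pa: "prod_algebra I (\<lambda>_. borel :: real measure) = {Pi\<^sub>E I X |X. X \<in> I \<rightarrow> sets borel}"
    using I by (simp add: prod_algebra_eq_finite)
  have "indep_set ?GA ?GB"
  proof (rule indep_setI)
    show "?GA \<subseteq> events" by auto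
    show "?GB \<subseteq> events" unfolding pa using I by (auto intro!: measurable_sets[OF Zm] sets_PiM_I_finite)
    show "prob (a \<inter> b) = prob a * prob b" if ab: "a \<in> ?GA" "b \<in> ?GB" for a b
    proof -
      obtain B where a: "a = Y -` B \<inter> space M" "B \<in> sets borel" using ab(1) by auto
      obtain A where b: "b = ?Z -` (PiE I A) \<inter> space M" "A \<in> I \<rightarrow> sets borel"
        using ab(2) unfolding pa by auto
      show ?thesis unfolding a b using a b by (intro prodB) auto
    qed
  qed
  moreover have "Int_stable ?GA"
    by (rule Int_stableI) (auto, metis (no_types, lifting) Int_assoc Int_left_commute inf.idem sets.Int vimage_Int)
  moreover have "Int_stable ?GB"
  proof (rule Int_stableI)
    fix a b assume "a \<in> ?GB" "b \<in> ?GB"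
    then obtain A B where AB: "A \<in> prod_algebra I (\<lambda>_. borel :: real measure)" "B \<in> prod_algebra I (\<lambda>_. borel :: real measure)"
      "a = ?Z -` A \<inter> space M" "b = ?Z -` B \<inter> space M" by auto
    then have "A \<inter> B \<in> prod_algebra I (\<lambda>_. borel :: real measure)"
      using Int_stable_prod_algebra[of I "\<lambda>_. borel :: real measure"] unfolding Int_stable_def by auto
    moreover have "a \<inter> b = ?Z -` (A \<inter> B) \<inter> space M" using AB by auto
    ultimately show "a \<inter> b \<in> ?GB" by blast
  qed
  ultimately have "indep_set (sigma_sets (space M) ?GA) (sigma_sets (space M) ?GB)"
    by (intro indep_set_sigma_sets)
  moreover have "sigma_sets (space M) ?GB = {?Z -` A \<inter> space M | A. A \<in> sets ?Pi}"
    unfolding sets_PiM by (intro sigma_sets_vimage_commute[symmetric]) (auto simp: space_PiM)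
  ultimately have ind: "indep_set (sigma_sets (space M) ?GA) {?Z -` A \<inter> space M | A. A \<in> sets ?Pi}"
    by simp
  have ind': "prob (Y -` A \<inter> space M \<inter> (?Z -` B \<inter> space M)) = prob (Y -` A \<inter> space M) * prob (?Z -` B \<inter> space M)"
    if "A \<in> sets borel" "B \<in> sets ?Pi" for A B
    by (rule indep_setD[OF ind]) (use that in \<open>auto intro!: sigma_sets.Basic\<close>)
  interpret PY: prob_space "distr M borel Y" by (rule prob_space_distr) simp
  interpret PZ: prob_space "distr M ?Pi ?Z" by (rule prob_space_distr) (rule Zm)
  have YZ[measurable]: "(\<lambda>\<omega>. (Y \<omega>, ?Z \<omega>)) \<in> measurable M (borel \<Otimes>\<^sub>M ?Pi)"
    using Zm by measurable
  show ?thesis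
  proof (rule pair_measure_eqI[symmetric])
    show "sigma_finite_measure (distr M borel Y)" "sigma_finite_measure (distr M ?Pi ?Z)" by unfold_locales
    show "sets (distr M borel Y \<Otimes>\<^sub>M distr M ?Pi ?Z) = sets (distr M (borel \<Otimes>\<^sub>M ?Pi) (\<lambda>\<omega>. (Y \<omega>, ?Z \<omega>)))"
      by (simp cong: sets_pair_measure_cong)
    fix A B assume "A \<in> sets (distr M borel Y)" "B \<in> sets (distr M ?Pi ?Z)"
    then have AB: "A \<in> sets borel" "B \<in> sets ?Pi" by auto
    have "(\<lambda>\<omega>. (Y \<omega>, ?Z \<omega>)) -` (A \<times> B) \<inter> space M = Y -` A \<inter> space M \<inter> (?Z -` B \<inter> space M)" by auto
    then show "emeasure (distr M borel Y) A * emeasure (distr M ?Pi ?Z) B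
        = emeasure (distr M (borel \<Otimes>\<^sub>M ?Pi) (\<lambda>\<omega>. (Y \<omega>, ?Z \<omega>))) (A \<times> B)"
      using AB Zm ind'[OF AB]
      by (simp add: emeasure_distr emeasure_eq_measure ennreal_mult[symmetric] pair_measureI)
  qed
qed

section \<open>Stein's identity and its multivariate form\<close>

lemma tendsto_normal_density_0:
  assumes "\<sigma> > 0"
  shows "(normal_density 0 \<sigma> \<longlongrightarrow> 0) at_top" "(normal_density 0 \<sigma> \<longlongrightarrow> 0) at_bot"
proof -
  have *: "((\<lambda>x. 1 / sqrt (2 * pi * \<sigma>^2) * exp (- (x^2 / (2 * \<sigma>^2)))) \<longlongrightarrow> 1 / sqrt (2 * pi * \<sigma>^2) * 0) F"
    if "filterlim (\<lambda>x::real. x^2) at_top F" for F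
  proof (intro tendsto_mult tendsto_const filterlim_compose[OF exp_at_bot])
    have "filterlim (\<lambda>x. inverse (2 * \<sigma>^2) * x^2) at_top F"
      using assms by (intro filterlim_tendsto_pos_mult_at_top[OF tendsto_const _ that]) auto
    then show "filterlim (\<lambda>x. - (x^2 / (2 * \<sigma>^2))) at_bot F"
      by (simp add: filterlim_uminus_at_bot field_simps)
  qed
  have eq: "normal_density 0 \<sigma> = (\<lambda>x. 1 / sqrt (2 * pi * \<sigma>^2) * exp (- (x^2 / (2 * \<sigma>^2))))"
    by (auto simp: normal_density_def fun_eq_iff)
  show "(normal_density 0 \<sigma> \<longlongrightarrow> 0) at_top"
    unfolding eq using *[OF filterlim_pow_at_top[OF _ filterlim_ident]] by simp
  show "(normal_density 0 \<sigma> \<longlongrightarrow> 0) at_bot"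
    unfolding eq using *[OF filterlim_pow_at_bot_even[OF _ filterlim_ident]] by simp
qed

text \<open>The density \<open>n\<close> satisfies \<open>n' = - (y / \<sigma>^2) n\<close>, so the
  derivative of \<open>n f\<close> combines the two integrands; its integral over the line is zero
  because \<open>f\<close> is bounded and \<open>n\<close> vanishes at infinity.\<close>

lemma stein_normal:
  fixes f f' :: "real \<Rightarrow> complex"
  assumes s: "\<sigma> > 0"
    and d: "\<And>y. (f has_vector_derivative f' y) (at y)"
    and c: "continuous_on UNIV f'"
    and b: "\<And>y. norm (f y) \<le> K" "\<And>y. norm (f' y) \<le> K"
  shows "(\<integral>y. normal_density 0 \<sigma> y *\<^sub>R (y *\<^sub>R f y) \<partial>lborel) = \<sigma>^2 *\<^sub>R (\<integral>y. normal_density 0 \<sigma> y *\<^sub>R f' y \<partial>lborel)"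
    and "integrable lborel (\<lambda>y. normal_density 0 \<sigma> y *\<^sub>R (y *\<^sub>R f y))"
proof -
  let ?n = "normal_density 0 \<sigma>"
  have cf: "continuous_on UNIV f"
    by (rule continuous_at_imp_continuous_on) (use d has_vector_derivative_continuous in blast)
  have fm[measurable]: "f \<in> borel_measurable borel" "f' \<in> borel_measurable borel"
    using c cf by (auto intro: borel_measurable_continuous_onI)
  have i1: "integrable lborel (\<lambda>y. ?n y *\<^sub>R f' y)"
  proof (rule Bochner_Integration.integrable_bound)
    show "integrable lborel (\<lambda>y. K * ?n y)" using s by simp
    show "AE y in lborel. norm (?n y *\<^sub>R f' y) \<le> norm (K * ?n y)"
      by (rule AE_I2, simp add: abs_mult, subst mult.commute, rule mult_right_mono) (auto intro: order_trans[OF b(2) abs_ge_self])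
  qed simp
  have im: "integrable lborel (\<lambda>y. ?n y * y)"
    using integrable_normal_moment[OF s, of 0 1] by simp
  show i2: "integrable lborel (\<lambda>y. ?n y *\<^sub>R (y *\<^sub>R f y))"
  proof (rule Bochner_Integration.integrable_bound)
    show "integrable lborel (\<lambda>y. K * (?n y * y))" using im by simp
    show "AE y in lborel. norm (?n y *\<^sub>R (y *\<^sub>R f y)) \<le> norm (K * (?n y * y))"
    proof (rule AE_I2)
      fix y
      have "norm (?n y *\<^sub>R (y *\<^sub>R f y)) = ?n y * \<bar>y\<bar> * norm (f y)" by (simp add: abs_mult mult_ac)
      also have "\<dots> \<le> ?n y * \<bar>y\<bar> * K" by (intro mult_left_mono b) auto
      also have "\<dots> \<le> norm (K * (?n y * y))" by (simp add: abs_mult mult_ac) (intro mult_right_mono; auto)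
      finally show "norm (?n y *\<^sub>R (y *\<^sub>R f y)) \<le> norm (K * (?n y * y))" .
    qed
  qed simp
  have nd: "(?n has_real_derivative (- (y / \<sigma>^2) * ?n y)) (at y)" for y
  proof -
    have "((\<lambda>x. 1 / sqrt (2 * pi * \<sigma>\<^sup>2) * exp (- (x - 0)\<^sup>2 / (2 * \<sigma>\<^sup>2))) has_real_derivative
       (1 / sqrt (2 * pi * \<sigma>\<^sup>2) * (exp (- (y - 0)\<^sup>2 / (2 * \<sigma>\<^sup>2)) * (- (2 * y) / (2 * \<sigma>\<^sup>2))))) (at y)"
      using s by (auto intro!: derivative_eq_intros simp: field_simps)
    then show ?thesis by (simp add: normal_density_def[abs_def] mult_ac)
  qed
  let ?g = "\<lambda>y. ?n y *\<^sub>R f y"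
  let ?g' = "\<lambda>y. ?n y *\<^sub>R f' y - (1 / \<sigma>^2) *\<^sub>R (?n y *\<^sub>R (y *\<^sub>R f y))"
  have gd: "(?g has_vector_derivative ?g' y) (at y)" for y
    using has_vector_derivative_scaleR[OF nd[of y] d[of y]] by (simp add: algebra_simps)
  have cn: "continuous_on UNIV ?n"
    unfolding normal_density_def[abs_def] using s by (intro continuous_intros) auto
  have "continuous_on UNIV ?g'" by (intro continuous_intros cn c cf)
  then have cg: "isCont ?g' y" for y by (simp add: continuous_on_eq_continuous_at)
  have lim: "(?g \<longlongrightarrow> 0) F" if "(?n \<longlongrightarrow> 0) F" for F
  proof (rule Lim_null_comparison)
    show "\<forall>\<^sub>F x in F. norm (?g x) \<le> ?n x * K"
      by (intro always_eventually allI) (simp add: mult_left_mono b)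
    show "((\<lambda>x. ?n x * K) \<longlongrightarrow> 0) F" using tendsto_mult_right[OF that, of K] by simp
  qed
  have "(LBINT y=-\<infinity>..\<infinity>. ?g' y) = 0 - 0"
  proof (rule interval_integral_FTC_integrable[where F="?g"])
    show "set_integrable lborel (einterval (- \<infinity>) \<infinity>) ?g'"
      unfolding set_integrable_def
      by (simp add: einterval_eq del: scaleR_scaleR)
         (intro Bochner_Integration.integrable_diff i1 integrable_scaleR_right i2)
    show "((?g \<circ> real_of_ereal) \<longlongrightarrow> 0) (at_right (- \<infinity>))" "((?g \<circ> real_of_ereal) \<longlongrightarrow> 0) (at_left \<infinity>)"
      unfolding ereal_tendsto_simps by (intro lim tendsto_normal_density_0 s)+
  qed (use gd cg in auto)
  then have "(\<integral>y. ?g' y \<partial>lborel) = 0"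
    by (simp add: interval_lebesgue_integral_def set_lebesgue_integral_def einterval_eq)
  then have "(\<integral>y. ?n y *\<^sub>R f' y \<partial>lborel) = (1 / \<sigma>^2) *\<^sub>R (\<integral>y. ?n y *\<^sub>R (y *\<^sub>R f y) \<partial>lborel)"
    using i1 i2 by (simp del: scaleR_scaleR)
  then show "(\<integral>y. ?n y *\<^sub>R (y *\<^sub>R f y) \<partial>lborel) = \<sigma>^2 *\<^sub>R (\<integral>y. ?n y *\<^sub>R f' y \<partial>lborel)"
    using s by simp
qed

text \<open>The characteristic function is expressed through the second moment rather than through
  \<open>\<sigma>\<close>, which covers the degenerate case by the same formula and spares case
  distinctions for linear combinations.\<close>

lemma centered_gaussian_rv_facts:
  assumes "prob_space M" "centered_gaussian_rv M U"
  shows "integrable M (\<lambda>\<omega>. (U \<omega>)^2)"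
    and "(\<integral>\<omega>. cis (U \<omega>) \<partial>M) = exp (- (\<integral>\<omega>. (U \<omega>)^2 \<partial>M) / 2)"
proof -
  interpret prob_space M by fact
  have [measurable]: "U \<in> borel_measurable M" using assms(2) by (simp add: centered_gaussian_rv_def)
  consider (n) \<sigma> where "\<sigma> > 0" "distributed M lborel U (normal_density 0 \<sigma>)" | (z) "AE \<omega> in M. U \<omega> = 0"
    using assms(2) by (auto simp: centered_gaussian_rv_def)
  then have "integrable M (\<lambda>\<omega>. (U \<omega>)^2) \<and> (\<integral>\<omega>. cis (U \<omega>) \<partial>M) = exp (- (\<integral>\<omega>. (U \<omega>)^2 \<partial>M) / 2)"
  proof cases
    case n
    have e: "expectation U = 0" using normal_distributed_expectation[OF n(1) n(2)] .
    have v: "(\<integral>\<omega>. (U \<omega>)^2 \<partial>M) = \<sigma>^2" using normal_distributed_variance[OF n] by (simp add: e)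
    \<comment> \<open>A non-integrable function has Bochner integral 0 by convention, so the nonzero
      value \<open>\<sigma>^2\<close> proves integrability.\<close>
    then have i: "integrable M (\<lambda>\<omega>. (U \<omega>)^2)" using n(1) not_integrable_integral_eq by fastforce
    have d: "distributed M lborel (\<lambda>\<omega>. U \<omega> / \<sigma>) std_normal_density"
      using normal_standard_normal_convert[OF n(1), of U 0] n(2) by simp
    have "(\<integral>\<omega>. cis (U \<omega>) \<partial>M) = (\<integral>\<omega>. cis (\<sigma> * (U \<omega> / \<sigma>)) \<partial>M)" using n(1) by simp
    also have "\<dots> = (\<integral>x. std_normal_density x *\<^sub>R cis (\<sigma> * x) \<partial>lborel)"
    proof -
      have "(\<integral>\<omega>. cis (\<sigma> * (U \<omega> / \<sigma>)) \<partial>M) = (\<integral>x. cis (\<sigma> * x) \<partial>distr M lborel (\<lambda>\<omega>. U \<omega> / \<sigma>))"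
        by (subst integral_distr) auto
      also have "\<dots> = (\<integral>x. cis (\<sigma> * x) \<partial>density lborel std_normal_density)"
        using d by (simp add: distributed_def)
      finally show ?thesis by (subst (asm) integral_density) auto
    qed
    also have "\<dots> = char std_normal_distribution \<sigma>"
      unfolding char_def by (subst integral_density) (auto simp: cis_conv_exp)
    also have "\<dots> = exp (- \<sigma>\<^sup>2 / 2)" by (simp add: char_std_normal_distribution)
    finally show ?thesis using v i by simp
  next
    case z
    have "integrable M (\<lambda>\<omega>. (U \<omega>)^2) \<longleftrightarrow> integrable M (\<lambda>_. 0::real)"
      using z by (intro integrable_cong_AE) auto
    moreover have "(\<integral>\<omega>. (U \<omega>)^2 \<partial>M) = (\<integral>\<omega>. 0 \<partial>M)" using z by (intro integral_cong_AE) auto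
    moreover have "(\<integral>\<omega>. cis (U \<omega>) \<partial>M) = (\<integral>\<omega>. 1 \<partial>M)" using z by (intro integral_cong_AE) auto
    ultimately show ?thesis by (simp add: prob_space)
  qed
  then show "integrable M (\<lambda>\<omega>. (U \<omega>)^2)"
    and "(\<integral>\<omega>. cis (U \<omega>) \<partial>M) = exp (- (\<integral>\<omega>. (U \<omega>)^2 \<partial>M) / 2)" by auto
qed

lemma gaussian_ibp:
  fixes W :: "'i \<Rightarrow> 'a \<Rightarrow> real" and F F' :: "('i \<Rightarrow> real) \<Rightarrow> complex"
  assumes M: "prob_space M" and I: "finite I" and W: "\<And>i. i \<in> I \<Longrightarrow> W i \<in> borel_measurable M"
    and ga: "\<And>c. centered_gaussian_rv M (\<lambda>\<omega>. \<Sum>i\<in>I. c i * W i \<omega>)"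
    and a: "a \<in> I" and C: "\<And>i. i \<in> I \<Longrightarrow> C i = (\<integral>\<omega>. W a \<omega> * W i \<omega> \<partial>M)"
    and Fm: "F \<in> borel_measurable (PiM I (\<lambda>_. borel))" "F' \<in> borel_measurable (PiM I (\<lambda>_. borel))"
    and Fb: "\<And>w. norm (F w) \<le> K" "\<And>w. norm (F' w) \<le> K"
    and d: "\<And>w y. ((\<lambda>y. F (\<lambda>i\<in>I. w i + y * C i)) has_vector_derivative F' (\<lambda>i\<in>I. w i + y * C i)) (at y)"
    and cn: "\<And>w. continuous_on UNIV (\<lambda>y. F' (\<lambda>i\<in>I. w i + y * C i))"
  shows "integrable M (\<lambda>\<omega>. W a \<omega> *\<^sub>R F (\<lambda>i\<in>I. W i \<omega>))"
    and "(\<integral>\<omega>. W a \<omega> *\<^sub>R F (\<lambda>i\<in>I. W i \<omega>) \<partial>M) = (\<integral>\<omega>. F' (\<lambda>i\<in>I. W i \<omega>) \<partial>M)"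
proof -
  interpret prob_space M by fact
  let ?Pi = "PiM I (\<lambda>_. borel :: real measure)"
  note W[measurable] Fm[measurable]
  have sing: "(\<Sum>i\<in>I. (if i = j then 1 else 0) * W i \<omega>) = W j \<omega>" if "j \<in> I" for j \<omega>
    using that I by (simp add: if_distrib[of "\<lambda>x. x * _"] cong: if_cong)
  have gW: "centered_gaussian_rv M (W j)" if "j \<in> I" for j
    using ga[of "\<lambda>i. if i = j then 1 else 0"] by (simp add: sing[OF that])
  have sq: "integrable M (\<lambda>\<omega>. (W j \<omega>)^2)" if "j \<in> I" for j
    using centered_gaussian_rv_facts(1)[OF M gW[OF that]] .
  have prodi: "integrable M (\<lambda>\<omega>. W i \<omega> * W j \<omega>)" if "i \<in> I" "j \<in> I" for i j
  proof (rule Bochner_Integration.integrable_bound)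
    show "integrable M (\<lambda>\<omega>. (W i \<omega>)^2 + (W j \<omega>)^2)" using sq that by auto
    have "\<bar>x * y\<bar> \<le> x^2 + y^2" for x y :: real
    proof -
      have "0 \<le> (\<bar>x\<bar> - \<bar>y\<bar>)^2" by simp
      then have "2 * \<bar>x * y\<bar> \<le> x^2 + y^2" by (simp add: power2_diff abs_mult)
      then show ?thesis using abs_ge_zero[of "x * y"] by linarith
    qed
    then show "AE \<omega> in M. norm (W i \<omega> * W j \<omega>) \<le> norm ((W i \<omega>)^2 + (W j \<omega>)^2)" by simp
  qed (use that in measurable)
  have Wm: "(\<lambda>\<omega>. \<lambda>i\<in>I. W i \<omega>) \<in> measurable M ?Pi" by measurable
  note Wm[measurable]
  let ?Y = "W a"
  have Ym[measurable]: "?Y \<in> borel_measurable M" using a W by auto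
  have Yi: "integrable M ?Y"
    by (rule square_integrable_imp_integrable) (use sq[OF a] in auto)
  show int: "integrable M (\<lambda>\<omega>. W a \<omega> *\<^sub>R F (\<lambda>i\<in>I. W i \<omega>))"
  proof (rule Bochner_Integration.integrable_bound)
    show "integrable M (\<lambda>\<omega>. K * W a \<omega>)" using Yi by simp
    have "\<bar>W a \<omega>\<bar> * norm (F (\<lambda>i\<in>I. W i \<omega>)) \<le> \<bar>K\<bar> * \<bar>W a \<omega>\<bar>" for \<omega>
      using Fb(1)[of "\<lambda>i\<in>I. W i \<omega>"] by (subst mult.commute) (intro mult_right_mono; simp)
    then show "AE \<omega> in M. norm (W a \<omega> *\<^sub>R F (\<lambda>i\<in>I. W i \<omega>)) \<le> norm (K * W a \<omega>)"
      by (simp add: abs_mult)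
  qed measurable
  consider (n) \<sigma> where "\<sigma> > 0" "distributed M lborel ?Y (normal_density 0 \<sigma>)" | (z) "AE \<omega> in M. ?Y \<omega> = 0"
    using gW[OF a] by (auto simp: centered_gaussian_rv_def)
  then show "(\<integral>\<omega>. W a \<omega> *\<^sub>R F (\<lambda>i\<in>I. W i \<omega>) \<partial>M) = (\<integral>\<omega>. F' (\<lambda>i\<in>I. W i \<omega>) \<partial>M)"
  proof cases
    case z
    \<comment> \<open>If \<open>W a\<close> vanishes almost surely, so does its covariance vector;
      \<open>F\<close> is then constant along the lines and its derivative \<open>F'\<close> is
      zero, so both sides are 0.\<close>
    have C0: "C i = 0" if "i \<in> I" for i
      unfolding C[OF that] using z that by (subst integral_cong_AE[where g="\<lambda>_. 0"]) auto
    have "F' (\<lambda>i\<in>I. w i) = 0" for w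
    proof -
      have "((\<lambda>y. F (\<lambda>i\<in>I. w i + y * C i)) has_vector_derivative F' (\<lambda>i\<in>I. w i + 0 * C i)) (at 0)" by (rule d)
      moreover have "(\<lambda>i\<in>I. w i + y * C i) = (\<lambda>i\<in>I. w i)" for y using C0 by (auto simp: restrict_def)
      ultimately have "((\<lambda>y. F (\<lambda>i\<in>I. w i)) has_vector_derivative F' (\<lambda>i\<in>I. w i)) (at (0::real))" by simp
      then show ?thesis
        using vector_derivative_unique_at[OF _ has_vector_derivative_const] by blast
    qed
    moreover have "(\<integral>\<omega>. W a \<omega> *\<^sub>R F (\<lambda>i\<in>I. W i \<omega>) \<partial>M) = (\<integral>\<omega>. 0 \<partial>M)"
      using z by (intro integral_cong_AE) auto
    ultimately show ?thesis by simp
  next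
    case n
    have e: "expectation ?Y = 0" using normal_distributed_expectation[OF n(1) n(2)] .
    have v: "(\<integral>\<omega>. (?Y \<omega>)^2 \<partial>M) = \<sigma>^2" using normal_distributed_variance[OF n] by (simp add: e)
    define Z where "Z i \<omega> = W i \<omega> - C i / \<sigma>^2 * W a \<omega>" for i \<omega>
    have Zm[measurable]: "Z i \<in> borel_measurable M" if "i \<in> I" for i unfolding Z_def using that by measurable
    have YZ: "(\<integral>\<omega>. ?Y \<omega> * Z i \<omega> \<partial>M) = 0" if "i \<in> I" for i
    proof -
      have "(\<integral>\<omega>. ?Y \<omega> * Z i \<omega> \<partial>M) = (\<integral>\<omega>. ?Y \<omega> * W i \<omega> - C i / \<sigma>^2 * (?Y \<omega>)^2 \<partial>M)"
        by (intro Bochner_Integration.integral_cong) (auto simp: Z_def algebra_simps power2_eq_square)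
      also have "\<dots> = C i - C i / \<sigma>^2 * \<sigma>^2"
        using prodi[OF a that] sq[OF a] C[OF that] v by simp
      finally show ?thesis using n(1) by simp
    qed
    have YZi: "integrable M (\<lambda>\<omega>. ?Y \<omega> * Z i \<omega>)" if "i \<in> I" for i
      unfolding Z_def right_diff_distrib using prodi[OF a that] prodi[OF a a]
      by (intro Bochner_Integration.integrable_diff) (auto simp: mult.left_commute)
    define T where "T t \<omega> = (\<Sum>i\<in>I. t i * Z i \<omega>)" for t \<omega>
    have gT: "centered_gaussian_rv M (\<lambda>\<omega>. s * ?Y \<omega> + T t \<omega>)" for s t
    proof -
      have "s * ?Y \<omega> + T t \<omega> = (\<Sum>i\<in>I. (t i + (if i = a then s - (\<Sum>j\<in>I. t j * C j / \<sigma>^2) else 0)) * W i \<omega>)" for \<omega>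
      proof -
        have "(\<Sum>i\<in>I. (t i + (if i = a then u else 0)) * W i \<omega>) = (\<Sum>i\<in>I. t i * W i \<omega>) + u * W a \<omega>" for u
          using I a by (simp add: distrib_right sum.distrib if_distrib[of "\<lambda>x. x * _"] cong: if_cong)
        moreover have "T t \<omega> = (\<Sum>i\<in>I. t i * W i \<omega>) - (\<Sum>j\<in>I. t j * C j / \<sigma>^2) * W a \<omega>"
          unfolding T_def Z_def by (simp add: right_diff_distrib sum_subtractf sum_distrib_right mult.assoc)
        ultimately show ?thesis by (simp add: algebra_simps)
      qed
      then show ?thesis using ga by presburger
    qed
    have Tm[measurable]: "T t \<in> borel_measurable M" for t unfolding T_def by measurable
    \<comment> \<open>\<open>W a\<close> and \<open>T t\<close> are uncorrelated, so the second
      moment of \<open>s * W a + T t\<close> is a sum, and the exponential in the Gaussian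
      characteristic function turns it into a product.\<close>
    have fac: "(\<integral>\<omega>. cis (s * ?Y \<omega>) * cis (\<Sum>i\<in>I. t i * Z i \<omega>) \<partial>M)
        = (\<integral>\<omega>. cis (s * ?Y \<omega>) \<partial>M) * (\<integral>\<omega>. cis (\<Sum>i\<in>I. t i * Z i \<omega>) \<partial>M)" for s t
    proof -
      have T0: "T (\<lambda>_. 0) \<omega> = 0" for \<omega> unfolding T_def by simp
      have iT: "integrable M (\<lambda>\<omega>. (T t \<omega>)^2)"
        using centered_gaussian_rv_facts(1)[OF M gT[of 0 t]] by simp
      have iYT: "integrable M (\<lambda>\<omega>. ?Y \<omega> * T t \<omega>)" and YT: "(\<integral>\<omega>. ?Y \<omega> * T t \<omega> \<partial>M) = 0"
      proof -
        have *: "?Y \<omega> * T t \<omega> = (\<Sum>i\<in>I. t i * (?Y \<omega> * Z i \<omega>))" for \<omega>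
          unfolding T_def by (simp add: sum_distrib_left mult_ac)
        show "integrable M (\<lambda>\<omega>. ?Y \<omega> * T t \<omega>)" unfolding * using YZi by auto
        show "(\<integral>\<omega>. ?Y \<omega> * T t \<omega> \<partial>M) = 0" unfolding *
          using YZi YZ by (subst Bochner_Integration.integral_sum) auto
      qed
      have "(\<integral>\<omega>. (s * ?Y \<omega> + T t \<omega>)^2 \<partial>M) = (\<integral>\<omega>. s^2 * (?Y \<omega>)^2 + 2 * s * (?Y \<omega> * T t \<omega>) + (T t \<omega>)^2 \<partial>M)"
        by (intro Bochner_Integration.integral_cong) (auto simp: power2_eq_square algebra_simps)
      also have "\<dots> = s^2 * \<sigma>^2 + (\<integral>\<omega>. (T t \<omega>)^2 \<partial>M)"
        using sq[OF a] iYT YT iT v by simp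
      finally have V: "(\<integral>\<omega>. (s * ?Y \<omega> + T t \<omega>)^2 \<partial>M) = s^2 * \<sigma>^2 + (\<integral>\<omega>. (T t \<omega>)^2 \<partial>M)" .
      have "(\<integral>\<omega>. cis (s * ?Y \<omega>) * cis (T t \<omega>) \<partial>M) = (\<integral>\<omega>. cis (s * ?Y \<omega> + T t \<omega>) \<partial>M)"
        by (simp add: cis_mult)
      also have "\<dots> = exp (- (s^2 * \<sigma>^2 + (\<integral>\<omega>. (T t \<omega>)^2 \<partial>M)) / 2)"
        unfolding centered_gaussian_rv_facts(2)[OF M gT] V ..
      also have "\<dots> = cx (exp (- (s^2 * \<sigma>^2) / 2)) * cx (exp (- (\<integral>\<omega>. (T t \<omega>)^2 \<partial>M) / 2))"
        unfolding of_real_mult[symmetric] mult_exp_exp by (simp add: add_divide_distrib diff_divide_distrib)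
      also have "cx (exp (- (s^2 * \<sigma>^2) / 2)) = (\<integral>\<omega>. cis (s * ?Y \<omega>) \<partial>M)"
        using centered_gaussian_rv_facts(2)[OF M gT[of s "\<lambda>_. 0"]] by (simp add: T0 power_mult_distrib v)
      also have "cx (exp (- (\<integral>\<omega>. (T t \<omega>)^2 \<partial>M) / 2)) = (\<integral>\<omega>. cis (T t \<omega>) \<partial>M)"
        using centered_gaussian_rv_facts(2)[OF M gT[of 0 t]] by simp
      finally show ?thesis unfolding T_def by simp
    qed
    have dist: "distr M (borel \<Otimes>\<^sub>M ?Pi) (\<lambda>\<omega>. (?Y \<omega>, \<lambda>i\<in>I. Z i \<omega>))
      = distr M borel ?Y \<Otimes>\<^sub>M distr M ?Pi (\<lambda>\<omega>. \<lambda>i\<in>I. Z i \<omega>)"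
      by (rule indep_var_of_char[OF M I Ym Zm fac])
    let ?Zv = "\<lambda>\<omega>. \<lambda>i\<in>I. Z i \<omega>"
    have Zvm[measurable]: "?Zv \<in> measurable M ?Pi" by measurable
    interpret PY: prob_space "distr M borel ?Y" by (rule prob_space_distr) simp
    interpret PZ: prob_space "distr M ?Pi ?Zv" by (rule prob_space_distr) (rule Zvm)
    interpret PP: pair_sigma_finite "distr M borel ?Y" "distr M ?Pi ?Zv" ..
    have shift: "(\<lambda>i\<in>I. W i \<omega>) = (\<lambda>i\<in>I. ?Zv \<omega> i + ?Y \<omega> * (C i / \<sigma>^2))" for \<omega>
      by (auto simp: Z_def restrict_def)
    have shm[measurable]: "(\<lambda>(y, z). (\<lambda>i\<in>I. z i + y * (C i / \<sigma>^2))) \<in> measurable (borel \<Otimes>\<^sub>M ?Pi) ?Pi"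
      unfolding split_beta by (rule measurable_restrict) measurable
    define g where "g = (\<lambda>(y, z). y *\<^sub>R F (\<lambda>i\<in>I. z i + y * (C i / \<sigma>^2)))"
    define g' where "g' = (\<lambda>(y::real, z). F' (\<lambda>i\<in>I. z i + y * (C i / \<sigma>^2)))"
    have gm[measurable]: "g \<in> borel_measurable (borel \<Otimes>\<^sub>M ?Pi)" "g' \<in> borel_measurable (borel \<Otimes>\<^sub>M ?Pi)"
      unfolding g_def g'_def using measurable_compose[OF shm Fm(1)] measurable_compose[OF shm Fm(2)]
      by (auto simp: split_beta')
    have YZm[measurable]: "(\<lambda>\<omega>. (?Y \<omega>, ?Zv \<omega>)) \<in> measurable M (borel \<Otimes>\<^sub>M ?Pi)" by measurable
    have bY: "distr M borel ?Y = density lborel (normal_density 0 \<sigma>)"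
    proof -
      have "distr M borel ?Y = distr M lborel ?Y" by (rule distr_cong) auto
      then show ?thesis using n(2) by (simp add: distributed_def)
    qed
    have stein: "(\<integral>y. g (y, z) \<partial>distr M borel ?Y) = (\<integral>y. g' (y, z) \<partial>distr M borel ?Y)" if z: "z \<in> space ?Pi" for z
    proof -
      define f where "f y = F (\<lambda>i\<in>I. z i + y * (C i / \<sigma>^2))" for y
      \<comment> \<open>The line is run through at speed \<open>C / \<sigma>^2\<close>; the
        resulting factor \<open>1 / \<sigma>^2\<close> cancels the variance in Stein's
        identity.\<close>
      define f' where "f' y = (1 / \<sigma>^2) *\<^sub>R F' (\<lambda>i\<in>I. z i + y * (C i / \<sigma>^2))" for y
      define L where "L = max K ((1 / \<sigma>^2) * K)"
      have dd: "(f has_vector_derivative f' y) (at y)" for y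
      proof -
        have "((\<lambda>y::real. y / \<sigma>^2) has_vector_derivative (1 / \<sigma>^2)) (at y)"
          unfolding has_real_derivative_iff_has_vector_derivative[symmetric]
          by (rule DERIV_cdivide[OF DERIV_ident])
        from vector_diff_chain_at[OF this d[of z "y / \<sigma>^2"]] show ?thesis
          unfolding f_def[abs_def] f'_def comp_def by (simp add: mult_ac)
      qed
      have cc: "continuous_on UNIV f'"
      proof -
        have "continuous_on UNIV ((\<lambda>y. F' (\<lambda>i\<in>I. z i + y * C i)) \<circ> (\<lambda>y. y / \<sigma>^2))"
          by (intro continuous_on_compose continuous_on_subset[OF cn] continuous_intros) (use n(1) in auto)
        then show ?thesis unfolding f'_def[abs_def] comp_def by (intro continuous_intros) (simp add: mult_ac)
      qed
      have b1: "norm (f y) \<le> L" for y unfolding f_def L_def using Fb(1) by (meson max.coboundedI1)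
      have b2: "norm (f' y) \<le> L" for y
        unfolding f'_def L_def using Fb(2) n(1) by (auto intro!: max.coboundedI2 divide_right_mono)
      have zm[measurable]: "(\<lambda>y. g (y, z)) \<in> borel_measurable borel" "(\<lambda>y. g' (y, z)) \<in> borel_measurable borel"
        using z by (auto intro!: measurable_compose[OF _ gm(1)] measurable_compose[OF _ gm(2)])
      have "(\<integral>y. g (y, z) \<partial>distr M borel ?Y) = (\<integral>y. normal_density 0 \<sigma> y *\<^sub>R (y *\<^sub>R f y) \<partial>lborel)"
        unfolding bY by (subst integral_density) (auto simp: g_def f_def zm[unfolded g_def] g_def[symmetric] zm)
      also have "\<dots> = \<sigma>^2 *\<^sub>R (\<integral>y. normal_density 0 \<sigma> y *\<^sub>R f' y \<partial>lborel)"
        by (rule stein_normal[OF n(1) dd cc b1 b2])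
      also have "\<dots> = (\<integral>y. \<sigma>^2 *\<^sub>R (normal_density 0 \<sigma> y *\<^sub>R f' y) \<partial>lborel)"
        by (rule integral_scaleR_right[symmetric])
      also have "\<dots> = (\<integral>y. normal_density 0 \<sigma> y *\<^sub>R g' (y, z) \<partial>lborel)"
        unfolding f'_def g'_def using n(1) by (intro Bochner_Integration.integral_cong refl) simp
      also have "\<dots> = (\<integral>y. g' (y, z) \<partial>distr M borel ?Y)"
        unfolding bY by (subst integral_density) auto
      finally show ?thesis .
    qed
    let ?PP = "distr M borel ?Y \<Otimes>\<^sub>M distr M ?Pi ?Zv"
    have ig: "integrable ?PP g"
      unfolding dist[symmetric] using int by (subst integrable_distr_eq) (auto simp: g_def shift)
    have ig': "integrable ?PP g'"
    proof -
      interpret P2: prob_space ?PP unfolding dist[symmetric] by (rule prob_space_distr) simp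
      have sPP: "sets ?PP = sets (borel \<Otimes>\<^sub>M ?Pi)" by (simp cong: sets_pair_measure_cong)
      show ?thesis
      proof (rule P2.integrable_const_bound[where B=K])
        show "AE p in ?PP. cmod (g' p) \<le> K" by (intro AE_I2) (simp add: g'_def Fb(2) split_beta)
        show "g' \<in> borel_measurable ?PP" using gm(2) by (subst measurable_cong_sets[OF sPP refl])
      qed
    qed
    have "(\<integral>\<omega>. W a \<omega> *\<^sub>R F (\<lambda>i\<in>I. W i \<omega>) \<partial>M) = (\<integral>\<omega>. g (?Y \<omega>, ?Zv \<omega>) \<partial>M)"
      by (simp add: g_def shift)
    also have "\<dots> = (\<integral>p. g p \<partial>?PP)" unfolding dist[symmetric] by (subst integral_distr) auto
    also have "\<dots> = (\<integral>z. (\<integral>y. g (y, z) \<partial>distr M borel ?Y) \<partial>distr M ?Pi ?Zv)"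
      using PP.integral_snd[of "\<lambda>y z. g (y, z)"] ig by simp
    also have "\<dots> = (\<integral>z. (\<integral>y. g' (y, z) \<partial>distr M borel ?Y) \<partial>distr M ?Pi ?Zv)"
      by (intro Bochner_Integration.integral_cong refl stein) simp
    also have "\<dots> = (\<integral>p. g' p \<partial>?PP)"
      using PP.integral_snd[of "\<lambda>y z. g' (y, z)"] ig' by simp
    also have "\<dots> = (\<integral>\<omega>. g' (?Y \<omega>, ?Zv \<omega>) \<partial>M)" unfolding dist[symmetric] by (subst integral_distr) auto
    also have "\<dots> = (\<integral>\<omega>. F' (\<lambda>i\<in>I. W i \<omega>) \<partial>M)" by (simp add: g'_def shift)
    finally show ?thesis .
  qed
qed

section \<open>Operators on finite sequences\<close>

text \<open>Vectors and matrices are total functions of which only the entries below the dimension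
  \<open>N\<close> count; one type serves all dimensions, and no carrier conditions arise.\<close>

type_synonym cvec = "nat \<Rightarrow> complex"
type_synonym cmatr = "nat \<Rightarrow> nat \<Rightarrow> complex"

abbreviation idm :: cmatr where "idm \<equiv> (\<lambda>i j. if i = j then 1 else 0)"

definition mvp :: "nat \<Rightarrow> cmatr \<Rightarrow> cvec \<Rightarrow> cvec" where
  "mvp N A v = (\<lambda>i. \<Sum>j<N. A i j * v j)"

text \<open>Bilinear, without conjugation: the resolvent of a real symmetric matrix is symmetric but
  not Hermitian, and the plane waves at \<open>x\<close> and \<open>- x\<close> are conjugate to
  each other, so conjugates are expressed by signs.\<close>

definition dotp :: "nat \<Rightarrow> cvec \<Rightarrow> cvec \<Rightarrow> complex" where
  "dotp N u v = (\<Sum>i<N. u i * v i)"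

definition nrm :: "nat \<Rightarrow> cvec \<Rightarrow> real" where
  "nrm N v = L2_set (\<lambda>i. cmod (v i)) {..<N}"

text \<open>The squared Hilbert-Schmidt norm; kept as a square since Parseval identities produce it
  directly.\<close>

definition hsq :: "nat \<Rightarrow> cmatr \<Rightarrow> real" where
  "hsq N A = (\<Sum>i<N. \<Sum>j<N. (cmod (A i j))^2)"

text \<open>An operator norm bound stated without forming the norm. Nonnegativity of
  \<open>c\<close> is included because the inequality says nothing about \<open>c\<close> when
  \<open>N = 0\<close>.\<close>

definition opb :: "nat \<Rightarrow> real \<Rightarrow> cmatr \<Rightarrow> bool" where
  "opb N c A \<longleftrightarrow> 0 \<le> c \<and> (\<forall>v. nrm N (mvp N A v) \<le> c * nrm N v)"

definition toep :: "nat \<Rightarrow> cmatr \<Rightarrow> cmatr" where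
  "toep N A = (\<lambda>i j. (\<Sum>k<N. \<Sum>l<N. if int k - int l = int i - int j then A k l else 0) / of_nat N)"

lemma nrm_ge_0[simp]: "0 \<le> nrm N v"
  by (simp add: nrm_def)

lemma nrm_sq: "(nrm N v)^2 = (\<Sum>i<N. (cmod (v i))^2)"
  by (simp add: nrm_def L2_set_def sum_nonneg)

lemma nrm_cong: "(\<And>i. i < N \<Longrightarrow> u i = v i) \<Longrightarrow> nrm N u = nrm N v"
  unfolding nrm_def by (rule L2_set_cong) auto

lemma nrm_cnj[simp]: "nrm N (\<lambda>i. cnj (v i)) = nrm N v"
  by (simp add: nrm_def)

lemma dotp_le: "cmod (dotp N u v) \<le> nrm N u * nrm N v"
proof -
  have "cmod (dotp N u v) \<le> (\<Sum>i<N. \<bar>cmod (u i)\<bar> * \<bar>cmod (v i)\<bar>)"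
    unfolding dotp_def by (rule order_trans[OF norm_sum]) (simp add: norm_mult)
  also have "\<dots> \<le> nrm N u * nrm N v" unfolding nrm_def by (rule L2_set_mult_ineq)
  finally show ?thesis .
qed

lemma dotp_cnj_self: "dotp N (\<lambda>i. cnj (v i)) v = cx ((nrm N v)^2)"
  unfolding nrm_sq dotp_def of_real_sum
  by (intro sum.cong refl) (metis complex_norm_square mult.commute of_real_power)

lemma dotp_commute: "dotp N u v = dotp N v u"
  by (simp add: dotp_def mult.commute)

lemma dotp_mvp: "dotp N u (mvp N A v) = dotp N (mvp N (\<lambda>i j. A j i) u) v"
  unfolding dotp_def mvp_def sum_distrib_left sum_distrib_right
  by (subst sum.swap) (simp add: mult_ac)

lemma dotp_mvp_sum: "dotp N u (mvp N A v) = (\<Sum>i<N. \<Sum>j<N. A i j * u i * v j)"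
  unfolding dotp_def mvp_def sum_distrib_left by (simp add: mult_ac)

lemma nrm_triangle: "nrm N (\<lambda>i. u i + v i) \<le> nrm N u + nrm N v"
  unfolding nrm_def by (rule order_trans[OF L2_set_mono L2_set_triangle_ineq]) (auto simp: norm_triangle_ineq)

lemma nrm_scale: "nrm N (\<lambda>i. a * v i) = cmod a * nrm N v"
  unfolding nrm_def by (simp add: norm_mult L2_set_right_distrib)

lemma opbD: "opb N c A \<Longrightarrow> nrm N (mvp N A v) \<le> c * nrm N v"
  by (simp add: opb_def)

lemma opbD': "opb N c A \<Longrightarrow> nrm N v \<le> d \<Longrightarrow> nrm N (mvp N A v) \<le> c * d"
  unfolding opb_def by (meson mult_left_mono order_trans)

lemma opb_nonneg: "opb N c A \<Longrightarrow> 0 \<le> c"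
  by (simp add: opb_def)

text \<open>For the converse, test with \<open>u\<close> the conjugate of \<open>A v\<close>. In the
  bilinear form, transposition and averaging over diagonals are easy to estimate.\<close>

lemma opb_bilinear:
  "opb N c A \<longleftrightarrow> 0 \<le> c \<and> (\<forall>u v. cmod (dotp N u (mvp N A v)) \<le> c * nrm N u * nrm N v)"
proof safe
  assume "opb N c A"
  then show "0 \<le> c" by (simp add: opb_def)
  fix u v
  have "cmod (dotp N u (mvp N A v)) \<le> nrm N u * nrm N (mvp N A v)" by (rule dotp_le)
  also have "\<dots> \<le> nrm N u * (c * nrm N v)" by (intro mult_left_mono opbD \<open>opb N c A\<close>) simp
  finally show "cmod (dotp N u (mvp N A v)) \<le> c * nrm N u * nrm N v" by (simp add: mult_ac)
next
  assume c: "0 \<le> c" and b: "\<forall>u v. cmod (dotp N u (mvp N A v)) \<le> c * nrm N u * nrm N v"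
  have "nrm N (mvp N A v) \<le> c * nrm N v" for v
  proof (cases "nrm N (mvp N A v) = 0")
    case False
    have "(nrm N (mvp N A v))^2 = cmod (dotp N (\<lambda>i. cnj (mvp N A v i)) (mvp N A v))"
      unfolding dotp_cnj_self by (simp add: norm_power)
    also have "\<dots> \<le> c * nrm N (mvp N A v) * nrm N v" using b[rule_format, of "\<lambda>i. cnj (mvp N A v i)" v] by simp
    finally have "nrm N (mvp N A v) * nrm N (mvp N A v) \<le> nrm N (mvp N A v) * (c * nrm N v)"
      by (simp add: power2_eq_square mult_ac)
    moreover have "nrm N (mvp N A v) > 0" using False nrm_ge_0[of N "mvp N A v"] by linarith
    ultimately show ?thesis by simp
  qed (simp add: c)
  then show "opb N c A" using c by (simp add: opb_def)
qed

lemma opb_transpose: "opb N c A \<Longrightarrow> opb N c (\<lambda>i j. A j i)"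
  unfolding opb_bilinear dotp_mvp by (auto simp: dotp_commute) (metis dotp_commute dotp_mvp mult.commute mult.left_commute)

lemma opb_cnj:
  assumes "opb N c A" shows "opb N c (\<lambda>i j. cnj (A i j))"
proof -
  have "nrm N (mvp N (\<lambda>i j. cnj (A i j)) v) \<le> c * nrm N v" for v
  proof -
    have "mvp N (\<lambda>i j. cnj (A i j)) v = (\<lambda>i. cnj (mvp N A (\<lambda>i. cnj (v i)) i))"
      by (simp add: mvp_def)
    then show ?thesis using opbD[OF assms, of "\<lambda>i. cnj (v i)"] by simp
  qed
  then show ?thesis using assms by (simp add: opb_def)
qed

lemma sum_diff_reindex:
  fixes A :: "nat \<Rightarrow> nat \<Rightarrow> complex"
  shows "(\<Sum>i<N. \<Sum>j<N. F (int i - int j) * A i j)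
    = (\<Sum>m\<in>{-int N<..<int N}. F m * (\<Sum>i<N. \<Sum>j<N. if int i - int j = m then A i j else 0))"
proof -
  have "(\<Sum>m\<in>{-int N<..<int N}. F m * (\<Sum>i<N. \<Sum>j<N. if int i - int j = m then A i j else 0))
    = (\<Sum>i<N. \<Sum>j<N. \<Sum>m\<in>{-int N<..<int N}. F m * (if int i - int j = m then A i j else 0))"
    unfolding sum_distrib_left by (subst sum.swap, rule sum.cong[OF refl], subst sum.swap) simp
  also have "\<dots> = (\<Sum>i<N. \<Sum>j<N. F (int i - int j) * A i j)"
    by (intro sum.cong refl) (simp add: if_distrib[of "\<lambda>x. _ * x"] sum.delta' cong: if_cong)
  finally show ?thesis by simp
qed

text \<open>Averaging a matrix over its diagonals is the same as averaging its conjugates by the truncated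
  shifts, which is why it does not increase the operator norm.\<close>
lemma opb_toep:
  assumes A: "opb N c A"
  shows "opb N c (toep N A)"
proof (cases "N = 0")
  case True
  then show ?thesis using A by (simp add: opb_def nrm_def)
next
  case False
  define S where "S = {-int N<..<int N}"
  \<comment> \<open>\<open>sh u s\<close> is \<open>u\<close> translated by \<open>s\<close> and cut
    off to indices below \<open>N\<close>. Two index pairs on a common diagonal are related by
    exactly one translation, whose length is less than \<open>N\<close>.\<close>
  define sh where "sh u s k = (\<Sum>i<N. if int i - int k = s then u i else 0)" for u :: cvec and s :: int and k :: nat
  have key: "(\<Sum>i<N. \<Sum>j<N. if int k - int l = int i - int j then u i * v j else 0) = (\<Sum>s\<in>S. sh u s k * sh v s l)"
    if "k < N" "l < N" for k l u v
  proof -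
    have "(\<Sum>s\<in>S. sh u s k * sh v s l)
      = (\<Sum>s\<in>S. \<Sum>i<N. \<Sum>j<N. (if int i - int k = s then u i else 0) * (if int j - int l = s then v j else 0))"
      unfolding sh_def sum_product ..
    also have "\<dots> = (\<Sum>i<N. \<Sum>j<N. \<Sum>s\<in>S. (if int i - int k = s then u i else 0) * (if int j - int l = s then v j else 0))"
      by (subst sum.swap, rule sum.cong[OF refl], subst sum.swap) simp
    also have "\<dots> = (\<Sum>i<N. \<Sum>j<N. \<Sum>s\<in>S. if s = int i - int k then (if int k - int l = int i - int j then u i * v j else 0) else 0)"
      by (intro sum.cong refl) auto
    also have "\<dots> = (\<Sum>i<N. \<Sum>j<N. if int k - int l = int i - int j then u i * v j else 0)"
    proof (intro sum.cong refl)
      fix i j assume "i \<in> {..<N}" "j \<in> {..<N}"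
      then have "int i - int k \<in> S" using that by (auto simp: S_def)
      then show "(\<Sum>s\<in>S. if s = int i - int k then (if int k - int l = int i - int j then u i * v j else 0) else 0)
         = (if int k - int l = int i - int j then u i * v j else 0)"
        by (simp add: S_def)
    qed
    finally show ?thesis by simp
  qed
  \<comment> \<open>Each entry of \<open>u\<close> reaches each of the \<open>N\<close> positions by
    exactly one shift. The factor \<open>N\<close> produced here cancels the \<open>1 / N\<close> in
    \<open>toep\<close> after Cauchy-Schwarz over the shifts.\<close>
  have nsh: "(\<Sum>s\<in>S. (nrm N (sh u s))^2) = of_nat N * (nrm N u)^2" for u
  proof -
    have sq: "(cmod (sh u s k))^2 = (\<Sum>i<N. if int i - int k = s then (cmod (u i))^2 else 0)" for s k
    proof (cases "\<exists>i<N. int i - int k = s")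
      case True
      then obtain i0 where i0: "i0 < N" "int i0 - int k = s" by auto
      have "(int i - int k = s) = (i = i0)" for i using i0 by auto
      then show ?thesis using i0 by (simp add: sh_def)
    next
      case False
      then have "(\<Sum>i<N. if int i - int k = s then u i else 0) = 0" "(\<Sum>i<N. if int i - int k = s then (cmod (u i))^2 else 0) = 0"
        by (auto intro!: sum.neutral)
      then show ?thesis by (simp add: sh_def)
    qed
    have "(\<Sum>s\<in>S. (nrm N (sh u s))^2) = (\<Sum>k<N. \<Sum>i<N. \<Sum>s\<in>S. if s = int i - int k then (cmod (u i))^2 else 0)"
      unfolding nrm_sq sq by (subst sum.swap, rule sum.cong[OF refl], subst sum.swap) (simp add: eq_commute)
    also have "\<dots> = (\<Sum>k<N. \<Sum>i<N. (cmod (u i))^2)"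
    proof (intro sum.cong refl)
      fix k i assume "k \<in> {..<N}" "i \<in> {..<N}"
      then have "int i - int k \<in> S" by (auto simp: S_def)
      then show "(\<Sum>s\<in>S. if s = int i - int k then (cmod (u i))^2 else 0) = (cmod (u i))^2"
        by (simp add: S_def)
    qed
    finally show ?thesis by (simp add: nrm_sq)
  qed
  have rep: "of_nat N * dotp N u (mvp N (toep N A) v) = (\<Sum>s\<in>S. dotp N (sh u s) (mvp N A (sh v s)))" for u v
  proof -
    have "of_nat N * dotp N u (mvp N (toep N A) v)
      = (\<Sum>i<N. \<Sum>j<N. (\<Sum>k<N. \<Sum>l<N. if int k - int l = int i - int j then A k l else 0) * u i * v j)"
      unfolding dotp_mvp_sum toep_def sum_distrib_left using False by simp
    also have "\<dots> = (\<Sum>i<N. \<Sum>j<N. \<Sum>k<N. \<Sum>l<N. A k l * (if int k - int l = int i - int j then u i * v j else 0))"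
      unfolding sum_distrib_right by (intro sum.cong refl) auto
    also have "\<dots> = (\<Sum>i<N. \<Sum>k<N. \<Sum>j<N. \<Sum>l<N. A k l * (if int k - int l = int i - int j then u i * v j else 0))"
      by (rule sum.cong[OF refl], rule sum.swap)
    also have "\<dots> = (\<Sum>k<N. \<Sum>i<N. \<Sum>l<N. \<Sum>j<N. A k l * (if int k - int l = int i - int j then u i * v j else 0))"
      by (subst sum.swap, rule sum.cong[OF refl], rule sum.cong[OF refl], rule sum.swap)
    also have "\<dots> = (\<Sum>k<N. \<Sum>l<N. A k l * (\<Sum>i<N. \<Sum>j<N. (if int k - int l = int i - int j then u i * v j else 0)))"
      unfolding sum_distrib_left by (rule sum.cong[OF refl], rule sum.swap)
    also have "\<dots> = (\<Sum>k<N. \<Sum>l<N. \<Sum>s\<in>S. A k l * sh u s k * sh v s l)"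
      by (intro sum.cong refl) (simp add: key sum_distrib_left mult.assoc)
    also have "\<dots> = (\<Sum>s\<in>S. dotp N (sh u s) (mvp N A (sh v s)))"
      unfolding dotp_mvp_sum
      by (subst sum.swap[where A=S], rule sum.cong[OF refl], subst sum.swap[where A=S], rule refl)
    finally show ?thesis .
  qed
  have "cmod (dotp N u (mvp N (toep N A) v)) \<le> c * nrm N u * nrm N v" for u v
  proof -
    have c: "0 \<le> c" using A by (simp add: opb_def)
    have "of_nat N * cmod (dotp N u (mvp N (toep N A) v)) = cmod (\<Sum>s\<in>S. dotp N (sh u s) (mvp N A (sh v s)))"
      unfolding rep[symmetric] by (simp add: norm_mult)
    also have "\<dots> \<le> (\<Sum>s\<in>S. c * (\<bar>nrm N (sh u s)\<bar> * \<bar>nrm N (sh v s)\<bar>))"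
      by (rule order_trans[OF norm_sum], rule sum_mono)
         (use A in \<open>simp add: opb_bilinear mult.assoc\<close>)
    also have "\<dots> \<le> c * (L2_set (\<lambda>s. nrm N (sh u s)) S * L2_set (\<lambda>s. nrm N (sh v s)) S)"
      unfolding sum_distrib_left[symmetric] by (intro mult_left_mono L2_set_mult_ineq c)
    also have "\<dots> = of_nat N * (c * nrm N u * nrm N v)"
      unfolding L2_set_def nsh by (simp add: real_sqrt_mult mult_ac)
    finally show ?thesis using False by simp
  qed
  then show ?thesis using A by (simp add: opb_bilinear)
qed

lemma opb_diff_id:
  assumes "opb N c A"
  shows "opb N (c + cmod a) (\<lambda>i j. A i j - (if i = j then a else 0))"
proof -
  have "nrm N (mvp N (\<lambda>i j. A i j - (if i = j then a else 0)) v) \<le> (c + cmod a) * nrm N v" for v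
  proof -
    have "nrm N (mvp N (\<lambda>i j. A i j - (if i = j then a else 0)) v) = nrm N (\<lambda>i. mvp N A v i + (- a) * v i)"
      by (rule nrm_cong) (simp add: mvp_def left_diff_distrib sum_subtractf if_distrib[of "\<lambda>x. x * _"] cong: if_cong)
    also have "\<dots> \<le> nrm N (mvp N A v) + nrm N (\<lambda>i. (- a) * v i)" by (rule nrm_triangle)
    also have "\<dots> \<le> c * nrm N v + cmod a * nrm N v"
      unfolding nrm_scale by (intro add_mono opbD assms) simp
    finally show ?thesis by (simp add: distrib_right)
  qed
  then show ?thesis using assms by (simp add: opb_def)
qed

lemma hsq_nonneg[simp]: "0 \<le> hsq N A"
  unfolding hsq_def by (intro sum_nonneg) auto

lemma hsq_col: "hsq N A = (\<Sum>j<N. (nrm N (\<lambda>i. A i j))^2)"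
  unfolding hsq_def nrm_sq by (rule sum.swap)

lemma hsq_row: "hsq N A = (\<Sum>i<N. (nrm N (A i))^2)"
  unfolding hsq_def nrm_sq ..

definition mmul :: "nat \<Rightarrow> cmatr \<Rightarrow> cmatr \<Rightarrow> cmatr" where
  "mmul N A B = (\<lambda>i j. \<Sum>k<N. A i k * B k j)"

lemma mvp_mmul: "mvp N (mmul N A B) v = mvp N A (mvp N B v)"
  unfolding mvp_def mmul_def sum_distrib_left sum_distrib_right
  by (rule ext, subst sum.swap) (simp add: mult.assoc)

lemma mmul_assoc: "mmul N (mmul N A B) C = mmul N A (mmul N B C)"
  unfolding mmul_def sum_distrib_left sum_distrib_right
  by (intro ext, subst sum.swap) (simp add: mult.assoc)

lemma hsq_mmul:
  assumes "opb N c A" shows "hsq N (mmul N A B) \<le> c^2 * hsq N B"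
proof -
  have "(nrm N (\<lambda>i. mmul N A B i j))^2 \<le> c^2 * (nrm N (\<lambda>i. B i j))^2" for j
  proof -
    have "nrm N (\<lambda>i. mmul N A B i j) \<le> c * nrm N (\<lambda>i. B i j)"
      using opbD[OF assms, of "\<lambda>i. B i j"] by (simp add: mvp_def mmul_def)
    then show ?thesis by (metis nrm_ge_0 power_mono power_mult_distrib)
  qed
  then show ?thesis unfolding hsq_col sum_distrib_left by (intro sum_mono)
qed

lemma hsq_mmul_right:
  assumes "opb N c A" shows "hsq N (mmul N B A) \<le> c^2 * hsq N B"
proof -
  have "hsq N (mmul N B A) = hsq N (mmul N (\<lambda>i j. A j i) (\<lambda>i j. B j i))"
    unfolding hsq_def mmul_def by (subst sum.swap) (simp add: mult.commute)
  also have "\<dots> \<le> c^2 * hsq N (\<lambda>i j. B j i)" by (rule hsq_mmul[OF opb_transpose[OF assms]])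
  also have "hsq N (\<lambda>i j. B j i) = hsq N B" unfolding hsq_def by (rule sum.swap)
  finally show ?thesis .
qed

lemma hsq_opb:
  assumes "opb N c A" shows "hsq N A \<le> of_nat N * c^2"
proof -
  have "(nrm N (\<lambda>i. A i j))^2 \<le> c^2" if "j < N" for j
  proof -
    have "nrm N (mvp N A (\<lambda>i. if i = j then 1 else 0)) \<le> c * nrm N (\<lambda>i. if i = j then 1 else 0)"
      by (rule opbD[OF assms])
    moreover have "mvp N A (\<lambda>i. if i = j then 1 else 0) = (\<lambda>i. A i j)"
      using that by (simp add: mvp_def if_distrib[of "\<lambda>x. _ * x"] cong: if_cong)
    moreover have "nrm N (\<lambda>i. if i = j then 1 else 0) = 1"
      using that by (simp add: nrm_def L2_set_def if_distrib[of "\<lambda>x. (cmod x)^2"] cong: if_cong)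
    ultimately show ?thesis by (simp add: power_mono)
  qed
  then have "hsq N A \<le> (\<Sum>j<N. c^2)" unfolding hsq_col by (intro sum_mono) auto
  then show ?thesis by simp
qed

lemma opb_mmul: "opb N c A \<Longrightarrow> opb N d B \<Longrightarrow> opb N (c * d) (mmul N A B)"
  unfolding opb_def mvp_mmul by (metis mult.assoc mult_left_mono mult_nonneg_nonneg order_trans)

text \<open>An orthogonal projection would do; only these three properties matter, and they are preserved
  by composing with the projection onto the complement of one further vector.\<close>
lemma ex_annihilating_contraction:
  assumes "finite F"
  shows "\<exists>P. opb N 1 P \<and> (\<forall>x\<in>F. \<forall>i<N. mvp N P (v x) i = 0)
     \<and> sqrt (hsq N (\<lambda>i j. (if i = j then 1 else 0) - P i j)) \<le> card F"
  using assms
proof (induction F rule: finite_induct)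
  case empty
  have "mvp N (\<lambda>i j. if i = j then 1 else 0) w i = w i" if "i < N" for w i
    using that by (simp add: mvp_def if_distrib[of "\<lambda>x. x * _"] cong: if_cong)
  then have "opb N 1 (\<lambda>i j. if i = j then 1 else 0)"
    by (simp add: opb_def cong: nrm_cong)
  then show ?case by (intro exI[of _ "\<lambda>i j. if i = j then 1 else 0"]) (auto simp: hsq_def)
next
  case (insert x F)
  then obtain P where P: "opb N 1 P" "\<And>y i. y \<in> F \<Longrightarrow> i < N \<Longrightarrow> mvp N P (v y) i = 0"
    "sqrt (hsq N (\<lambda>i j. (if i = j then 1 else 0) - P i j)) \<le> card F" by blast
  define w where "w = mvp N P (v x)"
  show ?case
  proof (cases "nrm N w = 0")
    case True
    then have "w i = 0" if "i < N" for i using that by (simp add: nrm_def L2_set_eq_0_iff)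
    moreover have "real (card F) \<le> real (card (insert x F))" using insert by simp
    ultimately show ?thesis using P unfolding w_def
      by (intro exI[of _ P]) (auto intro: order_trans)
  next
    case False
    \<comment> \<open>\<open>e\<close> is the normalised image of the new vector under
      \<open>P\<close>, and \<open>T\<close> projects orthogonally to \<open>e\<close>. The product
      is taken as \<open>T P\<close>, so that vectors killed by \<open>P\<close> remain killed and
      \<open>P (v x)\<close>, a multiple of \<open>e\<close>, is killed by \<open>T\<close>.\<close>
    define e where "e = (\<lambda>i. w i / nrm N w)"
    have e1: "nrm N e = 1" using False nrm_scale[of N "inverse (cx (nrm N w))" w]
      by (simp add: e_def divide_inverse mult.commute norm_inverse)
    define q where "q u = dotp N (\<lambda>i. cnj (e i)) u" for u
    define T where "T i j = (if i = j then 1 else 0) - e i * cnj (e j)" for i j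
    have Tv: "mvp N T u i = u i - q u * e i" if "i < N" for u i
    proof -
      have "(\<Sum>j<N. e i * cnj (e j) * u j) = q u * e i"
        unfolding q_def dotp_def sum_distrib_right by (simp add: mult_ac)
      then show ?thesis using that unfolding mvp_def T_def
        by (simp add: left_diff_distrib sum_subtractf if_distrib[of "\<lambda>x. x * _"] cong: if_cong)
    qed
    have qe: "q e = 1" unfolding q_def dotp_cnj_self e1 by simp
    have opT: "opb N 1 T"
    proof -
      have "nrm N (mvp N T u) \<le> nrm N u" for u
      proof -
        have "cx ((nrm N (mvp N T u))^2) = cx ((nrm N u)^2 - (cmod (q u))^2)"
        proof -
          have qs: "(\<Sum>i<N. cnj (u i) * e i) = cnj (q u)" unfolding q_def dotp_def by (simp add: mult.commute)
          have "cx ((nrm N (mvp N T u))^2) = dotp N (\<lambda>i. cnj (mvp N T u i)) (mvp N T u)"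
            by (rule dotp_cnj_self[symmetric])
          also have "\<dots> = (\<Sum>i<N. cnj (u i - q u * e i) * (u i - q u * e i))"
            unfolding dotp_def by (simp add: Tv)
          also have "\<dots> = (\<Sum>i<N. cnj (u i) * u i - q u * (cnj (u i) * e i) - cnj (q u) * (cnj (e i) * u i) + cnj (q u) * q u * (cnj (e i) * e i))"
            by (intro sum.cong refl) (simp add: algebra_simps)
          also have "\<dots> = dotp N (\<lambda>i. cnj (u i)) u - q u * (\<Sum>i<N. cnj (u i) * e i) - cnj (q u) * q u + cnj (q u) * q u * q e"
            by (simp add: sum.distrib sum_subtractf sum_distrib_left[symmetric] dotp_def q_def)
          also have "\<dots> = dotp N (\<lambda>i. cnj (u i)) u - q u * cnj (q u)" unfolding qs qe by simp
          also have "\<dots> = cx ((nrm N u)^2 - (cmod (q u))^2)"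
            unfolding dotp_cnj_self complex_norm_square[symmetric] by simp
          finally show ?thesis .
        qed
        then have "(nrm N (mvp N T u))^2 \<le> (nrm N u)^2"
          unfolding of_real_eq_iff by simp
        then show ?thesis by (rule power2_le_imp_le) simp
      qed
      then show ?thesis by (simp add: opb_def)
    qed
    define P' where "P' = mmul N T P"
    have PT: "mvp N P' u i = mvp N P u i - q (mvp N P u) * e i" if "i < N" for u i
      unfolding P'_def mvp_mmul using that by (rule Tv)
    have "opb N 1 P'" unfolding P'_def using opb_mmul[OF opT P(1)] by simp
    moreover have "mvp N P' (v y) i = 0" if "y \<in> F" "i < N" for y i
    proof -
      have "q (mvp N P (v y)) = 0" unfolding q_def dotp_def using P(2)[OF that(1)] by simp
      then show ?thesis using PT[OF that(2)] P(2)[OF that] by simp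
    qed
    moreover have "mvp N P' (v x) i = 0" if "i < N" for i
    proof -
      have we: "w j = nrm N w * e j" for j using False by (simp add: e_def)
      have "q w = nrm N w * q e" unfolding q_def dotp_def sum_distrib_left
        by (intro sum.cong refl) (subst we, simp)
      then have "q w * e i = w i" using we[of i] qe by simp
      then show ?thesis using PT[OF that, of "v x"] unfolding w_def by simp
    qed
    moreover have "sqrt (hsq N (\<lambda>i j. (if i = j then 1 else 0) - P' i j)) \<le> card (insert x F)"
    proof -
      \<comment> \<open>\<open>P'\<close> differs from \<open>P\<close> by a rank-one matrix whose
        factors are \<open>e\<close> and the image of a unit vector under the transposed
        contraction. Its Hilbert-Schmidt norm is at most 1, hence the distance to the identity grows
        by at most 1.\<close>
      have ent: "P' i j = P i j - e i * mvp N (\<lambda>i j. P j i) (\<lambda>i. cnj (e i)) j" if "i < N" for i j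
      proof -
        have "P' i j = mvp N T (\<lambda>k. P k j) i" unfolding P'_def mmul_def mvp_def ..
        also have "\<dots> = P i j - q (\<lambda>k. P k j) * e i" using that by (rule Tv)
        also have "q (\<lambda>k. P k j) = mvp N (\<lambda>i j. P j i) (\<lambda>i. cnj (e i)) j"
          unfolding q_def dotp_def mvp_def by (simp add: mult.commute)
        finally show ?thesis by (simp add: mult.commute)
      qed
      let ?r = "mvp N (\<lambda>i j. P j i) (\<lambda>i. cnj (e i))"
      have r: "nrm N ?r \<le> 1" using opbD[OF opb_transpose[OF P(1)], of "\<lambda>i. cnj (e i)"] by (simp add: e1)
      have hs: "sqrt (hsq N A) = L2_set (\<lambda>p. cmod (A (fst p) (snd p))) ({..<N} \<times> {..<N})" for A
        unfolding hsq_def L2_set_def by (simp add: sum.cartesian_product split_beta)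
      have "sqrt (hsq N (\<lambda>i j. (if i = j then 1 else 0) - P' i j))
        \<le> sqrt (hsq N (\<lambda>i j. (if i = j then 1 else 0) - P i j)) + sqrt (hsq N (\<lambda>i j. e i * ?r j))"
        unfolding hs by (rule order_trans[OF L2_set_mono L2_set_triangle_ineq])
          (auto simp: ent intro: norm_triangle_ineq norm_triangle_ineq4 order_trans[OF eq_refl norm_triangle_ineq] simp: algebra_simps)
      also have "hsq N (\<lambda>i j. e i * ?r j) = (nrm N e)^2 * (nrm N ?r)^2"
        unfolding hsq_def nrm_sq sum_product by (simp add: norm_mult power_mult_distrib)
      also have "sqrt ((nrm N e)^2 * (nrm N ?r)^2) = nrm N ?r" by (simp add: e1)
      finally show ?thesis using r P(3) insert by simp
    qed
    ultimately show ?thesis by (intro exI[of _ P']) auto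
  qed
qed

section \<open>Resolvents of symmetric matrices\<close>

definition shifted :: "nat \<Rightarrow> real \<Rightarrow> (nat \<Rightarrow> nat \<Rightarrow> real) \<Rightarrow> complex mat" where
  "shifted N \<eta> H = mat N N (\<lambda>(i,j). cx (H i j) - (if i = j then \<i> * \<eta> else 0))"

text \<open>The inverse of \<open>H - \<i> \<eta>\<close> by Cramer's rule: each entry is a quotient
  of polynomials in the entries of \<open>H\<close>, which gives measurability. Entries outside the
  dimension are 0, so symmetry and the entrywise bound hold for all indices.\<close>

definition resolv :: "nat \<Rightarrow> real \<Rightarrow> (nat \<Rightarrow> nat \<Rightarrow> real) \<Rightarrow> cmatr" where
  "resolv N \<eta> H = (\<lambda>i j. if i < N \<and> j < N then adj_mat (shifted N \<eta> H) $$ (i,j) / det (shifted N \<eta> H) else 0)"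

lemma shifted_carrier[simp]: "shifted N \<eta> H \<in> carrier_mat N N"
  by (simp add: shifted_def)

lemma shifted_dim[simp]: "dim_row (shifted N \<eta> H) = N" "dim_col (shifted N \<eta> H) = N"
  by (simp_all add: shifted_def)

text \<open>The cross term is a multiple of the imaginary part of the quadratic form of
  \<open>H\<close> at \<open>v\<close>, which is real for a real symmetric matrix.\<close>

lemma nrm_shifted:
  assumes sym: "\<And>i j. i < N \<Longrightarrow> j < N \<Longrightarrow> H i j = H j i"
  shows "(nrm N (\<lambda>i. mvp N (\<lambda>i j. cx (H i j)) v i - \<i> * \<eta> * v i))^2
    = (nrm N (mvp N (\<lambda>i j. cx (H i j)) v))^2 + \<eta>^2 * (nrm N v)^2"
proof -
  let ?h = "mvp N (\<lambda>i j. cx (H i j)) v"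
  define q where "q = (\<Sum>i<N. cnj (v i) * ?h i)"
  have "cnj q = (\<Sum>i<N. \<Sum>j<N. H i j * cnj (v j) * v i)"
    unfolding q_def mvp_def by (simp add: sum_distrib_left mult_ac)
  also have "\<dots> = (\<Sum>j<N. \<Sum>i<N. H i j * cnj (v j) * v i)" by (rule sum.swap)
  also have "\<dots> = q" unfolding q_def mvp_def sum_distrib_left
    by (intro sum.cong refl) (simp add: sym mult_ac)
  finally have "Im q = 0" by (metis complex_cnj_cancel_iff complex_cnj_cnj Reals_cnj_iff complex_is_Real_iff)
  have eq: "(cmod (a - \<i> * \<eta> * b))^2 = (cmod a)^2 + \<eta>^2 * (cmod b)^2 - 2 * \<eta> * Im (cnj b * a)" for a b
    unfolding cmod_power2 by (simp add: power2_eq_square algebra_simps)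
  have "(nrm N (\<lambda>i. ?h i - \<i> * \<eta> * v i))^2
     = (\<Sum>i<N. (cmod (?h i))^2 + \<eta>^2 * (cmod (v i))^2 - 2 * \<eta> * Im (cnj (v i) * ?h i))"
    unfolding nrm_sq eq ..
  also have "\<dots> = (nrm N ?h)^2 + \<eta>^2 * (nrm N v)^2 - 2 * \<eta> * Im q"
    unfolding nrm_sq q_def by (simp only: sum_subtractf sum.distrib sum_distrib_left Im_sum)
  finally show ?thesis using \<open>Im q = 0\<close> by simp
qed

lemma det_shifted_nonzero:
  assumes sym: "\<And>i j. i < N \<Longrightarrow> j < N \<Longrightarrow> H i j = H j i" and e: "\<eta> \<noteq> 0"
  shows "det (shifted N \<eta> H) \<noteq> 0"
proof
  assume "det (shifted N \<eta> H) = 0"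
  then obtain v where v: "v \<in> carrier_vec N" "v \<noteq> 0\<^sub>v N" "shifted N \<eta> H *\<^sub>v v = 0\<^sub>v N"
    using det_0_iff_vec_prod_zero[OF shifted_carrier] by blast
  define u where "u i = v $ i" for i
  have "mvp N (\<lambda>i j. cx (H i j)) u i - \<i> * \<eta> * u i = 0" if "i < N" for i
  proof -
    have "0 = (shifted N \<eta> H *\<^sub>v v) $ i" using v(3) that by simp
    also have "\<dots> = (\<Sum>j<N. (cx (H i j) - (if i = j then \<i> * \<eta> else 0)) * u j)"
      using v(1) that unfolding shifted_def u_def
      by (auto simp: mult_mat_vec_def scalar_prod_def atLeast0LessThan intro!: sum.cong)
    also have "\<dots> = mvp N (\<lambda>i j. cx (H i j)) u i - \<i> * \<eta> * u i"
      using that by (simp add: mvp_def left_diff_distrib sum_subtractf if_distrib[of "\<lambda>x. x * _"] cong: if_cong)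
    finally show ?thesis by simp
  qed
  then have "nrm N (\<lambda>i. mvp N (\<lambda>i j. cx (H i j)) u i - \<i> * \<eta> * u i) = nrm N (\<lambda>i. 0)"
    by (intro nrm_cong) auto
  also have "\<dots> = 0" by (simp add: nrm_def L2_set_def)
  finally have "(nrm N (mvp N (\<lambda>i j. cx (H i j)) u))^2 + \<eta>^2 * (nrm N u)^2 = 0"
    using nrm_shifted[where N=N and H=H and v=u and \<eta>=\<eta>, OF sym] by simp
  then have "(nrm N u)^2 = 0" using e
    by (simp add: add_nonneg_eq_0_iff)
  then have "u i = 0" if "i < N" for i
    using that by (simp add: nrm_def L2_set_eq_0_iff)
  then show False using v(1,2) unfolding u_def by auto
qed

context
  fixes N :: nat and \<eta> :: real and H :: "nat \<Rightarrow> nat \<Rightarrow> real"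
  assumes sym: "\<And>i j. i < N \<Longrightarrow> j < N \<Longrightarrow> H i j = H j i" and eta: "\<eta> > 0"
begin

lemma resolv_left:
  assumes "i < N" "k < N"
  shows "(\<Sum>j<N. (cx (H i j) - (if i = j then \<i> * \<eta> else 0)) * resolv N \<eta> H j k) = idm i k"
proof -
  let ?A = "shifted N \<eta> H"
  have d: "det ?A \<noteq> 0" using det_shifted_nonzero[of N H \<eta>] sym eta by auto
  have "(?A * adj_mat ?A) $$ (i,k) = det ?A * idm i k"
    unfolding adj_mat(2)[OF shifted_carrier] using assms by simp
  moreover have "(?A * adj_mat ?A) $$ (i,k) = (\<Sum>j<N. ?A $$ (i,j) * adj_mat ?A $$ (j,k))"
    using assms carrier_matD[OF adj_mat(1)[OF shifted_carrier, of N \<eta> H]]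
    by (simp add: times_mat_def scalar_prod_def atLeast0LessThan)
  moreover have "\<dots> = (\<Sum>j<N. (cx (H i j) - (if i = j then \<i> * \<eta> else 0)) * resolv N \<eta> H j k) * det ?A"
    unfolding sum_distrib_right using assms d by (intro sum.cong refl) (auto simp: shifted_def resolv_def)
  ultimately show ?thesis using d by simp
qed

lemma resolv_right:
  assumes "i < N" "k < N"
  shows "(\<Sum>j<N. resolv N \<eta> H i j * (cx (H j k) - (if j = k then \<i> * \<eta> else 0))) = idm i k"
proof -
  let ?A = "shifted N \<eta> H"
  have d: "det ?A \<noteq> 0" using det_shifted_nonzero[of N H \<eta>] sym eta by auto
  have "(adj_mat ?A * ?A) $$ (i,k) = det ?A * idm i k"
    unfolding adj_mat(3)[OF shifted_carrier] using assms by simp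
  moreover have "(adj_mat ?A * ?A) $$ (i,k) = (\<Sum>j<N. adj_mat ?A $$ (i,j) * ?A $$ (j,k))"
    using assms carrier_matD[OF adj_mat(1)[OF shifted_carrier, of N \<eta> H]]
    by (simp add: times_mat_def scalar_prod_def atLeast0LessThan)
  moreover have "\<dots> = (\<Sum>j<N. resolv N \<eta> H i j * (cx (H j k) - (if j = k then \<i> * \<eta> else 0))) * det ?A"
    unfolding sum_distrib_right using assms d by (intro sum.cong refl) (auto simp: shifted_def resolv_def)
  ultimately show ?thesis using d by simp
qed

lemma resolv_eq:
  assumes "i < N" "k < N"
  shows "mmul N (\<lambda>i j. cx (H i j)) (resolv N \<eta> H) i k = idm i k + \<i> * \<eta> * resolv N \<eta> H i k"
proof -
  have "(\<Sum>j<N. cx (H i j) * resolv N \<eta> H j k) - \<i> * \<eta> * resolv N \<eta> H i k = idm i k"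
    using resolv_left[OF assms] assms
    by (simp add: left_diff_distrib sum_subtractf if_distrib[of "\<lambda>x. x * _"] cong: if_cong)
  then show ?thesis by (simp add: mmul_def algebra_simps)
qed

text \<open>Pythagoras at the vector \<open>G v\<close>. It yields at once the bounds
  \<open>1 / \<eta>\<close> for \<open>G\<close> and \<open>1\<close> for \<open>H G\<close>; the
  second replaces any bound on the norm of the random matrix.\<close>

lemma resolv_nrm:
  "(nrm N v)^2 = (nrm N (mvp N (mmul N (\<lambda>i j. cx (H i j)) (resolv N \<eta> H)) v))^2
     + \<eta>^2 * (nrm N (mvp N (resolv N \<eta> H) v))^2"
proof -
  let ?G = "resolv N \<eta> H" and ?H = "\<lambda>i j. cx (H i j)"
  have "nrm N v = nrm N (\<lambda>i. mvp N ?H (mvp N ?G v) i - \<i> * \<eta> * mvp N ?G v i)"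
  proof (rule nrm_cong)
    fix i assume i: "i < N"
    have "mvp N ?H (mvp N ?G v) i = mvp N (mmul N ?H ?G) v i" by (simp add: mvp_mmul)
    also have "\<dots> = (\<Sum>j<N. (idm i j + \<i> * \<eta> * ?G i j) * v j)"
      unfolding mvp_def using resolv_eq[OF i] by simp
    also have "\<dots> = v i + \<i> * \<eta> * mvp N ?G v i"
      using i by (simp add: mvp_def distrib_right sum.distrib sum_distrib_left mult.assoc if_distrib[of "\<lambda>x. x * _"] cong: if_cong)
    finally show "v i = mvp N ?H (mvp N ?G v) i - \<i> * \<eta> * mvp N ?G v i" by simp
  qed
  then show ?thesis using nrm_shifted[where N=N and H=H and v="mvp N ?G v" and \<eta>=\<eta>, OF sym] by (simp add: mvp_mmul)
qed

lemma resolv_opb: "opb N (1 / \<eta>) (resolv N \<eta> H)"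
proof -
  have "nrm N (mvp N (resolv N \<eta> H) v) \<le> (1 / \<eta>) * nrm N v" for v
  proof -
    have "(\<eta> * nrm N (mvp N (resolv N \<eta> H) v))^2 \<le> (nrm N v)^2"
      unfolding resolv_nrm[of v] power_mult_distrib by simp
    then have "\<eta> * nrm N (mvp N (resolv N \<eta> H) v) \<le> nrm N v" by (rule power2_le_imp_le) simp
    then show ?thesis using eta by (simp add: field_simps)
  qed
  then show ?thesis using eta by (simp add: opb_def)
qed

lemma mmul_resolv_opb: "opb N 1 (mmul N (\<lambda>i j. cx (H i j)) (resolv N \<eta> H))"
proof -
  have "nrm N (mvp N (mmul N (\<lambda>i j. cx (H i j)) (resolv N \<eta> H)) v) \<le> nrm N v" for v
  proof (rule power2_le_imp_le)
    show "(nrm N (mvp N (mmul N (\<lambda>i j. cx (H i j)) (resolv N \<eta> H)) v))^2 \<le> (nrm N v)^2"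
      unfolding resolv_nrm[of v] by simp
  qed simp
  then show ?thesis by (simp add: opb_def)
qed

lemma resolv_sym: "resolv N \<eta> H i j = resolv N \<eta> H j i"
proof (cases "i < N \<and> j < N")
  case True
  let ?G = "resolv N \<eta> H"
  define A where "A i j = cx (H i j) - (if i = j then \<i> * \<eta> else 0)" for i j
  have Asym: "A k l = A l k" if "k < N" "l < N" for k l using sym that by (simp add: A_def)
  have AG: "(\<Sum>k<N. A l k * ?G k j) = idm l j" if "l < N" for l
    using resolv_left[of l j] that True by (simp add: A_def)
  have AG': "(\<Sum>k<N. A l k * ?G k i) = idm l i" if "l < N" for l
    using resolv_left[of l i] that True by (simp add: A_def)
  have "?G j i = (\<Sum>l<N. idm l j * ?G l i)" using True by (simp add: if_distrib[of "\<lambda>x. x * _"] cong: if_cong)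
  also have "\<dots> = (\<Sum>l<N. (\<Sum>k<N. A l k * ?G k j) * ?G l i)" by (simp add: AG)
  also have "\<dots> = (\<Sum>l<N. \<Sum>k<N. A k l * ?G k j * ?G l i)"
    unfolding sum_distrib_right by (intro sum.cong refl) (simp add: Asym)
  also have "\<dots> = (\<Sum>k<N. (\<Sum>l<N. A k l * ?G l i) * ?G k j)"
    unfolding sum_distrib_right by (subst sum.swap) (simp add: mult_ac)
  also have "\<dots> = (\<Sum>k<N. idm k i * ?G k j)" by (simp add: AG')
  also have "\<dots> = ?G i j" using True by (simp add: if_distrib[of "\<lambda>x. x * _"] cong: if_cong)
  finally show ?thesis by simp
qed (auto simp: resolv_def)

lemma resolv_entry_le: "cmod (resolv N \<eta> H i j) \<le> 1 / \<eta>"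
proof (cases "i < N \<and> j < N")
  case True
  have "(cmod (resolv N \<eta> H i j))^2 \<le> (nrm N (\<lambda>i. resolv N \<eta> H i j))^2"
    unfolding nrm_sq using True by (intro member_le_sum) auto
  then have "cmod (resolv N \<eta> H i j) \<le> nrm N (\<lambda>i. resolv N \<eta> H i j)"
    by (rule power2_le_imp_le) simp
  also have "nrm N (\<lambda>i. resolv N \<eta> H i j) \<le> 1 / \<eta>"
  proof -
    have eq: "(\<lambda>i. resolv N \<eta> H i j) = mvp N (resolv N \<eta> H) (\<lambda>i. if i = j then 1 else 0)"
    using True by (simp add: mvp_def if_distrib[of "\<lambda>x. _ * x"] cong: if_cong)
    have "nrm N (\<lambda>i. if i = j then 1 else 0) = 1"
      using True by (simp add: nrm_def L2_set_def if_distrib[of "\<lambda>x. (cmod x)^2"] cong: if_cong)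
    then show ?thesis
      using opbD[OF resolv_opb, of "\<lambda>i. if i = j then 1 else 0"] unfolding eq by simp
  qed
  finally show ?thesis .
qed (use eta in \<open>auto simp: resolv_def\<close>)

end

section \<open>Perturbation and measurability of the resolvent\<close>

lemma resolv_identity:
  assumes sym: "\<And>i j. i < N \<Longrightarrow> j < N \<Longrightarrow> H i j = H j i" and symC: "\<And>i j. i < N \<Longrightarrow> j < N \<Longrightarrow> H' i j = H' j i"
    and eta: "\<eta> > 0"
  shows "resolv N \<eta> H' i j - resolv N \<eta> H i j
    = (\<Sum>k<N. \<Sum>l<N. resolv N \<eta> H' i k * cx (H k l - H' k l) * resolv N \<eta> H l j)"
proof (cases "i < N \<and> j < N")
  case True
  let ?G = "resolv N \<eta> H" and ?G' = "resolv N \<eta> H'"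
  define A where "A i j = cx (H i j) - (if i = j then \<i> * \<eta> else 0)" for i j
  define A' where "A' i j = cx (H' i j) - (if i = j then \<i> * \<eta> else 0)" for i j
  have 1: "(\<Sum>l<N. A k l * ?G l j) = idm k j" if "k < N" for k
    using resolv_left[of N H \<eta> k j] sym eta that True by (auto simp: A_def)
  have 2: "(\<Sum>k<N. ?G' i k * A' k l) = idm i l" if "l < N" for l
    using resolv_right[of N H' \<eta> i l] symC eta that True by (auto simp: A'_def)
  have "(\<Sum>k<N. \<Sum>l<N. ?G' i k * cx (H k l - H' k l) * ?G l j)
     = (\<Sum>k<N. \<Sum>l<N. ?G' i k * A k l * ?G l j) - (\<Sum>k<N. \<Sum>l<N. ?G' i k * A' k l * ?G l j)"
    unfolding sum_subtractf[symmetric] by (intro sum.cong refl) (simp add: A_def A'_def algebra_simps)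
  also have "(\<Sum>k<N. \<Sum>l<N. ?G' i k * A k l * ?G l j) = (\<Sum>k<N. ?G' i k * (\<Sum>l<N. A k l * ?G l j))"
    by (simp add: sum_distrib_left mult.assoc)
  also have "\<dots> = ?G' i j" using True by (simp add: 1 if_distrib[of "\<lambda>x. _ * x"] cong: if_cong)
  also have "(\<Sum>k<N. \<Sum>l<N. ?G' i k * A' k l * ?G l j) = (\<Sum>l<N. (\<Sum>k<N. ?G' i k * A' k l) * ?G l j)"
    unfolding sum_distrib_right by (rule sum.swap)
  also have "\<dots> = ?G i j" using True by (simp add: 2 if_distrib[of "\<lambda>x. x * _"] cong: if_cong)
  finally show ?thesis by simp
qed (auto simp: resolv_def)

text \<open>Caratheodory's description of the derivative. The resolvent identity between two points
  of a line is exactly such a slope representation.\<close>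

lemma has_vector_derivative_slope:
  fixes f g :: "real \<Rightarrow> 'b::real_normed_vector"
  assumes f: "\<And>y. f y = f x + (y - x) *\<^sub>R g y" and g: "isCont g x"
  shows "(f has_vector_derivative g x) (at x)"
  unfolding has_vector_derivative_def has_derivative_iff_norm
proof (intro conjI)
  have "((\<lambda>y. norm (g y - g x)) \<longlongrightarrow> 0) (at x)"
    using g by (simp add: isCont_def tendsto_norm_zero_iff LIM_zero_iff)
  moreover have "norm ((f y - f x) - (y - x) *\<^sub>R g x) / norm (y - x) = norm (g y - g x)" if "y \<noteq> x" for y
  proof -
    have "(f y - f x) - (y - x) *\<^sub>R g x = (y - x) *\<^sub>R (g y - g x)" by (subst f[of y]) (simp add: algebra_simps)
    then show ?thesis using that by simp
  qed
  then have "\<forall>\<^sub>F y in at x. norm (g y - g x) = norm ((f y - f x) - (y - x) *\<^sub>R g x) / norm (y - x)"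
    by (simp add: eventually_at_filter)
  ultimately show "((\<lambda>y. norm ((f y - f x) - (y - x) *\<^sub>R g x) / norm (y - x)) \<longlongrightarrow> 0) (at x)"
    by (rule Lim_transform_eventually)
qed (rule bounded_linear_scaleR_left)

context
  fixes N :: nat and \<eta> :: real and H C :: "nat \<Rightarrow> nat \<Rightarrow> real"
  assumes sym: "\<And>i j. i < N \<Longrightarrow> j < N \<Longrightarrow> H i j = H j i" and symC: "\<And>i j. i < N \<Longrightarrow> j < N \<Longrightarrow> C i j = C j i"
    and eta: "\<eta> > 0"
begin

lemma resolv_line_slope:
  "resolv N \<eta> (\<lambda>i j. H i j + y * C i j) i j = resolv N \<eta> (\<lambda>i j. H i j + x * C i j) i j
    + (y - x) *\<^sub>R (- (\<Sum>k<N. \<Sum>l<N. resolv N \<eta> (\<lambda>i j. H i j + y * C i j) i k * cx (C k l)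
         * resolv N \<eta> (\<lambda>i j. H i j + x * C i j) l j))"
proof -
  define S where "S = (\<Sum>k<N. \<Sum>l<N. resolv N \<eta> (\<lambda>i j. H i j + y * C i j) i k * cx (C k l)
         * resolv N \<eta> (\<lambda>i j. H i j + x * C i j) l j)"
  have "resolv N \<eta> (\<lambda>i j. H i j + y * C i j) i j - resolv N \<eta> (\<lambda>i j. H i j + x * C i j) i j
    = (\<Sum>k<N. \<Sum>l<N. resolv N \<eta> (\<lambda>i j. H i j + y * C i j) i k *
        cx ((H k l + x * C k l) - (H k l + y * C k l)) * resolv N \<eta> (\<lambda>i j. H i j + x * C i j) l j)"
    by (rule resolv_identity) (use sym symC eta in auto)
  also have "\<dots> = (\<Sum>k<N. \<Sum>l<N. of_real (x - y) * (resolv N \<eta> (\<lambda>i j. H i j + y * C i j) i k *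
        cx (C k l) * resolv N \<eta> (\<lambda>i j. H i j + x * C i j) l j))"
    by (intro sum.cong refl) (simp add: algebra_simps)
  also have "\<dots> = of_real (x - y) * S"
    unfolding S_def by (simp only: sum_distrib_left)
  finally show ?thesis
    unfolding S_def[symmetric] by (simp add: scaleR_conv_of_real algebra_simps)
qed

text \<open>In the slope formula both resolvents have entries bounded by \<open>1 / \<eta>\<close>,
  so each entry is Lipschitz along the line.\<close>

lemma resolv_line_isCont: "isCont (\<lambda>y. resolv N \<eta> (\<lambda>i j. H i j + y * C i j) i j) x"
proof -
  let ?G = "\<lambda>y. resolv N \<eta> (\<lambda>i j. H i j + y * C i j)"
  define K where "K = (\<Sum>k<N. \<Sum>l<N. (1 / \<eta>) * \<bar>C k l\<bar> * (1 / \<eta>))"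
  have b: "cmod (?G y i j) \<le> 1 / \<eta>" for y i j
    by (rule resolv_entry_le) (use sym symC eta in auto)
  have "dist (?G y i j) (?G x i j) \<le> \<bar>y - x\<bar> * K" for y
  proof -
    have "dist (?G y i j) (?G x i j) = \<bar>y - x\<bar> * cmod (\<Sum>k<N. \<Sum>l<N. ?G y i k * cx (C k l) * ?G x l j)"
      unfolding dist_norm by (subst resolv_line_slope[of y i j x]) simp
    also have "\<dots> \<le> \<bar>y - x\<bar> * K"
    proof -
      have "cmod (?G y i k * cx (C k l) * ?G x l j) \<le> (1 / \<eta>) * \<bar>C k l\<bar> * (1 / \<eta>)" for k l
        unfolding norm_mult norm_of_real using eta by (intro mult_mono b) auto
      then show ?thesis
        unfolding K_def by (intro mult_left_mono order_trans[OF norm_sum] sum_mono) auto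
    qed
    finally show ?thesis .
  qed
  then have le: "\<forall>\<^sub>F y in at x. norm (dist (?G y i j) (?G x i j)) \<le> \<bar>y - x\<bar> * K" by simp
  have lim: "((\<lambda>y. \<bar>y - x\<bar> * K) \<longlongrightarrow> 0) (at x)"
    by (rule tendsto_eq_intros | simp)+
  have "((\<lambda>y. dist (?G y i j) (?G x i j)) \<longlongrightarrow> 0) (at x)"
    by (rule Lim_null_comparison[OF le lim])
  then show ?thesis unfolding isCont_def by (rule iffD2[OF tendsto_dist_iff])
qed

lemma resolv_line_derivative:
  "((\<lambda>y. resolv N \<eta> (\<lambda>i j. H i j + y * C i j) i j) has_vector_derivative
     - (\<Sum>k<N. \<Sum>l<N. resolv N \<eta> (\<lambda>i j. H i j + x * C i j) i k * cx (C k l)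
         * resolv N \<eta> (\<lambda>i j. H i j + x * C i j) l j)) (at x)"
proof (rule has_vector_derivative_slope[where g="\<lambda>y. - (\<Sum>k<N. \<Sum>l<N. resolv N \<eta> (\<lambda>i j. H i j + y * C i j) i k * cx (C k l)
         * resolv N \<eta> (\<lambda>i j. H i j + x * C i j) l j)"])
  show "isCont (\<lambda>y. - (\<Sum>k<N. \<Sum>l<N. resolv N \<eta> (\<lambda>i j. H i j + y * C i j) i k * cx (C k l)
         * resolv N \<eta> (\<lambda>i j. H i j + x * C i j) l j)) x"
    by (intro continuous_minus continuous_sum continuous_mult continuous_const resolv_line_isCont)
qed (rule resolv_line_slope)

end

text \<open>Determinants and minors are polynomials in the matrix entries by the Leibniz
  formula.\<close>

lemma resolv_measurable:
  assumes "\<And>i j. i < N \<Longrightarrow> j < N \<Longrightarrow> (\<lambda>w. H w i j) \<in> borel_measurable S"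
  shows "(\<lambda>w. resolv N \<eta> (H w) i j) \<in> borel_measurable S"
proof -
  have detm: "(\<lambda>w. det (A w)) \<in> borel_measurable S"
    if "\<And>w. A w \<in> carrier_mat n n" "\<And>i j. i < n \<Longrightarrow> j < n \<Longrightarrow> (\<lambda>w. A w $$ (i,j)) \<in> borel_measurable S"
    for A :: "_ \<Rightarrow> complex mat" and n
  proof -
    have "(\<lambda>w. det (A w)) = (\<lambda>w. \<Sum>p\<in>{p. p permutes {0..<n}}. signof p * (\<Prod>i = 0..<n. A w $$ (i, p i)))"
      using that(1) by (auto simp: det_def')
    also have "\<dots> \<in> borel_measurable S"
    proof (intro borel_measurable_sum borel_measurable_times borel_measurable_prod borel_measurable_const)
      fix p i assume "p \<in> {p. p permutes {0..<n}}" "i \<in> {0..<n}"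
      then have "i < n" "p i < n" using permutes_in_image[of p "{0..<n}" i] by auto
      then show "(\<lambda>w. A w $$ (i, p i)) \<in> borel_measurable S" by (rule that(2))
    qed
    finally show ?thesis .
  qed
  have ent: "(\<lambda>w. shifted N \<eta> (H w) $$ (i,j)) \<in> borel_measurable S" if ij: "i < N" "j < N" for i j
  proof -
    have "(\<lambda>w. shifted N \<eta> (H w) $$ (i,j)) = (\<lambda>w. cx (H w i j) - (if i = j then \<i> * \<eta> else 0))"
      using ij by (simp add: shifted_def)
    also have "\<dots> \<in> borel_measurable S" using assms[OF ij] by measurable
    finally show ?thesis .
  qed
  show ?thesis
  proof (cases "i < N \<and> j < N")
    case True
    have del: "(\<lambda>w. det (mat_delete (shifted N \<eta> (H w)) j i)) \<in> borel_measurable S"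
    proof (rule detm)
      show "mat_delete (shifted N \<eta> (H w)) j i \<in> carrier_mat (N - 1) (N - 1)" for w
        by (rule mat_delete_carrier) simp
      fix a b assume ab: "a < N - 1" "b < N - 1"
      then have "(\<lambda>w. mat_delete (shifted N \<eta> (H w)) j i $$ (a,b))
         = (\<lambda>w. shifted N \<eta> (H w) $$ (if a < j then a else Suc a, if b < i then b else Suc b))"
        by (auto simp: mat_delete_def shifted_def)
      also have "\<dots> \<in> borel_measurable S" using ab by (intro ent) auto
      finally show "(\<lambda>w. mat_delete (shifted N \<eta> (H w)) j i $$ (a,b)) \<in> borel_measurable S" .
    qed
    have "(\<lambda>w. resolv N \<eta> (H w) i j)
      = (\<lambda>w. (-1) ^ (j + i) * det (mat_delete (shifted N \<eta> (H w)) j i) / det (shifted N \<eta> (H w)))"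
      using True by (auto simp: resolv_def adj_mat_def cofactor_def shifted_def fun_eq_iff)
    also have "\<dots> \<in> borel_measurable S"
      using del detm[of "\<lambda>w. shifted N \<eta> (H w)" N, OF shifted_carrier ent] by measurable
    finally show ?thesis .
  qed (auto simp: resolv_def cong: if_cong)
qed

section \<open>The trace of the resolvent as a sum over eigenvalues\<close>

lemma pderiv_over_poly:
  fixes z :: complex
  assumes "finite S" "z \<notin> S"
  shows "poly (pderiv (\<Prod>t\<in>S. [:-t, 1:] ^ k t)) z
     = poly (\<Prod>t\<in>S. [:-t, 1:] ^ k t) z * (\<Sum>t\<in>S. of_nat (k t) / (z - t))"
  using assms
proof (induction S rule: finite_induct)
  case (insert s S)
  have zs: "z - s \<noteq> 0" using insert by auto
  have one: "poly (pderiv ([:-s, 1:] ^ n)) z = (z - s) ^ n * (of_nat n / (z - s))" for n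
  proof (cases n)
    case (Suc m)
    have "poly (pderiv ([:-s, 1:] ^ Suc m)) z = of_nat (Suc m) * (z - s) ^ m"
      by (simp add: pderiv_power_Suc pderiv_pCons poly_power del: power_Suc of_nat_Suc)
    then show ?thesis using zs unfolding Suc by simp
  qed simp
  have "poly (pderiv (\<Prod>t\<in>insert s S. [:-t, 1:] ^ k t)) z
     = (z - s) ^ k s * poly (pderiv (\<Prod>t\<in>S. [:-t, 1:] ^ k t)) z
       + poly (\<Prod>t\<in>S. [:-t, 1:] ^ k t) z * poly (pderiv ([:-s, 1:] ^ k s)) z"
    using insert by (simp add: pderiv_mult poly_power)
  also have "\<dots> = (z - s) ^ k s * poly (\<Prod>t\<in>S. [:-t, 1:] ^ k t) z * (\<Sum>t\<in>insert s S. of_nat (k t) / (z - t))"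
    unfolding one using insert by (simp add: algebra_simps)
  finally show ?case using insert by (simp add: poly_power)
qed (simp add: pderiv_1)

text \<open>The diagonal entries of the adjugate are principal minors, and the derivative of the
  characteristic polynomial \<open>p\<close> is the sum of the characteristic polynomials of the
  principal submatrices, so the trace equals \<open>- p' / p\<close> at \<open>\<i> \<eta>\<close>.
  The partial fractions of the logarithmic derivative then give the sum over the roots with
  multiplicities \<open>order\<close>, without diagonalising.\<close>

lemma trace_resolv:
  assumes sym: "\<And>i j. i < N \<Longrightarrow> j < N \<Longrightarrow> H i j = H j i" and eta: "\<eta> > 0"
  defines "B \<equiv> mat N N (\<lambda>(i,j). H i j)"
  shows "(\<Sum>i<N. resolv N \<eta> H i i)
    = (\<Sum>t\<in>{t. poly (char_poly B) t = 0}. of_nat (order t (char_poly B)) / (cx t - \<i> * \<eta>))"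
proof -
  define BC where "BC = map_mat cx B"
  have B: "B \<in> carrier_mat N N" by (simp add: B_def)
  have BC: "BC \<in> carrier_mat N N" using B by (simp add: BC_def)
  let ?z = "\<i> * cx \<eta>"
  define p where "p = char_poly BC"
  have pmap: "p = map_poly cx (char_poly B)"
    unfolding p_def BC_def by (rule of_real_hom.char_poly_hom[OF B])
  have sh: "shifted N e (\<lambda>i j. H i j - (if i = j then x else 0)) = char_matrix BC (cx x + \<i> * e)" for e x :: real
    by (rule eq_matI) (auto simp: shifted_def char_matrix_def BC_def B_def)
  have neg1: "- A = (-1) \<cdot>\<^sub>m A" for A :: "complex mat" by (intro eq_matI) auto
  have ev: "poly p k = det (- char_matrix BC k)" for k unfolding p_def by (rule char_poly_matrix[OF BC])
  have ev': "poly p k = (-1) ^ N * det (char_matrix BC k)" for k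
    unfolding ev using det_smult[of "-1" "char_matrix BC k"] BC neg1[of "char_matrix BC k"] by (simp add: char_matrix_def)
  \<comment> \<open>Invertibility of the shifted matrix, applied to \<open>H - x\<close> for every
    real \<open>x\<close>, says that \<open>p\<close> has no root off the real axis; so passing to
    complex numbers adds no roots.\<close>
  have nz: "poly p (cx x + \<i> * e) \<noteq> 0" if "e \<noteq> 0" for x e :: real
    using det_shifted_nonzero[where N=N and H="\<lambda>i j. H i j - (if i = j then x else 0)" and \<eta>=e] sym that
    unfolding ev' sh by auto
  have pz: "poly p ?z \<noteq> 0" using nz[of \<eta> 0] eta by simp
  have p0: "p \<noteq> 0" using pz by auto
  have cb0: "char_poly B \<noteq> 0" using p0 pmap by auto
  have lc: "lead_coeff p = 1" unfolding p_def using degree_monic_char_poly[OF BC] by simp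
  have roots: "{z. poly p z = 0} = cx ` {t. poly (char_poly B) t = 0}"
  proof safe
    fix z assume z: "poly p z = 0"
    have "Im z = 0" using nz[of "Im z" "Re z"] z by (metis complex_eq)
    then have zr: "z = cx (Re z)" by (simp add: complex_eq_iff)
    then have "poly (char_poly B) (Re z) = 0" using z unfolding pmap
      by (metis of_real_0 of_real_eq_iff of_real_hom.poly_map_poly)
    then show "z \<in> cx ` {t. poly (char_poly B) t = 0}" using zr by blast
  next
    fix t assume "poly (char_poly B) t = 0"
    then show "poly p (cx t) = 0" unfolding pmap by (simp add: of_real_hom.poly_map_poly)
  qed
  have ord: "order (cx t) p = order t (char_poly B)" for t
  proof -
    interpret h: map_poly_inj_idom_divide_hom "of_real :: real \<Rightarrow> complex" by (unfold_locales; simp)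
    show ?thesis unfolding pmap by (rule h.order_hom)
  qed
  have fin: "finite {z. poly p z = 0}" using p0 by (rule poly_roots_finite)
  have dec: "p = (\<Prod>z\<in>{z. poly p z = 0}. [:-z, 1:] ^ order z p)"
    using complex_poly_decompose[of p] lc by simp
  have "poly (pderiv p) ?z = poly p ?z * (\<Sum>t\<in>{z. poly p z = 0}. of_nat (order t p) / (?z - t))"
    using pderiv_over_poly[OF fin, of ?z "\<lambda>z. order z p"] pz unfolding dec[symmetric] by simp
  then have quot: "poly (pderiv p) ?z / poly p ?z = (\<Sum>t\<in>{t. poly (char_poly B) t = 0}. of_nat (order t (char_poly B)) / (?z - cx t))"
    using pz unfolding roots by (subst (asm) sum.reindex) (auto simp: inj_on_def ord)
  have diag: "resolv N \<eta> H i i = - (poly (char_poly (mat_delete BC i i)) ?z / poly p ?z)" if i: "i < N" for i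
  proof -
    have shz: "shifted N \<eta> H = char_matrix BC ?z" using sh[of \<eta> 0] by simp
    have md: "mat_delete (char_matrix BC ?z) i i = char_matrix (mat_delete BC i i) ?z"
      using BC i by (intro eq_matI) (auto simp: mat_delete_def char_matrix_def)
    have mdc: "mat_delete BC i i \<in> carrier_mat (N-1) (N-1)" by (rule mat_delete_carrier[OF BC])
    have "poly (char_poly (mat_delete BC i i)) ?z = (-1) ^ (N-1) * det (char_matrix (mat_delete BC i i) ?z)"
      unfolding char_poly_matrix[OF mdc]
      using det_smult[of "-1" "char_matrix (mat_delete BC i i) ?z"] mdc BC
        neg1[of "char_matrix (mat_delete BC i i) ?z"] by (simp add: char_matrix_def)
    moreover have "resolv N \<eta> H i i = det (char_matrix (mat_delete BC i i) ?z) / det (char_matrix BC ?z)"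
    proof -
      have "dim_row (char_matrix BC ?z) = N" "dim_col (char_matrix BC ?z) = N"
        using BC by (auto simp: char_matrix_def)
      then show ?thesis using i unfolding resolv_def shz adj_mat_def cofactor_def by (simp add: md)
    qed
    moreover obtain n where "N = Suc n" using i by (cases N) auto
    ultimately show ?thesis unfolding ev' by (simp add: field_simps)
  qed
  have "(\<Sum>i<N. resolv N \<eta> H i i) = - (poly (pderiv p) ?z / poly p ?z)"
    unfolding p_def pderiv_char_poly[OF BC] poly_sum
    by (simp add: diag p_def sum_divide_distrib sum_negf)
  also have "\<dots> = (\<Sum>t\<in>{t. poly (char_poly B) t = 0}. of_nat (order t (char_poly B)) / (cx t - ?z))"
    unfolding quot sum_negf[symmetric] by (intro sum.cong refl) (metis minus_diff_eq divide_minus_right)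
  finally show ?thesis .
qed

section \<open>The kernel produced by integration by parts\<close>

definition pwave :: "nat \<Rightarrow> real \<Rightarrow> cvec" where
  "pwave N x = (\<lambda>j. cis (real j * x) / cx (sqrt (real N)))"

definition tr :: "nat \<Rightarrow> cmatr \<Rightarrow> complex" where
  "tr N A = (\<Sum>i<N. A i i)"

lemma cnj_pwave: "cnj (pwave N x j) = pwave N (- x) j"
  by (simp add: pwave_def cis_cnj)

lemma nrm_pwave: "N > 0 \<Longrightarrow> nrm N (pwave N x) = 1"
  by (simp add: nrm_def L2_set_def pwave_def norm_divide power_divide)

lemma borel_measurable_fst_snd[measurable]:
  "fst \<in> borel_measurable (borel :: (real \<times> real) measure)"
  "snd \<in> borel_measurable (borel :: (real \<times> real) measure)"
  unfolding borel_prod[symmetric] by measurable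

lemma pwave_measurable[measurable (raw)]:
  "f \<in> borel_measurable M \<Longrightarrow> (\<lambda>z. pwave N (f z) j) \<in> borel_measurable M"
  unfolding pwave_def by (intro borel_measurable_divide borel_measurable_const) measurable

text \<open>The conjugate of \<open>G - \<alpha>\<close> summed over the \<open>m\<close>-th
  diagonal and divided by \<open>N\<close> on every diagonal, not by the diagonal's length. With
  this normalisation the diagonal sums of \<open>G - \<alpha>\<close> are \<open>N\<close> times the
  conjugate coefficients, so the trace against the Toeplitz matrix is a sum of squares, and the same
  numbers are the Fourier coefficients in \<open>diag_fourier\<close>.\<close>

definition toepcoef :: "nat \<Rightarrow> cmatr \<Rightarrow> complex \<Rightarrow> int \<Rightarrow> complex" where
  "toepcoef N G \<alpha> m = (\<Sum>k<N. \<Sum>l<N. if int k - int l = m then cnj (G k l) else 0) / of_nat N - (if m = 0 then cnj \<alpha> else 0)"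

definition toepdev :: "nat \<Rightarrow> cmatr \<Rightarrow> complex \<Rightarrow> cmatr" where
  "toepdev N G \<alpha> = (\<lambda>i j. toep N (\<lambda>k l. cnj (G k l)) i j - (if i = j then cnj \<alpha> else 0))"

text \<open>The quantity \<open>J\<close> of the overview. Only differences of two indices below
  \<open>N\<close> occur, hence the open range of \<open>m\<close>.\<close>

definition defect :: "nat \<Rightarrow> cmatr \<Rightarrow> complex \<Rightarrow> real" where
  "defect N G \<alpha> = (\<Sum>m\<in>{-int N<..<int N}. (cmod (toepcoef N G \<alpha> m))^2)"

lemma defect_nonneg: "0 \<le> defect N G \<alpha>"
  unfolding defect_def by (intro sum_nonneg) auto

lemma toepdev_eq: "toepdev N G \<alpha> i j = toepcoef N G \<alpha> (int i - int j)"
  by (simp add: toepdev_def toepcoef_def toep_def)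

lemma sum_diag_minus:
  fixes A :: cmatr
  shows "(\<Sum>i<N. \<Sum>j<N. if int i - int j = m then A i j - (if i = j then a else 0) else 0)
    = (\<Sum>i<N. \<Sum>j<N. if int i - int j = m then A i j else 0) - of_nat N * (if m = 0 then a else 0)"
proof -
  have "(\<Sum>i<N. \<Sum>j<N. if int i - int j = m then A i j - (if i = j then a else 0) else 0)
    = (\<Sum>i<N. \<Sum>j<N. (if int i - int j = m then A i j else 0) - (if j = i then (if m = 0 then a else 0) else 0))"
    by (intro sum.cong refl) auto
  also have "\<dots> = (\<Sum>i<N. \<Sum>j<N. if int i - int j = m then A i j else 0) - of_nat N * (if m = 0 then a else 0)"
    by (simp add: sum_subtractf sum.delta)
  finally show ?thesis .
qed

lemma tr_toepdev:
  assumes "N > 0" and sym: "\<And>i j. G i j = G j i"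
  shows "tr N (mmul N (\<lambda>i j. G i j - (if i = j then \<alpha> else 0)) (toepdev N G \<alpha>)) = of_nat N * cx (defect N G \<alpha>)"
proof -
  define D where "D i j = G i j - (if i = j then \<alpha> else 0)" for i j
  have Dsym: "D i j = D j i" for i j using sym by (simp add: D_def)
  have "tr N (mmul N D (toepdev N G \<alpha>)) = (\<Sum>i<N. \<Sum>j<N. toepcoef N G \<alpha> (int i - int j) * D i j)"
    unfolding tr_def mmul_def toepdev_eq by (subst sum.swap) (simp add: Dsym mult.commute)
  also have "\<dots> = (\<Sum>m\<in>{-int N<..<int N}. toepcoef N G \<alpha> m * (\<Sum>i<N. \<Sum>j<N. if int i - int j = m then D i j else 0))"
    by (rule sum_diff_reindex)
  also have "\<dots> = (\<Sum>m\<in>{-int N<..<int N}. of_nat N * cx ((cmod (toepcoef N G \<alpha> m))^2))"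
  proof (intro sum.cong refl)
    fix m
    have "(\<Sum>i<N. \<Sum>j<N. if int i - int j = m then D i j else 0) = of_nat N * cnj (toepcoef N G \<alpha> m)"
      unfolding D_def sum_diag_minus toepcoef_def using assms(1)
      by (simp add: algebra_simps if_distrib[of cnj] cong: if_cong)
    then show "toepcoef N G \<alpha> m * (\<Sum>i<N. \<Sum>j<N. if int i - int j = m then D i j else 0)
        = of_nat N * cx ((cmod (toepcoef N G \<alpha> m))^2)"
      by (simp add: complex_norm_square mult.left_commute del: of_real_power)
  qed
  finally show ?thesis unfolding D_def defect_def by (simp add: sum_distrib_left)
qed

text \<open>The term \<open>m = 0\<close> of the sum is already the squared deviation of the
  normalised trace.\<close>

lemma trace_le_defect:
  assumes "N > 0"
  shows "(cmod ((\<Sum>i<N. G i i) / of_nat N - \<alpha>))^2 \<le> defect N G \<alpha>"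
proof -
  have "(\<Sum>k<N. \<Sum>l<N. if int k - int l = 0 then cnj (G k l) else 0) = (\<Sum>k<N. cnj (G k k))"
  proof (rule sum.cong[OF refl])
    fix k assume "k \<in> {..<N}"
    have "(\<Sum>l<N. if int k - int l = 0 then cnj (G k l) else 0) = (\<Sum>l<N. if l = k then cnj (G k l) else 0)"
      by (intro sum.cong) auto
    then show "(\<Sum>l<N. if int k - int l = 0 then cnj (G k l) else 0) = cnj (G k k)" using \<open>k \<in> _\<close> by simp
  qed
  then have "toepcoef N G \<alpha> 0 = cnj ((\<Sum>i<N. G i i) / of_nat N - \<alpha>)" by (simp add: toepcoef_def)
  then have "(cmod ((\<Sum>i<N. G i i) / of_nat N - \<alpha>))^2 = (cmod (toepcoef N G \<alpha> 0))^2" by (simp only: complex_mod_cnj)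
  also have "\<dots> \<le> defect N G \<alpha>"
    unfolding defect_def using assms by (intro member_le_sum) auto
  finally show ?thesis .
qed

lemma pwave_diff: "N > 0 \<Longrightarrow> pwave N x k * pwave N (- x) l = cis (real_of_int (int k - int l) * x) / of_nat N"
proof -
  assume "N > 0"
  have "cx (sqrt (real N)) * cx (sqrt (real N)) = of_nat N"
    by (simp flip: of_real_mult)
  then show ?thesis by (simp add: pwave_def cis_mult algebra_simps)
qed

text \<open>In the quadratic form at a plane wave the entry \<open>(k, l)\<close> is weighted by a
  character of \<open>k - l\<close>, so the form is a trigonometric polynomial in \<open>x\<close>
  whose coefficients are the diagonal averages. Its deviation from \<open>\<alpha>\<close> is thus
  measured by the same numbers as the test matrix.\<close>

lemma diag_fourier:
  assumes "N > 0" and sym: "\<And>i j. G i j = G j i"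
  shows "dotp N (pwave N x) (mvp N G (pwave N (- x))) - \<alpha>
    = (\<Sum>m\<in>{-int N<..<int N}. cnj (toepcoef N G \<alpha> m) * cis (real_of_int m * x))"
proof -
  define D where "D i j = G i j - (if i = j then \<alpha> else 0)" for i j
  have dg: "(\<Sum>i<N. \<Sum>j<N. if int i - int j = m then D i j else 0) = of_nat N * cnj (toepcoef N G \<alpha> m)" for m
    unfolding D_def sum_diag_minus toepcoef_def using assms(1)
    by (simp add: algebra_simps if_distrib[of cnj] cong: if_cong)
  have a: "(\<Sum>i<N. \<Sum>j<N. cis (real_of_int (int i - int j) * x) / of_nat N * (if i = j then \<alpha> else 0)) = \<alpha>"
    using assms(1) by (simp add: if_distrib[of "\<lambda>x. _ * x"] cong: if_cong)
  have "dotp N (pwave N x) (mvp N G (pwave N (- x)))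
     = (\<Sum>i<N. \<Sum>j<N. cis (real_of_int (int i - int j) * x) / of_nat N * G i j)"
    unfolding dotp_mvp_sum pwave_diff[OF assms(1), symmetric] by (intro sum.cong refl) (simp add: mult_ac)
  then have "dotp N (pwave N x) (mvp N G (pwave N (- x))) - \<alpha>
     = (\<Sum>i<N. \<Sum>j<N. cis (real_of_int (int i - int j) * x) / of_nat N * G i j)
       - (\<Sum>i<N. \<Sum>j<N. cis (real_of_int (int i - int j) * x) / of_nat N * (if i = j then \<alpha> else 0))"
    unfolding a by simp
  also have "\<dots> = (\<Sum>i<N. \<Sum>j<N. cis (real_of_int (int i - int j) * x) / of_nat N * D i j)"
    unfolding sum_subtractf[symmetric] by (intro sum.cong refl) (simp add: D_def right_diff_distrib)
  also have "\<dots> = (\<Sum>m\<in>{-int N<..<int N}. cis (real_of_int m * x) / of_nat N * (\<Sum>i<N. \<Sum>j<N. if int i - int j = m then D i j else 0))"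
    by (rule sum_diff_reindex[where F="\<lambda>m. cis (real_of_int m * x) / of_nat N"])
  finally show ?thesis unfolding dg using assms(1) by (simp add: mult.commute)
qed

text \<open>A row of a Toeplitz matrix meets every diagonal at most once.\<close>

lemma hsq_toepdev: "hsq N (toepdev N G \<alpha>) \<le> of_nat N * defect N G \<alpha>"
proof -
  have "(\<Sum>j<N. (cmod (toepcoef N G \<alpha> (int i - int j)))^2) \<le> defect N G \<alpha>" if "i < N" for i
  proof -
    have "(\<Sum>j<N. (cmod (toepcoef N G \<alpha> (int i - int j)))^2)
      = (\<Sum>m\<in>(\<lambda>j. int i - int j) ` {..<N}. (cmod (toepcoef N G \<alpha> m))^2)"
      by (subst sum.reindex) (auto simp: inj_on_def)
    also have "\<dots> \<le> defect N G \<alpha>"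
      unfolding defect_def using that by (intro sum_mono2) auto
    finally show ?thesis .
  qed
  then have "hsq N (toepdev N G \<alpha>) \<le> (\<Sum>i<N. defect N G \<alpha>)"
    unfolding hsq_def toepdev_eq by (intro sum_mono) auto
  then show ?thesis by simp
qed

lemma nrm_mvp_hsq: "nrm N (mvp N A v) \<le> sqrt (hsq N A) * nrm N v"
proof -
  have "(nrm N (mvp N A v))^2 \<le> (\<Sum>i<N. (nrm N (A i) * nrm N v)^2)"
    unfolding nrm_sq[of N "mvp N A v"]
    by (intro sum_mono power_mono) (auto simp: mvp_def dotp_le[unfolded dotp_def])
  also have "\<dots> = (sqrt (hsq N A) * nrm N v)^2"
    by (simp add: power_mult_distrib hsq_row sum_distrib_right[symmetric] sum_nonneg)
  finally show ?thesis by (rule power2_le_imp_le) simp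
qed

text \<open>The weight \<open>s\<close> is free: with one factor of bounded Hilbert-Schmidt norm and
  the other of squared norm of order \<open>N\<close>, the choice \<open>s = sqrt N\<close> bounds
  the trace by a multiple of \<open>sqrt N\<close>, which is negligible after division by
  \<open>N\<close>.\<close>

lemma tr_mmul_le: "cmod (tr N (mmul N A B)) \<le> (s * hsq N A + hsq N B / s) / 2" if "s > 0"
proof -
  have ag: "a * b \<le> (s * a^2 + b^2 / s) / 2" for a b :: real
  proof -
    have "0 \<le> (sqrt s * a - b / sqrt s)^2" by simp
    also have "\<dots> = s * a^2 + b^2 / s - 2 * (a * b)" using that
      by (simp add: power2_diff power_mult_distrib power_divide)
    finally show ?thesis by simp
  qed
  have "cmod (tr N (mmul N A B)) \<le> (\<Sum>i<N. \<Sum>k<N. (s * (cmod (A i k))^2 + (cmod (B k i))^2 / s) / 2)"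
    unfolding tr_def mmul_def
    by (rule order_trans[OF norm_sum], rule sum_mono, rule order_trans[OF norm_sum], rule sum_mono)
       (simp only: norm_mult ag)
  also have "\<dots> = (s * hsq N A + (\<Sum>i<N. \<Sum>k<N. (cmod (B k i))^2) / s) / 2"
    unfolding hsq_def by (simp add: sum.distrib sum_distrib_left sum_divide_distrib add_divide_distrib)
  also have "(\<Sum>i<N. \<Sum>k<N. (cmod (B k i))^2) = hsq N B" unfolding hsq_def by (rule sum.swap)
  finally show ?thesis .
qed

section \<open>The integration by parts kernel and its splitting\<close>

definition symcov :: "nat \<Rightarrow> real \<Rightarrow> real \<Rightarrow> cmatr" where
  "symcov N x y = (\<lambda>i j. pwave N x i * pwave N y j + pwave N y i * pwave N x j)"

text \<open>The contribution of one frequency pair after integration by parts: the covariance of the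
  matrix entries is an integral over \<open>\<nu>\<close> of products of two rank-two matrices
  \<open>symcov\<close>, and the two summands are the derivative falling on \<open>G\<close> and on
  the test matrix. The minus sign is left out, so the normalised trace and the
  \<open>\<nu>\<close>-integral of this kernel add up to mean zero.\<close>

definition ibpkernel :: "nat \<Rightarrow> cmatr \<Rightarrow> complex \<Rightarrow> cmatr \<Rightarrow> real \<Rightarrow> real \<Rightarrow> complex" where
  "ibpkernel N G \<alpha> P x y = (\<Sum>i<N. \<Sum>a<N. \<Sum>b<N. \<Sum>j<N. P i a * symcov N x y a b *
     (mmul N (mmul N G (symcov N (- x) (- y))) G b j * toepdev N G \<alpha> j i
      + G b j * toep N (mmul N (mmul N (\<lambda>i j. cnj (G i j)) (symcov N (- x) (- y))) (\<lambda>i j. cnj (G i j))) j i))"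

text \<open>The pairing in which the first factor sees a single frequency: it is the symbol of
  \<open>G\<close> at \<open>y\<close>, for which the comparison value is \<open>\<alpha>\<close>
  rather than 0.\<close>

definition mainterm :: "nat \<Rightarrow> cmatr \<Rightarrow> complex \<Rightarrow> cmatr \<Rightarrow> real \<Rightarrow> real \<Rightarrow> complex" where
  "mainterm N G \<alpha> P x y = dotp N (pwave N y) (mvp N G (pwave N (- y)))
      * dotp N (pwave N (- x)) (mvp N G (mvp N (toepdev N G \<alpha>) (mvp N P (pwave N x))))"

text \<open>First the pairing in which \<open>G\<close> connects the waves at \<open>y\<close> and
  \<open>- x\<close>, then the derivative of the Toeplitz test matrix. Decay in \<open>N\<close> is
  obtained for both on average over the box.\<close>

definition remterm :: "nat \<Rightarrow> cmatr \<Rightarrow> complex \<Rightarrow> cmatr \<Rightarrow> real \<Rightarrow> real \<Rightarrow> complex" where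
  "remterm N G \<alpha> P x y = dotp N (pwave N y) (mvp N G (pwave N (- x)))
      * dotp N (pwave N (- y)) (mvp N G (mvp N (toepdev N G \<alpha>) (mvp N P (pwave N x))))
    + dotp N (pwave N y) (mvp N G (mvp N (toep N (mmul N (mmul N (\<lambda>i j. cnj (G i j)) (symcov N (- x) (- y))) (\<lambda>i j. cnj (G i j))))
        (mvp N P (pwave N x))))"

lemma symcov_commute: "symcov N x y = symcov N y x"
  by (simp add: symcov_def add.commute)

lemma mvp_symcov: "mvp N (symcov N x y) w = (\<lambda>i. pwave N x i * dotp N (pwave N y) w + pwave N y i * dotp N (pwave N x) w)"
  unfolding mvp_def symcov_def dotp_def sum_distrib_left sum.distrib[symmetric]
  by (intro ext sum.cong refl) (simp add: algebra_simps)

lemma dotp_add_right: "dotp N u (\<lambda>i. v i + w i) = dotp N u v + dotp N u w"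
  by (simp add: dotp_def distrib_left sum.distrib)

lemma dotp_diff_right: "dotp N u (\<lambda>i. v i - w i) = dotp N u v - dotp N u w"
  by (simp add: dotp_def right_diff_distrib sum_subtractf)

lemma dotp_scale_right: "dotp N u (\<lambda>i. v i * c) = dotp N u v * c"
  by (simp add: dotp_def sum_distrib_right mult.assoc)

lemma mvp_add_right: "mvp N A (\<lambda>i. v i + w i) = (\<lambda>i. mvp N A v i + mvp N A w i)"
  by (simp add: mvp_def distrib_left sum.distrib)

lemma mvp_diff_right: "mvp N A (\<lambda>i. v i - w i) = (\<lambda>i. mvp N A v i - mvp N A w i)"
  by (simp add: mvp_def right_diff_distrib sum_subtractf)

lemma mvp_scale_right: "mvp N A (\<lambda>i. v i * c) = (\<lambda>i. mvp N A v i * c)"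
  by (simp add: mvp_def sum_distrib_right mult.assoc)

lemma mvp_cong: "(\<And>i. i < N \<Longrightarrow> v i = w i) \<Longrightarrow> mvp N A v = mvp N A w"
  by (simp add: mvp_def)

text \<open>Each \<open>symcov\<close> is a sum of two rank-one matrices: the derivative of
  \<open>G\<close> gives four products, two of which pair equal frequencies, and the derivative of
  the test matrix gives two.\<close>

lemma ibpkernel_eq:
  "ibpkernel N G \<alpha> P x y = mainterm N G \<alpha> P x y + mainterm N G \<alpha> P y x + (remterm N G \<alpha> P x y + remterm N G \<alpha> P y x)"
proof -
  let ?Gc = "\<lambda>i j. cnj (G i j)"
  let ?T = "toep N (mmul N (mmul N ?Gc (symcov N (- x) (- y))) ?Gc)"
  let ?B = "toepdev N G \<alpha>"
  define R where "R b i = (\<Sum>j<N. mmul N (mmul N G (symcov N (- x) (- y))) G b j * ?B j i + G b j * ?T j i)" for b i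
  have R: "mvp N R w = (\<lambda>i. mvp N G (mvp N (symcov N (- x) (- y)) (mvp N G (mvp N ?B w))) i + mvp N G (mvp N ?T w) i)" for w
  proof -
    have "R = (\<lambda>b i. mmul N (mmul N (mmul N G (symcov N (- x) (- y))) G) ?B b i + mmul N G ?T b i)"
      unfolding R_def mmul_def[of N _ ?B] mmul_def[of N G ?T] by (simp add: sum.distrib)
    moreover have "mvp N (\<lambda>b i. X b i + Y b i) w = (\<lambda>i. mvp N X w i + mvp N Y w i)" for X Y
      by (simp add: mvp_def distrib_right sum.distrib)
    ultimately show ?thesis by (simp only: mvp_mmul)
  qed
  have one: "(\<Sum>i<N. \<Sum>a<N. \<Sum>b<N. P i a * (u a * v b) * R b i) = dotp N v (mvp N R (mvp N P u))" for u v
  proof -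
    have "dotp N v (mvp N R (mvp N P u)) = (\<Sum>b<N. \<Sum>i<N. \<Sum>a<N. P i a * (u a * v b) * R b i)"
      unfolding dotp_def mvp_def sum_distrib_left by (simp add: mult_ac)
    also have "\<dots> = (\<Sum>i<N. \<Sum>b<N. \<Sum>a<N. P i a * (u a * v b) * R b i)" by (rule sum.swap)
    also have "\<dots> = (\<Sum>i<N. \<Sum>a<N. \<Sum>b<N. P i a * (u a * v b) * R b i)" by (rule sum.cong[OF refl], rule sum.swap)
    finally show ?thesis by simp
  qed
  have "ibpkernel N G \<alpha> P x y = (\<Sum>i<N. \<Sum>a<N. \<Sum>b<N. P i a * symcov N x y a b * R b i)"
    unfolding ibpkernel_def R_def sum_distrib_left ..
  also have "\<dots> = (\<Sum>i<N. \<Sum>a<N. \<Sum>b<N. P i a * (pwave N x a * pwave N y b) * R b i)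
      + (\<Sum>i<N. \<Sum>a<N. \<Sum>b<N. P i a * (pwave N y a * pwave N x b) * R b i)"
    unfolding sum.distrib[symmetric] symcov_def by (intro sum.cong refl) (simp add: algebra_simps)
  also have "\<dots> = dotp N (pwave N y) (mvp N R (mvp N P (pwave N x))) + dotp N (pwave N x) (mvp N R (mvp N P (pwave N y)))"
    unfolding one ..
  finally show ?thesis
    unfolding R mvp_symcov mvp_add_right mvp_scale_right dotp_add_right dotp_scale_right mainterm_def remterm_def
    by (simp add: symcov_commute[of N "- y" "- x"] algebra_simps)
qed

lemma opb_symcov: "N > 0 \<Longrightarrow> opb N 2 (symcov N x y)"
  unfolding opb_bilinear
proof (intro conjI allI)
  fix u v assume N: "N > 0"
  have d: "cmod (dotp N w (pwave N x)) \<le> nrm N w" for w x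
    using dotp_le[of N w "pwave N x"] nrm_pwave[OF N] by simp
  have "dotp N u (mvp N (symcov N x y) v) = dotp N u (pwave N x) * dotp N v (pwave N y) + dotp N u (pwave N y) * dotp N v (pwave N x)"
    unfolding mvp_symcov dotp_add_right dotp_scale_right by (simp add: dotp_commute)
  then have "cmod (dotp N u (mvp N (symcov N x y) v))
      \<le> cmod (dotp N u (pwave N x)) * cmod (dotp N v (pwave N y)) + cmod (dotp N u (pwave N y)) * cmod (dotp N v (pwave N x))"
    by (simp only: norm_mult[symmetric] norm_triangle_ineq)
  also have "\<dots> \<le> nrm N u * nrm N v + nrm N u * nrm N v" by (intro add_mono mult_mono d) auto
  finally show "cmod (dotp N u (mvp N (symcov N x y) v)) \<le> 2 * nrm N u * nrm N v" by simp
qed simp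

context
  fixes N :: nat and \<eta> :: real and G P :: cmatr and \<alpha> :: complex
  assumes N: "N > 0" and eta: "\<eta> > 0" and G: "opb N (1 / \<eta>) G" and sym: "\<And>i j. G i j = G j i"
    and al: "cmod \<alpha> \<le> 1 / \<eta>" and P: "opb N 1 P"
begin

lemma opb_toepdev: "opb N (2 / \<eta>) (toepdev N G \<alpha>)"
proof -
  have "opb N (1 / \<eta> + cmod (cnj \<alpha>)) (toepdev N G \<alpha>)"
    unfolding toepdev_def by (rule opb_diff_id[OF opb_toep[OF opb_cnj[OF G]]])
  then have "nrm N (mvp N (toepdev N G \<alpha>) v) \<le> (1 / \<eta> + cmod \<alpha>) * nrm N v" for v by (simp add: opb_def)
  also have "(1 / \<eta> + cmod \<alpha>) * nrm N v \<le> (2 / \<eta>) * nrm N v" for v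
    using al by (intro mult_right_mono) (auto simp: field_simps)
  finally show ?thesis using eta by (simp add: opb_def)
qed

lemma opb_extra:
  "opb N (2 / \<eta>^2) (toep N (mmul N (mmul N (\<lambda>i j. cnj (G i j)) (symcov N x y)) (\<lambda>i j. cnj (G i j))))"
proof -
  have "opb N (1 / \<eta> * 2 * (1 / \<eta>)) (mmul N (mmul N (\<lambda>i j. cnj (G i j)) (symcov N x y)) (\<lambda>i j. cnj (G i j)))"
    by (intro opb_mmul opb_symcov[OF N] opb_cnj G)
  from opb_toep[OF this] show ?thesis by (simp add: power2_eq_square)
qed

lemma dotp_pwave_le: "cmod (dotp N (pwave N x) w) \<le> nrm N w"
  using dotp_le[of N "pwave N x" w] nrm_pwave[OF N] by simp

lemma ghat_le: "cmod (dotp N (pwave N x) (mvp N G (pwave N y))) \<le> 1 / \<eta>"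
  using dotp_pwave_le[of x "mvp N G (pwave N y)"] opbD[OF G, of "pwave N y"] nrm_pwave[OF N] by simp

lemma quad_le: "cmod (dotp N (pwave N x) (mvp N G (mvp N (toepdev N G \<alpha>) w))) \<le> 2 / \<eta>^2 * nrm N w"
proof -
  have "cmod (dotp N (pwave N x) (mvp N G (mvp N (toepdev N G \<alpha>) w))) \<le> 1 / \<eta> * (2 / \<eta> * nrm N w)"
    by (rule order_trans[OF dotp_pwave_le]) (intro opbD'[OF G] opbD[OF opb_toepdev])
  then show ?thesis by (simp add: power2_eq_square)
qed

lemma mainterm_le: "cmod (mainterm N G \<alpha> P x y) \<le> 2 / \<eta>^3 * nrm N (mvp N P (pwave N x))"
proof -
  have "cmod (mainterm N G \<alpha> P x y) \<le> (1 / \<eta>) * (2 / \<eta>^2 * nrm N (mvp N P (pwave N x)))"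
    unfolding mainterm_def norm_mult using eta by (intro mult_mono ghat_le quad_le) auto
  then show ?thesis by (simp add: power2_eq_square power3_eq_cube)
qed

lemma remterm_le: "cmod (remterm N G \<alpha> P x y) \<le> 4 / \<eta>^3 * nrm N (mvp N P (pwave N x))"
proof -
  let ?p = "nrm N (mvp N P (pwave N x))"
  have "cmod (remterm N G \<alpha> P x y) \<le> (1 / \<eta>) * (2 / \<eta>^2 * ?p) + 1 / \<eta> * (2 / \<eta>^2 * ?p)"
    unfolding remterm_def
  proof (rule order_trans[OF norm_triangle_ineq add_mono])
    show "cmod (dotp N (pwave N y) (mvp N G (pwave N (- x))) * dotp N (pwave N (- y)) (mvp N G (mvp N (toepdev N G \<alpha>) (mvp N P (pwave N x)))))
        \<le> (1 / \<eta>) * (2 / \<eta>^2 * ?p)"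
      unfolding norm_mult using eta by (intro mult_mono ghat_le quad_le) auto
    show "cmod (dotp N (pwave N y) (mvp N G (mvp N (toep N (mmul N (mmul N (\<lambda>i j. cnj (G i j)) (symcov N (- x) (- y))) (\<lambda>i j. cnj (G i j))))
        (mvp N P (pwave N x))))) \<le> 1 / \<eta> * (2 / \<eta>^2 * ?p)"
      by (rule order_trans[OF dotp_pwave_le]) (intro opbD'[OF G] opbD[OF opb_extra])
  qed
  then show ?thesis by (simp add: power2_eq_square power3_eq_cube)
qed

text \<open>The norms of \<open>P\<close> applied to the two plane waves are kept, so the kernel
  vanishes at frequency pairs whose waves \<open>P\<close> annihilates. The constant 6 collects 2
  from the main and 4 from the remaining terms.\<close>

lemma ibpkernel_le:
  "cmod (ibpkernel N G \<alpha> P x y) \<le> 6 / \<eta>^3 * (nrm N (mvp N P (pwave N x)) + nrm N (mvp N P (pwave N y)))"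
proof -
  have "cmod (ibpkernel N G \<alpha> P x y) \<le> (cmod (mainterm N G \<alpha> P x y) + cmod (mainterm N G \<alpha> P y x))
     + (cmod (remterm N G \<alpha> P x y) + cmod (remterm N G \<alpha> P y x))"
    unfolding ibpkernel_eq by (intro order_trans[OF norm_triangle_ineq] add_mono norm_triangle_ineq)
  also have "\<dots> \<le> (2 / \<eta>^3 * nrm N (mvp N P (pwave N x)) + 2 / \<eta>^3 * nrm N (mvp N P (pwave N y)))
      + (4 / \<eta>^3 * nrm N (mvp N P (pwave N x)) + 4 / \<eta>^3 * nrm N (mvp N P (pwave N y)))"
    by (intro add_mono mainterm_le remterm_le)
  finally show ?thesis by (simp add: algebra_simps)
qed

lemma nrm_P_pwave: "nrm N (mvp N P (pwave N x)) \<le> 1"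
  using opbD[OF P, of "pwave N x"] nrm_pwave[OF N] by simp

text \<open>Unlike \<open>remterm_le\<close>, this bound keeps the two factors whose mean squares
  over the box decay.\<close>

lemma remterm_small:
  "cmod (remterm N G \<alpha> P x y) \<le> 2 / \<eta>^2 * cmod (dotp N (pwave N y) (mvp N G (pwave N (- x))))
    + 1 / \<eta> * sqrt (hsq N (toep N (mmul N (mmul N (\<lambda>i j. cnj (G i j)) (symcov N (- x) (- y))) (\<lambda>i j. cnj (G i j)))))"
  (is "_ \<le> 2 / \<eta>^2 * ?c + 1 / \<eta> * sqrt (hsq N ?T)")
  unfolding remterm_def
proof (rule order_trans[OF norm_triangle_ineq add_mono])
  have "cmod (dotp N (pwave N (- y)) (mvp N G (mvp N (toepdev N G \<alpha>) (mvp N P (pwave N x))))) \<le> 2 / \<eta>^2 * nrm N (mvp N P (pwave N x))"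
    by (rule quad_le)
  also have "\<dots> \<le> 2 / \<eta>^2 * 1" by (intro mult_left_mono nrm_P_pwave) simp
  finally show "cmod (dotp N (pwave N y) (mvp N G (pwave N (- x))) * dotp N (pwave N (- y)) (mvp N G (mvp N (toepdev N G \<alpha>) (mvp N P (pwave N x)))))
        \<le> 2 / \<eta>^2 * ?c" unfolding norm_mult by (subst mult.commute) (intro mult_right_mono; simp)
  have "nrm N (mvp N ?T (mvp N P (pwave N x))) \<le> sqrt (hsq N ?T) * 1"
    by (rule order_trans[OF nrm_mvp_hsq]) (intro mult_left_mono nrm_P_pwave; simp)
  then show "cmod (dotp N (pwave N y) (mvp N G (mvp N ?T (mvp N P (pwave N x))))) \<le> 1 / \<eta> * sqrt (hsq N ?T)"
    using eta by (intro order_trans[OF dotp_pwave_le] opbD'[OF G]) simp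
qed

end

text \<open>Orthogonality is asked of the sum of the two Gram matrices, as it holds for the
  characters of the two coordinates when the symmetrised marginal is uniform. Expanding the squares
  and integrating termwise leaves the diagonal.\<close>

lemma parseval_pair:
  fixes e e' :: "'i \<Rightarrow> 'z \<Rightarrow> complex"
  assumes S: "finite S"
    and i: "\<And>a b. a \<in> S \<Longrightarrow> b \<in> S \<Longrightarrow> integrable \<rho> (\<lambda>z. e a z * cnj (e b z) + e' a z * cnj (e' b z))"
    and o: "\<And>a b. a \<in> S \<Longrightarrow> b \<in> S \<Longrightarrow> (\<integral>z. e a z * cnj (e b z) + e' a z * cnj (e' b z) \<partial>\<rho>) = (if a = b then cx \<kappa> else 0)"
  shows "integrable \<rho> (\<lambda>z. (cmod (\<Sum>a\<in>S. c a * e a z))^2 + (cmod (\<Sum>a\<in>S. c a * e' a z))^2)"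
    and "(\<integral>z. (cmod (\<Sum>a\<in>S. c a * e a z))^2 + (cmod (\<Sum>a\<in>S. c a * e' a z))^2 \<partial>\<rho>) = \<kappa> * (\<Sum>a\<in>S. (cmod (c a))^2)"
proof -
  let ?g = "\<lambda>z. (cmod (\<Sum>a\<in>S. c a * e a z))^2 + (cmod (\<Sum>a\<in>S. c a * e' a z))^2"
  have sq: "cx ((cmod (\<Sum>a\<in>S. c a * u a))^2) = (\<Sum>a\<in>S. \<Sum>b\<in>S. c a * cnj (c b) * (u a * cnj (u b)))" for u
    unfolding complex_norm_square cnj_sum sum_product by (simp add: mult_ac)
  have g: "cx (?g z) = (\<Sum>a\<in>S. \<Sum>b\<in>S. c a * cnj (c b) * (e a z * cnj (e b z) + e' a z * cnj (e' b z)))" for z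
    unfolding of_real_add sq by (simp add: sum.distrib[symmetric] distrib_left)
  have ig: "integrable \<rho> (\<lambda>z. cx (?g z))"
    unfolding g using i by (intro Bochner_Integration.integrable_sum integrable_mult_right) auto
  then show ir: "integrable \<rho> ?g" by (simp only: complex_of_real_integrable_eq)
  have "cx (\<integral>z. ?g z \<partial>\<rho>) = (\<integral>z. cx (?g z) \<partial>\<rho>)"
    by (rule integral_complex_of_real[symmetric])
  also have "\<dots> = (\<Sum>a\<in>S. \<integral>z. (\<Sum>b\<in>S. c a * cnj (c b) * (e a z * cnj (e b z) + e' a z * cnj (e' b z))) \<partial>\<rho>)"
    unfolding g by (intro Bochner_Integration.integral_sum Bochner_Integration.integrable_sum integrable_mult_right i)
  also have "\<dots> = (\<Sum>a\<in>S. \<Sum>b\<in>S. \<integral>z. c a * cnj (c b) * (e a z * cnj (e b z) + e' a z * cnj (e' b z)) \<partial>\<rho>)"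
    by (intro sum.cong refl Bochner_Integration.integral_sum integrable_mult_right i)
  also have "\<dots> = (\<Sum>a\<in>S. \<Sum>b\<in>S. c a * cnj (c b) * (if a = b then cx \<kappa> else 0))"
    by (intro sum.cong refl) (simp add: o)
  also have "\<dots> = cx (\<kappa> * (\<Sum>a\<in>S. (cmod (c a))^2))"
  proof -
    have "(\<Sum>a\<in>S. \<Sum>b\<in>S. c a * cnj (c b) * (if a = b then cx \<kappa> else 0)) = (\<Sum>a\<in>S. c a * cnj (c a) * cx \<kappa>)"
      using S by (simp add: if_distrib[of "\<lambda>x. _ * x"] cong: if_cong)
    also have "\<dots> = cx (\<kappa> * (\<Sum>a\<in>S. (cmod (c a))^2))"
      unfolding of_real_mult of_real_sum complex_norm_square sum_distrib_left
      by (intro sum.cong refl) simp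
    finally show ?thesis .
  qed
  finally show "(\<integral>z. ?g z \<partial>\<rho>) = \<kappa> * (\<Sum>a\<in>S. (cmod (c a))^2)"
    unfolding of_real_eq_iff .
qed

text \<open>Only the symmetrised marginal of the spectral density enters, and the orthogonality
  relations of the coefficients say exactly that it is uniform.\<close>
locale uniform_marginals = finite_measure \<rho> for \<rho> :: "(real \<times> real) measure" +
  fixes \<gamma> :: real
  assumes sets_rho[measurable_cong]: "sets \<rho> = sets borel"
    and marg: "\<And>j :: int. (\<integral>z. cis (real_of_int j * fst z) + cis (real_of_int j * snd z) \<partial>\<rho>)
        = (if j = 0 then cx \<gamma> else 0)"
begin

lemma integrable_cis:
  "integrable \<rho> (\<lambda>z. cis (c * fst z))" "integrable \<rho> (\<lambda>z. cis (c * snd z))"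
  by (rule integrable_const_bound[where B=1]; simp)+

lemma mass: "2 * measure \<rho> (space \<rho>) = \<gamma>"
proof -
  have "(\<integral>z. cis (real_of_int 0 * fst z) + cis (real_of_int 0 * snd z) \<partial>\<rho>) = cx \<gamma>"
    unfolding marg by simp
  moreover have "(\<integral>z. cis (real_of_int 0 * fst z) + cis (real_of_int 0 * snd z) \<partial>\<rho>) = cx (2 * measure \<rho> (space \<rho>))"
    by (simp add: scaleR_conv_of_real)
  ultimately show ?thesis by (simp only: of_real_eq_iff)
qed

lemma gamma_nonneg: "0 \<le> \<gamma>"
  using mass measure_nonneg[of \<rho> "space \<rho>"] by linarith

lemma parseval_cis:
  fixes \<phi> :: "'i \<Rightarrow> int"
  assumes S: "finite S" and inj: "inj_on \<phi> S"
  shows "integrable \<rho> (\<lambda>z. (cmod (\<Sum>m\<in>S. c m * cis (real_of_int (\<phi> m) * fst z)))^2 + (cmod (\<Sum>m\<in>S. c m * cis (real_of_int (\<phi> m) * snd z)))^2)"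
    and "(\<integral>z. (cmod (\<Sum>m\<in>S. c m * cis (real_of_int (\<phi> m) * fst z)))^2 + (cmod (\<Sum>m\<in>S. c m * cis (real_of_int (\<phi> m) * snd z)))^2 \<partial>\<rho>)
      = \<gamma> * (\<Sum>m\<in>S. (cmod (c m))^2)"
proof -
  have eq: "cis (real_of_int a * x) * cnj (cis (real_of_int b * x)) = cis (real_of_int (a - b) * x)" for a b x
    by (simp add: cis_cnj cis_mult algebra_simps)
  have 1: "integrable \<rho> (\<lambda>z. cis (real_of_int (\<phi> a) * fst z) * cnj (cis (real_of_int (\<phi> b) * fst z)) + cis (real_of_int (\<phi> a) * snd z) * cnj (cis (real_of_int (\<phi> b) * snd z)))" for a b
    unfolding eq by (intro Bochner_Integration.integrable_add integrable_cis)
  have 2: "(\<integral>z. cis (real_of_int (\<phi> a) * fst z) * cnj (cis (real_of_int (\<phi> b) * fst z)) + cis (real_of_int (\<phi> a) * snd z) * cnj (cis (real_of_int (\<phi> b) * snd z)) \<partial>\<rho>)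
     = (if a = b then cx \<gamma> else 0)" if "a \<in> S" "b \<in> S" for a b
    unfolding eq marg using inj that by (auto simp: inj_on_def)
  show "integrable \<rho> (\<lambda>z. (cmod (\<Sum>m\<in>S. c m * cis (real_of_int (\<phi> m) * fst z)))^2 + (cmod (\<Sum>m\<in>S. c m * cis (real_of_int (\<phi> m) * snd z)))^2)"
    and "(\<integral>z. (cmod (\<Sum>m\<in>S. c m * cis (real_of_int (\<phi> m) * fst z)))^2 + (cmod (\<Sum>m\<in>S. c m * cis (real_of_int (\<phi> m) * snd z)))^2 \<partial>\<rho>)
      = \<gamma> * (\<Sum>m\<in>S. (cmod (c m))^2)"
    by (rule parseval_pair[OF S 1 2]; assumption)+
qed

text \<open>Each row of \<open>A\<close> gives a trigonometric polynomial in the frequency of the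
  wave; Parseval row by row produces the Hilbert-Schmidt norm, and \<open>1 / N\<close> is the
  normalisation of \<open>pwave\<close>.\<close>

lemma parseval_mvp:
  assumes N: "N > 0"
  shows "integrable \<rho> (\<lambda>z. (nrm N (mvp N A (pwave N (fst z))))^2 + (nrm N (mvp N A (pwave N (snd z))))^2)"
    and "(\<integral>z. (nrm N (mvp N A (pwave N (fst z))))^2 + (nrm N (mvp N A (pwave N (snd z))))^2 \<partial>\<rho>) = \<gamma> * hsq N A / real N"
proof -
  have inj: "inj_on int {..<N}" by simp
  have row: "(cmod (mvp N A (pwave N x) i))^2 = (cmod (\<Sum>j<N. A i j * cis (real_of_int (int j) * x)))^2 / real N" for x i
  proof -
    have "mvp N A (pwave N x) i = (\<Sum>j<N. A i j * cis (real_of_int (int j) * x)) / cx (sqrt (real N))"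
      by (simp add: mvp_def pwave_def sum_divide_distrib)
    then show ?thesis by (simp add: norm_divide power_divide)
  qed
  have eq: "(nrm N (mvp N A (pwave N x)))^2 + (nrm N (mvp N A (pwave N y)))^2
    = (\<Sum>i<N. ((cmod (\<Sum>j<N. A i j * cis (real_of_int (int j) * x)))^2 + (cmod (\<Sum>j<N. A i j * cis (real_of_int (int j) * y)))^2) / real N)" for x y
    unfolding nrm_sq row by (simp add: sum.distrib[symmetric] add_divide_distrib)
  note P = parseval_cis[OF finite_lessThan inj]
  show "integrable \<rho> (\<lambda>z. (nrm N (mvp N A (pwave N (fst z))))^2 + (nrm N (mvp N A (pwave N (snd z))))^2)"
    unfolding eq by (intro Bochner_Integration.integrable_sum integrable_divide_zero P(1))
  show "(\<integral>z. (nrm N (mvp N A (pwave N (fst z))))^2 + (nrm N (mvp N A (pwave N (snd z))))^2 \<partial>\<rho>) = \<gamma> * hsq N A / real N"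
    unfolding eq
    by (subst Bochner_Integration.integral_sum, intro integrable_divide_zero P(1))
       (simp add: P(2) hsq_def sum_divide_distrib sum_distrib_left del: of_int_of_nat_eq)
qed

text \<open>Write the symbol of \<open>G\<close> as \<open>\<alpha> + d\<close> and \<open>P\<close>
  as the identity minus \<open>Q\<close>. The part \<open>\<alpha> r\<close> is a trigonometric
  polynomial in one coordinate, of which the uniform marginals leave just the constant coefficient,
  a trace. In \<open>d r\<close> one has \<open>|r| \<le> b / \<eta>\<close>, and the square
  integrals of \<open>d\<close> and \<open>b\<close>, summed over both coordinates, are at most
  \<open>\<gamma> J\<close>: the first by \<open>diag_fourier\<close>, the second because
  \<open>B\<close> is Toeplitz. This costs \<open>(\<gamma> / \<eta>) J\<close>. The part with
  \<open>Q\<close> is small as long as \<open>Q\<close> has bounded Hilbert-Schmidt norm.\<close>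

lemma integral_mainterm:
  fixes \<alpha> :: complex
  assumes N: "N > 0" and eta: "\<eta> > 0" and G: "opb N (1 / \<eta>) G" and sym: "\<And>i j. G i j = G j i"
    and al: "cmod \<alpha> \<le> 1 / \<eta>" and P: "opb N 1 P"
  shows "integrable \<rho> (\<lambda>z. mainterm N G \<alpha> P (fst z) (snd z) + mainterm N G \<alpha> P (snd z) (fst z))" (is ?A)
    and "cmod ((\<integral>z. mainterm N G \<alpha> P (fst z) (snd z) + mainterm N G \<alpha> P (snd z) (fst z) \<partial>\<rho>)
        - \<gamma> * \<alpha> * (tr N (mmul N G (toepdev N G \<alpha>)) / of_nat N))
      \<le> \<gamma> / \<eta> * defect N G \<alpha> + \<gamma> * (hsq N (\<lambda>i j. idm i j - P i j) + 1) / (\<eta>^3 * sqrt (real N))" (is ?bound)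
proof -
  let ?B = "toepdev N G \<alpha>"
  let ?Q = "\<lambda>i j. idm i j - P i j"
  define r where "r x = dotp N (pwave N (- x)) (mvp N G (mvp N ?B (pwave N x)))" for x
  define s where "s x = dotp N (pwave N (- x)) (mvp N G (mvp N ?B (mvp N ?Q (pwave N x))))" for x
  define g where "g x = dotp N (pwave N x) (mvp N G (pwave N (- x)))" for x
  define d where "d x = g x - \<alpha>" for x
  define b where "b x = nrm N (mvp N ?B (pwave N x))" for x
  define q where "q x = nrm N (mvp N ?Q (pwave N x))" for x
  note opB = opb_toepdev[OF N eta G sym al P]
  have PQ: "mvp N P (pwave N x) i = pwave N x i - mvp N ?Q (pwave N x) i" if "i < N" for x i
    using that by (simp add: mvp_def left_diff_distrib sum_subtractf if_distrib[of "\<lambda>x. x * _"] cong: if_cong)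
  have m: "mainterm N G \<alpha> P x y = \<alpha> * r x + d y * r x - g y * s x" for x y
  proof -
    have BP: "mvp N ?B (mvp N P (pwave N x)) = mvp N ?B (\<lambda>i. pwave N x i - mvp N ?Q (pwave N x) i)"
      by (rule mvp_cong) (rule PQ)
    have "dotp N (pwave N (- x)) (mvp N G (mvp N ?B (mvp N P (pwave N x)))) = r x - s x"
      unfolding BP r_def s_def by (simp only: mvp_diff_right dotp_diff_right)
    note A = this
    show ?thesis unfolding mainterm_def A d_def g_def[symmetric] by (simp add: algebra_simps)
  qed
  have rm[measurable]: "(\<lambda>z. r (fst z)) \<in> borel_measurable (borel :: (real \<times> real) measure)" "(\<lambda>z. r (snd z)) \<in> borel_measurable (borel :: (real \<times> real) measure)"
    unfolding r_def dotp_def mvp_def by measurable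
  have sm[measurable]: "(\<lambda>z. s (fst z)) \<in> borel_measurable (borel :: (real \<times> real) measure)" "(\<lambda>z. s (snd z)) \<in> borel_measurable (borel :: (real \<times> real) measure)"
    unfolding s_def dotp_def mvp_def by measurable
  have gm[measurable]: "(\<lambda>z. g (fst z)) \<in> borel_measurable (borel :: (real \<times> real) measure)" "(\<lambda>z. g (snd z)) \<in> borel_measurable (borel :: (real \<times> real) measure)"
    unfolding g_def dotp_def mvp_def by measurable
  have dm[measurable]: "(\<lambda>z. d (fst z)) \<in> borel_measurable (borel :: (real \<times> real) measure)" "(\<lambda>z. d (snd z)) \<in> borel_measurable (borel :: (real \<times> real) measure)"
    unfolding d_def by measurable
  have nev: "nrm N (pwave N x) = 1" for x by (rule nrm_pwave[OF N])
  have dle: "cmod (dotp N (pwave N x) w) \<le> nrm N w" for x w by (rule dotp_pwave_le[OF N eta G sym al P])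
  have gle: "cmod (g x) \<le> 1 / \<eta>" for x unfolding g_def by (rule ghat_le[OF N eta G sym al P])
  have dle': "cmod (d x) \<le> 2 / \<eta>" for x
    unfolding d_def using gle[of x] al norm_triangle_ineq4[of "g x" \<alpha>] by (simp add: field_simps)
  have rle: "cmod (r x) \<le> 1 / \<eta> * b x" for x
    unfolding r_def b_def by (rule order_trans[OF dle opbD[OF G]])
  have ble: "b x \<le> 2 / \<eta>" for x unfolding b_def using opbD[OF opB, of "pwave N x"] nev by simp
  have rle': "cmod (r x) \<le> 2 / \<eta>^2" for x
  proof -
    have "cmod (r x) \<le> 1 / \<eta> * (2 / \<eta>)" using eta by (intro order_trans[OF rle] mult_left_mono ble) auto
    then show ?thesis by (simp add: power2_eq_square)
  qed
  have sle: "cmod (s x) \<le> 2 / \<eta>^2 * q x" for x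
    unfolding s_def q_def by (rule quad_le[OF N eta G sym al P])
  have opQ: "q x \<le> 2" for x
  proof -
    have "q x = nrm N (\<lambda>i. pwave N x i + (-1) * mvp N P (pwave N x) i)"
      unfolding q_def by (rule nrm_cong) (simp add: PQ)
    also have "\<dots> \<le> nrm N (pwave N x) + nrm N (\<lambda>i. (-1) * mvp N P (pwave N x) i)" by (rule nrm_triangle)
    also have "\<dots> \<le> 1 + 1" unfolding nrm_scale nev using nrm_P_pwave[OF N eta G sym al P, of x] by simp
    finally show ?thesis by simp
  qed
  have sle': "cmod (s x) \<le> 2 / \<eta>^2 * 2" for x
    by (rule order_trans[OF sle mult_left_mono[OF opQ]]) simp
  have ir: "integrable \<rho> (\<lambda>z. r (fst z))" "integrable \<rho> (\<lambda>z. r (snd z))"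
    by (rule integrable_const_bound[where B="2 / \<eta>^2"]; simp add: rle')+
  have idr: "integrable \<rho> (\<lambda>z. d (snd z) * r (fst z))" "integrable \<rho> (\<lambda>z. d (fst z) * r (snd z))"
    by (rule integrable_const_bound[where B="2 / \<eta> * (2 / \<eta>^2)"];
        (simp only: norm_mult)?; (intro AE_I2 mult_mono dle' rle')?; (use eta in simp)?)+
  have igs: "integrable \<rho> (\<lambda>z. g (snd z) * s (fst z))" "integrable \<rho> (\<lambda>z. g (fst z) * s (snd z))"
    by (rule integrable_const_bound[where B="1 / \<eta> * (2 / \<eta>^2 * 2)"];
        (simp only: norm_mult)?; (intro AE_I2 mult_mono gle sle')?; (use eta in simp)?)+
  have mz: "mainterm N G \<alpha> P (fst z) (snd z) + mainterm N G \<alpha> P (snd z) (fst z)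
     = \<alpha> * (r (fst z) + r (snd z)) + ((d (snd z) * r (fst z) + d (fst z) * r (snd z)) - (g (snd z) * s (fst z) + g (fst z) * s (snd z)))" for z
    unfolding m by (simp add: algebra_simps)
  show ?A unfolding mz using ir idr igs by auto
  have e1: "(\<integral>z. r (fst z) + r (snd z) \<partial>\<rho>) = \<gamma> * (tr N (mmul N G ?B) / of_nat N)"
  proof -
    have rr: "r x = (\<Sum>i<N. \<Sum>j<N. mmul N G ?B i j / of_nat N * cis (real_of_int (int j - int i) * x))" for x
      unfolding r_def mvp_mmul[symmetric] dotp_mvp_sum
    proof (intro sum.cong refl)
      fix i j
      have "mmul N G ?B i j * pwave N (- x) i * pwave N x j = mmul N G ?B i j * (pwave N x j * pwave N (- x) i)"
        by simp
      then show "mmul N G ?B i j * pwave N (- x) i * pwave N x j = mmul N G ?B i j / of_nat N * cis (real_of_int (int j - int i) * x)"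
        unfolding pwave_diff[OF N] by simp
    qed
    have "(\<integral>z. r (fst z) + r (snd z) \<partial>\<rho>)
       = (\<integral>z. (\<Sum>i<N. \<Sum>j<N. mmul N G ?B i j / of_nat N * (cis (real_of_int (int j - int i) * fst z) + cis (real_of_int (int j - int i) * snd z))) \<partial>\<rho>)"
      unfolding rr by (simp add: sum.distrib[symmetric] distrib_left)
    also have "\<dots> = (\<Sum>i<N. \<integral>z. (\<Sum>j<N. mmul N G ?B i j / of_nat N * (cis (real_of_int (int j - int i) * fst z) + cis (real_of_int (int j - int i) * snd z))) \<partial>\<rho>)"
      by (intro Bochner_Integration.integral_sum Bochner_Integration.integrable_sum integrable_mult_right Bochner_Integration.integrable_add integrable_cis)
    also have "\<dots> = (\<Sum>i<N. \<Sum>j<N. \<integral>z. mmul N G ?B i j / of_nat N * (cis (real_of_int (int j - int i) * fst z) + cis (real_of_int (int j - int i) * snd z)) \<partial>\<rho>)"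
      by (intro sum.cong refl Bochner_Integration.integral_sum integrable_mult_right Bochner_Integration.integrable_add integrable_cis)
    also have "\<dots> = (\<Sum>i<N. \<Sum>j<N. mmul N G ?B i j / of_nat N * (if int j - int i = 0 then cx \<gamma> else 0))"
      by (intro sum.cong refl) (simp only: integral_mult_right_zero marg)
    also have "\<dots> = (\<Sum>i<N. \<Sum>j<N. if j = i then mmul N G ?B i j / of_nat N * cx \<gamma> else 0)"
      by (intro sum.cong refl) auto
    also have "\<dots> = \<gamma> * (tr N (mmul N G ?B) / of_nat N)"
      by (simp add: tr_def sum_divide_distrib sum_distrib_left mult.commute)
    finally show ?thesis .
  qed
  define X where "X z = (d (snd z) * r (fst z) + d (fst z) * r (snd z)) - (g (snd z) * s (fst z) + g (fst z) * s (snd z))" for z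
  have iX: "integrable \<rho> X" unfolding X_def using idr igs by auto
  have dd: "d x = (\<Sum>m\<in>{-int N<..<int N}. cnj (toepcoef N G \<alpha> m) * cis (real_of_int m * x))" for x
    unfolding d_def g_def by (rule diag_fourier[OF N sym])
  have id2: "integrable \<rho> (\<lambda>z. (cmod (d (fst z)))^2 + (cmod (d (snd z)))^2)"
    and ed2: "(\<integral>z. (cmod (d (fst z)))^2 + (cmod (d (snd z)))^2 \<partial>\<rho>) = \<gamma> * defect N G \<alpha>"
    unfolding dd using parseval_cis[of "{-int N<..<int N}" "\<lambda>m. m" "\<lambda>m. cnj (toepcoef N G \<alpha> m)"]
    by (simp_all add: defect_def)
  have ib2: "integrable \<rho> (\<lambda>z. (b (fst z))^2 + (b (snd z))^2)"
    and eb2: "(\<integral>z. (b (fst z))^2 + (b (snd z))^2 \<partial>\<rho>) \<le> \<gamma> * defect N G \<alpha>"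
  proof -
    show "integrable \<rho> (\<lambda>z. (b (fst z))^2 + (b (snd z))^2)" unfolding b_def by (rule parseval_mvp(1)[OF N])
    have "(\<integral>z. (b (fst z))^2 + (b (snd z))^2 \<partial>\<rho>) = \<gamma> * (hsq N ?B / real N)"
      unfolding b_def parseval_mvp(2)[OF N] by simp
    also have "\<dots> \<le> \<gamma> * defect N G \<alpha>"
      using hsq_toepdev[of N G \<alpha>] N by (intro mult_left_mono gamma_nonneg) (simp add: divide_le_eq mult.commute)
    finally show "(\<integral>z. (b (fst z))^2 + (b (snd z))^2 \<partial>\<rho>) \<le> \<gamma> * defect N G \<alpha>" .
  qed
  have iq2: "integrable \<rho> (\<lambda>z. (q (fst z))^2 + (q (snd z))^2)"
    and eq2: "(\<integral>z. (q (fst z))^2 + (q (snd z))^2 \<partial>\<rho>) = \<gamma> * hsq N ?Q / real N"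
    unfolding q_def by (rule parseval_mvp[OF N])+
  define D2 where "D2 z = (cmod (d (fst z)))^2 + (cmod (d (snd z)))^2" for z
  define B2 where "B2 z = (b (fst z))^2 + (b (snd z))^2" for z
  define Q2 where "Q2 z = (q (fst z))^2 + (q (snd z))^2" for z
  have i2: "integrable \<rho> D2" "integrable \<rho> B2" "integrable \<rho> Q2"
    using id2 ib2 iq2 unfolding D2_def B2_def Q2_def by auto
  have e2: "(\<integral>z. D2 z \<partial>\<rho>) = \<gamma> * defect N G \<alpha>" "(\<integral>z. B2 z \<partial>\<rho>) \<le> \<gamma> * defect N G \<alpha>"
    "(\<integral>z. Q2 z \<partial>\<rho>) = \<gamma> * hsq N ?Q / real N"
    using ed2 eb2 eq2 unfolding D2_def B2_def Q2_def by auto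
  \<comment> \<open>The products are bounded by arithmetic-geometric means. \<open>d\<close> and
    \<open>b\<close> get equal weights, as their square integrals have the same bound; that of
    \<open>q\<close> carries a factor \<open>1 / N\<close>, so the weight \<open>sqrt N\<close>
    balances it against a constant.\<close>
  define Y where "Y z = 1 / \<eta> * (D2 z / 2 + B2 z / 2) + 1 / \<eta>^3 * (sqrt (real N) * Q2 z + 2 / sqrt (real N))" for z
  have iY: "integrable \<rho> Y" unfolding Y_def using i2 by auto
  have XY: "cmod (X z) \<le> Y z" for z
  proof -
    have ag: "u * v \<le> (u^2 + v^2) / 2" for u v :: real using sum_squares_bound[of u v] by simp
    have dr: "cmod (d y * r x) \<le> 1 / \<eta> * (((cmod (d y))^2 + (b x)^2) / 2)" for x y
    proof -
      have "cmod (d y * r x) \<le> cmod (d y) * (1 / \<eta> * b x)" unfolding norm_mult by (intro mult_left_mono rle) simp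
      also have "\<dots> = 1 / \<eta> * (cmod (d y) * b x)" by simp
      also have "\<dots> \<le> 1 / \<eta> * (((cmod (d y))^2 + (b x)^2) / 2)" using eta by (intro mult_left_mono ag) simp
      finally show ?thesis .
    qed
    have gs: "cmod (g y * s x) \<le> 1 / \<eta>^3 * (sqrt (real N) * (q x)^2 + 1 / sqrt (real N))" for x y
    proof -
      have sN: "sqrt (real N) > 0" using N by simp
      have "cmod (g y * s x) \<le> 1 / \<eta> * (2 / \<eta>^2 * q x)" unfolding norm_mult using eta by (intro mult_mono gle sle) auto
      also have "\<dots> = 1 / \<eta>^3 * (2 * q x)" by (simp add: power2_eq_square power3_eq_cube)
      also have "\<dots> \<le> 1 / \<eta>^3 * (sqrt (real N) * (q x)^2 + 1 / sqrt (real N))"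
      proof (intro mult_left_mono)
        have "0 \<le> (sqrt (real N) * q x - 1)^2 / sqrt (real N)" by simp
        also have "\<dots> = sqrt (real N) * (q x)^2 + 1 / sqrt (real N) - 2 * q x"
          using sN by (simp add: power2_diff power_mult_distrib field_simps)
        finally show "2 * q x \<le> sqrt (real N) * (q x)^2 + 1 / sqrt (real N)" by simp
      qed (use eta in simp)
      finally show ?thesis .
    qed
    have "cmod (X z) \<le> (cmod (d (snd z) * r (fst z)) + cmod (d (fst z) * r (snd z))) + (cmod (g (snd z) * s (fst z)) + cmod (g (fst z) * s (snd z)))"
      unfolding X_def by (intro order_trans[OF norm_triangle_ineq4] add_mono norm_triangle_ineq)
    also have "\<dots> \<le> (1 / \<eta> * (((cmod (d (snd z)))^2 + (b (fst z))^2) / 2) + 1 / \<eta> * (((cmod (d (fst z)))^2 + (b (snd z))^2) / 2))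
      + (1 / \<eta>^3 * (sqrt (real N) * (q (fst z))^2 + 1 / sqrt (real N)) + 1 / \<eta>^3 * (sqrt (real N) * (q (snd z))^2 + 1 / sqrt (real N)))"
      by (intro add_mono dr gs)
    also have "\<dots> = Y z" unfolding Y_def D2_def B2_def Q2_def by (simp add: algebra_simps add_divide_distrib)
    finally show ?thesis .
  qed
  have "(\<integral>z. Y z \<partial>\<rho>) = 1 / \<eta> * ((\<gamma> * defect N G \<alpha>) / 2 + (\<integral>z. B2 z \<partial>\<rho>) / 2)
     + 1 / \<eta>^3 * (sqrt (real N) * (\<gamma> * hsq N ?Q / real N) + measure \<rho> (space \<rho>) * (2 / sqrt (real N)))"
    unfolding Y_def e2(1)[symmetric] e2(3)[symmetric] using i2 by simp
  also have "\<dots> \<le> 1 / \<eta> * ((\<gamma> * defect N G \<alpha>) / 2 + (\<gamma> * defect N G \<alpha>) / 2)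
     + 1 / \<eta>^3 * (sqrt (real N) * (\<gamma> * hsq N ?Q / real N) + measure \<rho> (space \<rho>) * (2 / sqrt (real N)))"
    using e2(2) eta by (intro add_mono mult_left_mono divide_right_mono order_refl) auto
  also have "\<dots> = \<gamma> / \<eta> * defect N G \<alpha> + \<gamma> * (hsq N ?Q + 1) / (\<eta>^3 * sqrt (real N))"
  proof -
    have a: "sqrt (real N) * (\<gamma> * hsq N ?Q / real N) = \<gamma> * hsq N ?Q / sqrt (real N)"
      using N by (simp add: field_simps)
    have b: "measure \<rho> (space \<rho>) * (2 / sqrt (real N)) = \<gamma> / sqrt (real N)" using mass by (simp add: mult.commute)
    show ?thesis unfolding a b using eta N by (simp add: field_simps)
  qed
  finally have YB: "(\<integral>z. Y z \<partial>\<rho>) \<le> \<gamma> / \<eta> * defect N G \<alpha> + \<gamma> * (hsq N ?Q + 1) / (\<eta>^3 * sqrt (real N))" .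
  have "(\<integral>z. mainterm N G \<alpha> P (fst z) (snd z) + mainterm N G \<alpha> P (snd z) (fst z) \<partial>\<rho>)
     = \<alpha> * (\<integral>z. r (fst z) + r (snd z) \<partial>\<rho>) + (\<integral>z. X z \<partial>\<rho>)"
    unfolding mz X_def[symmetric] using ir iX by (simp del: distrib_left_numeral)
  then have "(\<integral>z. mainterm N G \<alpha> P (fst z) (snd z) + mainterm N G \<alpha> P (snd z) (fst z) \<partial>\<rho>)
        - \<gamma> * \<alpha> * (tr N (mmul N G ?B) / of_nat N) = (\<integral>z. X z \<partial>\<rho>)"
    unfolding e1 by simp
  moreover have "cmod (\<integral>z. X z \<partial>\<rho>) \<le> (\<integral>z. Y z \<partial>\<rho>)"
    by (rule order_trans[OF integral_norm_bound]) (intro integral_mono integrable_norm iX iY XY)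
  ultimately show ?bound using YB by simp
qed

end

section \<open>Fourier averages over the box\<close>

lemma integral_cis_period:
  "integrable lborel (\<lambda>t. indicator {-pi<..pi} t *\<^sub>R cis (real_of_int n * t))"
  "(\<integral>t. indicator {-pi<..pi} t *\<^sub>R cis (real_of_int n * t) \<partial>lborel) = (if n = 0 then cx (2 * pi) else 0)"
proof -
  have i: "integrable lborel (\<lambda>t. indicator {-pi..pi} t *\<^sub>R cis (real_of_int n * t))"
    by (rule borel_integrable_compact) (auto intro!: continuous_intros)
  have ae: "AE t in lborel. indicator {-pi<..pi} t *\<^sub>R cis (real_of_int n * t) = indicator {-pi..pi} t *\<^sub>R cis (real_of_int n * t)"
    using AE_lborel_singleton[of "-pi"] by eventually_elim (auto simp: indicator_def)
  show "integrable lborel (\<lambda>t. indicator {-pi<..pi} t *\<^sub>R cis (real_of_int n * t))"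
    by (subst integrable_cong_AE[OF _ _ ae]) (use i in auto)
  have e: "(\<integral>t. indicator {-pi<..pi} t *\<^sub>R cis (real_of_int n * t) \<partial>lborel)
      = (\<integral>t. indicator {-pi..pi} t *\<^sub>R cis (real_of_int n * t) \<partial>lborel)"
    by (rule integral_cong_AE[OF _ _ ae]) auto
  show "(\<integral>t. indicator {-pi<..pi} t *\<^sub>R cis (real_of_int n * t) \<partial>lborel) = (if n = 0 then cx (2 * pi) else 0)"
  proof (cases "n = 0")
    case True
    then show ?thesis unfolding e by (simp add: scaleR_conv_of_real)
  next
    case False
    have d: "((\<lambda>t. cis (real_of_int n * t) / (\<i> * of_int n)) has_vector_derivative cis (real_of_int n * t)) (at t within {-pi..pi})" for t
    proof -
      have "((\<lambda>z. exp (\<i> * of_int n * z) / (\<i> * of_int n)) has_field_derivative exp (\<i> * of_int n * cx t)) (at (cx t))"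
        using False by (auto intro!: derivative_eq_intros)
      from has_vector_derivative_real_field[OF this] show ?thesis
        by (simp add: cis_conv_exp mult_ac)
    qed
    have "(\<integral>t. indicator {-pi..pi} t *\<^sub>R cis (real_of_int n * t) \<partial>lborel)
       = cis (real_of_int n * pi) / (\<i> * of_int n) - cis (real_of_int n * (- pi)) / (\<i> * of_int n)"
      by (rule integral_FTC_atLeastAtMost[OF _ d]) (auto intro!: continuous_intros)
    also have "cis (real_of_int n * pi) = cis (real_of_int n * (- pi))"
      by (auto simp: complex_eq_iff sin_zero_iff_int2)
    finally show ?thesis unfolding e using False by simp
  qed
qed

lemma indicator_spec_box: "indicator spec_box z = (indicator {-pi<..pi} (fst z) * indicator {-pi<..pi} (snd z) :: 'b::comm_semiring_1)"
  by (cases z) (auto simp: spec_box_def indicator_def)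

lemma spec_box_borel[measurable]: "spec_box \<in> sets borel"
  unfolding spec_box_def borel_prod[symmetric] by measurable

lemma integral_cis_box:
  "integrable lborel (\<lambda>z. indicator spec_box z *\<^sub>R cis (real_of_int c * fst z + real_of_int d * snd z))"
  "(\<integral>z. indicator spec_box z *\<^sub>R cis (real_of_int c * fst z + real_of_int d * snd z) \<partial>lborel)
     = (if c = 0 \<and> d = 0 then cx (4 * pi^2) else 0)"
proof -
  let ?u = "\<lambda>n t. indicator {-pi<..pi} t *\<^sub>R cis (real_of_int n * t)"
  have eq: "indicator spec_box z *\<^sub>R cis (real_of_int c * fst z + real_of_int d * snd z) = ?u c (fst z) * ?u d (snd z)" for z
    unfolding indicator_spec_box by (simp add: scaleR_conv_of_real cis_mult[symmetric])
  have int: "integrable (lborel \<Otimes>\<^sub>M lborel) (\<lambda>(x, y). ?u c x * ?u d y)"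
  proof (rule lborel_pair.Fubini_integrable)
    show "integrable lborel (\<lambda>x. \<integral>y. norm (case (x, y) of (x, y) \<Rightarrow> ?u c x * ?u d y) \<partial>lborel)"
      using integrable_norm[OF integral_cis_period(1)[of c]] integral_cis_period(1)[of d] by (simp add: norm_mult)
    show "AE x in lborel. integrable lborel (\<lambda>y. case (x, y) of (x, y) \<Rightarrow> ?u c x * ?u d y)"
      by (intro AE_I2, unfold prod.case, intro integrable_mult_right integral_cis_period(1))
  qed (simp add: split_beta')
  then show "integrable lborel (\<lambda>z. indicator spec_box z *\<^sub>R cis (real_of_int c * fst z + real_of_int d * snd z))"
    unfolding eq lborel_prod by (simp add: split_beta')
  have "(\<integral>z. indicator spec_box z *\<^sub>R cis (real_of_int c * fst z + real_of_int d * snd z) \<partial>lborel)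
     = (\<integral>x. (\<integral>y. ?u c x * ?u d y \<partial>lborel) \<partial>lborel)"
    unfolding eq using lborel_pair.integral_fst'[OF int] by (simp add: lborel_prod split_beta')
  also have "\<dots> = (if c = 0 \<and> d = 0 then cx (4 * pi^2) else 0)"
    by (simp only: integral_mult_right_zero integral_mult_left_zero integral_cis_period(2)) (simp add: power2_eq_square)
  finally show "(\<integral>z. indicator spec_box z *\<^sub>R cis (real_of_int c * fst z + real_of_int d * snd z) \<partial>lborel)
     = (if c = 0 \<and> d = 0 then cx (4 * pi^2) else 0)" .
qed

definition boxm :: "(real \<times> real) measure" where
  "boxm = density lborel (indicator spec_box)"

lemma sets_boxm[measurable_cong]: "sets boxm = sets borel"
  by (simp add: boxm_def)

lemma integral_boxm:
  fixes g :: "real \<times> real \<Rightarrow> 'b::{banach, second_countable_topology}"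
  assumes "g \<in> borel_measurable borel"
  shows "(\<integral>z. g z \<partial>boxm) = (\<integral>z. indicator spec_box z *\<^sub>R g z \<partial>lborel)"
    and "integrable boxm g \<longleftrightarrow> integrable lborel (\<lambda>z. indicator spec_box z *\<^sub>R g z)"
proof -
  have b: "boxm = density lborel (\<lambda>z. ennreal (indicator spec_box z))"
    unfolding boxm_def by (intro density_cong) (auto simp: indicator_def)
  show "(\<integral>z. g z \<partial>boxm) = (\<integral>z. indicator spec_box z *\<^sub>R g z \<partial>lborel)"
    unfolding b using assms by (subst integral_density) auto
  show "integrable boxm g \<longleftrightarrow> integrable lborel (\<lambda>z. indicator spec_box z *\<^sub>R g z)"
    unfolding b using assms by (subst integrable_density) auto
qed

lemma measure_boxm: "emeasure boxm (space boxm) = ennreal (4 * pi^2)"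
proof -
  have "emeasure boxm (space boxm) = emeasure lborel spec_box"
    by (simp add: boxm_def emeasure_density)
  also have "\<dots> = emeasure (lborel \<Otimes>\<^sub>M lborel) ({-pi<..pi} \<times> {-pi<..pi})"
    by (simp add: spec_box_def lborel_prod)
  also have "\<dots> = ennreal (2 * pi) * ennreal (2 * pi)"
  proof -
    have "emeasure lborel {-pi<..pi} = ennreal (2 * pi)" by (subst emeasure_lborel_Ioc) simp_all
    then show ?thesis by (subst lborel.emeasure_pair_measure_Times) simp_all
  qed
  finally show ?thesis by (simp add: ennreal_mult[symmetric] power2_eq_square)
qed

lemma finite_measure_boxm: "finite_measure boxm"
  by (rule finite_measureI) (simp add: measure_boxm)

lemma parseval_box:
  fixes \<phi> :: "'i \<Rightarrow> int \<times> int"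
  assumes S: "finite S" and inj: "inj_on \<phi> S"
  shows "integrable boxm (\<lambda>z. (cmod (\<Sum>p\<in>S. c p * cis (real_of_int (fst (\<phi> p)) * fst z + real_of_int (snd (\<phi> p)) * snd z)))^2)"
    and "(\<integral>z. (cmod (\<Sum>p\<in>S. c p * cis (real_of_int (fst (\<phi> p)) * fst z + real_of_int (snd (\<phi> p)) * snd z)))^2 \<partial>boxm)
      = 4 * pi^2 * (\<Sum>p\<in>S. (cmod (c p))^2)"
proof -
  let ?e = "\<lambda>p z. cis (real_of_int (fst (\<phi> p)) * fst z + real_of_int (snd (\<phi> p)) * snd z)"
  have eq: "?e a z * cnj (?e b z) = cis (real_of_int (fst (\<phi> a) - fst (\<phi> b)) * fst z + real_of_int (snd (\<phi> a) - snd (\<phi> b)) * snd z)" for a b z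
    by (simp add: cis_cnj cis_mult algebra_simps)
  have m[measurable]: "(\<lambda>z::real\<times>real. cis (real_of_int c * fst z + real_of_int d * snd z)) \<in> borel_measurable borel" for c d by measurable
  have 1: "integrable boxm (\<lambda>z. ?e a z * cnj (?e b z) + 0 * cnj 0)" for a b
    unfolding eq mult_zero_left add_0_right by (subst integral_boxm(2)[OF m], rule integral_cis_box(1))
  have 2: "(\<integral>z. ?e a z * cnj (?e b z) + 0 * cnj 0 \<partial>boxm) = (if a = b then cx (4 * pi^2) else 0)" if "a \<in> S" "b \<in> S" for a b
    unfolding eq using inj that
    by (simp add: integral_boxm(1)[OF m] integral_cis_box(2) inj_on_def prod_eq_iff del: of_int_diff)
  show "integrable boxm (\<lambda>z. (cmod (\<Sum>p\<in>S. c p * ?e p z))^2)"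
    using parseval_pair(1)[where S=S and \<rho>=boxm and e="?e" and e'="\<lambda>_ _. 0" and \<kappa>="4 * pi^2" and c=c, OF S 1 2] by simp
  show "(\<integral>z. (cmod (\<Sum>p\<in>S. c p * ?e p z))^2 \<partial>boxm) = 4 * pi^2 * (\<Sum>p\<in>S. (cmod (c p))^2)"
    using parseval_pair(2)[where S=S and \<rho>=boxm and e="?e" and e'="\<lambda>_ _. 0" and \<kappa>="4 * pi^2" and c=c, OF S 1 2] by simp
qed

context
  fixes N :: nat and \<eta> :: real and G P :: cmatr and \<alpha> :: complex
  assumes N: "N > 0" and eta: "\<eta> > 0" and G: "opb N (1 / \<eta>) G" and sym: "\<And>i j. G i j = G j i"
    and al: "cmod \<alpha> \<le> 1 / \<eta>" and P: "opb N 1 P"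
begin

text \<open>As a function of both frequencies this is a trigonometric polynomial with coefficients
  \<open>G k l / N\<close> at pairwise distinct frequencies, so its square integral is
  \<open>4 * pi^2\<close> times \<open>hsq N G / N^2\<close>, and \<open>hsq N G\<close> is at most
  \<open>N / \<eta>^2\<close>.\<close>

lemma integral_offdiag:
  shows "integrable boxm (\<lambda>z. (cmod (dotp N (pwave N (snd z)) (mvp N G (pwave N (- fst z)))))^2)"
    and "(\<integral>z. (cmod (dotp N (pwave N (snd z)) (mvp N G (pwave N (- fst z)))))^2 \<partial>boxm) \<le> 4 * pi^2 / (real N * \<eta>^2)"
    and "integrable boxm (\<lambda>z. (cmod (dotp N (pwave N (fst z)) (mvp N G (pwave N (- snd z)))))^2)"
    and "(\<integral>z. (cmod (dotp N (pwave N (fst z)) (mvp N G (pwave N (- snd z)))))^2 \<partial>boxm) \<le> 4 * pi^2 / (real N * \<eta>^2)"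
proof -
  let ?S = "{..<N} \<times> {..<N}"
  have sN: "cx (sqrt (real N)) * cx (sqrt (real N)) = of_nat N"
    by (simp flip: of_real_mult)
  have rep: "dotp N (pwave N y) (mvp N G (pwave N (- x))) = (\<Sum>p\<in>?S. G (fst p) (snd p) / of_nat N * cis (real (fst p) * y - real (snd p) * x))" for x y
  proof -
    have "G k l * pwave N y k * pwave N (- x) l = G k l / of_nat N * cis (real k * y - real l * x)" for k l
    proof -
      have "pwave N y k * pwave N (- x) l = cis (real k * y - real l * x) / of_nat N"
        unfolding pwave_def times_divide_times_eq sN by (simp add: cis_mult)
      then show ?thesis by (simp add: mult.assoc)
    qed
    then show ?thesis unfolding dotp_mvp_sum by (simp add: sum.cartesian_product split_beta)
  qed
  have bd: "4 * pi^2 * (\<Sum>p\<in>?S. (cmod (G (fst p) (snd p) / of_nat N))^2) \<le> 4 * pi^2 / (real N * \<eta>^2)"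
  proof -
    have "(\<Sum>p\<in>?S. (cmod (G (fst p) (snd p) / of_nat N))^2) = hsq N G / (real N)^2"
      unfolding hsq_def by (simp add: sum.cartesian_product split_beta norm_divide power_divide sum_divide_distrib)
    also have "\<dots> \<le> real N * (1 / \<eta>)^2 / (real N)^2"
      by (intro divide_right_mono hsq_opb G) simp
    also have "\<dots> = 1 / (real N * \<eta>^2)" using N by (simp add: power2_eq_square)
    finally show ?thesis using mult_left_mono[of _ "1 / (real N * \<eta>^2)" "4 * pi^2"] by simp
  qed
  have a: "cis (real (fst p) * snd z - real (snd p) * fst z)
     = cis (real_of_int (fst (- int (snd p), int (fst p))) * fst z + real_of_int (snd (- int (snd p), int (fst p))) * snd z)" for p :: "nat \<times> nat" and z
    by (rule arg_cong[where f=cis]) simp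
  have b: "cis (real (fst p) * fst z - real (snd p) * snd z)
     = cis (real_of_int (fst (int (fst p), - int (snd p))) * fst z + real_of_int (snd (int (fst p), - int (snd p))) * snd z)" for p :: "nat \<times> nat" and z
    by (rule arg_cong[where f=cis]) simp
  have inja: "inj_on (\<lambda>p. (- int (snd p), int (fst p))) ?S" by (auto simp: inj_on_def prod_eq_iff)
  have injb: "inj_on (\<lambda>p. (int (fst p), - int (snd p))) ?S" by (auto simp: inj_on_def prod_eq_iff)
  show "integrable boxm (\<lambda>z. (cmod (dotp N (pwave N (snd z)) (mvp N G (pwave N (- fst z)))))^2)"
    unfolding rep a by (rule parseval_box(1)[OF _ inja]) simp
  show "(\<integral>z. (cmod (dotp N (pwave N (snd z)) (mvp N G (pwave N (- fst z)))))^2 \<partial>boxm) \<le> 4 * pi^2 / (real N * \<eta>^2)"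
    unfolding rep a by (subst parseval_box(2)[OF _ inja]) (simp, rule bd)
  show "integrable boxm (\<lambda>z. (cmod (dotp N (pwave N (fst z)) (mvp N G (pwave N (- snd z)))))^2)"
    unfolding rep b by (rule parseval_box(1)[OF _ injb]) simp
  show "(\<integral>z. (cmod (dotp N (pwave N (fst z)) (mvp N G (pwave N (- snd z)))))^2 \<partial>boxm) \<le> 4 * pi^2 / (real N * \<eta>^2)"
    unfolding rep b by (subst parseval_box(2)[OF _ injb]) (simp, rule bd)
qed

text \<open>Along the diagonal \<open>m\<close> the entry is a trigonometric polynomial with
  coefficients \<open>Y m / N\<close>, where \<open>Y m\<close> is the diagonal indicator
  \<open>S m\<close> between two conjugate resolvents, divided by \<open>N\<close>.
  \<open>S m\<close> has at most one nonzero entry per row, so its squared Hilbert-Schmidt norm is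
  at most \<open>N\<close> and not \<open>N^2\<close>. This gives order \<open>1 / N^3\<close> for
  each of the \<open>N^2\<close> entries.\<close>

lemma integral_hsq_extra:
  defines "T \<equiv> \<lambda>x y. toep N (mmul N (mmul N (\<lambda>i j. cnj (G i j)) (symcov N (- x) (- y))) (\<lambda>i j. cnj (G i j)))"
  shows "integrable boxm (\<lambda>z. hsq N (T (fst z) (snd z)))"
    and "(\<integral>z. hsq N (T (fst z) (snd z)) \<partial>boxm) \<le> 16 * pi^2 / (real N * \<eta>^4)"
proof -
  let ?S = "{..<N} \<times> {..<N}"
  let ?Gc = "\<lambda>i j. cnj (G i j)"
  have sN: "cx (sqrt (real N)) * cx (sqrt (real N)) = of_nat N"
    by (simp flip: of_real_mult)
  define S where "S m k l = (if int k - int l = m then 1 else 0 :: complex)" for m k l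
  define Y where "Y m = (\<lambda>c d. mmul N (mmul N ?Gc (S m)) ?Gc c d / of_nat N)" for m
  have hS: "hsq N (S m) \<le> real N" for m
  proof -
    have "(\<Sum>l<N. (cmod (S m k l))^2) \<le> 1" for k
    proof -
      have "(\<Sum>l<N. (cmod (S m k l))^2) = (\<Sum>l\<in>{l\<in>{..<N}. int k - int l = m}. 1)"
        unfolding S_def by (simp add: sum.If_cases if_distrib[of "\<lambda>x. (cmod x)^2"] Int_def cong: if_cong)
      also have "\<dots> = real (card {l\<in>{..<N}. int k - int l = m})" by simp
      also have "\<dots> \<le> real (card {nat (int k - m)})"
        by (intro of_nat_mono card_mono) auto
      finally show ?thesis by simp
    qed
    then have "hsq N (S m) \<le> (\<Sum>k<N. 1)" unfolding hsq_def by (intro sum_mono) auto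
    then show ?thesis by simp
  qed
  have hY: "hsq N (Y m) \<le> 1 / (real N * \<eta>^4)" for m
  proof -
    have "hsq N (mmul N (mmul N ?Gc (S m)) ?Gc) \<le> (1 / \<eta>)^2 * hsq N (mmul N ?Gc (S m))"
      by (rule hsq_mmul_right[OF opb_cnj[OF G]])
    also have "\<dots> \<le> (1 / \<eta>)^2 * ((1 / \<eta>)^2 * hsq N (S m))"
      by (intro mult_left_mono hsq_mmul[OF opb_cnj[OF G]]) simp
    also have "\<dots> \<le> (1 / \<eta>)^2 * ((1 / \<eta>)^2 * real N)" by (intro mult_left_mono hS) auto
    finally have h: "hsq N (mmul N (mmul N ?Gc (S m)) ?Gc) \<le> real N / \<eta>^4"
      by (simp add: power2_eq_square power4_eq_xxxx)
    have "hsq N (Y m) = hsq N (mmul N (mmul N ?Gc (S m)) ?Gc) / (real N)^2"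
      unfolding hsq_def Y_def by (simp add: norm_divide power_divide sum_divide_distrib)
    also have "\<dots> \<le> real N / \<eta>^4 / (real N)^2" by (intro divide_right_mono h) simp
    also have "\<dots> = 1 / (real N * \<eta>^4)" using N by (simp add: power2_eq_square)
    finally show ?thesis .
  qed
  define U where "U m x y = (\<Sum>p\<in>?S. Y m (fst p) (snd p) / of_nat N * cis (- real (fst p) * x - real (snd p) * y))" for m x y
  have ent: "T x y i j = U (int i - int j) x y + U (int i - int j) y x" for x y i j
  proof -
    let ?m = "int i - int j"
    have "T x y i j = (\<Sum>k<N. \<Sum>l<N. S ?m k l * (\<Sum>d<N. \<Sum>c<N. ?Gc k c * symcov N (- x) (- y) c d * ?Gc d l)) / of_nat N"
      unfolding T_def toep_def mmul_def S_def sum_distrib_right by (simp add: if_distrib[of "\<lambda>x. x * _"] cong: if_cong)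
    also have "(\<Sum>k<N. \<Sum>l<N. S ?m k l * (\<Sum>d<N. \<Sum>c<N. ?Gc k c * symcov N (- x) (- y) c d * ?Gc d l))
       = (\<Sum>k<N. \<Sum>l<N. \<Sum>c<N. \<Sum>d<N. symcov N (- x) (- y) c d * (?Gc c k * S ?m k l * ?Gc l d))"
    proof (intro sum.cong refl)
      fix k l
      have "S ?m k l * (\<Sum>d<N. \<Sum>c<N. ?Gc k c * symcov N (- x) (- y) c d * ?Gc d l)
        = (\<Sum>d<N. \<Sum>c<N. symcov N (- x) (- y) c d * (?Gc c k * S ?m k l * ?Gc l d))"
        unfolding sum_distrib_left by (intro sum.cong refl) (simp add: sym mult_ac)
      also have "\<dots> = (\<Sum>c<N. \<Sum>d<N. symcov N (- x) (- y) c d * (?Gc c k * S ?m k l * ?Gc l d))" by (rule sum.swap)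
      finally show "S ?m k l * (\<Sum>d<N. \<Sum>c<N. ?Gc k c * symcov N (- x) (- y) c d * ?Gc d l)
        = (\<Sum>c<N. \<Sum>d<N. symcov N (- x) (- y) c d * (?Gc c k * S ?m k l * ?Gc l d))" .
    qed
    also have "\<dots> = (\<Sum>k<N. \<Sum>c<N. \<Sum>l<N. \<Sum>d<N. symcov N (- x) (- y) c d * (?Gc c k * S ?m k l * ?Gc l d))"
      by (rule sum.cong[OF refl], rule sum.swap)
    also have "\<dots> = (\<Sum>c<N. \<Sum>k<N. \<Sum>d<N. \<Sum>l<N. symcov N (- x) (- y) c d * (?Gc c k * S ?m k l * ?Gc l d))"
      by (subst sum.swap, rule sum.cong[OF refl], rule sum.cong[OF refl], rule sum.swap)
    also have "\<dots> = (\<Sum>c<N. \<Sum>d<N. \<Sum>k<N. \<Sum>l<N. symcov N (- x) (- y) c d * (?Gc c k * S ?m k l * ?Gc l d))"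
      by (rule sum.cong[OF refl], rule sum.swap)
    also have "\<dots> = (\<Sum>c<N. \<Sum>d<N. \<Sum>l<N. \<Sum>k<N. symcov N (- x) (- y) c d * (?Gc c k * S ?m k l * ?Gc l d))"
      by (rule sum.cong[OF refl], rule sum.cong[OF refl], rule sum.swap)
    also have "\<dots> = (\<Sum>c<N. \<Sum>d<N. symcov N (- x) (- y) c d * (of_nat N * Y ?m c d))"
    proof -
      have Yeq: "of_nat N * Y ?m c d = (\<Sum>l<N. \<Sum>k<N. ?Gc c k * S ?m k l * ?Gc l d)" for c d
        unfolding Y_def mmul_def using N by (simp add: sum_distrib_right)
      show ?thesis by (intro sum.cong refl) (simp only: Yeq sum_distrib_left)
    qed
    also have "\<dots> / of_nat N = (\<Sum>c<N. \<Sum>d<N. symcov N (- x) (- y) c d * Y ?m c d)"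
      unfolding sum_divide_distrib using N by simp
    also have "\<dots> = (\<Sum>c<N. \<Sum>d<N. Y ?m c d / of_nat N * cis (- real c * x - real d * y) + Y ?m c d / of_nat N * cis (- real c * y - real d * x))"
    proof (intro sum.cong refl)
      fix c d
      have "symcov N (- x) (- y) c d = cis (- real c * x - real d * y) / of_nat N + cis (- real c * y - real d * x) / of_nat N"
        unfolding symcov_def pwave_def times_divide_times_eq sN by (simp add: cis_mult)
      then show "symcov N (- x) (- y) c d * Y ?m c d = Y ?m c d / of_nat N * cis (- real c * x - real d * y) + Y ?m c d / of_nat N * cis (- real c * y - real d * x)"
        by (simp only: distrib_right) (simp add: mult.commute)
    qed
    finally show ?thesis unfolding U_def by (simp add: sum.distrib sum.cartesian_product split_beta)
  qed
  have sqs: "(cmod (u + v))^2 \<le> 2 * (cmod u)^2 + 2 * (cmod v)^2" for u v :: complex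
  proof -
    have "(cmod (u + v))^2 \<le> (cmod u + cmod v)^2" by (intro power_mono norm_triangle_ineq) simp
    also have "\<dots> \<le> 2 * (cmod u)^2 + 2 * (cmod v)^2"
      using sum_squares_bound[of "cmod u" "cmod v"] by (simp add: power2_sum)
    finally show ?thesis .
  qed
  have a: "cis (- real (fst p) * fst z - real (snd p) * snd z)
     = cis (real_of_int (fst (- int (fst p), - int (snd p))) * fst z + real_of_int (snd (- int (fst p), - int (snd p))) * snd z)" for p :: "nat \<times> nat" and z
    by (rule arg_cong[where f=cis]) simp
  have b: "cis (- real (fst p) * snd z - real (snd p) * fst z)
     = cis (real_of_int (fst (- int (snd p), - int (fst p))) * fst z + real_of_int (snd (- int (snd p), - int (fst p))) * snd z)" for p :: "nat \<times> nat" and z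
    by (rule arg_cong[where f=cis]) simp
  have inja: "inj_on (\<lambda>p. (- int (fst p), - int (snd p))) ?S" by (auto simp: inj_on_def prod_eq_iff)
  have injb: "inj_on (\<lambda>p. (- int (snd p), - int (fst p))) ?S" by (auto simp: inj_on_def prod_eq_iff)
  have sumY: "(\<Sum>p\<in>?S. (cmod (Y m (fst p) (snd p) / of_nat N))^2) \<le> 1 / (real N ^ 3 * \<eta>^4)" for m
  proof -
    have "(\<Sum>p\<in>?S. (cmod (Y m (fst p) (snd p) / of_nat N))^2) = hsq N (Y m) / (real N)^2"
      unfolding hsq_def by (simp add: sum.cartesian_product split_beta norm_divide power_divide sum_divide_distrib)
    also have "\<dots> \<le> 1 / (real N * \<eta>^4) / (real N)^2" by (intro divide_right_mono hY) simp
    finally show ?thesis by (simp add: power2_eq_square power3_eq_cube mult_ac)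
  qed
  have iU: "integrable boxm (\<lambda>z. (cmod (U m (fst z) (snd z)))^2)" "integrable boxm (\<lambda>z. (cmod (U m (snd z) (fst z)))^2)" for m
    unfolding U_def a b by (rule parseval_box(1)[OF _ inja], simp, rule parseval_box(1)[OF _ injb], simp)
  have eU: "(\<integral>z. (cmod (U m (fst z) (snd z)))^2 \<partial>boxm) \<le> 4 * pi^2 * (1 / (real N ^ 3 * \<eta>^4))"
    "(\<integral>z. (cmod (U m (snd z) (fst z)))^2 \<partial>boxm) \<le> 4 * pi^2 * (1 / (real N ^ 3 * \<eta>^4))" for m
    unfolding U_def a b
    by (subst parseval_box(2)[OF _ inja], simp, intro mult_left_mono sumY, simp,
        subst parseval_box(2)[OF _ injb], simp, intro mult_left_mono sumY, simp)
  define V where "V m z = 2 * (cmod (U m (fst z) (snd z)))^2 + 2 * (cmod (U m (snd z) (fst z)))^2" for m z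
  have iV: "integrable boxm (V m)" for m unfolding V_def using iU by auto
  have eV: "(\<integral>z. V m z \<partial>boxm) \<le> 16 * pi^2 / (real N ^ 3 * \<eta>^4)" for m
  proof -
    have "(\<integral>z. V m z \<partial>boxm) = 2 * (\<integral>z. (cmod (U m (fst z) (snd z)))^2 \<partial>boxm) + 2 * (\<integral>z. (cmod (U m (snd z) (fst z)))^2 \<partial>boxm)"
      unfolding V_def using iU[of m] by simp
    also have "\<dots> \<le> 2 * (4 * pi^2 * (1 / (real N ^ 3 * \<eta>^4))) + 2 * (4 * pi^2 * (1 / (real N ^ 3 * \<eta>^4)))"
      by (intro add_mono mult_left_mono eU) auto
    finally show ?thesis by (simp add: mult.commute)
  qed
  have le: "(cmod (T (fst z) (snd z) i j))^2 \<le> V (int i - int j) z" for z i j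
    unfolding ent V_def by (rule sqs)
  have Tm: "(\<lambda>z. (cmod (T (fst z) (snd z) i j))^2) \<in> borel_measurable (borel :: (real \<times> real) measure)" for i j
    unfolding ent U_def by measurable
  have iT: "integrable boxm (\<lambda>z. (cmod (T (fst z) (snd z) i j))^2)" for i j
    by (rule Bochner_Integration.integrable_bound[OF iV[of "int i - int j"]])
       (use Tm le in \<open>auto simp: measurable_cong_sets[OF sets_boxm refl] intro: order_trans[OF le abs_ge_self]\<close>)
  show "integrable boxm (\<lambda>z. hsq N (T (fst z) (snd z)))"
    unfolding hsq_def by (intro Bochner_Integration.integrable_sum iT)
  have "(\<integral>z. hsq N (T (fst z) (snd z)) \<partial>boxm) = (\<Sum>i<N. \<Sum>j<N. \<integral>z. (cmod (T (fst z) (snd z) i j))^2 \<partial>boxm)"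
    unfolding hsq_def
    by (subst Bochner_Integration.integral_sum) (auto intro!: sum.cong Bochner_Integration.integral_sum iT)
  also have "\<dots> \<le> (\<Sum>i<N. \<Sum>j<N. 16 * pi^2 / (real N ^ 3 * \<eta>^4))"
    by (intro sum_mono order_trans[OF integral_mono[OF iT iV le] eV])
  also have "\<dots> = 16 * pi^2 / (real N * \<eta>^4)" using N by (simp add: power3_eq_cube)
  finally show "(\<integral>z. hsq N (T (fst z) (snd z)) \<partial>boxm) \<le> 16 * pi^2 / (real N * \<eta>^4)" .
qed

text \<open>Square integrals of order \<open>1 / N\<close> become integrals of order
  \<open>1 / sqrt N\<close> by the inequality \<open>u \<le> (s u^2 + 1 / s) / 2\<close> with
  \<open>s = sqrt N\<close>, which takes the place of Cauchy-Schwarz on the box.\<close>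

lemma integral_remterm:
  shows "integrable boxm (\<lambda>z. cmod (remterm N G \<alpha> P (fst z) (snd z)) + cmod (remterm N G \<alpha> P (snd z) (fst z)))"
    and "(\<integral>z. cmod (remterm N G \<alpha> P (fst z) (snd z)) + cmod (remterm N G \<alpha> P (snd z) (fst z)) \<partial>boxm)
      \<le> 8 * pi^2 * (1 / \<eta>^4 + 1 / \<eta>^2 + 2 / \<eta>^5 + 1 / \<eta>) / sqrt (real N)"
proof -
  define T where "T x y = toep N (mmul N (mmul N (\<lambda>i j. cnj (G i j)) (symcov N (- x) (- y))) (\<lambda>i j. cnj (G i j)))" for x y
  define c where "c x y = dotp N (pwave N y) (mvp N G (pwave N (- x)))" for x y
  interpret finite_measure boxm by (rule finite_measure_boxm)
  define s where "s = sqrt (real N)"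
  have s: "s > 0" "s * s = real N" using N by (auto simp: s_def)
  have ag: "u \<le> (s * u^2 + 1 / s) / 2" for u :: real
  proof -
    have "0 \<le> (s * u - 1)^2 / s" using s by simp
    also have "\<dots> = s * u^2 + 1 / s - 2 * u" using s by (simp add: power2_diff power_mult_distrib field_simps power2_eq_square)
    finally show ?thesis by simp
  qed
  have Tcom: "T x y = T y x" for x y unfolding T_def by (simp add: symcov_commute)
  have bd: "cmod (remterm N G \<alpha> P x y) \<le> 2 / \<eta>^2 * ((s * (cmod (c x y))^2 + 1 / s) / 2) + 1 / \<eta> * ((s * hsq N (T x y) + 1 / s) / 2)" for x y
  proof -
    have "cmod (remterm N G \<alpha> P x y) \<le> 2 / \<eta>^2 * cmod (c x y) + 1 / \<eta> * sqrt (hsq N (T x y))"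
      unfolding c_def T_def by (rule remterm_small[OF N eta G sym al P])
    also have "\<dots> \<le> 2 / \<eta>^2 * ((s * (cmod (c x y))^2 + 1 / s) / 2) + 1 / \<eta> * ((s * (sqrt (hsq N (T x y)))^2 + 1 / s) / 2)"
      using eta by (intro add_mono mult_left_mono ag) auto
    finally show ?thesis by simp
  qed
  define C2 where "C2 z = (cmod (c (fst z) (snd z)))^2" for z
  define C2' where "C2' z = (cmod (c (snd z) (fst z)))^2" for z
  define H2 where "H2 z = hsq N (T (fst z) (snd z))" for z
  note off = integral_offdiag[folded c_def]
  have iC: "integrable boxm C2" "integrable boxm C2'" "integrable boxm H2"
    using integral_offdiag(1,3) integral_hsq_extra(1) unfolding C2_def C2'_def H2_def c_def T_def by auto
  have eC: "(\<integral>z. C2 z \<partial>boxm) \<le> 4 * pi^2 / (real N * \<eta>^2)" "(\<integral>z. C2' z \<partial>boxm) \<le> 4 * pi^2 / (real N * \<eta>^2)"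
    "(\<integral>z. H2 z \<partial>boxm) \<le> 16 * pi^2 / (real N * \<eta>^4)"
    using integral_offdiag(2,4) integral_hsq_extra(2) unfolding C2_def C2'_def H2_def c_def T_def by auto
  define Y where "Y z = 1 / \<eta>^2 * (s * C2 z + s * C2' z + 2 / s) + 1 / \<eta> * (s * H2 z + 1 / s)" for z
  have iY: "integrable boxm Y" unfolding Y_def using iC by auto
  let ?R = "\<lambda>z. cmod (remterm N G \<alpha> P (fst z) (snd z)) + cmod (remterm N G \<alpha> P (snd z) (fst z))"
  have RY: "?R z \<le> Y z" for z
  proof -
    have "?R z \<le> (2 / \<eta>^2 * ((s * C2 z + 1 / s) / 2) + 1 / \<eta> * ((s * H2 z + 1 / s) / 2)) + (2 / \<eta>^2 * ((s * C2' z + 1 / s) / 2) + 1 / \<eta> * ((s * H2 z + 1 / s) / 2))"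
      using add_mono[OF bd[of "fst z" "snd z"] bd[of "snd z" "fst z"]] unfolding C2_def C2'_def H2_def
      by (simp only: Tcom[of "snd z" "fst z"])
    also have "\<dots> = Y z" unfolding Y_def by (simp add: algebra_simps add_divide_distrib)
    finally show ?thesis .
  qed
  have Rm: "?R \<in> borel_measurable borel"
    unfolding remterm_def dotp_def mvp_def toep_def mmul_def symcov_def by measurable
  show iR: "integrable boxm ?R"
    by (rule Bochner_Integration.integrable_bound[OF iY])
       (use Rm in \<open>auto simp: measurable_cong_sets[OF sets_boxm refl] intro: order_trans[OF RY abs_ge_self]\<close>)
  have M: "measure boxm (space boxm) = 4 * pi^2" by (simp add: measure_def measure_boxm)
  have "(\<integral>z. ?R z \<partial>boxm) \<le> (\<integral>z. Y z \<partial>boxm)" by (rule integral_mono[OF iR iY RY])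
  also have "\<dots> = 1 / \<eta>^2 * (s * (\<integral>z. C2 z \<partial>boxm) + s * (\<integral>z. C2' z \<partial>boxm) + 4 * pi^2 * (2 / s))
      + 1 / \<eta> * (s * (\<integral>z. H2 z \<partial>boxm) + 4 * pi^2 * (1 / s))"
    unfolding Y_def using iC by (simp add: M)
  also have "\<dots> \<le> 1 / \<eta>^2 * (s * (4 * pi^2 / (real N * \<eta>^2)) + s * (4 * pi^2 / (real N * \<eta>^2)) + 4 * pi^2 * (2 / s))
      + 1 / \<eta> * (s * (16 * pi^2 / (real N * \<eta>^4)) + 4 * pi^2 * (1 / s))"
    using eta s by (intro add_mono mult_left_mono eC order_refl) auto
  also have "\<dots> = 8 * pi^2 * (1 / \<eta>^4 + 1 / \<eta>^2 + 2 / \<eta>^5 + 1 / (2 * \<eta>)) / s"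
    unfolding s(2)[symmetric] using eta s(1) by (simp add: field_simps power2_eq_square power4_eq_xxxx eval_nat_numeral)
  also have "\<dots> \<le> 8 * pi^2 * (1 / \<eta>^4 + 1 / \<eta>^2 + 2 / \<eta>^5 + 1 / \<eta>) / s"
    using eta s by (intro divide_right_mono mult_left_mono add_left_mono) (auto simp: field_simps)
  finally show "(\<integral>z. ?R z \<partial>boxm) \<le> 8 * pi^2 * (1 / \<eta>^4 + 1 / \<eta>^2 + 2 / \<eta>^5 + 1 / \<eta>) / sqrt (real N)" unfolding s_def .
qed

end

section \<open>Stieltjes transforms and the semicircle law\<close>

lemma laplace_transform_complex:
  fixes z :: complex
  assumes "Re z > 0"
  shows "integrable lborel (\<lambda>t. indicator {0<..} t *\<^sub>R exp (- z * cx t))"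
    and "(\<integral>t. indicator {0<..} t *\<^sub>R exp (- z * cx t) \<partial>lborel) = 1 / z"
proof -
  have z0: "z \<noteq> 0" using assms by auto
  have ir: "integrable lborel (\<lambda>t. indicator {0<..} t *\<^sub>R exp (- (Re z * t)))"
  proof -
    have "set_integrable lborel {0<..} (\<lambda>t. exp (- (t * Re z)))"
      using integrable_I0i_exp_mscale[OF assms] unfolding set_integrable_def interval_lebesgue_integrable_def
      by (simp add: zero_ereal_def)
    then show ?thesis by (simp add: set_integrable_def mult.commute)
  qed
  show i: "integrable lborel (\<lambda>t. indicator {0<..} t *\<^sub>R exp (- z * cx t))"
    by (rule Bochner_Integration.integrable_bound[OF ir]) (auto simp: indicator_def)
  have e: "einterval 0 \<infinity> = {0<..}" by (auto simp: einterval_def zero_ereal_def)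
  have "(LBINT t=0..\<infinity>. exp (- z * cx t)) = 0 - (- 1 / z)"
  proof (rule interval_integral_FTC_integrable[where F="\<lambda>t. - exp (- z * cx t) / z"])
    show "((\<lambda>t. - exp (- z * cx t) / z) has_vector_derivative exp (- z * cx t)) (at t)" for t
    proof -
      have "((\<lambda>w. - exp (- z * w) / z) has_field_derivative exp (- z * cx t)) (at (cx t))"
        using z0 by (auto intro!: derivative_eq_intros)
      from has_vector_derivative_real_field[OF this] show ?thesis by simp
    qed
    show "set_integrable lborel (einterval 0 \<infinity>) (\<lambda>t. exp (- z * cx t))"
      unfolding e set_integrable_def by (rule i)
    show "(((\<lambda>t. - exp (- z * cx t) / z) \<circ> real_of_ereal) \<longlongrightarrow> - 1 / z) (at_right 0)"
      unfolding zero_ereal_def ereal_tendsto_simps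
      using isCont_tendsto_compose[where g="\<lambda>t. - exp (- z * cx t) / z" and l=0 and f="\<lambda>t. t" and F="at_right (0::real)"] z0
      by (auto intro!: continuous_intros tendsto_ident_at)
    show "(((\<lambda>t. - exp (- z * cx t) / z) \<circ> real_of_ereal) \<longlongrightarrow> 0) (at_left \<infinity>)"
      unfolding ereal_tendsto_simps
    proof (rule tendsto_norm_zero_cancel)
      have "((\<lambda>t. exp (- (Re z * t))) \<longlongrightarrow> 0) at_top"
        using assms by (intro filterlim_compose[OF exp_at_bot] filterlim_tendsto_pos_mult_at_top[OF tendsto_const _ filterlim_ident, THEN filterlim_compose[OF filterlim_uminus_at_bot_at_top]]) auto
      then have "((\<lambda>t. exp (- (Re z * t)) / cmod z) \<longlongrightarrow> 0) at_top" using z0 by (auto intro: tendsto_divide_zero)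
      then show "((\<lambda>t. norm (- exp (- z * cx t) / z)) \<longlongrightarrow> 0) at_top"
        by (simp add: norm_divide)
    qed
  qed (auto intro!: continuous_intros)
  then show "(\<integral>t. indicator {0<..} t *\<^sub>R exp (- z * cx t) \<partial>lborel) = 1 / z"
    unfolding interval_lebesgue_integral_def set_lebesgue_integral_def e by simp
qed

text \<open>The argument \<open>- t\<close> makes the exponent \<open>- (\<eta> + \<i> x) t\<close>,
  so by Fubini the inner integral is \<open>1 / (\<eta> + \<i> x)\<close>, whose real and imaginary
  parts are the two kernels up to sign.\<close>

lemma laplace_char:
  assumes "real_distribution \<mu>" and eta: "\<eta> > 0"
  shows "integrable lborel (\<lambda>t. indicator {0<..} t *\<^sub>R (exp (- (\<eta> * t)) *\<^sub>R char \<mu> (- t)))"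
    and "(\<integral>t. indicator {0<..} t *\<^sub>R (exp (- (\<eta> * t)) *\<^sub>R char \<mu> (- t)) \<partial>lborel)
      = cx (\<integral>x. \<eta> / (x^2 + \<eta>^2) \<partial>\<mu>) - \<i> * cx (\<integral>x. x / (x^2 + \<eta>^2) \<partial>\<mu>)"
proof -
  interpret real_distribution \<mu> by fact
  interpret P: pair_sigma_finite \<mu> lborel ..
  define k where "k x t = indicator {0<..} t *\<^sub>R exp (- Complex \<eta> x * cx t)" for x t :: real
  have kk: "k x t = indicator {0<..} t *\<^sub>R (exp (- (\<eta> * t)) *\<^sub>R exp (\<i> * cx (- t * x)))" for x t
  proof -
    have "- Complex \<eta> x * cx t = cx (- (\<eta> * t)) + \<i> * cx (- t * x)"
      by (simp add: complex_eq_iff)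
    then show ?thesis unfolding k_def by (simp only: exp_add exp_of_real scaleR_conv_of_real)
  qed
  have km: "(\<lambda>(x, t). k x t) \<in> borel_measurable (\<mu> \<Otimes>\<^sub>M lborel)"
    unfolding kk by measurable
  have ir: "integrable lborel (\<lambda>t. indicator {0<..} t *\<^sub>R exp (- (\<eta> * t)))"
  proof -
    have "set_integrable lborel {0<..} (\<lambda>t. exp (- (t * \<eta>)))"
      using integrable_I0i_exp_mscale[OF eta] unfolding set_integrable_def interval_lebesgue_integrable_def
      by (simp add: zero_ereal_def)
    then show ?thesis by (simp add: set_integrable_def mult.commute)
  qed
  have nk: "norm (k x t) = indicator {0<..} t *\<^sub>R exp (- (\<eta> * t))" for x t unfolding kk by (simp add: norm_exp_eq_Re)
  have ki: "integrable lborel (k x)" for x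
  proof (rule Bochner_Integration.integrable_bound[OF ir])
    have "(\<lambda>t. k x t) \<in> borel_measurable lborel" unfolding kk by measurable
    then show "k x \<in> borel_measurable lborel" by simp
  qed (simp add: nk)
  have int: "integrable (\<mu> \<Otimes>\<^sub>M lborel) (\<lambda>(x, t). k x t)"
    by (rule P.Fubini_integrable[OF km]) (auto simp: nk ki)
  have in_t: "(\<integral>x. k x t \<partial>\<mu>) = indicator {0<..} t *\<^sub>R (exp (- (\<eta> * t)) *\<^sub>R char \<mu> (- t))" for t
    unfolding kk char_def by (simp add: mult.commute)
  show "integrable lborel (\<lambda>t. indicator {0<..} t *\<^sub>R (exp (- (\<eta> * t)) *\<^sub>R char \<mu> (- t)))"
    using P.integrable_snd[OF int] unfolding in_t .
  have "(\<integral>t. indicator {0<..} t *\<^sub>R (exp (- (\<eta> * t)) *\<^sub>R char \<mu> (- t)) \<partial>lborel) = (\<integral>t. (\<integral>x. k x t \<partial>\<mu>) \<partial>lborel)"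
    unfolding in_t ..
  also have "\<dots> = (\<integral>x. (\<integral>t. k x t \<partial>lborel) \<partial>\<mu>)"
    by (rule P.Fubini_integral[OF int])
  also have "\<dots> = (\<integral>x. cx (\<eta> / (x^2 + \<eta>^2)) - \<i> * cx (x / (x^2 + \<eta>^2)) \<partial>\<mu>)"
  proof (intro Bochner_Integration.integral_cong refl)
    fix x
    have "(\<integral>t. k x t \<partial>lborel) = 1 / Complex \<eta> x"
      unfolding k_def by (rule laplace_transform_complex(2)) (simp add: eta)
    also have "\<dots> = cx (\<eta> / (x^2 + \<eta>^2)) - \<i> * cx (x / (x^2 + \<eta>^2))"
    proof -
      have "x * x + \<eta> * \<eta> \<noteq> 0" using eta by (metis add_nonneg_pos less_irrefl mult_pos_pos zero_le_square)
      then have "Complex \<eta> x * (cx (\<eta> / (x^2 + \<eta>^2)) - \<i> * cx (x / (x^2 + \<eta>^2))) = 1"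
        by (simp add: complex_eq_iff power2_eq_square add_divide_distrib[symmetric] add.commute)
      moreover have "Complex \<eta> x \<noteq> 0" using eta by (simp add: complex_eq_iff)
      ultimately show ?thesis by (simp add: divide_eq_eq mult.commute)
    qed
    finally show "(\<integral>t. k x t \<partial>lborel) = cx (\<eta> / (x^2 + \<eta>^2)) - \<i> * cx (x / (x^2 + \<eta>^2))" .
  qed
  also have "\<dots> = cx (\<integral>x. \<eta> / (x^2 + \<eta>^2) \<partial>\<mu>) - \<i> * cx (\<integral>x. x / (x^2 + \<eta>^2) \<partial>\<mu>)"
  proof -
    have pos: "x^2 + \<eta>^2 > 0" for x using eta by (simp add: add_nonneg_pos)
    have "integrable \<mu> (\<lambda>x. \<eta> / (x^2 + \<eta>^2))"
      by (rule integrable_const_bound[where B="1 / \<eta>"])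
         (use eta pos in \<open>auto simp: divide_simps power2_eq_square\<close>)
    moreover have "integrable \<mu> (\<lambda>x. x / (x^2 + \<eta>^2))"
    proof (rule integrable_const_bound[where B="1 / \<eta>"])
      have "\<bar>x\<bar> * \<eta> \<le> x^2 + \<eta>^2" for x
      proof -
        have "0 \<le> \<bar>x\<bar> * \<eta>" using eta by simp
        then show ?thesis using sum_squares_bound[of "\<bar>x\<bar>" \<eta>] by simp
      qed
      then show "AE x in \<mu>. norm (x / (x^2 + \<eta>^2)) \<le> 1 / \<eta>"
        using pos eta by (intro AE_I2) (simp add: divide_le_eq pos_divide_le_eq abs_of_pos field_simps)
    qed simp
    ultimately have "(\<integral>x. cx (\<eta> / (x^2 + \<eta>^2)) - \<i> * cx (x / (x^2 + \<eta>^2)) \<partial>\<mu>)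
        = (\<integral>x. cx (\<eta> / (x^2 + \<eta>^2)) \<partial>\<mu>) - (\<integral>x. \<i> * cx (x / (x^2 + \<eta>^2)) \<partial>\<mu>)"
      by (intro Bochner_Integration.integral_diff integrable_mult_right) (simp_all only: complex_of_real_integrable_eq)
    then show ?thesis unfolding integral_mult_right_zero integral_complex_of_real .
  qed
  finally show "(\<integral>t. indicator {0<..} t *\<^sub>R (exp (- (\<eta> * t)) *\<^sub>R char \<mu> (- t)) \<partial>lborel)
      = cx (\<integral>x. \<eta> / (x^2 + \<eta>^2) \<partial>\<mu>) - \<i> * cx (\<integral>x. x / (x^2 + \<eta>^2) \<partial>\<mu>)" .
qed

text \<open>In the variable \<open>u = exp (- t)\<close> the vanishing of the Laplace transform at the points
  \<open>a + n\<close> says that all moments of a continuous function on the unit interval vanish.\<close>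
lemma laplace_unique:
  fixes \<psi> :: "real \<Rightarrow> complex"
  assumes c: "continuous_on UNIV \<psi>" and b: "\<And>t. cmod (\<psi> t) \<le> K" and a: "a > 0"
    and z: "\<And>n :: nat. (\<integral>t. indicator {0<..} t *\<^sub>R (exp (- ((a + real n) * t)) *\<^sub>R \<psi> t) \<partial>lborel) = 0"
    and t: "t > 0"
  shows "\<psi> t = 0"
proof -
  have K: "K \<ge> 0" using b[of 0] norm_ge_zero order_trans by blast
  have pm[measurable]: "\<psi> \<in> borel_measurable borel" using c by (rule borel_measurable_continuous_onI)
  define w where "w t = indicator {0<..} t *\<^sub>R (exp (- (a * t)) *\<^sub>R \<psi> t)" for t
  have wm[measurable]: "w \<in> borel_measurable borel" unfolding w_def by measurable
  have ir: "integrable lborel (\<lambda>t. indicator {0<..} t *\<^sub>R exp (- (a * t)))"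
  proof -
    have "set_integrable lborel {0<..} (\<lambda>t. exp (- (t * a)))"
      using integrable_I0i_exp_mscale[OF a] unfolding set_integrable_def interval_lebesgue_integrable_def
      by (simp add: zero_ereal_def)
    then show ?thesis by (simp add: set_integrable_def mult.commute)
  qed
  have wb: "cmod (w t) \<le> K * (indicator {0<..} t *\<^sub>R exp (- (a * t)))" for t
    unfolding w_def using b[of t] by (auto simp: indicator_def mult.commute intro!: mult_left_mono)
  have iw: "integrable lborel w"
    by (rule Bochner_Integration.integrable_bound[OF integrable_mult_right[OF ir, of K]])
       (use wb in \<open>auto intro: order_trans[OF _ abs_ge_self]\<close>)
  have iwg: "integrable lborel (\<lambda>t. w t * g t)" if "g \<in> borel_measurable borel" "\<And>t. t > 0 \<Longrightarrow> cmod (g t) \<le> L" for g L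
  proof (rule Bochner_Integration.integrable_bound[OF integrable_mult_left[OF iw, of "cx L"]])
    show "AE t in lborel. norm (w t * g t) \<le> norm (w t * cx L)"
      using that(2) by (intro AE_I2) (auto simp: norm_mult w_def indicator_def intro!: mult_left_mono order_trans[OF that(2) abs_ge_self])
  qed (use that in measurable)
  \<comment> \<open>The factor \<open>u\<close> makes \<open>g\<close> continuous at 0, where the
    argument of \<open>\<psi>\<close> runs to infinity and \<open>\<psi>\<close> need not converge.
    The conjugate is there to turn the product with \<open>\<psi>\<close> into a squared
    modulus.\<close>
  define g where "g u = (if u \<le> 0 then 0 else cx u * cnj (\<psi> (- ln u)))" for u :: real
  have gexp: "g (exp (- s)) = exp (- s) *\<^sub>R cnj (\<psi> s)" for s by (simp add: g_def scaleR_conv_of_real exp_of_real)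
  have cg: "continuous_on {0..1} g"
    unfolding continuous_on_eq_continuous_within
  proof
    fix u :: real assume u: "u \<in> {0..1}"
    show "continuous (at u within {0..1}) g"
    proof (cases "u = 0")
      case True
      have "(g \<longlongrightarrow> 0) (at 0 within {0..1})"
      proof (rule Lim_null_comparison)
        have "norm (g v) \<le> \<bar>v\<bar> * K" for v
          using b[of "- ln v"] K by (auto simp: g_def norm_mult intro!: mult_left_mono mult_nonpos_nonneg)
        then show "\<forall>\<^sub>F v in at 0 within {0..1}. norm (g v) \<le> \<bar>v\<bar> * K" by simp
        show "((\<lambda>v. \<bar>v\<bar> * K) \<longlongrightarrow> 0) (at 0 within {0..1})" by (rule tendsto_eq_intros | simp)+
      qed
      then show ?thesis unfolding True continuous_within by (simp add: g_def)
    next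
      case False
      then have u0: "u > 0" using u by auto
      have "isCont (\<lambda>u. cx u * cnj (\<psi> (- ln u))) u"
      proof -
        have "isCont \<psi> (- ln u)" using c by (simp add: continuous_on_eq_continuous_at)
        then have "isCont (\<lambda>u. \<psi> (- ln u)) u"
          using u0 by (intro isCont_o2[where f="\<lambda>u. - ln u" and g=\<psi>]) (auto intro!: continuous_intros)
        then show ?thesis by (intro continuous_intros)
      qed
      moreover have "\<forall>\<^sub>F v in nhds u. cx v * cnj (\<psi> (- ln v)) = g v"
        using eventually_gt_at_top eventually_nhds_in_open[of "{0<..}" u] u0
        by (auto elim!: eventually_mono simp: g_def)
      ultimately have "isCont g u" by (simp add: isCont_cong[of "\<lambda>u. cx u * cnj (\<psi> (- ln u))" g])
      then show ?thesis by (rule continuous_at_imp_continuous_at_within)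
    qed
  qed
  have poly0: "(\<integral>t. w t * (\<Sum>i\<le>n. cx (q i) * cx (exp (- t)) ^ i) \<partial>lborel) = 0" for q n
  proof -
    have e: "w t * (\<Sum>i\<le>n. cx (q i) * cx (exp (- t)) ^ i)
       = (\<Sum>i\<le>n. cx (q i) * (indicator {0<..} t *\<^sub>R (exp (- ((a + real i) * t)) *\<^sub>R \<psi> t)))" for t
    proof -
      have "cx (exp (- t)) ^ i * exp (- (a * t)) = cx (exp (- ((a + real i) * t)))" for i
      proof -
        have "exp (- t) ^ i * exp (- (a * t)) = exp (- ((a + real i) * t))"
          by (simp add: exp_of_nat_mult[symmetric] mult_exp_exp algebra_simps)
        then show ?thesis by (metis of_real_mult of_real_power)
      qed
      note * = this
      show ?thesis unfolding sum_distrib_left w_def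
        by (intro sum.cong refl, unfold scaleR_conv_of_real *[symmetric], simp only: mult_ac)
    qed
    have "integrable lborel (\<lambda>t. indicator {0<..} t *\<^sub>R (exp (- ((a + real i) * t)) *\<^sub>R \<psi> t))" for i
    proof -
      have "integrable lborel (\<lambda>t. w t * cx (exp (- (real i * t))))"
        by (rule iwg[where L=1]) auto
      moreover have "w t * cx (exp (- (real i * t))) = indicator {0<..} t *\<^sub>R (exp (- ((a + real i) * t)) *\<^sub>R \<psi> t)" for t
      proof -
        have "exp (- (a * t)) * exp (- (real i * t)) = exp (- ((a + real i) * t))" by (simp add: mult_exp_exp algebra_simps)
        from arg_cong[OF this, of cx] show ?thesis unfolding w_def by (simp add: scaleR_conv_of_real mult_ac del: exp_of_real)
      qed
      ultimately show ?thesis by simp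
    qed
    then have "(\<integral>t. (\<Sum>i\<le>n. cx (q i) * (indicator {0<..} t *\<^sub>R (exp (- ((a + real i) * t)) *\<^sub>R \<psi> t))) \<partial>lborel)
       = (\<Sum>i\<le>n. \<integral>t. cx (q i) * (indicator {0<..} t *\<^sub>R (exp (- ((a + real i) * t)) *\<^sub>R \<psi> t)) \<partial>lborel)"
      by (intro Bochner_Integration.integral_sum integrable_mult_right)
    also have "\<dots> = 0" by (simp only: integral_mult_right_zero z) simp
    finally show ?thesis unfolding e .
  qed
  have gm: "(\<lambda>t. g (exp (- t))) \<in> borel_measurable borel"
  proof -
    have "(\<lambda>t. cnj (\<psi> t)) \<in> borel_measurable borel"
      using c by (intro borel_measurable_continuous_onI continuous_intros) auto
    then show ?thesis unfolding gexp by measurable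
  qed
  have gb: "cmod (g (exp (- t))) \<le> K" if "t > 0" for t
  proof -
    have "cmod (g (exp (- t))) = exp (- t) * cmod (\<psi> t)" unfolding gexp by simp
    also have "\<dots> \<le> 1 * K" using that by (intro mult_mono b) auto
    finally show ?thesis by simp
  qed
  have "cmod (\<integral>t. w t * g (exp (- t)) \<partial>lborel) \<le> e * (\<integral>t. cmod (w t) \<partial>lborel)" if e: "e > 0" for e
  proof -
    obtain p where p: "polynomial_function p" "\<And>u. u \<in> {0..1} \<Longrightarrow> norm (g u - p u) < e"
      using Stone_Weierstrass_polynomial_function[OF compact_Icc cg e] by blast
    have "real_polynomial_function (Re \<circ> p)" "real_polynomial_function (Im \<circ> p)"
      using p(1) bounded_linear_Re bounded_linear_Im unfolding polynomial_function_def by auto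
    then obtain q n q' n' where q: "Re \<circ> p = (\<lambda>x. \<Sum>i\<le>n. q i * x ^ i)" "Im \<circ> p = (\<lambda>x. \<Sum>i\<le>n'. q' i * x ^ i)"
      unfolding real_polynomial_function_iff_sum by auto
    have pe: "p x = (\<Sum>i\<le>n. cx (q i) * cx x ^ i) + \<i> * (\<Sum>i\<le>n'. cx (q' i) * cx x ^ i)" for x
      using fun_cong[OF q(1), of x] fun_cong[OF q(2), of x]
      by (simp add: complex_eq_iff flip: of_real_power of_real_mult of_real_sum)
    have bd: "\<And>t. t > 0 \<Longrightarrow> cmod (\<Sum>i\<le>n. cx (q i) * cx (exp (- t)) ^ i) \<le> (\<Sum>i\<le>n. \<bar>q i\<bar>)" for q :: "nat \<Rightarrow> real" and n
      by (rule order_trans[OF norm_sum], rule sum_mono) (auto simp: norm_mult norm_power intro!: mult_left_le power_le_one)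
    have ip: "integrable lborel (\<lambda>t. w t * (\<Sum>i\<le>n. cx (q i) * cx (exp (- t)) ^ i))" for q n
      by (rule iwg[OF _ bd]) measurable
    have wp: "w t * p (exp (- t)) = w t * (\<Sum>i\<le>n. cx (q i) * cx (exp (- t)) ^ i)
       + \<i> * (w t * (\<Sum>i\<le>n'. cx (q' i) * cx (exp (- t)) ^ i))" for t
      unfolding pe by (simp add: distrib_left)
    have iwp: "integrable lborel (\<lambda>t. w t * p (exp (- t)))"
      unfolding wp by (intro Bochner_Integration.integrable_add integrable_mult_right ip)
    have p0: "(\<integral>t. w t * p (exp (- t)) \<partial>lborel) = 0"
      unfolding wp by (subst Bochner_Integration.integral_add) (auto intro!: ip simp: poly0 simp del: of_real_exp)
    have iwgg: "integrable lborel (\<lambda>t. w t * g (exp (- t)))"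
      by (rule iwg[OF gm gb])
    have "(\<integral>t. w t * g (exp (- t)) \<partial>lborel) = (\<integral>t. w t * g (exp (- t)) - w t * p (exp (- t)) \<partial>lborel)"
      using iwp iwgg p0 by simp
    also have "cmod \<dots> \<le> (\<integral>t. cmod (w t * g (exp (- t)) - w t * p (exp (- t))) \<partial>lborel)" by (rule integral_norm_bound)
    also have "\<dots> \<le> (\<integral>t. e * cmod (w t) \<partial>lborel)"
    proof (rule integral_mono)
      show "integrable lborel (\<lambda>t. cmod (w t * g (exp (- t)) - w t * p (exp (- t))))" using iwp iwgg by auto
      show "integrable lborel (\<lambda>t. e * cmod (w t))" using iw by auto
      fix t
      show "cmod (w t * g (exp (- t)) - w t * p (exp (- t))) \<le> e * cmod (w t)"
      proof (cases "t > 0")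
        case True
        then have "cmod (g (exp (- t)) - p (exp (- t))) \<le> e" using p(2)[of "exp (- t)"] by simp
        then show ?thesis unfolding right_diff_distrib[symmetric] norm_mult
          by (subst mult.commute) (intro mult_right_mono; simp)
      qed (simp add: w_def)
    qed
    finally show ?thesis by simp
  qed
  note small = this
  have "cmod (\<integral>t. w t * g (exp (- t)) \<partial>lborel) \<le> 0"
  proof (rule field_le_epsilon)
    fix e :: real assume e: "e > 0"
    define I where "I = (\<integral>t. cmod (w t) \<partial>lborel)"
    have I: "I \<ge> 0" unfolding I_def by simp
    have "cmod (\<integral>t. w t * g (exp (- t)) \<partial>lborel) \<le> e / (I + 1) * I"
      using small[of "e / (I + 1)"] e I unfolding I_def by simp
    also have "\<dots> \<le> e" using e I by (simp add: field_simps)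
    finally show "cmod (\<integral>t. w t * g (exp (- t)) \<partial>lborel) \<le> 0 + e" by simp
  qed
  then have 0: "(\<integral>t. w t * g (exp (- t)) \<partial>lborel) = 0" by simp
  \<comment> \<open>Uniform approximation of \<open>g\<close> by polynomials in \<open>u\<close>
    gave integral zero against \<open>w\<close>. The product is a nonnegative function, so it
    vanishes almost everywhere, and continuity of \<open>\<psi>\<close> removes the exceptional
    set.\<close>
  define h where "h t = indicator {0<..} t * (exp (- ((a + 1) * t)) * (cmod (\<psi> t))^2)" for t :: real
  have wh: "w t * g (exp (- t)) = cx (h t)" for t
  proof -
    have "exp (- (a * t)) * exp (- t) = exp (- ((a + 1) * t))" by (simp add: mult_exp_exp algebra_simps)
    from arg_cong[OF this, of cx] show ?thesis
      unfolding gexp w_def h_def of_real_mult complex_norm_square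
      by (auto simp: indicator_def scaleR_conv_of_real mult_ac)
  qed
  have ih: "integrable lborel h"
  proof -
    have "integrable lborel (\<lambda>t. w t * g (exp (- t)))"
      by (rule iwg[OF gm gb])
    then show ?thesis unfolding wh by (simp only: complex_of_real_integrable_eq)
  qed
  have "(\<integral>t. h t \<partial>lborel) = 0"
    using 0 unfolding wh integral_complex_of_real by simp
  then have ae: "AE t in lborel. h t = 0"
    by (subst (asm) integral_nonneg_eq_0_iff_AE[OF ih]) (auto simp: h_def)
  have "\<psi> t = 0"
  proof (rule ccontr)
    assume "\<psi> t \<noteq> 0"
    define U where "U = {s. s > 0 \<and> \<psi> s \<noteq> 0}"
    have oU: "open U"
    proof -
      have "U = {0<..} \<inter> (\<psi> -` (- {0}))" unfolding U_def by auto
      moreover have "open (\<psi> -` (- {0}))" using c by (intro open_vimage) auto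
      ultimately show ?thesis by auto
    qed
    have "AE s in lborel. s \<notin> U"
      using ae by eventually_elim (auto simp: h_def U_def)
    then have "emeasure lborel U = 0"
      using oU by (intro AE_iff_measurable[THEN iffD1, of U]) auto
    moreover have "t \<in> U" using t \<open>\<psi> t \<noteq> 0\<close> by (simp add: U_def)
    moreover obtain d where d: "d > 0" "ball t d \<subseteq> U" using oU \<open>t \<in> U\<close> open_contains_ball by blast
    moreover have "emeasure lborel (ball t d) \<le> emeasure lborel U" using oU d by (intro emeasure_mono) auto
    moreover have "emeasure lborel (ball t d) = ennreal (2 * d)" using d by (simp add: ball_eq_greaterThanLessThan)
    ultimately show False by simp
  qed
  then show ?thesis .
qed

text \<open>Together the two kernels give the Laplace transforms of the characteristic functions on
  a half-line, at all positive points above \<open>\<eta>0\<close>. Equality there forces the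
  characteristic functions to agree at negative arguments; conjugation gives the positive
  ones.\<close>

lemma stieltjes_unique:
  assumes m1: "real_distribution \<mu>\<^sub>1" and m2: "real_distribution \<mu>\<^sub>2"
    and re: "\<And>\<eta>. \<eta> > \<eta>0 \<Longrightarrow> (\<integral>x. x / (x^2 + \<eta>^2) \<partial>\<mu>\<^sub>1) = (\<integral>x. x / (x^2 + \<eta>^2) \<partial>\<mu>\<^sub>2)"
    and im: "\<And>\<eta>. \<eta> > \<eta>0 \<Longrightarrow> (\<integral>x. \<eta> / (x^2 + \<eta>^2) \<partial>\<mu>\<^sub>1) = (\<integral>x. \<eta> / (x^2 + \<eta>^2) \<partial>\<mu>\<^sub>2)"
  shows "\<mu>\<^sub>1 = \<mu>\<^sub>2"
proof (rule Levy_uniqueness[OF m1 m2])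
  interpret M1: real_distribution \<mu>\<^sub>1 by fact
  interpret M2: real_distribution \<mu>\<^sub>2 by fact
  define \<psi> where "\<psi> t = char \<mu>\<^sub>1 (- t) - char \<mu>\<^sub>2 (- t)" for t
  have cm: "cmod (char \<mu> t) \<le> 1" if "real_distribution \<mu>" for \<mu> t
    by (rule real_distribution.cmod_char_le_1[OF that])
  \<comment> \<open>The starting point \<open>max \<eta>0 0 + 1\<close> is positive and above
    \<open>\<eta>0\<close>, and remains so when integers are added; 2 bounds the difference of two
    characteristic functions.\<close>
  have cpos: "\<psi> t = 0" if "t > 0" for t
  proof (rule laplace_unique[where a="max \<eta>0 0 + 1" and K=2])
    have "isCont (\<lambda>t. char \<mu> (- t)) t" if "real_distribution \<mu>" for \<mu> t
      using real_distribution.isCont_char[OF that, of "- t"] by (intro isCont_o2[where f=uminus and g="char \<mu>"]) auto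
    then show "continuous_on UNIV \<psi>" unfolding \<psi>_def[abs_def]
      using m1 m2 by (intro continuous_at_imp_continuous_on ballI continuous_diff) auto
    show "cmod (\<psi> t) \<le> 2" for t
      unfolding \<psi>_def using cm[OF m1, of "-t"] cm[OF m2, of "-t"] norm_triangle_ineq4[of "char \<mu>\<^sub>1 (- t)" "char \<mu>\<^sub>2 (- t)"] by simp
    fix n :: nat
    define \<eta> where "\<eta> = max \<eta>0 0 + 1 + real n"
    have e: "\<eta> > 0" "\<eta> > \<eta>0" unfolding \<eta>_def by auto
    have "(\<integral>t. indicator {0<..} t *\<^sub>R (exp (- (\<eta> * t)) *\<^sub>R \<psi> t) \<partial>lborel)
      = (\<integral>t. indicator {0<..} t *\<^sub>R (exp (- (\<eta> * t)) *\<^sub>R char \<mu>\<^sub>1 (- t)) \<partial>lborel)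
       - (\<integral>t. indicator {0<..} t *\<^sub>R (exp (- (\<eta> * t)) *\<^sub>R char \<mu>\<^sub>2 (- t)) \<partial>lborel)"
      unfolding \<psi>_def scaleR_diff_right
      by (rule Bochner_Integration.integral_diff) (rule laplace_char(1)[OF m1 e(1)], rule laplace_char(1)[OF m2 e(1)])
    also have "\<dots> = 0"
      unfolding laplace_char(2)[OF m1 e(1)] laplace_char(2)[OF m2 e(1)] using re[OF e(2)] im[OF e(2)] by simp
    finally show "(\<integral>t. indicator {0<..} t *\<^sub>R (exp (- ((max \<eta>0 0 + 1 + real n) * t)) *\<^sub>R \<psi> t) \<partial>lborel) = 0"
      unfolding \<eta>_def .
  qed (use that in auto)
  have neg: "char \<mu>\<^sub>1 t = char \<mu>\<^sub>2 t" if "t < 0" for t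
    using cpos[of "- t"] that by (simp add: \<psi>_def)
  have cnjc: "char \<mu> (- t) = cnj (char \<mu> t)" for \<mu> t
  proof -
    have "char \<mu> (- t) = (\<integral>x. cnj (iexp (t * x)) \<partial>\<mu>)" unfolding char_def by (simp add: exp_cnj)
    also have "\<dots> = cnj (char \<mu> t)" unfolding char_def by (rule Bochner_Integration.integral_cnj)
    finally show ?thesis .
  qed
  show "char \<mu>\<^sub>1 = char \<mu>\<^sub>2"
  proof
    fix t :: real
    consider "t < 0" | "t = 0" | "t > 0" by linarith
    then show "char \<mu>\<^sub>1 t = char \<mu>\<^sub>2 t"
    proof cases
      case 2
      then show ?thesis by (simp add: M1.char_zero M2.char_zero)
    next
      case 3
      then have "cnj (char \<mu>\<^sub>1 t) = cnj (char \<mu>\<^sub>2 t)" using neg[of "- t"] by (simp add: cnjc)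
      then show ?thesis by simp
    qed (rule neg)
  qed
qed

text \<open>Explicit antiderivatives on the open interval from \<open>- c\<close> to
  \<open>c\<close>, where \<open>c = 2 * sqrt \<gamma>\<close>. The ends are reached as limits,
  since \<open>S\<close> vanishes there and stands in denominators. The kernel
  \<open>x / (x^2 + \<eta>^2)\<close> is odd and the density even.\<close>

lemma WSL_integrals:
  assumes g: "\<gamma> > 0"
  shows "emeasure (WSL \<gamma>) UNIV = 1"
    and "\<eta> > 0 \<Longrightarrow> (\<integral>x. \<eta> / (x^2 + \<eta>^2) \<partial>WSL \<gamma>) = 2 / (\<eta> + sqrt (\<eta>^2 + 4 * \<gamma>))"
    and "(\<integral>x. x / (x^2 + \<eta>^2) \<partial>WSL \<gamma>) = 0"
proof -
  define c where "c = 2 * sqrt \<gamma>"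
  have c: "c > 0" "c^2 = 4 * \<gamma>" using g by (auto simp: c_def power_mult_distrib)
  have cc: "c * c = 4 * \<gamma>" using c(2) by (simp add: power2_eq_square)
  define S where "S x = sqrt (c^2 - x^2)" for x
  have Spos: "S x > 0" "(S x)^2 = c^2 - x^2" if "-c < x" "x < c" for x
  proof -
    have "\<bar>x\<bar> < c" using that by auto
    then have "\<bar>x\<bar>^2 < c^2" by (intro power_strict_mono) auto
    then have "x^2 < c^2" by simp
    then show "S x > 0" "(S x)^2 = c^2 - x^2" unfolding S_def by auto
  qed
  have Sd: "(S has_real_derivative (- x / S x)) (at x)" if "-c < x" "x < c" for x
  proof -
    have "c^2 - x^2 > 0" using Spos[OF that] by (metis zero_less_power)
    then show ?thesis unfolding S_def[abs_def]
      by (auto intro!: derivative_eq_intros simp: field_simps)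
  qed
  have Scont: "continuous_on UNIV S" unfolding S_def[abs_def] by (intro continuous_intros)
  have Sc: "S c = 0" "S (- c) = 0" by (simp_all add: S_def)
  have asd: "((\<lambda>x. arcsin (x / c)) has_real_derivative (1 / S x)) (at x)" if x: "-c < x" "x < c" for x
  proof -
    have r: "-1 < x / c" "x / c < 1" using x c(1) by (auto simp: field_simps)
    have "((\<lambda>x. arcsin (x / c)) has_real_derivative (inverse (sqrt (1 - (x / c)^2)) * (1 / c))) (at x)"
      by (rule DERIV_chain2[where f=arcsin and g="\<lambda>x. x / c", OF DERIV_arcsin[OF r] DERIV_cdivide[OF DERIV_ident]])
    moreover have "sqrt (1 - (x / c)^2) = S x / c"
    proof -
      have "1 - (x / c)^2 = (c^2 - x^2) / c^2" using c(1) by (simp add: field_simps)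
      then show ?thesis using c(1) unfolding S_def by (simp add: real_sqrt_divide)
    qed
    ultimately show ?thesis using c(1) by (simp add: field_simps)
  qed
  have Slim: "(S \<longlongrightarrow> 0) (at_left c)" "(S \<longlongrightarrow> 0) (at_right (- c))"
    using Scont Sc by (metis UNIV_I continuous_on_eq_continuous_at open_UNIV isCont_def tendsto_within_subset subset_UNIV)+
  have aslim: "((\<lambda>x. arcsin (x / c)) \<longlongrightarrow> pi / 2) (at_left c)" "((\<lambda>x. arcsin (x / c)) \<longlongrightarrow> - (pi / 2)) (at_right (- c))"
  proof -
    have co: "continuous_on {-c..c} (\<lambda>x. arcsin (x / c))"
      using c(1) by (intro continuous_intros) (auto simp: field_simps)
    have L: "((\<lambda>x. arcsin (x / c)) \<longlongrightarrow> arcsin (u / c)) (at u within {-c..c})" if "u \<in> {-c..c}" for u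
      using co that unfolding continuous_on_def by blast
    have "((\<lambda>x. arcsin (x / c)) \<longlongrightarrow> arcsin (c / c)) (at c within {-c..c})"
      "((\<lambda>x. arcsin (x / c)) \<longlongrightarrow> arcsin ((-c) / c)) (at (- c) within {-c..c})"
      using L[of c] L[of "- c"] c(1) by simp_all
    moreover have "at c within {-c..c} = at_left c" "at (- c) within {-c..c} = at_right (- c)"
      using c(1) by (auto simp: at_within_Icc_at_left at_within_Icc_at_right)
    ultimately show "((\<lambda>x. arcsin (x / c)) \<longlongrightarrow> pi / 2) (at_left c)" "((\<lambda>x. arcsin (x / c)) \<longlongrightarrow> - (pi / 2)) (at_right (- c))"
      using c(1) by simp_all
  qed
  have ei: "einterval (ereal (- c)) (ereal c) = {-c<..<c}" by (auto simp: einterval_def)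
  have evl: "\<forall>\<^sub>F x in at_left c. S x > 0" "\<forall>\<^sub>F x in at_right (- c). S x > 0"
    using eventually_at_left_real[of "-c" c] eventually_at_right_real[of "-c" c] c(1)
    by (auto elim!: eventually_mono intro!: Spos(1))
  have mass: "(LBINT x=ereal (- c)..ereal c. S x) = pi * c^2 / 4 - - (pi * c^2 / 4)"
    "set_integrable lborel (einterval (ereal (- c)) (ereal c)) S"
  proof -
    let ?F = "\<lambda>x. (x * S x + c^2 * arcsin (x / c)) / 2"
    have d: "(?F has_real_derivative S x) (at x)" if "ereal (- c) < ereal x" "ereal x < ereal c" for x
    proof -
      have x: "-c < x" "x < c" using that by auto
      have "(?F has_real_derivative ((x * (- x / S x) + 1 * S x) + c^2 * (1 / S x)) / 2) (at x)"
        by (rule DERIV_cdivide[OF DERIV_add[OF DERIV_mult'[OF DERIV_ident Sd[OF x]] DERIV_cmult[OF asd[OF x]]]])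
      moreover have E: "((x * (- x / S x) + 1 * S x) + c^2 * (1 / S x)) / 2 = S x"
        using Spos[OF x] by (simp add: field_simps power2_eq_square)
      ultimately show ?thesis unfolding E by simp
    qed
    have A: "((?F \<circ> real_of_ereal) \<longlongrightarrow> - (pi * c^2 / 4)) (at_right (ereal (- c)))"
      unfolding ereal_tendsto_simps by (rule tendsto_eq_intros Slim aslim refl | simp)+
    have B: "((?F \<circ> real_of_ereal) \<longlongrightarrow> pi * c^2 / 4) (at_left (ereal c))"
      unfolding ereal_tendsto_simps by (rule tendsto_eq_intros Slim aslim refl | simp)+
    have lt: "ereal (- c) < ereal c" using c by simp
    have ic: "isCont S x" for x using Scont by (simp add: continuous_on_eq_continuous_at)
    have nn: "AE x in lborel. ereal (- c) < ereal x \<longrightarrow> ereal x < ereal c \<longrightarrow> 0 \<le> S x"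
      using Spos(1) by (intro AE_I2) (auto intro: less_imp_le)
    show "(LBINT x=ereal (- c)..ereal c. S x) = pi * c^2 / 4 - - (pi * c^2 / 4)"
      "set_integrable lborel (einterval (ereal (- c)) (ereal c)) S"
      using interval_integral_FTC_nonneg[OF lt d ic nn A B] by auto
  qed
  define w where "w x = 1 / (2 * pi * sqrt \<gamma>) * sqrt (4 - x^2 / \<gamma>) * indicator {-(2 * sqrt \<gamma>)..2 * sqrt \<gamma>} x" for x
  have W: "WSL \<gamma> = density lborel (\<lambda>x. ennreal (w x))" using g by (simp add: WSL_def w_def)
  have wm[measurable]: "w \<in> borel_measurable borel" unfolding w_def by measurable
  have ws: "w x = 1 / (2 * pi * \<gamma>) * (indicator {-c<..<c} x * S x)" for x
  proof -
    have "sqrt (4 - x^2 / \<gamma>) = S x / sqrt \<gamma>"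
    proof -
      have "4 - x^2 / \<gamma> = (c^2 - x^2) / \<gamma>" using g c(2) by (simp add: field_simps)
      then show ?thesis unfolding S_def by (simp add: real_sqrt_divide)
    qed
    then have "w x = 1 / (2 * pi * \<gamma>) * (S x * indicator {-c..c} x)"
      using g unfolding w_def c_def by (simp add: mult.assoc[symmetric])
    also have "S x * indicator {-c..c} x = indicator {-c<..<c} x * S x"
      using Sc by (auto simp: indicator_def)
    finally show ?thesis .
  qed
  have w0: "w x \<ge> 0" for x unfolding ws using Spos(1)[of x] g by (auto simp: indicator_def intro!: mult_nonneg_nonneg less_imp_le)
  have wS: "(\<integral>x. w x * h x \<partial>lborel) = 1 / (2 * pi * \<gamma>) * (LBINT x=ereal (- c)..ereal c. S x * h x)" for h
    using c(1) unfolding interval_lebesgue_integral_def set_lebesgue_integral_def ei ws by (simp add: mult.assoc)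
  have iw: "integrable lborel w"
    using mass(2) unfolding set_integrable_def ei ws by simp
  have iw1: "(\<integral>x. w x \<partial>lborel) = 1"
    using wS[of "\<lambda>_. 1"] mass(1) g by (simp add: c(2))
  show "emeasure (WSL \<gamma>) UNIV = 1"
    unfolding W by (subst emeasure_density) (auto simp: nn_integral_eq_integral[OF iw] w0 iw1)
  have WI: "(\<integral>x. h x \<partial>WSL \<gamma>) = (\<integral>x. w x * h x \<partial>lborel)" if "h \<in> borel_measurable borel" for h :: "real \<Rightarrow> real"
    unfolding W using that w0 by (subst integral_density) auto
  show "(\<integral>x. x / (x^2 + \<eta>^2) \<partial>WSL \<gamma>) = 0"
  proof -
    have "(\<integral>x. w x * (x / (x^2 + \<eta>^2)) \<partial>lborel) = (\<integral>x. w (- x) * (- x / ((- x)^2 + \<eta>^2)) \<partial>lborel)"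
      using lborel_integral_real_affine[of "-1" "\<lambda>x. w x * (x / (x^2 + \<eta>^2))" 0] by simp
    also have "\<dots> = - (\<integral>x. w x * (x / (x^2 + \<eta>^2)) \<partial>lborel)"
    proof -
      have "w (- x) = w x" for x unfolding ws S_def by (auto simp: indicator_def)
      then show ?thesis by simp
    qed
    finally show ?thesis by (subst WI) auto
  qed
  assume eta: "\<eta> > 0"
  define R where "R = sqrt (\<eta>^2 + c^2)"
  have R: "R > 0" "R^2 = \<eta>^2 + c^2" unfolding R_def using eta by (auto intro: add_pos_nonneg)
  have "(LBINT x=ereal (- c)..ereal c. S x * (1 / (x^2 + \<eta>^2))) = (- (pi / 2) + R / \<eta> * (pi / 2)) - (pi / 2 + R / \<eta> * (- (pi / 2)))"
  proof -
    \<comment> \<open>With \<open>R^2 = \<eta>^2 + c^2\<close> the integrand splits as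
      \<open>- 1 / S + R^2 / (S * (x^2 + \<eta>^2))\<close>; the first summand integrates to an
      arcsine, the second to an arctangent through the substitution
      \<open>x * R / (\<eta> * S)\<close>.\<close>
    let ?F = "\<lambda>x. - arcsin (x / c) + R / \<eta> * arctan (x * R / (\<eta> * S x))"
    have d: "(?F has_real_derivative (S x * (1 / (x^2 + \<eta>^2)))) (at x)" if "ereal (- c) < ereal x" "ereal x < ereal c" for x
    proof -
      have x: "-c < x" "x < c" using that by auto
      note Sx = Spos[OF x]
      have nz: "\<eta> * S x \<noteq> 0" using eta Sx by simp
      have x2: "x^2 + \<eta>^2 > 0" using eta by (simp add: add_nonneg_pos)
      have du: "((\<lambda>x. x * R / (\<eta> * S x)) has_real_derivative (R * c^2 / (\<eta> * S x ^ 3))) (at x)"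
      proof -
        have "((\<lambda>x. x * R / (\<eta> * S x)) has_real_derivative ((1 * R) * (\<eta> * S x) - (x * R) * (\<eta> * (- x / S x))) / ((\<eta> * S x) * (\<eta> * S x))) (at x)"
          by (rule DERIV_divide DERIV_cmult DERIV_cmult_right DERIV_ident Sd[OF x] nz)+
        moreover have "((1 * R) * (\<eta> * S x) - (x * R) * (\<eta> * (- x / S x))) / ((\<eta> * S x) * (\<eta> * S x)) = R * c^2 / (\<eta> * S x ^ 3)"
        proof -
          have "((1 * R) * (\<eta> * S x) - (x * R) * (\<eta> * (- x / S x))) = R * \<eta> * ((S x)^2 + x^2) / S x"
            using Sx(1) by (simp add: field_simps power2_eq_square)
          also have "(S x)^2 + x^2 = c^2" using Sx(2) by simp
          finally show ?thesis using Sx(1) eta by (simp add: field_simps power3_eq_cube)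
        qed
        ultimately show ?thesis by simp
      qed
      have "((\<lambda>x. arctan (x * R / (\<eta> * S x))) has_real_derivative (inverse (1 + (x * R / (\<eta> * S x))^2) * (R * c^2 / (\<eta> * S x ^ 3)))) (at x)"
        by (rule DERIV_chain2[where f=arctan and g="\<lambda>x. x * R / (\<eta> * S x)", OF DERIV_arctan du])
      moreover have "inverse (1 + (x * R / (\<eta> * S x))^2) * (R * c^2 / (\<eta> * S x ^ 3)) = R * \<eta> / (S x * (x^2 + \<eta>^2))"
      proof -
        have "1 + (x * R / (\<eta> * S x))^2 = (\<eta>^2 * (S x)^2 + x^2 * R^2) / (\<eta>^2 * (S x)^2)"
          using nz by (simp add: power_mult_distrib power_divide add_divide_distrib)
        also have "\<eta>^2 * (S x)^2 + x^2 * R^2 = c^2 * (x^2 + \<eta>^2)" unfolding Sx(2) R(2) by (simp add: algebra_simps)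
        finally have E: "1 + (x * R / (\<eta> * S x))^2 = c^2 * (x^2 + \<eta>^2) / (\<eta>^2 * (S x)^2)" .
        have gen: "inverse (C * A / (\<eta>^2 * s^2)) * (R * C / (\<eta> * s ^ 3)) = R * \<eta> / (s * A)"
          if "C \<noteq> 0" "A \<noteq> 0" "s \<noteq> 0" for C A s
          using that eta by (simp add: field_simps power2_eq_square power3_eq_cube)
        show ?thesis unfolding E by (rule gen) (use Sx(1) c(1) x2 in auto)
      qed
      ultimately have "(?F has_real_derivative (- (1 / S x) + R / \<eta> * (R * \<eta> / (S x * (x^2 + \<eta>^2))))) (at x)"
        using asd[OF x] by (intro DERIV_add DERIV_minus DERIV_cmult) auto
      moreover have "- (1 / S x) + R / \<eta> * (R * \<eta> / (S x * (x^2 + \<eta>^2))) = S x * (1 / (x^2 + \<eta>^2))"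
      proof -
        have E1: "R / \<eta> * (R * \<eta> / (S x * (x^2 + \<eta>^2))) = R^2 / (S x * (x^2 + \<eta>^2))" using eta by (simp add: power2_eq_square)
        have E2: "- (1 / S x) = - (x^2 + \<eta>^2) / (S x * (x^2 + \<eta>^2))"
        proof -
          have gen: "- (1 / s) = - A / (s * A)" if "A \<noteq> 0" for s A :: real using that by simp
          show ?thesis by (rule gen) (use eta in auto)
        qed
        have gen2: "- A / B + C / B = (C - A) / B" for A B C :: real by (simp add: diff_divide_distrib)
        have "- (1 / S x) + R / \<eta> * (R * \<eta> / (S x * (x^2 + \<eta>^2))) = (R^2 - (x^2 + \<eta>^2)) / (S x * (x^2 + \<eta>^2))"
          unfolding E1 E2 by (rule gen2)
        also have "R^2 - (x^2 + \<eta>^2) = S x * S x" using R(2) Sx(2) by (simp add: power2_eq_square)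
        finally show ?thesis using Sx(1) by simp
      qed
      ultimately show ?thesis by simp
    qed
    have atl: "((\<lambda>x. arctan (x * R / (\<eta> * S x))) \<longlongrightarrow> pi / 2) (at_left c)"
    proof (rule filterlim_compose[OF tendsto_arctan_at_top])
      have "LIM x at_left c. (x * R) / (\<eta> * S x) :> at_top"
      proof (rule LIM_at_top_divide)
        show "((\<lambda>x. x * R) \<longlongrightarrow> c * R) (at_left c)" by (intro tendsto_intros)
        show "((\<lambda>x. \<eta> * S x) \<longlongrightarrow> 0) (at_left c)" using tendsto_mult_left[OF Slim(1), of \<eta>] by simp
        show "\<forall>\<^sub>F x in at_left c. 0 < \<eta> * S x" using evl(1) by eventually_elim (simp add: eta)
      qed (use c R in auto)
      then show "filterlim (\<lambda>x. x * R / (\<eta> * S x)) at_top (at_left c)" .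
    qed
    have atr: "((\<lambda>x. arctan (x * R / (\<eta> * S x))) \<longlongrightarrow> - (pi / 2)) (at_right (- c))"
    proof (rule filterlim_compose[OF tendsto_arctan_at_bot])
      have "LIM x at_right (- c). (- x * R) / (\<eta> * S x) :> at_top"
      proof (rule LIM_at_top_divide)
        show "((\<lambda>x. - x * R) \<longlongrightarrow> - (- c) * R) (at_right (- c))" by (intro tendsto_intros)
        show "((\<lambda>x. \<eta> * S x) \<longlongrightarrow> 0) (at_right (- c))" using tendsto_mult_left[OF Slim(2), of \<eta>] by simp
        show "\<forall>\<^sub>F x in at_right (- c). 0 < \<eta> * S x" using evl(2) by eventually_elim (simp add: eta)
      qed (use c R in auto)
      then show "filterlim (\<lambda>x. x * R / (\<eta> * S x)) at_bot (at_right (- c))"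
        by (simp add: filterlim_uminus_at_bot)
    qed
    have A: "((?F \<circ> real_of_ereal) \<longlongrightarrow> (pi / 2 + R / \<eta> * (- (pi / 2)))) (at_right (ereal (- c)))"
      unfolding ereal_tendsto_simps by (rule tendsto_eq_intros aslim atr refl | simp)+
    have B: "((?F \<circ> real_of_ereal) \<longlongrightarrow> (- (pi / 2) + R / \<eta> * (pi / 2))) (at_left (ereal c))"
      unfolding ereal_tendsto_simps by (rule tendsto_eq_intros aslim atl refl | simp)+
    have lt: "ereal (- c) < ereal c" using c by simp
    have ic: "isCont (\<lambda>x. S x * (1 / (x^2 + \<eta>^2))) x" for x
    proof -
      have "isCont S x" using Scont by (simp add: continuous_on_eq_continuous_at)
      moreover have "x^2 + \<eta>^2 \<noteq> 0" using eta by (metis add_nonneg_pos less_irrefl zero_le_power2 zero_less_power)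
      ultimately show ?thesis by (intro continuous_intros) auto
    qed
    have nn: "AE x in lborel. ereal (- c) < ereal x \<longrightarrow> ereal x < ereal c \<longrightarrow> 0 \<le> S x * (1 / (x^2 + \<eta>^2))"
    proof (intro AE_I2 impI)
      fix x assume "ereal (- c) < ereal x" "ereal x < ereal c"
      then have "S x > 0" by (intro Spos(1)) auto
      then show "0 \<le> S x * (1 / (x^2 + \<eta>^2))" by (intro mult_nonneg_nonneg) simp_all
    qed
    show ?thesis
      by (rule interval_integral_FTC_nonneg(2)[OF lt d ic nn A B])
  qed
  also have "\<dots> = pi * (R - \<eta>) / \<eta>" using eta by (simp add: field_simps)
  finally have I: "(LBINT x=ereal (- c)..ereal c. S x * (1 / (x^2 + \<eta>^2))) = pi * (R - \<eta>) / \<eta>" .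
  have "(\<integral>x. \<eta> / (x^2 + \<eta>^2) \<partial>WSL \<gamma>) = \<eta> * (\<integral>x. w x * (1 / (x^2 + \<eta>^2)) \<partial>lborel)"
    by (subst WI) (auto simp flip: integral_mult_right_zero intro!: Bochner_Integration.integral_cong)
  also have "\<dots> = (R - \<eta>) / (2 * \<gamma>)" unfolding wS I using eta by simp
  \<comment> \<open>Rationalising with \<open>R^2 - \<eta>^2 = 4 * \<gamma>\<close>. This form has
    no \<open>\<gamma>\<close> as a denominator and remains correct for the point mass at
    \<open>\<gamma> = 0\<close>.\<close>
  also have "\<dots> = 2 / (\<eta> + R)"
  proof -
    have "(R - \<eta>) * (\<eta> + R) = 4 * \<gamma>" using R(2) c(2) by (simp add: algebra_simps power2_eq_square)
    then show ?thesis using g eta R(1) by (simp add: field_simps)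
  qed
  finally show "(\<integral>x. \<eta> / (x^2 + \<eta>^2) \<partial>WSL \<gamma>) = 2 / (\<eta> + sqrt (\<eta>^2 + 4 * \<gamma>))"
    unfolding R_def c(2) .
qed

section \<open>Symmetry of the spectral density\<close>

inductive trigpoly :: "(real \<times> real \<Rightarrow> complex) \<Rightarrow> bool" where
  mono: "trigpoly (\<lambda>z. cis (real_of_int k * fst z + real_of_int l * snd z))"
| add: "trigpoly p \<Longrightarrow> trigpoly q \<Longrightarrow> trigpoly (\<lambda>z. p z + q z)"
| cmul: "trigpoly p \<Longrightarrow> trigpoly (\<lambda>z. c * p z)"

lemma trigpoly_const: "trigpoly (\<lambda>z. c)"
  using trigpoly.cmul[OF trigpoly.mono[of 0 0], of c] by simp

lemma trigpoly_mult:
  assumes "trigpoly p" "trigpoly q" shows "trigpoly (\<lambda>z. p z * q z)"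
  using assms
proof (induction p rule: trigpoly.induct)
  case (mono k l)
  then show ?case
  proof (induction q rule: trigpoly.induct)
    case (mono k' l')
    have "cis (real_of_int k * fst z + real_of_int l * snd z) * cis (real_of_int k' * fst z + real_of_int l' * snd z)
      = cis (real_of_int (k + k') * fst z + real_of_int (l + l') * snd z)" for z
      by (simp add: cis_mult algebra_simps)
    then show ?case using trigpoly.mono by presburger
  next
    case (add p q)
    then show ?case using trigpoly.add by (simp add: distrib_left)
  next
    case (cmul p c)
    then show ?case using trigpoly.cmul[of _ c] by (simp add: mult.left_commute)
  qed
next
  case (add p q)
  then show ?case using trigpoly.add by (simp add: distrib_right)
next
  case (cmul p c)
  then show ?case using trigpoly.cmul[of _ c] by (simp add: mult.assoc)
qed

lemma trigpoly_measurable: "trigpoly p \<Longrightarrow> p \<in> borel_measurable borel"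
proof (induction rule: trigpoly.induct)
  case (mono k l)
  show ?case by (intro borel_measurable_continuous_onI continuous_intros)
next
  case (add p q)
  then show ?case by (intro borel_measurable_add)
next
  case (cmul p c)
  then show ?case by (intro borel_measurable_times borel_measurable_const)
qed

lemma trigpoly_bounded: "trigpoly p \<Longrightarrow> \<exists>B. \<forall>z. cmod (p z) \<le> B"
proof (induction rule: trigpoly.induct)
  case (mono k l)
  show ?case by (intro exI[of _ 1]) simp
next
  case (add p q)
  then obtain B C where "\<forall>z. cmod (p z) \<le> B" "\<forall>z. cmod (q z) \<le> C" by blast
  then show ?case by (intro exI[of _ "B + C"]) (meson add_mono norm_triangle_ineq order_trans)
next
  case (cmul p c)
  then obtain B where "\<forall>z. cmod (p z) \<le> B" by blast
  then show ?case by (intro exI[of _ "cmod c * B"]) (simp add: norm_mult mult_left_mono)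
qed

lemma trigpoly_sum:
  assumes "trigpoly p"
  shows "\<exists>S c. finite S \<and> p = (\<lambda>z. \<Sum>m\<in>S. c m * cis (real_of_int (fst m) * fst z + real_of_int (snd m) * snd z))"
  using assms
proof (induction rule: trigpoly.induct)
  case (mono k l)
  show ?case by (intro exI[of _ "{(k,l)}"] exI[of _ "\<lambda>_. 1"]) simp
next
  case (add p q)
  let ?e = "\<lambda>m z. cis (real_of_int (fst m) * fst z + real_of_int (snd m) * snd z)"
  from add obtain S c S' c' where S: "finite S" "p = (\<lambda>z. \<Sum>m\<in>S. c m * ?e m z)"
    and S': "finite S'" "q = (\<lambda>z. \<Sum>m\<in>S'. c' m * ?e m z)" by blast
  have 1: "(\<Sum>m\<in>S. c m * ?e m z) = (\<Sum>m\<in>S\<union>S'. (if m \<in> S then c m else 0) * ?e m z)" for z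
    using S S' by (intro sum.mono_neutral_cong_left) auto
  have 2: "(\<Sum>m\<in>S'. c' m * ?e m z) = (\<Sum>m\<in>S\<union>S'. (if m \<in> S' then c' m else 0) * ?e m z)" for z
    using S S' by (intro sum.mono_neutral_cong_left) auto
  show ?case unfolding S(2) S'(2) 1 2
    by (intro exI[of _ "S \<union> S'"] exI[of _ "\<lambda>m. (if m \<in> S then c m else 0) + (if m \<in> S' then c' m else 0)"])
       (simp add: S S' sum.distrib distrib_right)
next
  case (cmul p a)
  then obtain S c where "finite S" "p = (\<lambda>z. \<Sum>m\<in>S. c m * cis (real_of_int (fst m) * fst z + real_of_int (snd m) * snd z))" by blast
  then show ?case by (intro exI[of _ S] exI[of _ "\<lambda>m. a * c m"]) (simp add: sum_distrib_left mult.assoc)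
qed

text \<open>The half-open box embeds injectively into the compact torus. Real polynomials there pull
  back to trigonometric polynomials, so Stone-Weierstrass gives uniform approximation of continuous
  functions on the torus.\<close>

definition torus :: "real \<times> real \<Rightarrow> complex \<times> complex" where
  "torus z = (cis (fst z), cis (snd z))"

lemma continuous_on_torus[continuous_intros]: "continuous_on S torus"
  unfolding torus_def by (intro continuous_intros)

lemma trigpoly_real_polynomial:
  assumes "real_polynomial_function g"
  shows "trigpoly (\<lambda>z. cx (g (torus z)))"
  using assms
proof (induction rule: real_polynomial_function.induct)
  case (linear f)
  interpret bounded_linear f by fact
  have e: "torus z = cos (fst z) *\<^sub>R (1, 0) + sin (fst z) *\<^sub>R (\<i>, 0) + cos (snd z) *\<^sub>R (0, 1) + sin (snd z) *\<^sub>R (0, \<i>)" for z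
    by (simp add: torus_def complex_eq_iff)
  have e1: "trigpoly (\<lambda>z. cis (fst z))" "trigpoly (\<lambda>z. cis (- fst z))" "trigpoly (\<lambda>z. cis (snd z))" "trigpoly (\<lambda>z. cis (- snd z))"
    using trigpoly.mono[of 1 0] trigpoly.mono[of "-1" 0] trigpoly.mono[of 0 1] trigpoly.mono[of 0 "-1"] by simp_all
  have cs: "cx (cos x) = (1/2) * cis x + (1/2) * cis (- x)" "cx (sin x) = (- \<i>/2) * cis x + (\<i>/2) * cis (- x)" for x
    by (simp_all add: complex_eq_iff)
  have "trigpoly (\<lambda>z. cx (f (1, 0)) * cx (cos (fst z)) + cx (f (\<i>, 0)) * cx (sin (fst z))
     + cx (f (0, 1)) * cx (cos (snd z)) + cx (f (0, \<i>)) * cx (sin (snd z)))"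
    unfolding cs by (intro trigpoly.add trigpoly.cmul e1)
  then show ?case unfolding e add scaleR by (simp add: mult.commute)
next
  case (const c)
  show ?case by (rule trigpoly_const)
next
  case (add f g)
  then show ?case by (simp add: trigpoly.add)
next
  case (mult f g)
  then show ?case by (simp add: trigpoly_mult)
qed

lemma trigpoly_approx_torus:
  fixes g :: "complex \<times> complex \<Rightarrow> real"
  assumes "continuous_on UNIV g" "e > 0"
  shows "\<exists>p. trigpoly p \<and> (\<forall>z. cmod (cx (g (torus z)) - p z) < e)"
proof -
  have "compact (sphere (0::complex) 1 \<times> sphere (0::complex) 1)" by (intro compact_Times compact_sphere)
  then obtain q where q: "real_polynomial_function q" "\<And>w. w \<in> sphere 0 1 \<times> sphere 0 1 \<Longrightarrow> \<bar>g w - q w\<bar> < e"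
    using Stone_Weierstrass_real_polynomial_function[OF _ continuous_on_subset[OF assms(1)] assms(2)] by (metis subset_UNIV)
  have "cmod (cx (g (torus z)) - cx (q (torus z))) < e" for z
    using q(2)[of "torus z"] by (simp add: torus_def flip: of_real_diff)
  then show ?thesis using trigpoly_real_polynomial[OF q(1)] by blast
qed

text \<open>Reflection does not preserve the half-open box, as \<open>pi\<close> is an admissible
  coordinate and \<open>- pi\<close> is not. It does preserve the open box, and the difference is
  Lebesgue null, which is enough for the density.\<close>

definition obox :: "(real \<times> real) set" where "obox = {-pi<..<pi} \<times> {-pi<..<pi}"

lemma obox_sub: "obox \<subseteq> spec_box" unfolding obox_def spec_box_def by auto

lemma open_obox: "open obox" unfolding obox_def by (intro open_Times) auto

lemma torus_inj: "z \<in> spec_box \<Longrightarrow> z' \<in> spec_box \<Longrightarrow> torus z = torus z' \<Longrightarrow> z = z'"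
proof -
  have "x = y" if "x \<in> {-pi<..pi}" "y \<in> {-pi<..pi}" "cis x = cis y" for x y
  proof -
    have a: "Arg (cis x) = x" by (rule Arg_cis[OF that(1)])
    have b: "Arg (cis y) = y" by (rule Arg_cis[OF that(2)])
    show ?thesis by (rule trans[OF a[unfolded that(3), symmetric] b])
  qed
  then show "z \<in> spec_box \<Longrightarrow> z' \<in> spec_box \<Longrightarrow> torus z = torus z' \<Longrightarrow> z = z'"
    unfolding spec_box_def torus_def by (cases z; cases z') auto
qed

definition tent :: "(real \<times> real) set \<Rightarrow> nat \<Rightarrow> complex \<times> complex \<Rightarrow> real" where
  "tent B n w = max 0 (1 - real n * setdist {w} (torus ` B))"

lemma tent_continuous: "continuous_on UNIV (tent B n)"
  unfolding tent_def[abs_def] by (intro continuous_intros continuous_on_setdist)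

lemma tent_bound: "0 \<le> tent B n w" "tent B n w \<le> 1"
  unfolding tent_def by (auto simp: setdist_pos_le)

lemma tent_limit:
  assumes B: "compact B" "B \<noteq> {}"
  shows "(\<lambda>n. tent B n w) \<longlonglongrightarrow> indicator (torus ` B) w"
proof -
  have cl: "closed (torus ` B)" using B by (intro compact_imp_closed compact_continuous_image continuous_intros) auto
  show ?thesis
  proof (cases "w \<in> torus ` B")
    case True
    then have "setdist {w} (torus ` B) = 0" by (simp add: setdist_sing_in_set)
    then show ?thesis using True by (simp add: tent_def)
  next
    case False
    then have "setdist {w} (torus ` B) > 0"
      using setdist_eq_0_closed[OF cl, of w] B setdist_pos_le[of "{w}" "torus ` B"] by (auto simp: less_le)
    moreover from this obtain n0 where n0: "1 < real n0 * setdist {w} (torus ` B)"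
      using reals_Archimedean3 by blast
    ultimately have "tent B n w = 0" if "n \<ge> n0" for n
    proof -
      have "real n0 * setdist {w} (torus ` B) \<le> real n * setdist {w} (torus ` B)"
        using that by (intro mult_right_mono setdist_pos_le) auto
      then show ?thesis using n0 by (simp add: tent_def)
    qed
    then have "eventually (\<lambda>n. tent B n w = 0) sequentially" unfolding eventually_sequentially by blast
    then show ?thesis using False by (simp add: tendsto_eventually)
  qed
qed

lemma torus_image_iff:
  assumes "B \<subseteq> spec_box" "z \<in> spec_box"
  shows "torus z \<in> torus ` B \<longleftrightarrow> z \<in> B"
  using torus_inj assms by blast

text \<open>The point \<open>- z\<close> may leave the half-open box, so injectivity is applied to
  \<open>z\<close> and \<open>- b\<close>, both of which lie in it.\<close>

lemma torus_image_uminus_iff: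
  assumes "B \<subseteq> obox" "z \<in> spec_box"
  shows "torus (- z) \<in> torus ` B \<longleftrightarrow> - z \<in> B"
proof
  assume "torus (- z) \<in> torus ` B"
  then obtain b where b: "b \<in> B" "torus (- z) = torus b" by auto
  then have "torus z = torus (- b)" unfolding torus_def by (auto simp: cis_cnj[symmetric]) (metis complex_cnj_cnj)+
  moreover have "- b \<in> spec_box" using assms(1) b(1) unfolding obox_def spec_box_def by (cases b) auto
  ultimately have "z = - b" using torus_inj assms(2) by blast
  then show "- z \<in> B" using b by simp
qed auto

lemma torus_measurable[measurable]: "torus \<in> borel_measurable borel"
  by (intro borel_measurable_continuous_onI continuous_intros)

lemma tent_measurable[measurable]: "tent B n \<in> borel_measurable borel"
  by (intro borel_measurable_continuous_onI tent_continuous)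

lemma uminus_measurable_pair[measurable]: "uminus \<in> (borel :: (real \<times> real) measure) \<rightarrow>\<^sub>M borel"
  by (intro borel_measurable_continuous_onI continuous_intros)

text \<open>Real Fourier coefficients mean that trigonometric polynomials have the same integral
  before and after reflection. Uniform approximation carries this to the tent functions, and
  dominated convergence to indicators of compact sets, as \<open>torus\<close> is injective on the
  box that carries \<open>\<nu>\<close>.\<close>

lemma spectral_symmetric_compact:
  assumes fin: "finite_measure \<nu>" and sn[measurable_cong]: "sets \<nu> = sets borel"
    and supp: "emeasure \<nu> (UNIV - spec_box) = 0"
    and re: "\<And>u v :: int. \<exists>r :: real. (\<integral>z. cis (real_of_int u * fst z + real_of_int v * snd z) \<partial>\<nu>) = cx r"
    and B: "compact B" "B \<subseteq> obox"
  shows "measure \<nu> B = measure \<nu> (uminus ` B)"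
proof (cases "B = {}")
  case False
  interpret finite_measure \<nu> by fact
  have ae: "AE z in \<nu>. z \<in> spec_box"
    using supp by (intro AE_I[where N="UNIV - spec_box"]) (auto simp: sn)
  have trig: "integrable \<nu> p \<and> integrable \<nu> (\<lambda>z. p (- z)) \<and> (\<integral>z. p z \<partial>\<nu>) = (\<integral>z. p (- z) \<partial>\<nu>)" if "trigpoly p" for p
    using that
  proof (induction rule: trigpoly.induct)
    case (mono k l)
    let ?c = "\<lambda>k l z. cis (real_of_int k * fst z + real_of_int l * snd z)"
    have i: "integrable \<nu> (?c k l)" for k l by (rule integrable_const_bound[where B=1]) auto
    have neg: "?c k l (- z) = cnj (?c k l z)" for z by (simp add: cis_cnj algebra_simps)
    have "(\<integral>z. ?c k l (- z) \<partial>\<nu>) = cnj (\<integral>z. ?c k l z \<partial>\<nu>)"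
      unfolding neg by (rule Bochner_Integration.integral_cnj)
    also have "\<dots> = (\<integral>z. ?c k l z \<partial>\<nu>)" using re[of k l] by auto
    finally have e: "(\<integral>z. ?c k l (- z) \<partial>\<nu>) = (\<integral>z. ?c k l z \<partial>\<nu>)" .
    have "integrable \<nu> (\<lambda>z. ?c k l (- z))" unfolding neg using i by simp
    then show ?case using i e by simp
  next
    case (add p q)
    then show ?case by simp
  next
    case (cmul p c)
    then show ?case by simp
  qed
  have cont: "(\<integral>z. tent B n (torus z) \<partial>\<nu>) = (\<integral>z. tent B n (torus (- z)) \<partial>\<nu>)" for n
  proof -
    let ?a = "(\<integral>z. tent B n (torus z) \<partial>\<nu>)" and ?b = "(\<integral>z. tent B n (torus (- z)) \<partial>\<nu>)"
    let ?M = "measure \<nu> (space \<nu>)"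
    have i: "integrable \<nu> (\<lambda>z. cx (tent B n (torus z)))" "integrable \<nu> (\<lambda>z. cx (tent B n (torus (- z))))"
      by (rule integrable_const_bound[where B=1]; simp add: tent_bound)+
    have "\<bar>?a - ?b\<bar> \<le> 0 + e" if e: "e > 0" for e
    proof -
      define d where "d = e / (2 * (?M + 1))"
      have M: "?M \<ge> 0" by simp
      have d: "d > 0" using e M by (simp add: d_def add_nonneg_pos)
      obtain p where p: "trigpoly p" "\<And>z. cmod (cx (tent B n (torus z)) - p z) < d"
        using trigpoly_approx_torus[OF tent_continuous d] by blast
      note t = trig[OF p(1)]
      have bd: "cmod ((\<integral>z. F z \<partial>\<nu>) - (\<integral>z. P z \<partial>\<nu>)) \<le> d * ?M"
        if "integrable \<nu> F" "integrable \<nu> P" "\<And>z. cmod (F z - P z) < d" for F P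
      proof -
        have "cmod ((\<integral>z. F z \<partial>\<nu>) - (\<integral>z. P z \<partial>\<nu>)) = cmod (\<integral>z. F z - P z \<partial>\<nu>)" using that by simp
        also have "\<dots> \<le> (\<integral>z. cmod (F z - P z) \<partial>\<nu>)" by (rule integral_norm_bound)
        also have "\<dots> \<le> (\<integral>z. d \<partial>\<nu>)" using that by (intro integral_mono) (auto intro: less_imp_le)
        finally show ?thesis by (simp add: mult.commute)
      qed
      have "cx (?a - ?b) = ((\<integral>z. cx (tent B n (torus z)) \<partial>\<nu>) - (\<integral>z. p z \<partial>\<nu>))
          - ((\<integral>z. cx (tent B n (torus (- z))) \<partial>\<nu>) - (\<integral>z. p (- z) \<partial>\<nu>))"
        using t by (simp add: integral_complex_of_real)
      then have "\<bar>?a - ?b\<bar> = cmod (((\<integral>z. cx (tent B n (torus z)) \<partial>\<nu>) - (\<integral>z. p z \<partial>\<nu>))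
          - ((\<integral>z. cx (tent B n (torus (- z))) \<partial>\<nu>) - (\<integral>z. p (- z) \<partial>\<nu>)))"
        by (metis norm_of_real)
      also have "\<dots> \<le> d * ?M + d * ?M"
        using t p(2) i by (intro order_trans[OF norm_triangle_ineq4] add_mono bd) auto
      also have "\<dots> \<le> d * (2 * (?M + 1))" using d by (simp add: algebra_simps)
      also have "\<dots> = e" using M by (simp add: d_def add_nonneg_eq_0_iff)
      finally show ?thesis by simp
    qed
    then have "\<bar>?a - ?b\<bar> \<le> 0" by (rule field_le_epsilon)
    then show ?thesis by simp
  qed
  have cB: "closed B" "closed (uminus ` B)" using B by (auto intro: compact_imp_closed compact_negations)
  have "(\<lambda>n. \<integral>z. tent B n (torus z) \<partial>\<nu>) \<longlonglongrightarrow> (\<integral>z. indicator B z \<partial>\<nu>)"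
  proof (rule integral_dominated_convergence[where w="\<lambda>_. 1"])
    show "AE z in \<nu>. (\<lambda>n. tent B n (torus z)) \<longlonglongrightarrow> indicator B z"
      using ae
    proof eventually_elim
      case (elim z)
      have "indicator (torus ` B) (torus z) = (indicator B z :: real)"
        using torus_image_iff[of B z] B(2) obox_sub elim by (auto simp: indicator_def)
      then show ?case using tent_limit[OF B(1) False, of "torus z"] by simp
    qed
  qed (use cB in \<open>auto simp: tent_bound sn intro!: borel_measurable_indicator\<close>)
  moreover have "(\<lambda>n. \<integral>z. tent B n (torus (- z)) \<partial>\<nu>) \<longlonglongrightarrow> (\<integral>z. indicator (uminus ` B) z \<partial>\<nu>)"
  proof (rule integral_dominated_convergence[where w="\<lambda>_. 1"])
    show "AE z in \<nu>. (\<lambda>n. tent B n (torus (- z))) \<longlonglongrightarrow> indicator (uminus ` B) z"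
      using ae
    proof eventually_elim
      case (elim z)
      have "z \<in> uminus ` B \<longleftrightarrow> - z \<in> B" by (metis image_iff minus_minus)
      then have "indicator (torus ` B) (torus (- z)) = (indicator (uminus ` B) z :: real)"
        using torus_image_uminus_iff[OF B(2) elim] by (auto simp: indicator_def)
      then show ?case using tent_limit[OF B(1) False, of "torus (- z)"] by simp
    qed
  qed (use cB in \<open>auto simp: tent_bound sn intro!: borel_measurable_indicator\<close>)
  ultimately have "(\<integral>z. indicat_real B z \<partial>\<nu>) = (\<integral>z. indicat_real (uminus ` B) z \<partial>\<nu>)"
    unfolding cont by (rule LIMSEQ_unique)
  moreover have "space \<nu> = UNIV" using sets_eq_imp_space_eq[OF sn] by simp
  ultimately show ?thesis by simp
qed simp

definition kbox :: "nat \<Rightarrow> (real \<times> real) set" where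
  "kbox n = {- pi + 1 / real (Suc n)..pi - 1 / real (Suc n)} \<times> {- pi + 1 / real (Suc n)..pi - 1 / real (Suc n)}"

lemma kbox_facts: "compact (kbox n)" "kbox n \<subseteq> obox" "incseq kbox" "(\<Union>n. kbox n) = obox"
proof -
  show "compact (kbox n)" unfolding kbox_def by (intro compact_Times compact_Icc)
  have sub: "kbox n \<subseteq> obox" for n
  proof -
    define d where "d = 1 / real (Suc n)"
    have "d > 0" by (simp add: d_def)
    then show ?thesis unfolding kbox_def obox_def d_def[symmetric] by auto
  qed
  show "kbox n \<subseteq> obox" by (rule sub)
  from sub have 1: "(\<Union>n. kbox n) \<subseteq> obox" by blast
  have "1 / real (Suc m) \<le> 1 / real (Suc n)" if "n \<le> m" for n m using that by (simp add: frac_le)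
  then show "incseq kbox" unfolding incseq_def kbox_def by (fastforce simp del: of_nat_Suc)
  show "(\<Union>n. kbox n) = obox"
  proof (rule equalityI[OF 1], rule subsetI)
    fix z assume z: "z \<in> obox"
    define d where "d = min (min (fst z + pi) (pi - fst z)) (min (snd z + pi) (pi - snd z))"
    have "d > 0" using z unfolding d_def obox_def by auto
    then obtain n where n: "1 / real (Suc n) < d" using reals_Archimedean[of d] by (auto simp: inverse_eq_divide)
    then have "z \<in> kbox n" unfolding kbox_def d_def by (cases z) (auto simp del: of_nat_Suc)
    then show "z \<in> (\<Union>n. kbox n)" by blast
  qed
qed

text \<open>Closed sets form an intersection-stable generator, and inside the open box each is
  exhausted by the compact pieces \<open>X \<inter> kbox n\<close>, for which the compact case
  applies.\<close>

lemma spectral_symmetric: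
  assumes fin: "finite_measure \<nu>" and sn[measurable_cong]: "sets \<nu> = sets borel"
    and supp: "emeasure \<nu> (UNIV - spec_box) = 0"
    and re: "\<And>u v :: int. \<exists>r :: real. (\<integral>z. cis (real_of_int u * fst z + real_of_int v * snd z) \<partial>\<nu>) = cx r"
    and B[measurable]: "B \<in> sets borel"
  shows "emeasure \<nu> (B \<inter> obox) = emeasure \<nu> (uminus -` (B \<inter> obox))"
proof -
  interpret finite_measure \<nu> by fact
  have sp: "space \<nu> = UNIV" using sets_eq_imp_space_eq[OF sn] by simp
  have om[measurable]: "obox \<in> sets borel" using open_obox by simp
  define m1 where "m1 = density \<nu> (indicator obox)"
  define m2 where "m2 = distr (density \<nu> (indicator (uminus -` obox))) borel uminus"
  have uo[measurable]: "uminus -` obox \<in> sets borel"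
    using measurable_sets[OF uminus_measurable_pair om] by simp
  have e1: "emeasure m1 A = emeasure \<nu> (A \<inter> obox)" if "A \<in> sets borel" for A
    unfolding m1_def using that by (subst emeasure_density) (auto simp: sn Int_commute indicator_inter_arith[symmetric] mult.commute)
  have e2: "emeasure m2 A = emeasure \<nu> (uminus -` (A \<inter> obox))" if "A \<in> sets borel" for A
  proof -
    have "uminus -` A \<in> sets borel" using measurable_sets[OF uminus_measurable_pair that] by simp
    then show ?thesis
      unfolding m2_def using that
      by (subst emeasure_distr, simp, simp, subst emeasure_density)
         (auto simp: sn sp Int_commute indicator_inter_arith[symmetric] mult.commute vimage_Int intro!: arg_cong2[where f=emeasure])
  qed
  have "m1 = m2"
  proof (rule measure_eqI_generator_eq[where E="Collect closed" and \<Omega>=UNIV and A="\<lambda>_. UNIV"])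
    show "Int_stable (Collect (closed :: (real \<times> real) set \<Rightarrow> bool))" by (auto simp: Int_stable_def)
    show "sets m1 = sigma_sets UNIV (Collect closed)" "sets m2 = sigma_sets UNIV (Collect closed)"
      unfolding m1_def m2_def by (auto simp: sn borel_eq_closed)
    show "emeasure m1 UNIV \<noteq> \<infinity>" by (subst e1) auto
    fix X :: "(real \<times> real) set" assume "X \<in> Collect closed"
    then have X: "closed X" by simp
    have cp: "compact (X \<inter> kbox n)" for n using X kbox_facts(1) by (intro closed_Int_compact)
    have inc: "incseq (\<lambda>n. X \<inter> kbox n)" using kbox_facts(3) unfolding incseq_def by blast
    have inc2: "incseq (\<lambda>n. uminus ` (X \<inter> kbox n))" using inc unfolding incseq_def by blast
    have "(\<lambda>n. emeasure \<nu> (X \<inter> kbox n)) \<longlonglongrightarrow> emeasure \<nu> (\<Union>n. X \<inter> kbox n)"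
      using cp inc by (intro Lim_emeasure_incseq) (auto simp: sn compact_imp_closed)
    moreover have "(\<Union>n. X \<inter> kbox n) = X \<inter> obox" using kbox_facts(4) by blast
    moreover have "(\<lambda>n. emeasure \<nu> (uminus ` (X \<inter> kbox n))) \<longlonglongrightarrow> emeasure \<nu> (\<Union>n. uminus ` (X \<inter> kbox n))"
      using cp inc2 by (intro Lim_emeasure_incseq) (auto simp: sn compact_imp_closed compact_negations)
    moreover have "(\<Union>n. uminus ` (X \<inter> kbox n)) = uminus -` (X \<inter> obox)"
    proof -
      have "(\<Union>n. uminus ` (X \<inter> kbox n)) = uminus ` (\<Union>n. X \<inter> kbox n)" by blast
      also have "(\<Union>n. X \<inter> kbox n) = X \<inter> obox" using kbox_facts(4) by blast
      also have "uminus ` (X \<inter> obox) = uminus -` (X \<inter> obox)"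
      proof (rule Set.set_eqI)
        fix z show "z \<in> uminus ` (X \<inter> obox) \<longleftrightarrow> z \<in> uminus -` (X \<inter> obox)"
          unfolding vimage_def mem_Collect_eq by (metis image_iff minus_minus)
      qed
      finally show ?thesis .
    qed
    moreover have "emeasure \<nu> (X \<inter> kbox n) = emeasure \<nu> (uminus ` (X \<inter> kbox n))" for n
      using spectral_symmetric_compact[OF fin sn supp re cp[of n]] kbox_facts(2)[of n]
      by (simp add: emeasure_eq_measure le_infI2)
    ultimately have "emeasure \<nu> (X \<inter> obox) = emeasure \<nu> (uminus -` (X \<inter> obox))"
      using LIMSEQ_unique by fastforce
    then show "emeasure m1 X = emeasure m2 X" using X by (subst e1, simp, subst e2, simp) simp
  qed auto
  then show ?thesis using e1[OF B] e2[OF B] by simp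
qed

lemma lborel_uminus_pair: "distr lborel borel uminus = (lborel :: (real \<times> real) measure)"
proof -
  show ?thesis using lborel_affine[of "-1" "0 :: real \<times> real"] by (simp add: density_1)
qed

text \<open>The measure is invariant under reflection of the open box because its Fourier
  coefficients are real, and the density inherits this away from the atoms. The symmetry is wanted
  because the products of coefficients in the orthogonality relations carry no conjugates, whereas
  those in Parseval's identity do.\<close>

lemma density_symmetric:
  assumes fin: "finite_measure \<nu>" and sn: "sets \<nu> = sets borel"
    and supp: "emeasure \<nu> (UNIV - spec_box) = 0"
    and re: "\<And>u v :: int. \<exists>r :: real. (\<integral>z. cis (real_of_int u * fst z + real_of_int v * snd z) \<partial>\<nu>) = cx r"
    and f: "\<And>z. 0 \<le> f z" "f \<in> borel_measurable borel"
    and D: "countable D" "sets \<nu>d = sets borel" "emeasure \<nu>d (UNIV - D) = 0"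
    and dec: "\<And>A. A \<in> sets borel \<Longrightarrow> emeasure \<nu> A = (\<integral>\<^sup>+z. ennreal (f z) * indicator (A \<inter> spec_box) z \<partial>lborel) + emeasure \<nu>d A"
  shows "AE z in lborel. z \<in> obox \<longrightarrow> f (- z) = f z"
proof -
  note [measurable] = f(2)
  have om[measurable]: "obox \<in> sets borel" using open_obox by simp
  define D' where "D' = D \<union> uminus ` D"
  have D'c: "countable D'" using D(1) by (simp add: D'_def)
  have D'm[measurable]: "D' \<in> sets borel" by (rule sets.countable[OF _ D'c]) simp
  have Dm: "D \<in> sets borel" by (rule sets.countable[OF _ D(1)]) simp
  have D'0: "AE z in lborel. z \<notin> D'"
    using D'c by (intro AE_not_in countable_imp_null_set_lborel)
  have mu: "uminus \<in> (lborel :: (real\<times>real) measure) \<rightarrow>\<^sub>M borel" using uminus_measurable_pair by simp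
  have main: "(\<integral>\<^sup>+z. ennreal (f z) * indicator (A \<inter> obox) z \<partial>lborel) = (\<integral>\<^sup>+z. ennreal (f (- z)) * indicator (A \<inter> obox) z \<partial>lborel)"
    if A[measurable]: "A \<in> sets borel" for A
  proof -
    \<comment> \<open>Removing \<open>D\<close> together with its reflection discards a Lebesgue
      null set and leaves a set on which, both before and after reflection, \<open>\<nu>\<close> is
      given by the density alone.\<close>
    define A' where "A' = A - D'"
    have A'm[measurable]: "A' \<in> sets borel" by (simp add: A'_def)
    have nd: "emeasure \<nu> X = (\<integral>\<^sup>+z. ennreal (f z) * indicator X z \<partial>lborel)" if "X \<in> sets borel" "X \<subseteq> spec_box" "X \<inter> D = {}" for X
    proof -
      have "emeasure \<nu>d X \<le> emeasure \<nu>d (UNIV - D)"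
        using that Dm by (intro emeasure_mono) (auto simp: D(2))
      then have "emeasure \<nu>d X = 0" using D(3) by simp
      moreover have "X \<inter> spec_box = X" using that by blast
      ultimately show ?thesis using dec[OF that(1)] by simp
    qed
    have um[measurable]: "uminus -` (A' \<inter> obox) \<in> sets borel"
      using measurable_sets[OF uminus_measurable_pair, of "A' \<inter> obox"] by simp
    have 1: "emeasure \<nu> (A' \<inter> obox) = (\<integral>\<^sup>+z. ennreal (f z) * indicator (A' \<inter> obox) z \<partial>lborel)"
    proof (rule nd)
      show "A' \<inter> obox \<in> sets borel" by measurable
      show "A' \<inter> obox \<subseteq> spec_box" using obox_sub by blast
      show "A' \<inter> obox \<inter> D = {}" unfolding A'_def D'_def by blast
    qed
    have 2: "emeasure \<nu> (uminus -` (A' \<inter> obox)) = (\<integral>\<^sup>+z. ennreal (f z) * indicator (uminus -` (A' \<inter> obox)) z \<partial>lborel)"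
    proof (rule nd[OF um])
      show "uminus -` (A' \<inter> obox) \<subseteq> spec_box" unfolding obox_def spec_box_def by auto
      show "uminus -` (A' \<inter> obox) \<inter> D = {}"
      proof (rule equals0I)
        fix z assume "z \<in> uminus -` (A' \<inter> obox) \<inter> D"
        then have "- z \<notin> D'" "z \<in> D" unfolding A'_def by blast+
        then show False using imageI[of z D uminus] unfolding D'_def by blast
      qed
    qed
    also have "\<dots> = (\<integral>\<^sup>+z. ennreal (f z) * indicator (uminus -` (A' \<inter> obox)) z \<partial>distr lborel borel uminus)"
      by (simp only: lborel_uminus_pair)
    also have "\<dots> = (\<integral>\<^sup>+z. ennreal (f (- z)) * indicator (uminus -` (A' \<inter> obox)) (- z) \<partial>lborel)"
      by (subst nn_integral_distr[OF mu]) auto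
    also have "\<dots> = (\<integral>\<^sup>+z. ennreal (f (- z)) * indicator (A' \<inter> obox) z \<partial>lborel)"
      by (simp add: indicator_def)
    finally have 3: "(\<integral>\<^sup>+z. ennreal (f z) * indicator (A' \<inter> obox) z \<partial>lborel) = (\<integral>\<^sup>+z. ennreal (f (- z)) * indicator (A' \<inter> obox) z \<partial>lborel)"
      using spectral_symmetric[OF fin sn supp re A'm] 1 by simp
    have 4: "(\<integral>\<^sup>+z. F z * indicator (A \<inter> obox) z \<partial>lborel) = (\<integral>\<^sup>+z. F z * indicator (A' \<inter> obox) z \<partial>lborel)" for F :: "_ \<Rightarrow> ennreal"
      by (rule nn_integral_cong_AE, use D'0 in eventually_elim) (auto simp: A'_def indicator_def)
    show ?thesis unfolding 4 by (rule 3)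
  qed
  have fum[measurable]: "(\<lambda>z. f (- z)) \<in> borel_measurable borel"
    using measurable_compose[OF uminus_measurable_pair f(2)] .
  have "density lborel (\<lambda>z. ennreal (f z) * indicator obox z) = density lborel (\<lambda>z. ennreal (f (- z)) * indicator obox z)"
  proof (rule measure_eqI)
    fix A assume "A \<in> sets (density lborel (\<lambda>z. ennreal (f z) * indicator obox z))"
    then have A: "A \<in> sets borel" by simp
    show "emeasure (density lborel (\<lambda>z. ennreal (f z) * indicator obox z)) A = emeasure (density lborel (\<lambda>z. ennreal (f (- z)) * indicator obox z)) A"
      using main[OF A] A by (simp add: emeasure_density indicator_inter_arith mult_ac)
  qed simp
  then have "AE z in lborel. ennreal (f z) * indicator obox z = ennreal (f (- z)) * indicator obox z"
    by (subst (asm) sigma_finite_measure.density_unique_iff[OF lborel.sigma_finite_measure_axioms]) auto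
  then show ?thesis
    by eventually_elim (auto simp: indicator_def f(1))
qed

section \<open>Trigonometric approximation and the orthogonality hypothesis\<close>

lemma integrable_boxm_bounded:
  fixes g :: "real \<times> real \<Rightarrow> 'b::{banach, second_countable_topology}"
  assumes "g \<in> borel_measurable borel" "\<And>z. norm (g z) \<le> B"
  shows "integrable boxm g"
proof -
  interpret finite_measure boxm by (rule finite_measure_boxm)
  show ?thesis by (rule integrable_const_bound[where B=B]) (use assms in \<open>auto simp: measurable_cong_sets[OF sets_boxm refl]\<close>)
qed

lemma AE_boxm: "(AE z in boxm. P z) \<longleftrightarrow> (AE z in lborel. z \<in> spec_box \<longrightarrow> P z)"
  unfolding boxm_def by (subst AE_density) (auto simp: indicator_def)

lemma AE_boxm_obox: "AE z in boxm. z \<in> obox"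
proof -
  have 0: "emeasure (lborel :: (real \<times> real) measure) ({pi} \<times> UNIV) = 0" "emeasure (lborel :: (real \<times> real) measure) (UNIV \<times> {pi}) = 0"
    unfolding lborel_prod[symmetric] by (subst lborel.emeasure_pair_measure_Times; simp)+
  have "AE z in lborel. z \<notin> {pi} \<times> (UNIV :: real set)" "AE z in lborel. z \<notin> (UNIV :: real set) \<times> {pi}"
    by (rule AE_not_in; rule null_setsI[OF 0(1)]; simp add: borel_prod[symmetric]; measurable)
       (rule AE_not_in; rule null_setsI[OF 0(2)]; simp add: borel_prod[symmetric]; measurable)
  then have "AE z in lborel. z \<in> spec_box \<longrightarrow> z \<in> obox"
    by eventually_elim (auto simp: spec_box_def obox_def)
  then show ?thesis by (simp add: AE_boxm)
qed

lemma boxm_obox: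
  fixes g :: "real \<times> real \<Rightarrow> 'b::{banach, second_countable_topology}"
  assumes [measurable]: "g \<in> borel_measurable borel"
  shows "(\<integral>z. g z \<partial>boxm) = (\<integral>z. indicator obox z *\<^sub>R g z \<partial>lborel)"
proof -
  have om[measurable]: "obox \<in> sets borel" using open_obox by simp
  have "AE z in lborel. z \<in> spec_box \<longrightarrow> z \<in> obox" using AE_boxm_obox by (simp add: AE_boxm)
  then have "AE z in lborel. indicator spec_box z *\<^sub>R g z = indicator obox z *\<^sub>R g z"
    by eventually_elim (use obox_sub in \<open>auto simp: indicator_def\<close>)
  then show ?thesis by (subst integral_boxm(1)) (auto intro!: integral_cong_AE)
qed

lemma boxm_uminus:
  fixes g :: "real \<times> real \<Rightarrow> 'b::{banach, second_countable_topology}"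
  assumes [measurable]: "g \<in> borel_measurable borel"
  shows "(\<integral>z. g z \<partial>boxm) = (\<integral>z. g (- z) \<partial>boxm)"
proof -
  have om[measurable]: "obox \<in> sets borel" using open_obox by simp
  have mu: "uminus \<in> (lborel :: (real\<times>real) measure) \<rightarrow>\<^sub>M borel" using uminus_measurable_pair by simp
  have gm: "(\<lambda>z. g (- z)) \<in> borel_measurable borel" using measurable_compose[OF uminus_measurable_pair assms] .
  have "(\<integral>z. g z \<partial>boxm) = (\<integral>z. indicator obox z *\<^sub>R g z \<partial>distr lborel borel uminus)"
    by (simp only: boxm_obox[OF assms] lborel_uminus_pair)
  also have "\<dots> = (\<integral>z. indicator obox (- z) *\<^sub>R g (- z) \<partial>lborel)"
    by (subst integral_distr[OF mu]) auto
  also have "\<dots> = (\<integral>z. indicator obox z *\<^sub>R g (- z) \<partial>lborel)"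
  proof -
    have "indicator obox (- z) = (indicator obox z :: real)" for z by (cases z) (auto simp: indicator_def obox_def)
    then show ?thesis by simp
  qed
  also have "\<dots> = (\<integral>z. g (- z) \<partial>boxm)" by (rule boxm_obox[OF gm, symmetric])
  finally show ?thesis .
qed

lemma swap_measurable[measurable]: "(\<lambda>z. (snd z, fst z)) \<in> (borel :: (real \<times> real) measure) \<rightarrow>\<^sub>M borel"
  by (intro borel_measurable_continuous_onI continuous_intros)

lemma lborel_swap: "distr lborel borel (\<lambda>z. (snd z, fst z)) = (lborel :: (real \<times> real) measure)"
proof -
  have "(lborel :: (real \<times> real) measure) = distr (lborel \<Otimes>\<^sub>M lborel) (lborel \<Otimes>\<^sub>M lborel) (\<lambda>(x, y). (y, x))"
    using lborel_pair.distr_pair_swap by (simp add: lborel_prod)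
  also have "\<dots> = distr lborel borel (\<lambda>z. (snd z, fst z))"
    unfolding lborel_prod by (rule distr_cong) (auto simp: split_beta)
  finally show ?thesis by simp
qed

lemma boxm_swap:
  fixes g :: "real \<times> real \<Rightarrow> 'b::{banach, second_countable_topology}"
  assumes [measurable]: "g \<in> borel_measurable borel"
  shows "(\<integral>z. g z \<partial>boxm) = (\<integral>z. g (snd z, fst z) \<partial>boxm)"
    and "integrable boxm g \<Longrightarrow> integrable boxm (\<lambda>z. g (snd z, fst z))"
proof -
  have ms: "(\<lambda>z. (snd z, fst z)) \<in> (lborel :: (real\<times>real) measure) \<rightarrow>\<^sub>M borel" using swap_measurable by simp
  have gm: "(\<lambda>z. g (snd z, fst z)) \<in> borel_measurable borel" using measurable_compose[OF swap_measurable assms] .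
  have isw: "indicator spec_box (snd z, fst z) = (indicator spec_box z :: real)" for z
    by (cases z) (auto simp: indicator_def spec_box_def)
  have "(\<integral>z. g z \<partial>boxm) = (\<integral>z. indicator spec_box z *\<^sub>R g z \<partial>distr lborel borel (\<lambda>z. (snd z, fst z)))"
    by (simp only: integral_boxm(1)[OF assms] lborel_swap)
  also have "\<dots> = (\<integral>z. indicator spec_box z *\<^sub>R g (snd z, fst z) \<partial>lborel)"
    by (subst integral_distr[OF ms]) (auto simp: isw)
  also have "\<dots> = (\<integral>z. g (snd z, fst z) \<partial>boxm)" by (rule integral_boxm(1)[OF gm, symmetric])
  finally show "(\<integral>z. g z \<partial>boxm) = (\<integral>z. g (snd z, fst z) \<partial>boxm)" .
  assume "integrable boxm g"
  then have "integrable (distr lborel borel (\<lambda>z. (snd z, fst z))) (\<lambda>z. indicator spec_box z *\<^sub>R g z)"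
    by (simp only: integral_boxm(2)[OF assms] lborel_swap)
  then have "integrable lborel (\<lambda>z. indicator spec_box z *\<^sub>R g (snd z, fst z))"
    by (subst (asm) integrable_distr_eq[OF ms]) (auto simp: isw)
  then show "integrable boxm (\<lambda>z. g (snd z, fst z))" by (simp only: integral_boxm(2)[OF gm])
qed

section \<open>Density of trigonometric polynomials in mean square\<close>

definition L2_approx :: "(real \<times> real \<Rightarrow> real) \<Rightarrow> bool" where
  "L2_approx u \<longleftrightarrow> (\<forall>e>0. \<exists>p. trigpoly p \<and> (\<integral>z. (cmod (cx (u z) - p z))^2 \<partial>boxm) < e)"

lemma cmod_add_sq: "(cmod (a + b))^2 \<le> 2 * (cmod a)^2 + 2 * (cmod b)^2"
proof -
  have "(cmod (a + b))^2 \<le> (cmod a + cmod b)^2" by (intro power_mono norm_triangle_ineq) simp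
  also have "\<dots> \<le> 2 * (cmod a)^2 + 2 * (cmod b)^2"
    using sum_squares_bound[of "cmod a" "cmod b"] by (simp add: power2_sum)
  finally show ?thesis .
qed

lemma integrable_trig_dist:
  assumes u: "u \<in> borel_measurable borel" "integrable boxm (\<lambda>z. (u z)^2)" and p: "trigpoly p"
  shows "integrable boxm (\<lambda>z. (cmod (cx (u z) - p z))^2)"
proof -
  note [measurable] = u(1) trigpoly_measurable[OF p]
  obtain B where B: "\<And>z. cmod (p z) \<le> B" using trigpoly_bounded[OF p] by blast
  have "integrable boxm (\<lambda>z. B^2)" by (rule integrable_boxm_bounded[where B="B^2"]) auto
  then have i: "integrable boxm (\<lambda>z. 2 * (u z)^2 + 2 * B^2)" using u(2) by auto
  show ?thesis
  proof (rule Bochner_Integration.integrable_bound[OF i])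
    have "(cmod (cx (u z) - p z))^2 \<le> 2 * (u z)^2 + 2 * B^2" for z
      using cmod_add_sq[of "cx (u z)" "- p z"] power_mono[OF B[of z], of 2] by simp
    then show "AE z in boxm. norm ((cmod (cx (u z) - p z))^2) \<le> norm (2 * (u z)^2 + 2 * B^2)" by simp
  qed measurable
qed

lemma L2_approx_close:
  assumes u: "u \<in> borel_measurable borel" "integrable boxm (\<lambda>z. (u z)^2)"
    and v: "\<And>e. e > 0 \<Longrightarrow> \<exists>v. v \<in> borel_measurable borel \<and> integrable boxm (\<lambda>z. (v z)^2) \<and> L2_approx v \<and> (\<integral>z. (u z - v z)^2 \<partial>boxm) < e"
  shows "L2_approx u"
  unfolding L2_approx_def
proof (intro allI impI)
  fix e :: real assume e: "e > 0"
  then obtain w where w: "w \<in> borel_measurable borel" "integrable boxm (\<lambda>z. (w z)^2)" "L2_approx w" "(\<integral>z. (u z - w z)^2 \<partial>boxm) < e / 4"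
    using v[of "e / 4"] by auto
  then obtain p where p: "trigpoly p" "(\<integral>z. (cmod (cx (w z) - p z))^2 \<partial>boxm) < e / 4"
    using e unfolding L2_approx_def by (metis divide_pos_pos zero_less_numeral)
  note [measurable] = u(1) w(1)
  have i1: "integrable boxm (\<lambda>z. (u z - w z)^2)"
  proof (rule Bochner_Integration.integrable_bound)
    show "integrable boxm (\<lambda>z. 2 * (u z)^2 + 2 * (w z)^2)" using u w by auto
    have "(u z - w z)^2 \<le> 2 * (u z)^2 + 2 * (w z)^2" for z
      using sum_squares_bound[of "u z" "- w z"] by (simp add: power2_diff)
    then show "AE z in boxm. norm ((u z - w z)^2) \<le> norm (2 * (u z)^2 + 2 * (w z)^2)" by simp
  qed measurable
  note i2 = integrable_trig_dist[OF w(1,2) p(1)]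
  have "(\<integral>z. (cmod (cx (u z) - p z))^2 \<partial>boxm) \<le> (\<integral>z. 2 * (u z - w z)^2 + 2 * (cmod (cx (w z) - p z))^2 \<partial>boxm)"
  proof (rule integral_mono[OF integrable_trig_dist[OF u p(1)]])
    show "integrable boxm (\<lambda>z. 2 * (u z - w z)^2 + 2 * (cmod (cx (w z) - p z))^2)" using i1 i2 by auto
    fix z
    show "(cmod (cx (u z) - p z))^2 \<le> 2 * (u z - w z)^2 + 2 * (cmod (cx (w z) - p z))^2"
      using cmod_add_sq[of "cx (u z - w z)" "cx (w z) - p z"] by (simp flip: of_real_diff) (simp add: norm_of_real)
  qed
  also have "\<dots> = 2 * (\<integral>z. (u z - w z)^2 \<partial>boxm) + 2 * (\<integral>z. (cmod (cx (w z) - p z))^2 \<partial>boxm)"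
    using i1 i2 by simp
  also have "\<dots> < e" using w(4) p(2) by simp
  finally show "\<exists>p. trigpoly p \<and> (\<integral>z. (cmod (cx (u z) - p z))^2 \<partial>boxm) < e" using p(1) by blast
qed

lemma L2_approx_limit:
  assumes U: "\<And>i. U i \<in> borel_measurable borel" "\<And>i :: nat. L2_approx (U i)"
    and u[measurable]: "u \<in> borel_measurable borel"
    and v[measurable]: "v \<in> borel_measurable borel" and iv: "integrable boxm (\<lambda>z. (v z)^2)"
    and b: "\<And>i z. \<bar>U i z\<bar> \<le> v z" "\<And>z. \<bar>u z\<bar> \<le> v z"
    and lim: "AE z in boxm. (\<lambda>i. U i z) \<longlonglongrightarrow> u z"
  shows "L2_approx u"
proof (rule L2_approx_close)
  note [measurable] = U(1)
  have sq: "integrable boxm (\<lambda>z. (w z)^2)" if [measurable]: "w \<in> borel_measurable borel" and "\<And>z. \<bar>w z\<bar> \<le> v z" for w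
    by (rule Bochner_Integration.integrable_bound[OF iv])
       (use power_mono[OF that(2) abs_ge_zero, of _ 2] in \<open>auto simp: that(1) measurable_cong_sets[OF sets_boxm refl]\<close>)
  show "integrable boxm (\<lambda>z. (u z)^2)" by (rule sq[OF u b(2)])
  have "(\<lambda>i. \<integral>z. (u z - U i z)^2 \<partial>boxm) \<longlonglongrightarrow> (\<integral>z. 0 \<partial>boxm)"
  proof (rule integral_dominated_convergence[where w="\<lambda>z. 4 * (v z)^2"])
    show "AE z in boxm. (\<lambda>i. (u z - U i z)^2) \<longlonglongrightarrow> 0"
      using lim
    proof eventually_elim
      case (elim z)
      have "(\<lambda>i. (u z - U i z)^2) \<longlonglongrightarrow> (u z - u z)^2" by (intro tendsto_intros elim)
      then show ?case by simp
    qed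
    have "(u z - U i z)^2 \<le> 4 * (v z)^2" for i z
    proof -
      have "\<bar>u z - U i z\<bar> \<le> 2 * v z" using b(1)[of i z] b(2)[of z] by simp
      from power_mono[OF this abs_ge_zero, of 2] show ?thesis by (simp add: power_mult_distrib)
    qed
    then show "AE z in boxm. norm ((u z - U i z)^2) \<le> 4 * (v z)^2" for i by simp
  qed (use iv in auto)
  then have l: "(\<lambda>i. \<integral>z. (u z - U i z)^2 \<partial>boxm) \<longlonglongrightarrow> 0" by simp
  fix e :: real assume "e > 0"
  then have "eventually (\<lambda>i. (\<integral>z. (u z - U i z)^2 \<partial>boxm) < e) sequentially" by (rule order_tendstoD(2)[OF l])
  then obtain i where "(\<integral>z. (u z - U i z)^2 \<partial>boxm) < e" by (meson eventually_sequentially order_refl)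
  then show "\<exists>w. w \<in> borel_measurable borel \<and> integrable boxm (\<lambda>z. (w z)^2) \<and> L2_approx w \<and> (\<integral>z. (u z - w z)^2 \<partial>boxm) < e"
    using U sq[OF U(1) b(1)] by blast
qed (rule u)

lemma L2_approx_limit_bounded:
  assumes "\<And>i. U i \<in> borel_measurable borel" "\<And>i :: nat. L2_approx (U i)" "u \<in> borel_measurable borel"
    and "\<And>i z. \<bar>U i z\<bar> \<le> 1" "\<And>z. \<bar>u z\<bar> \<le> 1"
    and "AE z in boxm. (\<lambda>i. U i z) \<longlonglongrightarrow> u z"
  shows "L2_approx u"
proof (rule L2_approx_limit[where U=U and v="\<lambda>_. 1"])
  show "integrable boxm (\<lambda>z. (1::real)^2)" by (rule integrable_boxm_bounded[where B=1]) auto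
qed (use assms in auto)

lemma L2_approx_add:
  assumes u: "u \<in> borel_measurable borel" "integrable boxm (\<lambda>z. (u z)^2)" "L2_approx u"
    and v: "v \<in> borel_measurable borel" "integrable boxm (\<lambda>z. (v z)^2)" "L2_approx v"
  shows "L2_approx (\<lambda>z. u z + v z)"
  unfolding L2_approx_def
proof (intro allI impI)
  fix e :: real assume e: "e > 0"
  obtain p where p: "trigpoly p" "(\<integral>z. (cmod (cx (u z) - p z))^2 \<partial>boxm) < e / 4"
    using e u(3) unfolding L2_approx_def by (metis divide_pos_pos zero_less_numeral)
  obtain q where q: "trigpoly q" "(\<integral>z. (cmod (cx (v z) - q z))^2 \<partial>boxm) < e / 4"
    using e v(3) unfolding L2_approx_def by (metis divide_pos_pos zero_less_numeral)
  note [measurable] = u(1) v(1) trigpoly_measurable[OF p(1)] trigpoly_measurable[OF q(1)]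
  note i = integrable_trig_dist[OF u(1,2) p(1)] integrable_trig_dist[OF v(1,2) q(1)]
  have le: "(cmod (cx (u z + v z) - (p z + q z)))^2 \<le> 2 * (cmod (cx (u z) - p z))^2 + 2 * (cmod (cx (v z) - q z))^2" for z
    using cmod_add_sq[of "cx (u z) - p z" "cx (v z) - q z"] by (simp add: algebra_simps)
  have i2: "integrable boxm (\<lambda>z. 2 * (cmod (cx (u z) - p z))^2 + 2 * (cmod (cx (v z) - q z))^2)" using i by auto
  have "(\<integral>z. (cmod (cx (u z + v z) - (p z + q z)))^2 \<partial>boxm)
     \<le> (\<integral>z. 2 * (cmod (cx (u z) - p z))^2 + 2 * (cmod (cx (v z) - q z))^2 \<partial>boxm)"
    by (intro integral_mono_AE' i2 AE_I2 le) simp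
  also have "\<dots> < e" using i p(2) q(2) by simp
  finally show "\<exists>p. trigpoly p \<and> (\<integral>z. (cmod (cx (u z + v z) - p z))^2 \<partial>boxm) < e"
    using trigpoly.add[OF p(1) q(1)] by blast
qed

lemma L2_approx_cmul:
  assumes "L2_approx u" shows "L2_approx (\<lambda>z. c * u z)"
proof (cases "c = 0")
  case True
  then show ?thesis unfolding L2_approx_def
    by (auto intro!: exI[of _ "\<lambda>_. 0"] trigpoly_const)
next
  case False
  show ?thesis unfolding L2_approx_def
  proof (intro allI impI)
    fix e :: real assume e: "e > 0"
    then have "e / c^2 > 0" using False by simp
    then obtain p where p: "trigpoly p" "(\<integral>z. (cmod (cx (u z) - p z))^2 \<partial>boxm) < e / c^2"
      using assms unfolding L2_approx_def by blast
    have "(cmod (cx (c * u z) - cx c * p z))^2 = c^2 * (cmod (cx (u z) - p z))^2" for z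
    proof -
      have "cx (c * u z) - cx c * p z = cx c * (cx (u z) - p z)"
        by (simp add: right_diff_distrib)
      then show ?thesis by (simp add: norm_mult power_mult_distrib)
    qed
    then have "(\<integral>z. (cmod (cx (c * u z) - cx c * p z))^2 \<partial>boxm) < e"
      using p(2) False by (simp add: pos_less_divide_eq mult.commute)
    then show "\<exists>p. trigpoly p \<and> (\<integral>z. (cmod (cx (c * u z) - p z))^2 \<partial>boxm) < e"
      using trigpoly.cmul[OF p(1), of "cx c"] by blast
  qed
qed

text \<open>Indicators of compact sets in the open box are limits of tent functions, those of closed
  sets are limits over compact pieces up to the null boundary of the box, and the remaining Borel
  sets follow by Dynkin induction over complements and disjoint unions.\<close>

lemma L2_approx_indicator:
  assumes A: "A \<in> sets (borel :: (real \<times> real) measure)"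
  shows "L2_approx (indicator A)"
proof -
  have one: "integrable boxm (\<lambda>z. (1::real)^2)" by (rule integrable_boxm_bounded[where B=1]) auto
  have cpt: "L2_approx (indicator B)" if B: "compact B" "B \<subseteq> obox" for B
  proof (cases "B = {}")
    case True
    then show ?thesis unfolding L2_approx_def by (auto intro!: exI[of _ "\<lambda>_. 0"] trigpoly_const)
  next
    case False
    have Bm: "B \<in> sets borel" using B by (simp add: compact_imp_closed)
    show ?thesis
    proof (rule L2_approx_limit_bounded[where U="\<lambda>n z. tent B n (torus z)"])
      show "L2_approx (\<lambda>z. tent B n (torus z))" for n
        unfolding L2_approx_def
      proof (intro allI impI)
        fix e :: real assume e: "e > 0"
        define d where "d = sqrt (e / (8 * pi^2))"
        have d: "d > 0" using e by (simp add: d_def)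
        obtain p where p: "trigpoly p" "\<And>z. cmod (cx (tent B n (torus z)) - p z) < d"
          using trigpoly_approx_torus[OF tent_continuous d] by blast
        note [measurable] = trigpoly_measurable[OF p(1)]
        have M: "measure boxm (space boxm) = 4 * pi^2" by (simp add: measure_def measure_boxm)
        have "(\<integral>z. (cmod (cx (tent B n (torus z)) - p z))^2 \<partial>boxm) \<le> (\<integral>z. d^2 \<partial>boxm)"
          by (intro integral_mono integrable_boxm_bounded[where B="d^2"])
             (auto intro: power_mono[OF less_imp_le[OF p(2)]])
        also have "\<dots> = 4 * pi^2 * d^2" by (simp add: M)
        also have "\<dots> < e" using e by (simp add: d_def field_simps)
        finally show "\<exists>p. trigpoly p \<and> (\<integral>z. (cmod (cx (tent B n (torus z)) - p z))^2 \<partial>boxm) < e"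
          using p(1) by blast
      qed
      show "AE z in boxm. (\<lambda>n. tent B n (torus z)) \<longlonglongrightarrow> indicator B z"
        unfolding AE_boxm
      proof (intro AE_I2 impI)
        fix z assume z: "z \<in> spec_box"
        have "indicator (torus ` B) (torus z) = (indicator B z :: real)"
          using torus_image_iff[of B z] B(2) obox_sub z by (auto simp: indicator_def)
        then show "(\<lambda>n. tent B n (torus z)) \<longlonglongrightarrow> indicator B z" using tent_limit[OF B(1) False, of "torus z"] by simp
      qed
      show "(\<lambda>z. tent B n (torus z)) \<in> borel_measurable borel" for n by measurable
      show "indicat_real B \<in> borel_measurable borel" using Bm by simp
      show "\<bar>tent B n (torus z)\<bar> \<le> 1" for n z using tent_bound[of B n "torus z"] by simp
      show "\<bar>indicat_real B z\<bar> \<le> 1" for z by (simp add: indicator_def)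
    qed
  qed
  have As: "A \<in> sigma_sets UNIV (Collect closed)" using A by (simp add: borel_eq_closed)
  have Cs: "Int_stable (Collect (closed :: (real \<times> real) set \<Rightarrow> bool))" by (auto simp: Int_stable_def)
  have P: "Collect (closed :: (real \<times> real) set \<Rightarrow> bool) \<subseteq> Pow UNIV" by simp
  have ind2: "integrable boxm (\<lambda>z. (indicat_real X z)^2)" if "X \<in> sets borel" for X
    by (rule integrable_boxm_bounded[where B=1]) (use that in \<open>auto simp: indicator_def\<close>)
  from Cs P As show ?thesis
  proof (induction rule: sigma_sets_induct_disjoint)
    case (basic C)
    then have C: "closed C" by simp
    show ?case
    proof (rule L2_approx_limit_bounded[where U="\<lambda>n. indicator (C \<inter> kbox n)"])
      show "L2_approx (indicator (C \<inter> kbox n))" for n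
        using C kbox_facts(1,2)[of n] by (intro cpt closed_Int_compact) auto
      show "AE z in boxm. (\<lambda>n. indicat_real (C \<inter> kbox n) z) \<longlonglongrightarrow> indicator C z"
        using AE_boxm_obox
      proof eventually_elim
        case (elim z)
        then obtain n0 where "z \<in> kbox n0" using kbox_facts(4) by blast
        then have "z \<in> kbox n" if "n \<ge> n0" for n using kbox_facts(3) that unfolding incseq_def by blast
        then have "eventually (\<lambda>n. indicat_real (C \<inter> kbox n) z = indicator C z) sequentially"
          unfolding eventually_sequentially by (intro exI[of _ n0]) (auto simp: indicator_def)
        then show ?case by (rule tendsto_eventually)
      qed
      show "indicat_real (C \<inter> kbox n) \<in> borel_measurable borel" for n
        using C kbox_facts(1)[of n] by (intro borel_measurable_indicator) (auto simp: compact_imp_closed)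
      show "indicat_real C \<in> borel_measurable borel" using C by (intro borel_measurable_indicator) auto
      show "\<bar>indicat_real (C \<inter> kbox n) z\<bar> \<le> 1" "\<bar>indicat_real C z\<bar> \<le> 1" for n z by (simp_all add: indicator_def)
    qed
  next
    case empty
    show ?case unfolding L2_approx_def by (auto intro!: exI[of _ "\<lambda>_. 0"] trigpoly_const)
  next
    case (compl X)
    then have X: "X \<in> sets borel" by (simp add: borel_eq_closed)
    have "L2_approx (\<lambda>z. 1 + (-1) * indicator X z)"
    proof (rule L2_approx_add)
      show "L2_approx (\<lambda>z. 1)" unfolding L2_approx_def
        by (auto intro!: exI[of _ "\<lambda>_. 1"] trigpoly_const)
      show "L2_approx (\<lambda>z. (-1) * indicator X z)" by (rule L2_approx_cmul[OF compl(2)])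
      show "(\<lambda>z. 1::real) \<in> borel_measurable borel" by simp
      show "(\<lambda>z. - 1 * indicat_real X z) \<in> borel_measurable borel"
        by (intro borel_measurable_times borel_measurable_const borel_measurable_indicator X)
      show "integrable boxm (\<lambda>z. (1::real)^2)" by (rule one)
      have "(\<lambda>z. (- 1 * indicat_real X z)^2) = (\<lambda>z. (indicat_real X z)^2)" by simp
      then show "integrable boxm (\<lambda>z. (- 1 * indicat_real X z)^2)" using ind2[OF X] by simp
    qed
    moreover have "(\<lambda>z. 1 + (-1) * indicator X z) = indicat_real (UNIV - X)" by (auto simp: indicator_def)
    ultimately show ?case by simp
  next
    case (union X)
    then have X: "X i \<in> sets borel" for i by (auto simp: borel_eq_closed)
    have fin: "L2_approx (indicator (\<Union>i<n. X i))" for n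
    proof (induction n)
      case 0
      show ?case unfolding L2_approx_def by (auto intro!: exI[of _ "\<lambda>_. 0"] trigpoly_const)
    next
      case (Suc n)
      have m: "(\<Union>i<n. X i) \<in> sets borel" using X by auto
      have "L2_approx (\<lambda>z. indicator (\<Union>i<n. X i) z + indicator (X n) z)"
      proof (rule L2_approx_add)
        show "indicat_real (\<Union>i<n. X i) \<in> borel_measurable borel" by (intro borel_measurable_indicator m)
        show "indicat_real (X n) \<in> borel_measurable borel" by (intro borel_measurable_indicator X)
        show "integrable boxm (\<lambda>z. (indicat_real (\<Union>i<n. X i) z)^2)" by (rule ind2[OF m])
        show "integrable boxm (\<lambda>z. (indicat_real (X n) z)^2)" by (rule ind2[OF X])
        show "L2_approx (indicat_real (\<Union>i<n. X i))" by (rule Suc.IH)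
        show "L2_approx (indicat_real (X n))" by (rule union(3))
      qed
      moreover have "(\<lambda>z. indicat_real (\<Union>i<n. X i) z + indicat_real (X n) z) = indicator (\<Union>i<Suc n. X i)"
      proof
        fix z
        have "z \<notin> X i" if "z \<in> X n" "i < n" for i
          using union(1) that unfolding disjoint_family_on_def by (metis IntI UNIV_I empty_iff less_irrefl)
        then show "indicat_real (\<Union>i<n. X i) z + indicat_real (X n) z = indicator (\<Union>i<Suc n. X i) z"
          by (auto simp: indicator_def less_Suc_eq)
      qed
      ultimately show ?case by simp
    qed
    show ?case
    proof (rule L2_approx_limit_bounded[where U="\<lambda>n. indicator (\<Union>i<n. X i)"])
      show "AE z in boxm. (\<lambda>n. indicat_real (\<Union>i<n. X i) z) \<longlonglongrightarrow> indicator (\<Union>i. X i) z"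
      proof (rule AE_I2)
        fix z
        show "(\<lambda>n. indicat_real (\<Union>i<n. X i) z) \<longlonglongrightarrow> indicator (\<Union>i. X i) z"
        proof (cases "\<exists>i. z \<in> X i")
          case True
          then obtain i where i: "z \<in> X i" by blast
          then have "eventually (\<lambda>n. indicat_real (\<Union>i<n. X i) z = indicator (\<Union>i. X i) z) sequentially"
            unfolding eventually_sequentially by (intro exI[of _ "Suc i"]) (auto simp: indicator_def Suc_le_eq)
          then show ?thesis by (rule tendsto_eventually)
        qed (auto simp: indicator_def)
      qed
      show "indicator (\<Union>i<n. X i) \<in> borel_measurable borel" for n :: nat using X by (intro borel_measurable_indicator) auto
      show "indicator (\<Union>i. X i) \<in> borel_measurable borel" using X by (intro borel_measurable_indicator) auto
      show "\<bar>indicat_real (\<Union>i<n. X i) z\<bar> \<le> 1" "\<bar>indicat_real (\<Union>i. X i) z\<bar> \<le> 1" for n :: nat and z by (simp_all add: indicator_def)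
    qed (rule fin)
  qed
qed

text \<open>The function is an increasing limit of simple ones and itself serves as the dominating
  function, so the convergence holds in mean square. Square integrability is carried as an
  implication through the induction: by nonnegativity each summand inherits it from the sum.\<close>

lemma L2_approx_square_integrable:
  assumes u: "u \<in> borel_measurable borel" "\<And>z. 0 \<le> u z" and "integrable boxm (\<lambda>z. (u z)^2)"
  shows "L2_approx u"
proof -
  have "integrable boxm (\<lambda>z. (u z)^2) \<longrightarrow> L2_approx u"
    using u
  proof (induction rule: borel_measurable_induct_real)
    case (set A)
    then show ?case using L2_approx_indicator by auto
  next
    case (mult u c)
    show ?case
    proof
      assume i: "integrable boxm (\<lambda>z. (c * u z)^2)"
      show "L2_approx (\<lambda>z. c * u z)"
      proof (cases "c = 0")
        case True
        then show ?thesis unfolding L2_approx_def by (auto intro!: exI[of _ "\<lambda>_. 0"] trigpoly_const)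
      next
        case False
        then have "integrable boxm (\<lambda>z. (u z)^2)" using i by (simp add: power_mult_distrib)
        then show ?thesis using mult by (intro L2_approx_cmul) auto
      qed
    qed
  next
    case (add u v)
    show ?case
    proof
      assume i: "integrable boxm (\<lambda>z. (v z + u z)^2)"
      have [measurable]: "u \<in> borel_measurable borel" "v \<in> borel_measurable borel" using add by auto
      have pos: "0 \<le> u z" "0 \<le> v z" for z using add by auto
      have "(u z)^2 \<le> (v z + u z)^2" "(v z)^2 \<le> (v z + u z)^2" for z
        using pos[of z] by (auto intro!: power_mono)
      then have iu: "integrable boxm (\<lambda>z. (u z)^2)" and iv: "integrable boxm (\<lambda>z. (v z)^2)"
        by (auto intro!: Bochner_Integration.integrable_bound[OF i])
      show "L2_approx (\<lambda>z. v z + u z)"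
        using add iu iv by (intro L2_approx_add) auto
    qed
  next
    case (seq U)
    show ?case
    proof
      assume i: "integrable boxm (\<lambda>z. (u z)^2)"
      have le: "U n z \<le> u z" for n z
      proof (rule incseq_le[of "\<lambda>n. U n z"])
        have "incseq U" using seq by auto
        then show "incseq (\<lambda>n. U n z)" unfolding incseq_def le_fun_def by blast
        show "(\<lambda>n. U n z) \<longlonglongrightarrow> u z" using seq by auto
      qed
      have [measurable]: "U n \<in> borel_measurable borel" for n using seq by auto
      have pos: "0 \<le> U n z" for n z using seq by auto
      have iU: "integrable boxm (\<lambda>z. (U n z)^2)" for n
        by (rule Bochner_Integration.integrable_bound[OF i]) (auto intro!: power_mono le pos)
      show "L2_approx u"
        by (rule L2_approx_limit[where U=U and v=u]) (use seq i le iU u pos in \<open>auto simp: abs_of_nonneg\<close>)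
    qed
  qed
  then show ?thesis using assms(3) by blast
qed

section \<open>Fourier sums and the orthogonality relations\<close>

definition fcoef :: "(real \<times> real \<Rightarrow> real) \<Rightarrow> int \<Rightarrow> int \<Rightarrow> complex" where
  "fcoef s k l = (\<integral>z. cis (- (real_of_int k * fst z + real_of_int l * snd z)) * cx (s z) \<partial>boxm) / cx (4 * pi^2)"

lemma square_integrable_imp_integrable_boxm:
  fixes s :: "real \<times> real \<Rightarrow> real"
  assumes "s \<in> borel_measurable borel" "integrable boxm (\<lambda>z. (s z)^2)"
  shows "integrable boxm s"
proof (rule Bochner_Integration.integrable_bound)
  have "integrable boxm (\<lambda>z. 1::real)" by (rule integrable_boxm_bounded[where B=1]) auto
  then show "integrable boxm (\<lambda>z. (s z)^2 + 1)" using assms by auto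
  have "\<bar>s z\<bar> \<le> (s z)^2 + 1" for z
    using sum_squares_bound[of "\<bar>s z\<bar>" 1] abs_ge_zero[of "s z"] by simp
  then show "AE z in boxm. norm (s z) \<le> norm ((s z)^2 + 1)" by simp
qed (use assms in measurable)

text \<open>Completing the square; it shows that for a fixed set of frequencies the Fourier
  coefficients are the best choice of \<open>c\<close>.\<close>

lemma dist_fourier_sum:
  assumes s: "s \<in> borel_measurable borel" "integrable boxm (\<lambda>z. (s z)^2)" and F: "finite F"
  defines "e \<equiv> \<lambda>m z. cis (real_of_int (fst m) * fst z + real_of_int (snd m) * snd z)"
  shows "(\<integral>z. (cmod (cx (s z) - (\<Sum>m\<in>F. c m * e m z)))^2 \<partial>boxm)
    = (\<integral>z. (s z)^2 \<partial>boxm) + 4 * pi^2 * (\<Sum>m\<in>F. (cmod (c m - fcoef s (fst m) (snd m)))^2 - (cmod (fcoef s (fst m) (snd m)))^2)"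
proof -
  note [measurable] = s(1)
  have em[measurable]: "e m \<in> borel_measurable borel" for m
    unfolding e_def by (intro borel_measurable_continuous_onI continuous_intros)
  have isi: "integrable boxm s" by (rule square_integrable_imp_integrable_boxm[OF s])
  have ce: "cnj (e m z) = cis (- (real_of_int (fst m) * fst z + real_of_int (snd m) * snd z))" for m z
    by (simp add: e_def cis_cnj)
  have ies: "integrable boxm (\<lambda>z. cnj (e m z) * cx (s z))" for m
  proof (rule Bochner_Integration.integrable_bound[OF isi])
    show "(\<lambda>z. cnj (e m z) * cx (s z)) \<in> borel_measurable boxm"
      unfolding ce by (intro borel_measurable_times borel_measurable_of_real)
        (auto simp: measurable_cong_sets[OF sets_boxm refl] intro!: borel_measurable_continuous_onI continuous_intros)
    show "AE z in boxm. norm (cnj (e m z) * cx (s z)) \<le> norm (s z)"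
      by (simp add: norm_mult e_def)
  qed
  have ees: "(\<integral>z. cnj (e m z) * cx (s z) \<partial>boxm) = cx (4 * pi^2) * fcoef s (fst m) (snd m)" for m
    unfolding fcoef_def ce by simp
  let ?p = "\<lambda>z. \<Sum>m\<in>F. c m * e m z"
  have inj: "inj_on (\<lambda>m. m) F" by simp
  have ip: "integrable boxm (\<lambda>z. (cmod (?p z))^2)" and ep: "(\<integral>z. (cmod (?p z))^2 \<partial>boxm) = 4 * pi^2 * (\<Sum>m\<in>F. (cmod (c m))^2)"
    unfolding e_def using parseval_box[OF F inj, of c] by auto
  have ips: "integrable boxm (\<lambda>z. cnj (?p z) * cx (s z))"
    and eps: "(\<integral>z. cnj (?p z) * cx (s z) \<partial>boxm) = cx (4 * pi^2) * (\<Sum>m\<in>F. cnj (c m) * fcoef s (fst m) (snd m))"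
  proof -
    have q: "cnj (?p z) * cx (s z) = (\<Sum>m\<in>F. cnj (c m) * (cnj (e m z) * cx (s z)))" for z
      by (simp add: sum_distrib_right mult.assoc)
    show "integrable boxm (\<lambda>z. cnj (?p z) * cx (s z))"
      unfolding q by (intro Bochner_Integration.integrable_sum integrable_mult_right ies)
    have "(\<integral>z. cnj (?p z) * cx (s z) \<partial>boxm) = (\<Sum>m\<in>F. \<integral>z. cnj (c m) * (cnj (e m z) * cx (s z)) \<partial>boxm)"
      unfolding q by (intro Bochner_Integration.integral_sum integrable_mult_right ies)
    also have "\<dots> = cx (4 * pi^2) * (\<Sum>m\<in>F. cnj (c m) * fcoef s (fst m) (snd m))"
      unfolding sum_distrib_left by (intro sum.cong refl) (simp only: integral_mult_right_zero ees, simp only: mult_ac)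
    finally show "(\<integral>z. cnj (?p z) * cx (s z) \<partial>boxm) = cx (4 * pi^2) * (\<Sum>m\<in>F. cnj (c m) * fcoef s (fst m) (snd m))" .
  qed
  have sq: "(cmod (cx a - b))^2 = a^2 - 2 * Re (cnj b * cx a) + (cmod b)^2" for a b
    unfolding cmod_power2 by (simp add: power2_eq_square algebra_simps)
  have iRe: "integrable boxm (\<lambda>z. Re (cnj (?p z) * cx (s z)))" using ips by (rule integrable_Re)
  have "(\<integral>z. (cmod (cx (s z) - ?p z))^2 \<partial>boxm)
     = (\<integral>z. (s z)^2 \<partial>boxm) - 2 * (\<integral>z. Re (cnj (?p z) * cx (s z)) \<partial>boxm) + (\<integral>z. (cmod (?p z))^2 \<partial>boxm)"
    unfolding sq using s(2) iRe ip by simp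
  also have "(\<integral>z. Re (cnj (?p z) * cx (s z)) \<partial>boxm) = Re (cx (4 * pi^2) * (\<Sum>m\<in>F. cnj (c m) * fcoef s (fst m) (snd m)))"
    unfolding eps[symmetric] by (rule integral_Re[OF ips])
  also have "\<dots> = 4 * pi^2 * (\<Sum>m\<in>F. Re (cnj (c m) * fcoef s (fst m) (snd m)))"
  proof -
    have "Re (cx a * w) = a * Re w" for a w by simp
    then show ?thesis by (simp only: Re_sum)
  qed
  finally have "(\<integral>z. (cmod (cx (s z) - ?p z))^2 \<partial>boxm)
     = (\<integral>z. (s z)^2 \<partial>boxm) + 4 * pi^2 * (\<Sum>m\<in>F. (cmod (c m))^2 - 2 * Re (cnj (c m) * fcoef s (fst m) (snd m)))"
    unfolding ep by (simp only: sum_subtractf sum_distrib_left[symmetric] right_diff_distrib)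
  moreover have "(cmod (a - b))^2 - (cmod b)^2 = (cmod a)^2 - 2 * Re (cnj a * b)" for a b
    unfolding cmod_power2 by (simp add: power2_eq_square algebra_simps)
  ultimately show ?thesis by simp
qed

text \<open>Let \<open>P n\<close> be the partial Fourier sum over \<open>A n \<times> A n\<close>.
  Its coefficients are real because \<open>s\<close> is even almost everywhere, so the integral of
  its squared modulus against the character of frequency \<open>j\<close> is a multiple of the
  finite sum in \<open>orth\<close>, which has no conjugates. It vanishes exactly for each
  \<open>n\<close>, and mean-square approximation of \<open>s\<close> by \<open>P n\<close> passes
  this on to \<open>s^2\<close>.\<close>

lemma fourier_square_orthogonal:
  assumes s[measurable]: "s \<in> borel_measurable borel" and s0: "\<And>z. 0 \<le> s z" and s2: "integrable boxm (\<lambda>z. (s z)^2)"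
    and sym: "AE z in boxm. s (- z) = s z"
    and A: "\<And>n :: nat. n \<ge> 1 \<Longrightarrow> finite (A n)" "\<And>n. n \<ge> 1 \<Longrightarrow> A n \<subseteq> A (Suc n)" "(\<Union>n\<in>{1..}. A n) = (UNIV :: int set)"
    and orth: "\<And>n. n \<ge> 1 \<Longrightarrow> (\<Sum>k\<in>A n. \<Sum>l\<in>A n. if j + k \<in> A n then fcoef s k l * fcoef s (j + k) l else 0) = 0"
  shows "(\<integral>z. cx ((s z)^2) * cis (real_of_int j * fst z) \<partial>boxm) = 0"
proof -
  let ?e = "\<lambda>m z. cis (real_of_int (fst m) * fst z + real_of_int (snd m) * snd z)"
  define F where "F n = A n \<times> A n" for n
  define P where "P n z = (\<Sum>m\<in>F n. fcoef s (fst m) (snd m) * ?e m z)" for n z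
  have Ff: "finite (F n)" if "n \<ge> 1" for n using A(1)[OF that] by (simp add: F_def)
  have em[measurable]: "?e m \<in> borel_measurable borel" for m
    by (intro borel_measurable_continuous_onI continuous_intros)
  have Pm[measurable]: "P n \<in> borel_measurable borel" for n unfolding P_def
    by (intro borel_measurable_sum borel_measurable_times borel_measurable_const em)
  have mono: "A n \<subseteq> A m" if "1 \<le> n" "n \<le> m" for n m
    using that(2)
  proof (induction rule: dec_induct)
    case (step k)
    then show ?case using A(2)[of k] that(1) by (meson order_trans)
  qed simp
  have real: "cnj (fcoef s k l) = fcoef s k l" for k l
  proof -
    have m1: "(\<lambda>z. cis (real_of_int k * fst z + real_of_int l * snd z) * cx (s z)) \<in> borel_measurable borel"
      using em[of "(k, l)"] by (intro borel_measurable_times) auto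
    have c: "cnj (cis (- (real_of_int k * fst z + real_of_int l * snd z)) * cx (s z))
      = cis (real_of_int k * fst z + real_of_int l * snd z) * cx (s z)" for z
      by (simp only: complex_cnj_mult cis_cnj minus_minus complex_cnj_complex_of_real)
    have "cnj (\<integral>z. cis (- (real_of_int k * fst z + real_of_int l * snd z)) * cx (s z) \<partial>boxm)
      = (\<integral>z. cis (real_of_int k * fst z + real_of_int l * snd z) * cx (s z) \<partial>boxm)"
      unfolding Bochner_Integration.integral_cnj[symmetric] c ..
    also have "\<dots> = (\<integral>z. cis (real_of_int k * fst (- z) + real_of_int l * snd (- z)) * cx (s (- z)) \<partial>boxm)"
      by (rule boxm_uminus[OF m1])
    also have "\<dots> = (\<integral>z. cis (- (real_of_int k * fst z + real_of_int l * snd z)) * cx (s z) \<partial>boxm)"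
    proof (rule integral_cong_AE)
      have "(\<lambda>z. cis (real_of_int k * fst (- z) + real_of_int l * snd (- z)) * cx (s (- z))) \<in> borel_measurable borel"
        using measurable_compose[OF uminus_measurable_pair m1] by simp
      then show "(\<lambda>z. cis (real_of_int k * fst (- z) + real_of_int l * snd (- z)) * cx (s (- z))) \<in> borel_measurable boxm"
        by (simp add: measurable_cong_sets[OF sets_boxm refl])
      have "(\<lambda>z. cis (- (real_of_int k * fst z + real_of_int l * snd z))) \<in> borel_measurable (borel :: (real \<times> real) measure)"
        by (intro borel_measurable_continuous_onI continuous_intros)
      then show "(\<lambda>z. cis (- (real_of_int k * fst z + real_of_int l * snd z)) * cx (s z)) \<in> borel_measurable boxm"
        unfolding measurable_cong_sets[OF sets_boxm refl] by (intro borel_measurable_times) auto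
    qed (use sym in eventually_elim, simp)
    finally show ?thesis unfolding fcoef_def by simp
  qed
  have Pzero: "(\<integral>z. (P n z * cnj (P n z)) * cis (real_of_int j * fst z) \<partial>boxm) = 0" if n: "n \<ge> 1" for n
  proof -
    let ?c = "\<lambda>m m' z. cis (real_of_int (fst m - fst m' + j) * fst z + real_of_int (snd m - snd m') * snd z)"
    have cm: "(\<lambda>z::real\<times>real. cis (real_of_int a * fst z + real_of_int b * snd z)) \<in> borel_measurable borel" for a b
      by (intro borel_measurable_continuous_onI continuous_intros)
    have ic: "integrable boxm (?c m m')" for m m'
      by (subst integral_boxm(2)[OF cm]) (rule integral_cis_box(1))
    have ec: "(\<integral>z. ?c m m' z \<partial>boxm) = (if fst m' = j + fst m \<and> snd m' = snd m then cx (4 * pi^2) else 0)" for m m'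
      by (subst integral_boxm(1)[OF cm], subst integral_cis_box(2)) auto
    have "(P n z * cnj (P n z)) * cis (real_of_int j * fst z)
      = (\<Sum>m\<in>F n. \<Sum>m'\<in>F n. fcoef s (fst m) (snd m) * fcoef s (fst m') (snd m') * ?c m m' z)" for z
    proof -
      have t: "?e m z * cnj (?e m' z) * cis (real_of_int j * fst z) = ?c m m' z" for m m'
        by (simp add: cis_cnj cis_mult algebra_simps)
      have "(P n z * cnj (P n z)) * cis (real_of_int j * fst z)
        = (\<Sum>m\<in>F n. \<Sum>m'\<in>F n. fcoef s (fst m) (snd m) * fcoef s (fst m') (snd m') * (?e m z * cnj (?e m' z) * cis (real_of_int j * fst z)))"
      proof -
        have gen: "(\<Sum>m\<in>T. a m * u m) * (\<Sum>m\<in>T. a m * v m) * w = (\<Sum>m\<in>T. \<Sum>m'\<in>T. a m * a m' * (u m * v m' * w))"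
          for a u v :: "int \<times> int \<Rightarrow> complex" and w T
          unfolding sum_product unfolding sum_distrib_right by (intro sum.cong refl) (simp only: mult_ac)
        show ?thesis unfolding P_def cnj_sum complex_cnj_mult real by (rule gen)
      qed
      then show ?thesis unfolding t .
    qed
    then have "(\<integral>z. (P n z * cnj (P n z)) * cis (real_of_int j * fst z) \<partial>boxm)
      = (\<integral>z. (\<Sum>m\<in>F n. \<Sum>m'\<in>F n. fcoef s (fst m) (snd m) * fcoef s (fst m') (snd m') * ?c m m' z) \<partial>boxm)" by simp
    also have "\<dots> = (\<Sum>m\<in>F n. \<integral>z. (\<Sum>m'\<in>F n. fcoef s (fst m) (snd m) * fcoef s (fst m') (snd m') * ?c m m' z) \<partial>boxm)"
      by (intro Bochner_Integration.integral_sum Bochner_Integration.integrable_sum integrable_mult_right ic)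
    also have "\<dots> = (\<Sum>m\<in>F n. \<Sum>m'\<in>F n. \<integral>z. fcoef s (fst m) (snd m) * fcoef s (fst m') (snd m') * ?c m m' z \<partial>boxm)"
      by (intro sum.cong refl Bochner_Integration.integral_sum integrable_mult_right ic)
    also have "\<dots> = (\<Sum>m\<in>F n. \<Sum>m'\<in>F n. fcoef s (fst m) (snd m) * fcoef s (fst m') (snd m') * (if fst m' = j + fst m \<and> snd m' = snd m then cx (4 * pi^2) else 0))"
      by (intro sum.cong refl) (simp only: integral_mult_right_zero ec)
    also have "\<dots> = (\<Sum>m\<in>F n. cx (4 * pi^2) * (if j + fst m \<in> A n then fcoef s (fst m) (snd m) * fcoef s (j + fst m) (snd m) else 0))"
    proof (rule sum.cong[OF refl])
      fix m assume m: "m \<in> F n"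
      have "(\<Sum>m'\<in>F n. fcoef s (fst m) (snd m) * fcoef s (fst m') (snd m') * (if fst m' = j + fst m \<and> snd m' = snd m then cx (4 * pi^2) else 0))
        = (\<Sum>m'\<in>F n. if m' = (j + fst m, snd m) then fcoef s (fst m) (snd m) * fcoef s (j + fst m) (snd m) * cx (4 * pi^2) else 0)"
        by (intro sum.cong refl) auto
      also have "\<dots> = cx (4 * pi^2) * (if j + fst m \<in> A n then fcoef s (fst m) (snd m) * fcoef s (j + fst m) (snd m) else 0)"
        using m Ff[OF n] by (auto simp: F_def)
      finally show "(\<Sum>m'\<in>F n. fcoef s (fst m) (snd m) * fcoef s (fst m') (snd m') * (if fst m' = j + fst m \<and> snd m' = snd m then cx (4 * pi^2) else 0))
        = cx (4 * pi^2) * (if j + fst m \<in> A n then fcoef s (fst m) (snd m) * fcoef s (j + fst m) (snd m) else 0)" .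
    qed
    also have "\<dots> = cx (4 * pi^2) * (\<Sum>k\<in>A n. \<Sum>l\<in>A n. if j + k \<in> A n then fcoef s k l * fcoef s (j + k) l else 0)"
      unfolding F_def sum_distrib_left[symmetric] sum.cartesian_product by (simp add: split_beta)
    also have "\<dots> = 0" using orth[OF n] by simp
    finally show ?thesis .
  qed
  \<comment> \<open>As soon as \<open>A n \<times> A n\<close> contains the frequencies of a good
    trigonometric approximation, the partial Fourier sum is at least as good, being the best
    approximation with the frequencies at hand.\<close>
  have conv: "\<exists>n\<ge>1. (\<integral>z. (cmod (cx (s z) - P n z))^2 \<partial>boxm) < e" if e: "e > 0" for e
  proof -
    obtain p where p: "trigpoly p" "(\<integral>z. (cmod (cx (s z) - p z))^2 \<partial>boxm) < e"
      using L2_approx_square_integrable[OF s s0 s2] e unfolding L2_approx_def by blast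
    obtain S c where S: "finite S" "p = (\<lambda>z. \<Sum>m\<in>S. c m * ?e m z)" using trigpoly_sum[OF p(1)] by blast
    have "\<exists>n\<ge>1. T \<subseteq> A n" if "finite T" for T :: "int set"
      using that
    proof (induction T rule: finite_induct)
      case (insert x T)
      then obtain n where n: "n \<ge> 1" "T \<subseteq> A n" by blast
      obtain m where m: "m \<ge> 1" "x \<in> A m" using A(3) by (metis UNIV_I UN_iff atLeast_iff)
      show ?case
        by (intro exI[of _ "max n m"] conjI) (use n m mono[of n "max n m"] mono[of m "max n m"] in auto)
    qed auto
    then obtain n where n: "n \<ge> 1" "fst ` S \<union> snd ` S \<subseteq> A n" using S(1) by (metis finite_Un finite_imageI)
    have SF: "S \<subseteq> F n" using n(2) unfolding F_def by (force simp: image_subset_iff)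
    define c' where "c' m = (if m \<in> S then c m else 0)" for m
    have pc: "p z = (\<Sum>m\<in>F n. c' m * ?e m z)" for z
      unfolding S(2) c'_def using SF Ff[OF n(1)] by (intro sum.mono_neutral_cong_left) auto
    note D = dist_fourier_sum[OF s s2 Ff[OF n(1)]]
    have "(\<integral>z. (cmod (cx (s z) - P n z))^2 \<partial>boxm) \<le> (\<integral>z. (cmod (cx (s z) - p z))^2 \<partial>boxm)"
      unfolding P_def pc D
      by (intro add_left_mono mult_left_mono sum_mono) auto
    then show ?thesis using n(1) p(2) by (intro exI[of _ n]) auto
  qed
  define I where "I = (\<integral>z. cx ((s z)^2) * cis (real_of_int j * fst z) \<partial>boxm)"
  have cj[measurable]: "(\<lambda>z::real\<times>real. cis (real_of_int j * fst z)) \<in> borel_measurable borel"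
    by (intro borel_measurable_continuous_onI continuous_intros)
  define Q where "Q = (\<integral>z. (s z)^2 \<partial>boxm)"
  have Q0: "Q \<ge> 0" unfolding Q_def by simp
  have "cmod I \<le> 0 + \<epsilon>" if eps: "\<epsilon> > 0" for \<epsilon>
  proof -
    \<comment> \<open>\<open>t\<close> splits the error: \<open>t * Q\<close> stays below
      \<open>\<epsilon> / 2\<close>, and the mean-square error is then made small relative to the
      fixed factor \<open>1 + 1 / t\<close>. The \<open>+ 1\<close> avoids division by zero when
      \<open>Q = 0\<close>.\<close>
    define t where "t = \<epsilon> / (2 * (Q + 1))"
    have t: "t > 0" using eps Q0 by (simp add: t_def)
    have "\<epsilon> / (2 * (1 + 1 / t)) > 0" using eps t by (simp add: add_pos_pos)
    then obtain n where n: "n \<ge> 1" "(\<integral>z. (cmod (cx (s z) - P n z))^2 \<partial>boxm) < \<epsilon> / (2 * (1 + 1 / t))"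
      using conv by blast
    have trP: "trigpoly (P n)"
    proof -
      have "trigpoly (\<lambda>z. \<Sum>m\<in>G. fcoef s (fst m) (snd m) * ?e m z)" if "finite G" for G
        using that
      proof (induction G rule: finite_induct)
        case (insert m G)
        have "trigpoly (\<lambda>z. fcoef s (fst m) (snd m) * ?e m z + (\<Sum>m\<in>G. fcoef s (fst m) (snd m) * ?e m z))"
          by (intro trigpoly.add trigpoly.cmul trigpoly.mono insert.IH)
        then show ?case using insert.hyps by simp
      qed (simp add: trigpoly_const)
      then show ?thesis unfolding P_def[abs_def] using Ff[OF n(1)] by blast
    qed
    obtain BP where BP: "\<And>z. cmod (P n z) \<le> BP" using trigpoly_bounded[OF trP] by blast
    have iD: "integrable boxm (\<lambda>z. (cmod (cx (s z) - P n z))^2)" by (rule integrable_trig_dist[OF s s2 trP])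
    have i1: "integrable boxm (\<lambda>z. cx ((s z)^2) * cis (real_of_int j * fst z))"
      by (rule Bochner_Integration.integrable_bound[OF s2]) (auto simp: norm_mult norm_power measurable_cong_sets[OF sets_boxm refl])
    have cPm: "(\<lambda>z. cnj (P n z)) \<in> borel_measurable borel"
      by (rule measurable_compose[OF Pm]) (auto intro!: borel_measurable_continuous_onI continuous_intros)
    have i2: "integrable boxm (\<lambda>z. (P n z * cnj (P n z)) * cis (real_of_int j * fst z))"
    proof (rule integrable_boxm_bounded[where B="BP * BP * 1"])
      show "(\<lambda>z. (P n z * cnj (P n z)) * cis (real_of_int j * fst z)) \<in> borel_measurable borel"
        using cPm by (intro borel_measurable_times Pm cj)
      fix z
      have "0 \<le> BP" using BP[of z] norm_ge_zero order_trans by blast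
      then show "norm ((P n z * cnj (P n z)) * cis (real_of_int j * fst z)) \<le> BP * BP * 1"
        unfolding norm_mult complex_mod_cnj norm_cis using BP by (intro mult_mono) auto
    qed
    have "I = (\<integral>z. cx ((s z)^2) * cis (real_of_int j * fst z) - (P n z * cnj (P n z)) * cis (real_of_int j * fst z) \<partial>boxm)"
      unfolding I_def using i1 i2 Pzero[OF n(1)] by (subst Bochner_Integration.integral_diff) auto
    also have "cmod \<dots> \<le> (\<integral>z. cmod (cx ((s z)^2) * cis (real_of_int j * fst z) - (P n z * cnj (P n z)) * cis (real_of_int j * fst z)) \<partial>boxm)"
      by (rule integral_norm_bound)
    also have "\<dots> \<le> (\<integral>z. t * (s z)^2 + (1 + 1 / t) * (cmod (cx (s z) - P n z))^2 \<partial>boxm)"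
    proof (rule integral_mono)
      show "integrable boxm (\<lambda>z. cmod (cx ((s z)^2) * cis (real_of_int j * fst z) - (P n z * cnj (P n z)) * cis (real_of_int j * fst z)))"
        using i1 i2 by auto
      show "integrable boxm (\<lambda>z. t * (s z)^2 + (1 + 1 / t) * (cmod (cx (s z) - P n z))^2)" using s2 iD by auto
      fix z
      define \<delta> where "\<delta> = cmod (cx (s z) - P n z)"
      have d0: "\<delta> \<ge> 0" by (simp add: \<delta>_def)
      have "cmod (cx ((s z)^2) * cis (real_of_int j * fst z) - (P n z * cnj (P n z)) * cis (real_of_int j * fst z))
        = \<bar>(s z)^2 - (cmod (P n z))^2\<bar>"
        unfolding left_diff_distrib[symmetric] norm_mult norm_cis complex_norm_square[symmetric] of_real_diff[symmetric] norm_of_real by simp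
      also have "\<dots> = \<bar>s z - cmod (P n z)\<bar> * (s z + cmod (P n z))"
      proof -
        have "0 \<le> s z + cmod (P n z)" using s0[of z] by simp
        moreover have "(s z)^2 - (cmod (P n z))^2 = (s z - cmod (P n z)) * (s z + cmod (P n z))"
          by (simp add: power2_eq_square algebra_simps)
        ultimately show ?thesis by (simp only: abs_mult abs_of_nonneg)
      qed
      also have "\<dots> \<le> \<delta> * (2 * s z + \<delta>)"
      proof (intro mult_mono)
        have ns: "cmod (cx (s z)) = s z" using s0[of z] by simp
        show "\<bar>s z - cmod (P n z)\<bar> \<le> \<delta>" unfolding \<delta>_def
          using norm_triangle_ineq3[of "cx (s z)" "P n z"] unfolding ns .
        have "cmod (P n z) \<le> cmod (cx (s z)) + \<delta>" unfolding \<delta>_def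
          using norm_triangle_ineq2[of "P n z" "cx (s z)"] by (simp add: norm_minus_commute)
        then show "s z + cmod (P n z) \<le> 2 * s z + \<delta>" unfolding ns by simp
      qed (use s0[of z] d0 in auto)
      also have "\<dots> \<le> t * (s z)^2 + (1 + 1 / t) * \<delta>^2"
      proof -
        have "0 \<le> (t * s z - \<delta>)^2 / t" using t by simp
        also have "\<dots> = t * (s z)^2 + \<delta>^2 / t - 2 * s z * \<delta>" using t by (simp add: power2_eq_square field_simps)
        finally show ?thesis by (simp add: power2_eq_square algebra_simps)
      qed
      finally show "cmod (cx ((s z)^2) * cis (real_of_int j * fst z) - (P n z * cnj (P n z)) * cis (real_of_int j * fst z))
         \<le> t * (s z)^2 + (1 + 1 / t) * (cmod (cx (s z) - P n z))^2" unfolding \<delta>_def .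
    qed
    also have "\<dots> = t * Q + (1 + 1 / t) * (\<integral>z. (cmod (cx (s z) - P n z))^2 \<partial>boxm)"
      unfolding Q_def using s2 iD by simp
    also have "\<dots> \<le> \<epsilon> / 2 + (1 + 1 / t) * (\<epsilon> / (2 * (1 + 1 / t)))"
    proof (intro add_mono mult_left_mono)
      show "t * Q \<le> \<epsilon> / 2" using eps Q0 unfolding t_def by (simp add: field_simps)
    qed (use n(2) t in auto)
    also have "\<dots> = \<epsilon>"
    proof -
      have gen: "\<epsilon> / 2 + a * (\<epsilon> / (2 * a)) = \<epsilon>" if "a > 0" for a :: real using that by simp
      show ?thesis by (rule gen) (use t in \<open>simp add: add_pos_pos\<close>)
    qed
    finally show ?thesis by simp
  qed
  then have "cmod I \<le> 0" by (rule field_le_epsilon)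
  then show ?thesis unfolding I_def by simp
qed

section \<open>Splitting off the atoms\<close>

definition acpart :: "(real \<times> real \<Rightarrow> real) \<Rightarrow> (real \<times> real) measure" where
  "acpart f = density lborel (\<lambda>z. ennreal (f z * indicator spec_box z))"

lemma sets_acpart[measurable_cong]: "sets (acpart f) = sets borel"
  by (simp add: acpart_def)

lemma integral_acpart:
  fixes g :: "real \<times> real \<Rightarrow> 'b::{banach, second_countable_topology}"
  assumes f: "\<And>z. 0 \<le> f z" "f \<in> borel_measurable borel" and g: "g \<in> borel_measurable borel"
  shows "(\<integral>z. g z \<partial>acpart f) = (\<integral>z. f z *\<^sub>R g z \<partial>boxm)"
    and "integrable (acpart f) g \<longleftrightarrow> integrable boxm (\<lambda>z. f z *\<^sub>R g z)"
proof -
  note [measurable] = f(2) g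
  have m: "(\<lambda>z. f z *\<^sub>R g z) \<in> borel_measurable borel" by measurable
  have e: "(f z * indicator spec_box z) *\<^sub>R g z = indicator spec_box z *\<^sub>R f z *\<^sub>R g z" for z by simp
  have n: "AE z in lborel. 0 \<le> f z * indicator spec_box z" using f(1) by simp
  have m1: "(\<lambda>z. f z * indicator spec_box z) \<in> borel_measurable lborel" by measurable
  have m2: "g \<in> borel_measurable lborel" by simp
  show "(\<integral>z. g z \<partial>acpart f) = (\<integral>z. f z *\<^sub>R g z \<partial>boxm)"
    unfolding acpart_def integral_density[OF m2 m1 n] integral_boxm(1)[OF m] e ..
  show "integrable (acpart f) g \<longleftrightarrow> integrable boxm (\<lambda>z. f z *\<^sub>R g z)"
    unfolding acpart_def integrable_density[OF m2 m1 n] integral_boxm(2)[OF m] e ..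
qed

text \<open>The discrete part is encoded by a countable carrier \<open>D\<close> off which
  \<open>\<nu>\<close> has density \<open>f\<close>. The atoms are then treated through finite
  subsets \<open>T\<close> of \<open>D\<close> and the remaining mass on
  \<open>D - T\<close>.\<close>

locale spectral_split = finite_measure \<nu> for \<nu> :: "(real \<times> real) measure" +
  fixes f :: "real \<times> real \<Rightarrow> real" and D :: "(real \<times> real) set"
  assumes sets_nu[measurable_cong]: "sets \<nu> = sets borel"
    and f0: "\<And>z. 0 \<le> f z" and fm[measurable]: "f \<in> borel_measurable borel"
    and cD: "countable D"
    and off_D: "\<And>A. A \<in> sets borel \<Longrightarrow> A \<inter> D = {} \<Longrightarrow>
      emeasure \<nu> A = (\<integral>\<^sup>+z. ennreal (f z) * indicator (A \<inter> spec_box) z \<partial>lborel)"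
begin

lemma space_nu[simp]: "space \<nu> = UNIV"
  using sets_eq_imp_space_eq[OF sets_nu] by simp

lemma D_meas[measurable]: "D \<in> sets borel"
  by (rule sets.countable[OF _ cD]) simp

lemma off_D_eq: "density \<nu> (indicator (- D)) = acpart f"
proof (rule measure_eqI)
  show "sets (density \<nu> (indicator (- D))) = sets (acpart f)" by (simp add: sets_nu acpart_def)
  fix A assume "A \<in> sets (density \<nu> (indicator (- D)))"
  then have A: "A \<in> sets borel" by (simp add: sets_nu)
  have n: "AE z in lborel. z \<notin> D"
    by (rule AE_not_in, rule null_setsI[OF emeasure_lborel_countable[OF cD]]) simp
  have m: "- D \<inter> A \<in> sets borel" using A by (intro sets.Int) (auto simp: borel_comp)
  have "emeasure (density \<nu> (indicator (- D))) A = (\<integral>\<^sup>+z. indicator (- D) z * indicator A z \<partial>\<nu>)"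
    using A by (subst emeasure_density) (auto simp: sets_nu)
  also have "\<dots> = (\<integral>\<^sup>+z. indicator (- D \<inter> A) z \<partial>\<nu>)"
    by (intro nn_integral_cong) (auto simp: indicator_def)
  also have "\<dots> = emeasure \<nu> (- D \<inter> A)" using m by (simp add: sets_nu)
  also have "\<dots> = (\<integral>\<^sup>+z. ennreal (f z) * indicator (- D \<inter> A \<inter> spec_box) z \<partial>lborel)"
    by (rule off_D[OF m]) auto
  also have "\<dots> = (\<integral>\<^sup>+z. ennreal (f z * indicator spec_box z) * indicator A z \<partial>lborel)"
    using n by (intro nn_integral_cong_AE) (auto simp: indicator_def elim!: eventually_mono)
  also have "\<dots> = emeasure (acpart f) A"
    unfolding acpart_def using A by (subst emeasure_density) auto
  finally show "emeasure (density \<nu> (indicator (- D))) A = emeasure (acpart f) A" .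
qed

lemma finite_acpart: "finite_measure (acpart f)"
proof (rule finite_measureI)
  have "emeasure (acpart f) (space (acpart f)) = (\<integral>\<^sup>+z. indicator (- D) z * indicator (space \<nu>) z \<partial>\<nu>)"
    unfolding off_D_eq[symmetric] by (subst emeasure_density) (auto simp: sets_nu)
  also have "\<dots> \<le> (\<integral>\<^sup>+z. indicator (space \<nu>) z \<partial>\<nu>)"
    by (intro nn_integral_mono) (auto simp: indicator_def)
  also have "\<dots> = emeasure \<nu> (space \<nu>)" by simp
  finally show "emeasure (acpart f) (space (acpart f)) \<noteq> \<infinity>"
    using emeasure_finite[of "space \<nu>"] by (auto simp: top_unique)
qed

lemma integrable_f: "integrable boxm f"
proof -
  interpret ac: finite_measure "acpart f" by (rule finite_acpart)
  have "integrable (acpart f) (\<lambda>z. 1::real)" by simp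
  then show ?thesis by (subst (asm) integral_acpart(2)[OF f0 fm]) auto
qed

text \<open>Off \<open>D\<close> the two measures agree, and \<open>acpart f\<close> does not charge
  \<open>D\<close>. Their difference therefore lives on \<open>D\<close>, and for a kernel vanishing
  on \<open>T\<close> only \<open>D - T\<close> contributes.\<close>

lemma integral_split_le:
  fixes K :: "real \<times> real \<Rightarrow> complex"
  assumes K: "K \<in> borel_measurable borel" and B: "\<And>z. cmod (K z) \<le> B"
    and T: "finite T" "\<And>z. z \<in> T \<Longrightarrow> K z = 0"
  shows "cmod ((\<integral>z. K z \<partial>\<nu>) - (\<integral>z. K z \<partial>acpart f)) \<le> B * measure \<nu> (D - T)"
proof -
  note [measurable] = K
  have Tm[measurable]: "T \<in> sets borel" using T(1) by (simp add: finite_imp_closed)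
  have Km: "K \<in> borel_measurable \<nu>" by measurable
  have B0: "0 \<le> B" using B[of undefined] norm_ge_zero order_trans by blast
  have iK: "integrable \<nu> K" by (rule integrable_const_bound[where B=B]) (use B Km in auto)
  have Dc: "- D \<in> sets \<nu>" by (simp add: sets_nu borel_comp)
  have "acpart f = density \<nu> (\<lambda>z. ennreal (indicator (- D) z))"
    unfolding off_D_eq[symmetric] by (intro density_cong) (auto simp: indicator_def sets_nu borel_comp)
  then have "(\<integral>z. K z \<partial>acpart f) = (\<integral>z. indicat_real (- D) z *\<^sub>R K z \<partial>\<nu>)"
    using Km Dc by (simp add: integral_density)
  then have "(\<integral>z. K z \<partial>\<nu>) - (\<integral>z. K z \<partial>acpart f) = (\<integral>z. K z - indicat_real (- D) z *\<^sub>R K z \<partial>\<nu>)"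
    using integrable_mult_indicator[OF Dc iK] iK by (simp add: Bochner_Integration.integral_diff)
  also have "cmod \<dots> \<le> (\<integral>z. B * indicat_real (D - T) z \<partial>\<nu>)"
  proof (rule Bochner_Integration.integral_norm_bound_integral)
    show "integrable \<nu> (\<lambda>z. K z - indicat_real (- D) z *\<^sub>R K z)"
      using integrable_mult_indicator[OF Dc iK] iK by auto
    have "D - T \<in> sets borel" by measurable
    then have "integrable \<nu> (indicat_real (D - T))"
      by (intro integrable_const_bound[where B=1]) (auto simp: measurable_cong_sets[OF sets_nu refl] indicator_def)
    then show "integrable \<nu> (\<lambda>z. B * indicat_real (D - T) z)" by (rule integrable_mult_right)
    fix z
    show "cmod (K z - indicat_real (- D) z *\<^sub>R K z) \<le> B * indicat_real (D - T) z"
      using B[of z] T(2)[of z] B0 by (auto simp: indicator_def)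
  qed
  also have "\<dots> = B * measure \<nu> (D - T)" by simp
  finally show ?thesis .
qed

text \<open>Continuity from above along an enumeration of the countable set.\<close>

lemma finite_capture:
  assumes "e > 0" shows "\<exists>T. finite T \<and> T \<subseteq> D \<and> measure \<nu> (D - T) < e"
proof (cases "D = {}")
  case True
  then show ?thesis using assms by auto
next
  case False
  define E where "E n = D - from_nat_into D ` {..<n}" for n :: nat
  have "(\<lambda>n. measure \<nu> (E n)) \<longlonglongrightarrow> measure \<nu> (\<Inter>n. E n)"
  proof (rule finite_Lim_measure_decseq)
    have "E n \<in> sets borel" for n
      unfolding E_def by (intro sets.Diff D_meas borel_closed finite_imp_closed finite_imageI finite_lessThan)
    then show "range E \<subseteq> sets \<nu>" by (auto simp: sets_nu)
    show "decseq E" by (auto simp: E_def decseq_def)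
  qed
  moreover have "(\<Inter>n. E n) = {}"
  proof -
    have "\<exists>n. z \<notin> E n" if "z \<in> D" for z
    proof -
      have "z \<in> range (from_nat_into D)" using that unfolding range_from_nat_into[OF False cD] .
      then obtain n where "z = from_nat_into D n" by blast
      then show ?thesis unfolding E_def by (intro exI[of _ "Suc n"]) auto
    qed
    then show ?thesis by (auto simp: E_def)
  qed
  ultimately have "(\<lambda>n. measure \<nu> (E n)) \<longlonglongrightarrow> 0" by simp
  then have "eventually (\<lambda>n. measure \<nu> (E n) < e) sequentially"
    by (rule order_tendstoD(2)) (rule assms)
  then obtain n where n: "measure \<nu> (E n) < e" unfolding eventually_sequentially by blast
  have "from_nat_into D ` {..<n} \<subseteq> D" using from_nat_into[OF False] by auto
  then show ?thesis using n unfolding E_def by (intro exI[of _ "from_nat_into D ` {..<n}"]) auto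
qed

lemma truncation_small:
  assumes "e > 0" shows "\<exists>k. k \<ge> 0 \<and> (\<integral>z. max (f z - k) 0 \<partial>boxm) < e"
proof -
  have "(\<lambda>n. \<integral>z. max (f z - real n) 0 \<partial>boxm) \<longlonglongrightarrow> (\<integral>z. 0 \<partial>boxm)"
  proof (rule integral_dominated_convergence[where w=f])
    show "integrable boxm f" by (rule integrable_f)
    show "AE z in boxm. (\<lambda>n. max (f z - real n) 0) \<longlonglongrightarrow> 0"
    proof (rule AE_I2)
      fix z
      obtain n0 :: nat where "f z \<le> real n0" using real_arch_simple by blast
      then have "eventually (\<lambda>n. max (f z - real n) 0 = 0) sequentially"
        unfolding eventually_sequentially by (intro exI[of _ n0]) auto
      then show "(\<lambda>n. max (f z - real n) 0) \<longlonglongrightarrow> 0" by (rule tendsto_eventually)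
    qed
    show "AE z in boxm. norm (max (f z - real n) 0) \<le> f z" for n using f0 by (auto simp: max_def)
  qed measurable
  then have "(\<lambda>n. \<integral>z. max (f z - real n) 0 \<partial>boxm) \<longlonglongrightarrow> 0" by simp
  then have "eventually (\<lambda>n. (\<integral>z. max (f z - real n) 0 \<partial>boxm) < e) sequentially"
    by (rule order_tendstoD(2)) (rule assms)
  then obtain n where n: "(\<integral>z. max (f z - real n) 0 \<partial>boxm) < e" unfolding eventually_sequentially by blast
  show ?thesis by (rule exI[of _ "real n"]) (use n in simp)
qed

lemma mainterm_measurable: "(\<lambda>z. mainterm N G \<alpha> P (fst z) (snd z)) \<in> borel_measurable borel"
  "(\<lambda>z. mainterm N G \<alpha> P (snd z) (fst z)) \<in> borel_measurable borel"
  unfolding mainterm_def dotp_def mvp_def by measurable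

lemma remterm_measurable: "(\<lambda>z. remterm N G \<alpha> P (fst z) (snd z)) \<in> borel_measurable borel"
  "(\<lambda>z. remterm N G \<alpha> P (snd z) (fst z)) \<in> borel_measurable borel"
proof -
  have s[measurable]: "(\<lambda>z. symcov N (- fst z) (- snd z) i j) \<in> borel_measurable borel"
    "(\<lambda>z. symcov N (- snd z) (- fst z) i j) \<in> borel_measurable borel" for i j
    unfolding symcov_def by measurable
  have ifm: "(\<lambda>z. if b then g z else 0) \<in> borel_measurable borel"
    if "g \<in> borel_measurable borel" for b and g :: "real \<times> real \<Rightarrow> complex"
    using that by (cases b) auto
  have t: "(\<lambda>z. toep N (A z) i j) \<in> borel_measurable borel"
    if "\<And>i j. (\<lambda>z. A z i j) \<in> borel_measurable borel" for A :: "real \<times> real \<Rightarrow> cmatr" and i j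
    unfolding toep_def using that
    by (intro borel_measurable_divide borel_measurable_sum borel_measurable_const ifm)
  have t1[measurable]: "(\<lambda>z. toep N (mmul N (mmul N (\<lambda>i j. cnj (G i j)) (symcov N (- fst z) (- snd z))) (\<lambda>i j. cnj (G i j))) i j) \<in> borel_measurable borel"
    "(\<lambda>z. toep N (mmul N (mmul N (\<lambda>i j. cnj (G i j)) (symcov N (- snd z) (- fst z))) (\<lambda>i j. cnj (G i j))) i j) \<in> borel_measurable borel" for i j
    unfolding mmul_def by (rule t, intro borel_measurable_sum borel_measurable_times borel_measurable_const s)+
  show "(\<lambda>z. remterm N G \<alpha> P (fst z) (snd z)) \<in> borel_measurable borel"
    "(\<lambda>z. remterm N G \<alpha> P (snd z) (fst z)) \<in> borel_measurable borel"
    unfolding remterm_def dotp_def mvp_def by measurable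
qed

text \<open>The order of the choices matters: the finite set \<open>T\<close> of atoms and the
  height \<open>k\<close> are fixed before \<open>N\<close>, so the number of annihilated waves, and
  with it the bound \<open>r\<close>, is the same for all \<open>N\<close>; only then is
  \<open>N0\<close> chosen. The estimate is uniform in \<open>G\<close> and can be applied to each
  realisation of the resolvent.\<close>

lemma kernel_estimate:
  assumes um: "uniform_marginals (acpart f) \<gamma>" and eta: "\<eta> > 0" and e: "e > 0"
  shows "\<exists>P r N0. \<forall>N\<ge>N0. N > 0 \<and> opb N 1 (P N) \<and> hsq N (\<lambda>i j. idm i j - P N i j) \<le> r \<and>
    (\<forall>G \<alpha>. opb N (1 / \<eta>) G \<longrightarrow> (\<forall>i j. G i j = G j i) \<longrightarrow> cmod \<alpha> \<le> 1 / \<eta> \<longrightarrow>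
      cmod ((\<integral>z. ibpkernel N G \<alpha> (P N) (fst z) (snd z) \<partial>\<nu>)
        - cx \<gamma> * \<alpha> * (tr N (mmul N G (toepdev N G \<alpha>)) / of_nat N)) \<le> \<gamma> / \<eta> * defect N G \<alpha> + e)"
proof -
  interpret um: uniform_marginals "acpart f" \<gamma> by (rule um)
  have g0: "0 \<le> \<gamma>" by (rule um.gamma_nonneg)
  \<comment> \<open>Three errors share \<open>e\<close>: \<open>12 / \<eta>^3\<close> bounds the
    kernel, hence the loss on the atoms outside \<open>T\<close>; \<open>8 / \<eta>^3\<close> below
    bounds the remainder terms, hence the loss from cutting the density at \<open>k\<close>; the
    last third is for the terms decaying in \<open>N\<close>.\<close>
  obtain T where T: "finite T" "T \<subseteq> D" "measure \<nu> (D - T) < e / 3 / (12 / \<eta>^3)"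
    using finite_capture[of "e / 3 / (12 / \<eta>^3)"] e eta by auto
  obtain k where k: "k \<ge> 0" "(\<integral>z. max (f z - k) 0 \<partial>boxm) < e / 3 / (8 / \<eta>^3)"
    using truncation_small[of "e / 3 / (8 / \<eta>^3)"] e eta by auto
  \<comment> \<open>Both coordinates of each atom are included, since the kernel bound contains the
    waves at \<open>x\<close> and at \<open>y\<close>.\<close>
  define F where "F = fst ` T \<union> snd ` T"
  have F: "finite F" using T(1) by (simp add: F_def)
  define P where "P N = (SOME P. opb N 1 P \<and> (\<forall>x\<in>F. \<forall>i<N. mvp N P (pwave N x) i = 0)
     \<and> sqrt (hsq N (\<lambda>i j. idm i j - P i j)) \<le> card F)" for N
  have PN: "opb N 1 (P N) \<and> (\<forall>x\<in>F. \<forall>i<N. mvp N (P N) (pwave N x) i = 0) \<and> sqrt (hsq N (\<lambda>i j. idm i j - P N i j)) \<le> card F" for N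
    using someI_ex[OF ex_annihilating_contraction[OF F, of N "pwave N"]] unfolding P_def .
  define r where "r = (real (card F))^2"
  have hs: "hsq N (\<lambda>i j. idm i j - P N i j) \<le> r" for N
    unfolding r_def using PN[of N] sqrt_le_D by blast
  define C where "C = \<gamma> * (r + 1) / \<eta>^3 + k * (8 * pi^2 * (1 / \<eta>^4 + 1 / \<eta>^2 + 2 / \<eta>^5 + 1 / \<eta>))"
  have C0: "C \<ge> 0" unfolding C_def using g0 eta k(1) by (intro add_nonneg_nonneg mult_nonneg_nonneg divide_nonneg_nonneg) (auto simp: r_def)
  obtain N0 :: nat where N0: "N0 > 0" "(C * 3 / e + 1)^2 \<le> real N0"
  proof -
    obtain n :: nat where n: "(C * 3 / e + 1)^2 \<le> real n" using real_arch_simple by blast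
    show ?thesis by (rule that[of "Suc n"]) (use n in auto)
  qed
  have CN: "C / sqrt (real N) \<le> e / 3" if "N \<ge> N0" for N
  proof -
    have "(C * 3 / e + 1)^2 \<le> real N" using N0(2) that by linarith
    then have "C * 3 / e + 1 \<le> sqrt (real N)" by (rule real_le_rsqrt)
    then have "C * 3 / e \<le> sqrt (real N)" by simp
    moreover have "sqrt (real N) > 0" using N0(1) that by simp
    ultimately show ?thesis using e by (simp add: field_simps)
  qed
  show ?thesis
  proof (intro exI[of _ P] exI[of _ r] exI[of _ N0] allI impI conjI)
    fix N assume N: "N0 \<le> N"
    show N_pos: "N > 0" using N0(1) N by simp
    show P1: "opb N 1 (P N)" using PN by blast
    show "hsq N (\<lambda>i j. idm i j - P N i j) \<le> r" by (rule hs)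
    fix G :: cmatr and \<alpha> :: complex
    assume G: "opb N (1 / \<eta>) G" and sym': "\<forall>i j. G i j = G j i" and al: "cmod \<alpha> \<le> 1 / \<eta>"
    then have sym: "\<And>i j. G i j = G j i" by blast
    note ctx = N_pos eta G sym al P1
    define p where "p x = nrm N (mvp N (P N) (pwave N x))" for x
    have p1: "p x \<le> 1" for x unfolding p_def by (rule nrm_P_pwave[OF ctx])
    have p0: "p x = 0" if "x \<in> F" for x
    proof -
      have "p x = nrm N (\<lambda>i. 0)" unfolding p_def using PN[of N] that by (intro nrm_cong) auto
      then show ?thesis by (simp add: nrm_def L2_set_def)
    qed
    let ?m = "\<lambda>z. mainterm N G \<alpha> (P N) (fst z) (snd z) + mainterm N G \<alpha> (P N) (snd z) (fst z)"
    let ?r = "\<lambda>z. remterm N G \<alpha> (P N) (fst z) (snd z) + remterm N G \<alpha> (P N) (snd z) (fst z)"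
    let ?R = "\<lambda>z. cmod (remterm N G \<alpha> (P N) (fst z) (snd z)) + cmod (remterm N G \<alpha> (P N) (snd z) (fst z))"
    let ?K = "\<lambda>z. ibpkernel N G \<alpha> (P N) (fst z) (snd z)"
    note [measurable] = mainterm_measurable[of N G \<alpha> "P N"] remterm_measurable[of N G \<alpha> "P N"]
    have Km: "?K \<in> borel_measurable borel" unfolding ibpkernel_eq by measurable
    have Kb: "cmod (?K z) \<le> 6 / \<eta>^3 * (p (fst z) + p (snd z))" for z
      unfolding p_def by (rule ibpkernel_le[OF ctx])
    have Kb12: "cmod (?K z) \<le> 12 / \<eta>^3" for z
    proof -
      have "6 / \<eta>^3 * (p (fst z) + p (snd z)) \<le> 6 / \<eta>^3 * (1 + 1)"
        using eta by (intro mult_left_mono add_mono p1) auto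
      then show ?thesis using Kb[of z] by simp
    qed
    have K0: "?K z = 0" if "z \<in> T" for z
    proof -
      have "p (fst z) = 0" "p (snd z) = 0" using that by (auto intro!: p0 simp: F_def)
      then show ?thesis using Kb[of z] by simp
    qed
    have s1: "cmod ((\<integral>z. ?K z \<partial>\<nu>) - (\<integral>z. ?K z \<partial>acpart f)) \<le> e / 3"
    proof -
      have "cmod ((\<integral>z. ?K z \<partial>\<nu>) - (\<integral>z. ?K z \<partial>acpart f)) \<le> 12 / \<eta>^3 * measure \<nu> (D - T)"
        by (rule integral_split_le[OF Km Kb12 T(1) K0])
      also have "\<dots> \<le> 12 / \<eta>^3 * (e / 3 / (12 / \<eta>^3))" using T(3) eta by (intro mult_left_mono) auto
      also have "\<dots> = e / 3" using eta by simp
      finally show ?thesis .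
    qed
    have Rb: "?R z \<le> 8 / \<eta>^3" for z
    proof -
      have "?R z \<le> 4 / \<eta>^3 * p (fst z) + 4 / \<eta>^3 * p (snd z)"
        unfolding p_def by (intro add_mono remterm_le[OF ctx])
      also have "\<dots> \<le> 4 / \<eta>^3 * 1 + 4 / \<eta>^3 * 1" using eta by (intro add_mono mult_left_mono p1) auto
      finally show ?thesis by simp
    qed
    note Ri = integral_remterm[OF ctx]
    have Rm: "?R \<in> borel_measurable borel" by measurable
    have iR: "integrable (acpart f) ?R"
      by (rule um.integrable_const_bound[where B="8 / \<eta>^3"]) (use Rb in \<open>auto simp: measurable_cong_sets[OF sets_acpart refl]\<close>)
    have rm: "?r \<in> borel_measurable borel" by measurable
    have ir: "integrable (acpart f) ?r"
      by (rule Bochner_Integration.integrable_bound[OF iR])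
         (auto simp: measurable_cong_sets[OF sets_acpart refl] intro: norm_triangle_ineq)
    have s2: "cmod (\<integral>z. ?r z \<partial>acpart f) \<le> k * (8 * pi^2 * (1 / \<eta>^4 + 1 / \<eta>^2 + 2 / \<eta>^5 + 1 / \<eta>)) / sqrt (real N) + e / 3"
    proof -
      have "cmod (\<integral>z. ?r z \<partial>acpart f) \<le> (\<integral>z. ?R z \<partial>acpart f)"
        by (rule Bochner_Integration.integral_norm_bound_integral[OF ir iR]) (rule norm_triangle_ineq)
      also have "\<dots> = (\<integral>z. f z *\<^sub>R ?R z \<partial>boxm)" by (rule integral_acpart(1)[OF f0 fm Rm])
      \<comment> \<open>Up to height \<open>k\<close> the density is compared with a multiple of
        Lebesgue measure, for which the remainder is small; the excess is met with the uniform bound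
        on the remainder.\<close>
      also have "\<dots> \<le> (\<integral>z. k * ?R z + 8 / \<eta>^3 * max (f z - k) 0 \<partial>boxm)"
      proof (rule integral_mono)
        show "integrable boxm (\<lambda>z. f z *\<^sub>R ?R z)" using iR integral_acpart(2)[OF f0 fm Rm] by blast
        have "integrable boxm (\<lambda>z. max (f z - k) 0)"
          by (rule Bochner_Integration.integrable_bound[OF integrable_f]) (use f0 k(1) in \<open>auto simp: measurable_cong_sets[OF sets_boxm refl]\<close>)
        then show "integrable boxm (\<lambda>z. k * ?R z + 8 / \<eta>^3 * max (f z - k) 0)" using Ri(1) by auto
        fix z
        have R0: "0 \<le> ?R z" by simp
        have "f z * ?R z \<le> (k + max (f z - k) 0) * ?R z" by (intro mult_right_mono R0) auto
        also have "\<dots> = k * ?R z + ?R z * max (f z - k) 0" by (simp only: distrib_right mult.commute)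
        also have "\<dots> \<le> k * ?R z + 8 / \<eta>^3 * max (f z - k) 0" by (intro add_left_mono mult_right_mono Rb) auto
        finally show "f z *\<^sub>R ?R z \<le> k * ?R z + 8 / \<eta>^3 * max (f z - k) 0" by simp
      qed
      also have "\<dots> = k * (\<integral>z. ?R z \<partial>boxm) + 8 / \<eta>^3 * (\<integral>z. max (f z - k) 0 \<partial>boxm)"
      proof -
        have "integrable boxm (\<lambda>z. max (f z - k) 0)"
          by (rule Bochner_Integration.integrable_bound[OF integrable_f]) (use f0 k(1) in \<open>auto simp: measurable_cong_sets[OF sets_boxm refl]\<close>)
        then have "integrable boxm (\<lambda>z. 8 / \<eta>^3 * max (f z - k) 0)" by (rule integrable_mult_right)
        from Bochner_Integration.integral_add[OF integrable_mult_right[OF Ri(1), of k] this] show ?thesis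
          by (simp only: integral_mult_right_zero)
      qed
      also have "\<dots> \<le> k * (8 * pi^2 * (1 / \<eta>^4 + 1 / \<eta>^2 + 2 / \<eta>^5 + 1 / \<eta>) / sqrt (real N)) + 8 / \<eta>^3 * (e / 3 / (8 / \<eta>^3))"
        using Ri(2) k eta by (intro add_mono mult_left_mono) auto
      finally show ?thesis using eta by simp
    qed
    note Mi = um.integral_mainterm[OF ctx]
    define c where "c = cx \<gamma> * \<alpha> * (tr N (mmul N G (toepdev N G \<alpha>)) / of_nat N)"
    have s3: "cmod ((\<integral>z. ?m z \<partial>acpart f) - c) \<le> \<gamma> / \<eta> * defect N G \<alpha> + \<gamma> * (r + 1) / (\<eta>^3 * sqrt (real N))"
    proof -
      have "\<gamma> * (hsq N (\<lambda>i j. idm i j - P N i j) + 1) / (\<eta>^3 * sqrt (real N)) \<le> \<gamma> * (r + 1) / (\<eta>^3 * sqrt (real N))"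
        using g0 eta hs[of N] by (intro divide_right_mono mult_left_mono) auto
      then show ?thesis using Mi(2) unfolding c_def by linarith
    qed
    have dec: "(\<integral>z. ?K z \<partial>acpart f) = (\<integral>z. ?m z \<partial>acpart f) + (\<integral>z. ?r z \<partial>acpart f)"
      unfolding ibpkernel_eq by (rule Bochner_Integration.integral_add[OF Mi(1) ir])
    have eq: "(\<integral>z. ?K z \<partial>\<nu>) - c = ((\<integral>z. ?K z \<partial>\<nu>) - (\<integral>z. ?K z \<partial>acpart f)) + (\<integral>z. ?r z \<partial>acpart f) + ((\<integral>z. ?m z \<partial>acpart f) - c)"
      unfolding dec by (simp only: algebra_simps)
    have "cmod ((\<integral>z. ?K z \<partial>\<nu>) - c) \<le> e / 3 + (k * (8 * pi^2 * (1 / \<eta>^4 + 1 / \<eta>^2 + 2 / \<eta>^5 + 1 / \<eta>)) / sqrt (real N) + e / 3)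
       + (\<gamma> / \<eta> * defect N G \<alpha> + \<gamma> * (r + 1) / (\<eta>^3 * sqrt (real N)))"
      unfolding eq by (rule order_trans[OF norm_triangle_ineq add_mono[OF order_trans[OF norm_triangle_ineq add_mono[OF s1 s2]] s3]])
    also have "\<dots> = \<gamma> / \<eta> * defect N G \<alpha> + 2 * (e / 3) + C / sqrt (real N)"
      unfolding C_def by (simp add: add_divide_distrib)
    also have "\<dots> \<le> \<gamma> / \<eta> * defect N G \<alpha> + e" using CN[OF N] by linarith
    finally show "cmod ((\<integral>z. ?K z \<partial>\<nu>) - cx \<gamma> * \<alpha> * (tr N (mmul N G (toepdev N G \<alpha>)) / of_nat N)) \<le> \<gamma> / \<eta> * defect N G \<alpha> + e"
      unfolding c_def .
  qed
qed

end

section \<open>The integrand of the trace and its derivative along a line\<close>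

lemma resolv_cong: "(\<And>i j. i < N \<Longrightarrow> j < N \<Longrightarrow> H i j = H' i j) \<Longrightarrow> resolv N \<eta> H = resolv N \<eta> H'"
proof -
  assume "\<And>i j. i < N \<Longrightarrow> j < N \<Longrightarrow> H i j = H' i j"
  then have "shifted N \<eta> H = shifted N \<eta> H'" unfolding shifted_def by (intro eq_matI) auto
  then show ?thesis unfolding resolv_def by (simp only:)
qed

text \<open>Up to sign, the formal derivative of \<open>G b j * toepdev N G \<alpha> j i\<close>
  with respect to the entry \<open>(k, l)\<close> of the matrix. Separating it from the covariance
  weights lets the integral over \<open>\<nu>\<close> act on the weights alone.\<close>

definition ibpcoef :: "nat \<Rightarrow> cmatr \<Rightarrow> complex \<Rightarrow> nat \<Rightarrow> nat \<Rightarrow> nat \<Rightarrow> nat \<Rightarrow> nat \<Rightarrow> complex" where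
  "ibpcoef N G \<alpha> b j i k l = G b k * G l j * toepdev N G \<alpha> j i
     + G b j * toep N (\<lambda>p q. cnj (G p k) * cnj (G l q)) j i"

lemma mmul3_sum: "mmul N (mmul N A S) B b j = (\<Sum>k<N. \<Sum>l<N. S k l * (A b k * B l j))"
  unfolding mmul_def sum_distrib_right by (subst sum.swap) (simp add: mult_ac)

lemma toep_sum:
  "toep N (\<lambda>p q. \<Sum>k<N. \<Sum>l<N. S k l * T k l p q) i j = (\<Sum>k<N. \<Sum>l<N. S k l * toep N (T k l) i j)"
proof -
  let ?d = "\<lambda>p q. int p - int q = int i - int j"
  have "(\<Sum>p<N. \<Sum>q<N. if ?d p q then \<Sum>k<N. \<Sum>l<N. S k l * T k l p q else 0)
    = (\<Sum>p<N. \<Sum>q<N. \<Sum>k<N. \<Sum>l<N. S k l * (if ?d p q then T k l p q else 0))"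
    by (intro sum.cong refl) auto
  also have "\<dots> = (\<Sum>p<N. \<Sum>k<N. \<Sum>q<N. \<Sum>l<N. S k l * (if ?d p q then T k l p q else 0))"
    by (rule sum.cong[OF refl], rule sum.swap)
  also have "\<dots> = (\<Sum>k<N. \<Sum>p<N. \<Sum>q<N. \<Sum>l<N. S k l * (if ?d p q then T k l p q else 0))"
    by (rule sum.swap)
  also have "\<dots> = (\<Sum>k<N. \<Sum>p<N. \<Sum>l<N. \<Sum>q<N. S k l * (if ?d p q then T k l p q else 0))"
    by (rule sum.cong[OF refl], rule sum.cong[OF refl], rule sum.swap)
  also have "\<dots> = (\<Sum>k<N. \<Sum>l<N. \<Sum>p<N. \<Sum>q<N. S k l * (if ?d p q then T k l p q else 0))"
    by (rule sum.cong[OF refl], rule sum.swap)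
  also have "\<dots> = (\<Sum>k<N. \<Sum>l<N. S k l * (\<Sum>p<N. \<Sum>q<N. if ?d p q then T k l p q else 0))"
    by (simp only: sum_distrib_left)
  finally have eq: "(\<Sum>p<N. \<Sum>q<N. if ?d p q then \<Sum>k<N. \<Sum>l<N. S k l * T k l p q else 0)
    = (\<Sum>k<N. \<Sum>l<N. S k l * (\<Sum>p<N. \<Sum>q<N. if ?d p q then T k l p q else 0))" .
  have gen: "(\<Sum>k<N. \<Sum>l<N. S k l * X k l) / n = (\<Sum>k<N. \<Sum>l<N. S k l * (X k l / n))" for X :: cmatr and n
    by (simp only: sum_divide_distrib times_divide_eq_right)
  show ?thesis unfolding toep_def eq by (rule gen)
qed

lemma ibpcoef_sum:
  "mmul N (mmul N G S) G b j * toepdev N G \<alpha> j i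
      + G b j * toep N (mmul N (mmul N (\<lambda>i j. cnj (G i j)) S) (\<lambda>i j. cnj (G i j))) j i
    = (\<Sum>k<N. \<Sum>l<N. S k l * ibpcoef N G \<alpha> b j i k l)"
proof -
  have m: "mmul N (mmul N (\<lambda>i j. cnj (G i j)) S) (\<lambda>i j. cnj (G i j)) = (\<lambda>p q. \<Sum>k<N. \<Sum>l<N. S k l * (cnj (G p k) * cnj (G l q)))"
    by (intro ext mmul3_sum)
  have gen: "(\<Sum>k<N. \<Sum>l<N. S k l * a k l) * t + g * (\<Sum>k<N. \<Sum>l<N. S k l * u k l)
    = (\<Sum>k<N. \<Sum>l<N. S k l * (a k l * t + g * u k l))" for a u :: cmatr and t g
    by (simp only: sum_distrib_left sum_distrib_right sum.distrib distrib_left mult_ac)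
  show ?thesis unfolding m toep_sum mmul3_sum gen ibpcoef_def ..
qed

lemma ibpkernel_sum:
  "ibpkernel N G \<alpha> P x y = (\<Sum>i<N. \<Sum>a<N. \<Sum>b<N. \<Sum>j<N. P i a *
     (\<Sum>k<N. \<Sum>l<N. symcov N x y a b * symcov N (- x) (- y) k l * ibpcoef N G \<alpha> b j i k l))"
  unfolding ibpkernel_def ibpcoef_sum sum_distrib_left by (simp only: mult_ac)

lemma toep_bound:
  assumes "N > 0" "\<And>k l. cmod (A k l) \<le> c" shows "cmod (toep N A i j) \<le> real N * c"
proof -
  have c0: "0 \<le> c" using assms(2)[of 0 0] norm_ge_zero order_trans by blast
  have "cmod (\<Sum>k<N. \<Sum>l<N. if int k - int l = int i - int j then A k l else 0) \<le> (\<Sum>k<N. \<Sum>l<N. c)"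
    by (intro order_trans[OF norm_sum] sum_mono) (use assms(2) c0 in auto)
  also have "\<dots> = real N * (real N * c)" by simp
  finally show ?thesis using assms(1) unfolding toep_def by (simp add: norm_divide field_simps)
qed

lemma toepdev_bound:
  assumes "N > 0" "\<And>k l. cmod (G k l) \<le> c" shows "cmod (toepdev N G \<alpha> i j) \<le> real N * c + cmod \<alpha>"
proof -
  have "cmod (toepdev N G \<alpha> i j) \<le> cmod (toep N (\<lambda>k l. cnj (G k l)) i j) + cmod (if i = j then cnj \<alpha> else 0)"
    unfolding toepdev_def by (rule norm_triangle_ineq4)
  also have "\<dots> \<le> real N * c + cmod \<alpha>"
    by (intro add_mono toep_bound assms) (use assms(2) in auto)
  finally show ?thesis .
qed

lemma ibpcoef_bound:
  assumes "N > 0" "\<And>k l. cmod (G k l) \<le> c"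
  shows "cmod (ibpcoef N G \<alpha> b j i k l) \<le> c * c * (real N * c + cmod \<alpha>) + c * (real N * (c * c))"
proof -
  have c0: "0 \<le> c" using assms(2)[of 0 0] norm_ge_zero order_trans by blast
  have "cmod (G b k * G l j * toepdev N G \<alpha> j i) \<le> c * c * (real N * c + cmod \<alpha>)"
    unfolding norm_mult using c0 by (intro mult_mono assms toepdev_bound) auto
  moreover have "cmod (G b j * toep N (\<lambda>p q. cnj (G p k) * cnj (G l q)) j i) \<le> c * (real N * (c * c))"
    unfolding norm_mult using c0
    by (intro mult_mono assms toep_bound) (auto simp: norm_mult intro!: mult_mono assms)
  ultimately show ?thesis unfolding ibpcoef_def by (rule norm_triangle_mono)
qed

lemma cnj_measurable: "g \<in> borel_measurable S \<Longrightarrow> (\<lambda>w. cnj (g w)) \<in> borel_measurable S"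
  by (rule measurable_compose[where g=cnj]) (auto intro!: borel_measurable_continuous_onI continuous_intros)

lemma measurable_if_const:
  "g \<in> borel_measurable S \<Longrightarrow> (\<lambda>w. if b then g w else (0::complex)) \<in> borel_measurable S"
  by (cases b) auto

lemma toep_measurable:
  assumes "\<And>k l. (\<lambda>w. A w k l) \<in> borel_measurable S" shows "(\<lambda>w. toep N (A w) i j) \<in> borel_measurable S"
  unfolding toep_def by (intro borel_measurable_divide borel_measurable_sum borel_measurable_const measurable_if_const assms)

lemma toepdev_measurable:
  assumes "\<And>k l. (\<lambda>w. G w k l) \<in> borel_measurable S" shows "(\<lambda>w. toepdev N (G w) \<alpha> i j) \<in> borel_measurable S"
  unfolding toepdev_def by (intro borel_measurable_diff toep_measurable cnj_measurable assms borel_measurable_const)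

lemma ibpcoef_measurable:
  assumes "\<And>k l. (\<lambda>w. G w k l) \<in> borel_measurable S" shows "(\<lambda>w. ibpcoef N (G w) \<alpha> b j i k l) \<in> borel_measurable S"
  unfolding ibpcoef_def
  by (intro borel_measurable_add borel_measurable_times toep_measurable toepdev_measurable cnj_measurable assms)

lemma isCont_if_const: "isCont g x \<Longrightarrow> isCont (\<lambda>y. if b then g y else (0::complex)) x"
  by (cases b) auto

lemma toep_isCont:
  assumes "\<And>k l. isCont (\<lambda>y. A y k l) (x::real)" shows "isCont (\<lambda>y. toep N (A y) i j) x"
  unfolding toep_def divide_inverse
  by (intro continuous_mult continuous_sum isCont_if_const assms continuous_const)

lemma ibpcoef_isCont:
  assumes "\<And>k l. isCont (\<lambda>y. G y k l) (x::real)" shows "isCont (\<lambda>y. ibpcoef N (G y) \<alpha> b j i k l) x"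
  unfolding ibpcoef_def toepdev_def
  by (intro continuous_add continuous_mult continuous_diff toep_isCont continuous_cnj assms continuous_const)

lemma has_vector_derivative_toepdev:
  assumes "\<And>k l. ((\<lambda>y. G y k l) has_vector_derivative G' k l) (at (x::real))"
  shows "((\<lambda>y. toepdev N (G y) \<alpha> j i) has_vector_derivative toep N (\<lambda>k l. cnj (G' k l)) j i) (at x)"
proof -
  have c: "((\<lambda>y. cnj (G y k l)) has_vector_derivative cnj (G' k l)) (at x)" for k l
    using assms by (rule has_vector_derivative_cnj)
  have i: "((\<lambda>y. if b then cnj (G y k l) else 0) has_vector_derivative (if b then cnj (G' k l) else 0)) (at x)" for b k l
    using c by (cases b) auto
  have "((\<lambda>y. toep N (\<lambda>k l. cnj (G y k l)) j i - (if j = i then cnj \<alpha> else 0)) has_vector_derivative toep N (\<lambda>k l. cnj (G' k l)) j i - 0) (at x)"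
    unfolding toep_def divide_inverse
    by (intro has_vector_derivative_diff has_vector_derivative_mult_left has_vector_derivative_sum i has_vector_derivative_const)
  then show ?thesis unfolding toepdev_def by simp
qed

lemma toep_uminus_sum:
  "toep N (\<lambda>p q. cnj (- (\<Sum>k<N. \<Sum>l<N. G p k * cx (C k l) * G l q))) j i
    = - (\<Sum>k<N. \<Sum>l<N. cx (C k l) * toep N (\<lambda>p q. cnj (G p k) * cnj (G l q)) j i)"
proof -
  have eq: "(\<lambda>p q. cnj (- (\<Sum>k<N. \<Sum>l<N. G p k * cx (C k l) * G l q)))
    = (\<lambda>p q. \<Sum>k<N. \<Sum>l<N. (- cx (C k l)) * (cnj (G p k) * cnj (G l q)))"
    by (simp add: sum_negf mult_ac)
  show ?thesis unfolding eq toep_sum by (simp only: mult_minus_left sum_negf)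
qed

text \<open>Product rule, with the derivative \<open>- G C G\<close> for \<open>G\<close> and its
  averaged conjugate for the test matrix; conjugation is harmless because the line is real. The pair
  of conclusions is what \<open>gaussian_ibp\<close> asks for along lines.\<close>

lemma has_vector_derivative_ibp:
  assumes eta: "\<eta> > 0" and sH: "\<And>i j. i < N \<Longrightarrow> j < N \<Longrightarrow> H i j = H j i" and sC: "\<And>i j. i < N \<Longrightarrow> j < N \<Longrightarrow> C i j = C j i"
  defines "G \<equiv> \<lambda>y. resolv N \<eta> (\<lambda>i j. H i j + y * C i j)"
  shows "((\<lambda>y. G y b j * toepdev N (G y) \<alpha> j i) has_vector_derivative
     - (\<Sum>k<N. \<Sum>l<N. cx (C k l) * ibpcoef N (G x) \<alpha> b j i k l)) (at x)"
    and "isCont (\<lambda>y. - (\<Sum>k<N. \<Sum>l<N. cx (C k l) * ibpcoef N (G y) \<alpha> b j i k l)) x"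
proof -
  let ?G' = "\<lambda>p q. - (\<Sum>k<N. \<Sum>l<N. G x p k * cx (C k l) * G x l q)"
  have d: "((\<lambda>y. G y p q) has_vector_derivative ?G' p q) (at x)" for p q
    unfolding G_def using sH sC eta by (intro resolv_line_derivative) auto
  have c: "isCont (\<lambda>y. G y p q) x" for p q
    unfolding G_def using sH sC eta by (intro resolv_line_isCont) auto
  have gen: "g * - (\<Sum>k<N. \<Sum>l<N. cx (C k l) * u k l) + - (\<Sum>k<N. \<Sum>l<N. a k * cx (C k l) * b l) * t
    = - (\<Sum>k<N. \<Sum>l<N. cx (C k l) * (a k * b l * t + g * u k l))" for g t a b and u :: cmatr
    by (simp only: sum_distrib_left sum_distrib_right sum.distrib distrib_left mult_ac mult_minus_right mult_minus_left add.commute minus_add_distrib)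
  have "((\<lambda>y. G y b j * toepdev N (G y) \<alpha> j i) has_vector_derivative
     G x b j * toep N (\<lambda>p q. cnj (?G' p q)) j i + ?G' b j * toepdev N (G x) \<alpha> j i) (at x)"
    by (intro has_vector_derivative_mult d has_vector_derivative_toepdev)
  then show "((\<lambda>y. G y b j * toepdev N (G y) \<alpha> j i) has_vector_derivative
     - (\<Sum>k<N. \<Sum>l<N. cx (C k l) * ibpcoef N (G x) \<alpha> b j i k l)) (at x)"
    unfolding toep_uminus_sum gen ibpcoef_def .
  show "isCont (\<lambda>y. - (\<Sum>k<N. \<Sum>l<N. cx (C k l) * ibpcoef N (G y) \<alpha> b j i k l)) x"
    by (intro continuous_minus continuous_sum continuous_mult continuous_const ibpcoef_isCont c)
qed

section \<open>The defect of the resolvent vanishes\<close>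

text \<open>\<open>w\<close> takes arbitrary values at ordered pairs, so the two entries are
  averaged to make the matrix symmetric for every \<open>w\<close>; at the actual entries, which are
  already symmetric, it is \<open>W / sqrt N\<close>.\<close>

definition Hmat :: "nat \<Rightarrow> (nat \<times> nat \<Rightarrow> real) \<Rightarrow> nat \<Rightarrow> nat \<Rightarrow> real" where
  "Hmat N w i j = (w (i, j) + w (j, i)) / (2 * sqrt (real N))"

lemma Hmat_sym: "Hmat N w i j = Hmat N w j i"
  by (simp add: Hmat_def add.commute)

lemma resolv_Hmat_cong:
  "(\<And>p. p \<in> {..<N} \<times> {..<N} \<Longrightarrow> w p = w' p) \<Longrightarrow> resolv N \<eta> (Hmat N w) = resolv N \<eta> (Hmat N w')"
  by (rule resolv_cong) (simp add: Hmat_def)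

lemma symcov_prod:
  assumes "N > 0"
  shows "of_nat N * of_nat N * (symcov N x y a b * symcov N (- x) (- y) c d)
    = cis (real_of_int (int a - int c) * x + real_of_int (int b - int d) * y)
    + cis (real_of_int (int a - int d) * x + real_of_int (int b - int c) * y)
    + cis (real_of_int (int b - int c) * x + real_of_int (int a - int d) * y)
    + cis (real_of_int (int b - int d) * x + real_of_int (int a - int c) * y)"
proof -
  define u where "u k l = cis (real_of_int (int k - int l) * x)" for k l
  define v where "v k l = cis (real_of_int (int k - int l) * y)" for k l
  have pu: "pwave N x k * pwave N (- x) l = u k l / of_nat N" for k l unfolding u_def by (rule pwave_diff[OF assms])
  have pv: "pwave N y k * pwave N (- y) l = v k l / of_nat N" for k l unfolding v_def by (rule pwave_diff[OF assms])
  have uv: "cis (real_of_int (int k - int l) * x + real_of_int (int m - int n) * y) = u k l * v m n" for k l m n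
    unfolding u_def v_def cis_mult ..
  have "symcov N x y a b * symcov N (- x) (- y) c d
    = (pwave N x a * pwave N (- x) c) * (pwave N y b * pwave N (- y) d) + (pwave N x a * pwave N (- x) d) * (pwave N y b * pwave N (- y) c)
    + ((pwave N x b * pwave N (- x) c) * (pwave N y a * pwave N (- y) d) + (pwave N x b * pwave N (- x) d) * (pwave N y a * pwave N (- y) c))"
    unfolding symcov_def by (simp only: distrib_left distrib_right mult_ac add_ac)
  also have "\<dots> = (u a c * v b d + u a d * v b c + u b c * v a d + u b d * v a c) / (of_nat N * of_nat N)"
    unfolding pu pv by (simp add: add_divide_distrib)
  finally show ?thesis unfolding uv using assms by simp
qed

locale gaussian_matrix = prob_space M for M :: "'a measure" +
  fixes X :: "int \<Rightarrow> int \<Rightarrow> 'a \<Rightarrow> real" and \<nu> :: "(real \<times> real) measure"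
  assumes Xm[measurable]: "\<And>j k. X j k \<in> borel_measurable M"
    and gf: "centered_gaussian_field M X" and sm: "is_spectral_measure M X \<nu>"
begin

definition W :: "nat \<times> nat \<Rightarrow> 'a \<Rightarrow> real" where
  "W p \<omega> = X (int (fst p) + 1) (int (snd p) + 1) \<omega> + X (int (snd p) + 1) (int (fst p) + 1) \<omega>"

lemma W_meas[measurable]: "W p \<in> borel_measurable M"
  unfolding W_def by measurable

lemma W_swap: "W (k, l) = W (l, k)"
  by (intro ext) (simp add: W_def add.commute)

lemma finite_nu: "finite_measure \<nu>" and sets_spec: "sets \<nu> = sets borel"
  using sm unfolding is_spectral_measure_def by auto

lemma integrable_cis_nu: "integrable \<nu> (\<lambda>z. cis (a * fst z + b * snd z))"
proof -
  interpret nu: finite_measure \<nu> by (rule finite_nu)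
  have "(\<lambda>z. cis (a * fst z + b * snd z)) \<in> borel_measurable (borel :: (real \<times> real) measure)"
    by (intro borel_measurable_continuous_onI continuous_intros)
  then have m: "(\<lambda>z. cis (a * fst z + b * snd z)) \<in> borel_measurable \<nu>"
    by (simp add: measurable_cong_sets[OF sets_spec refl])
  show ?thesis by (rule nu.integrable_const_bound[where B=1]) (use m in auto)
qed

lemma gaussian_X: "centered_gaussian_rv M (X j k)"
proof -
  have "centered_gaussian_rv M (\<lambda>\<omega>. \<Sum>p\<in>{(j, k)}. 1 * X (fst p) (snd p) \<omega>)"
    by (rule gf[unfolded centered_gaussian_field_def, rule_format]) simp
  then show ?thesis by simp
qed

lemma integrable_XX: "integrable M (\<lambda>\<omega>. X j k \<omega> * X j' k' \<omega>)"
proof (rule Bochner_Integration.integrable_bound)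
  show "integrable M (\<lambda>\<omega>. (X j k \<omega>)^2 + (X j' k' \<omega>)^2)"
    using centered_gaussian_rv_facts(1)[OF prob_space_axioms gaussian_X]
    by (intro Bochner_Integration.integrable_add) auto
  have "\<bar>x * y\<bar> \<le> x^2 + y^2" for x y :: real
  proof -
    have "0 \<le> \<bar>x\<bar> * \<bar>y\<bar>" by simp
    then show ?thesis using sum_squares_bound[of "\<bar>x\<bar>" "\<bar>y\<bar>"] unfolding abs_mult power2_abs by linarith
  qed
  then show "AE \<omega> in M. norm (X j k \<omega> * X j' k' \<omega>) \<le> norm ((X j k \<omega>)^2 + (X j' k' \<omega>)^2)"
    by simp
qed measurable

lemma cov_X: "cx (\<integral>\<omega>. X j k \<omega> * X j' k' \<omega> \<partial>M)
    = (\<integral>z. cis (real_of_int (j' - j) * fst z + real_of_int (k' - k) * snd z) \<partial>\<nu>)"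
proof -
  have "cx (expectation (\<lambda>\<omega>. X j k \<omega> * X (j + (j' - j)) (k + (k' - k)) \<omega>)) =
        (\<integral>z. cis (real_of_int (j' - j) * fst z + real_of_int (k' - k) * snd z) \<partial>\<nu>)"
    using sm[unfolded is_spectral_measure_def] by (elim conjE) (erule allE[where x=j], erule allE[where x=k], erule allE[where x="j' - j"], erule allE[where x="k' - k"])
  then show ?thesis by simp
qed

lemma integrable_symcov:
  assumes "N > 0"
  shows "integrable \<nu> (\<lambda>z. symcov N (fst z) (snd z) a b * symcov N (- fst z) (- snd z) c d)"
proof -
  have e: "symcov N (fst z) (snd z) a b * symcov N (- fst z) (- snd z) c d
    = (cis (real_of_int (int a - int c) * fst z + real_of_int (int b - int d) * snd z)
    + cis (real_of_int (int a - int d) * fst z + real_of_int (int b - int c) * snd z)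
    + cis (real_of_int (int b - int c) * fst z + real_of_int (int a - int d) * snd z)
    + cis (real_of_int (int b - int d) * fst z + real_of_int (int a - int c) * snd z)) / (of_nat N * of_nat N)" for z
    unfolding symcov_prod[OF assms, symmetric] using assms by simp
  show ?thesis unfolding e
    by (intro integrable_divide_zero impI Bochner_Integration.integrable_add integrable_cis_nu)
qed

text \<open>Each entry is a sum of two variables. The resulting four covariances match the four
  products of plane waves in the two factors \<open>symcov\<close>, and \<open>N^2\<close> undoes
  the normalisation of four plane waves.\<close>

lemma cov_W:
  assumes "N > 0"
  shows "cx (\<integral>\<omega>. W (a, b) \<omega> * W (c, d) \<omega> \<partial>M)
    = of_nat N * of_nat N * (\<integral>z. symcov N (fst z) (snd z) a b * symcov N (- fst z) (- snd z) c d \<partial>\<nu>)"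
proof -
  let ?X = "\<lambda>i j. X (int i + 1) (int j + 1)"
  let ?c = "\<lambda>i j k l. \<integral>z. cis (real_of_int (int k - int i) * fst z + real_of_int (int l - int j) * snd z) \<partial>\<nu>"
  have cx: "cx (\<integral>\<omega>. ?X i j \<omega> * ?X k l \<omega> \<partial>M) = ?c i j k l" for i j k l
    using cov_X[of "int i + 1" "int j + 1" "int k + 1" "int l + 1"] by simp
  have "W (a, b) \<omega> * W (c, d) \<omega> = ?X c d \<omega> * ?X a b \<omega> + ?X d c \<omega> * ?X a b \<omega> + ?X c d \<omega> * ?X b a \<omega> + ?X d c \<omega> * ?X b a \<omega>" for \<omega>
    by (simp add: W_def algebra_simps)
  then have "(\<integral>\<omega>. W (a, b) \<omega> * W (c, d) \<omega> \<partial>M)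
     = (\<integral>\<omega>. ?X c d \<omega> * ?X a b \<omega> \<partial>M) + (\<integral>\<omega>. ?X d c \<omega> * ?X a b \<omega> \<partial>M) + (\<integral>\<omega>. ?X c d \<omega> * ?X b a \<omega> \<partial>M) + (\<integral>\<omega>. ?X d c \<omega> * ?X b a \<omega> \<partial>M)"
    by (simp add: Bochner_Integration.integral_add Bochner_Integration.integrable_add integrable_XX)
  then have "cx (\<integral>\<omega>. W (a, b) \<omega> * W (c, d) \<omega> \<partial>M) = ?c c d a b + ?c d c a b + ?c c d b a + ?c d c b a"
    by (simp only: of_real_add cx)
  also have "\<dots> = (\<integral>z. of_nat N * of_nat N * (symcov N (fst z) (snd z) a b * symcov N (- fst z) (- snd z) c d) \<partial>\<nu>)"
    unfolding symcov_prod[OF assms]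
    by (simp add: Bochner_Integration.integral_add Bochner_Integration.integrable_add integrable_cis_nu del: of_int_diff)
  finally show ?thesis by simp
qed

lemma gaussian_W: "centered_gaussian_rv M (\<lambda>\<omega>. \<Sum>p\<in>{..<N} \<times> {..<N}. c p * W p \<omega>)"
proof -
  let ?S = "{1..int N} \<times> {1..int N}"
  define e where "e q = c (nat (fst q - 1), nat (snd q - 1)) + c (nat (snd q - 1), nat (fst q - 1))" for q :: "int \<times> int"
  have 1: "(\<Sum>p\<in>{..<N} \<times> {..<N}. c p * X (int (fst p) + 1) (int (snd p) + 1) \<omega>)
     = (\<Sum>q\<in>?S. c (nat (fst q - 1), nat (snd q - 1)) * X (fst q) (snd q) \<omega>)" for \<omega>
    by (rule sum.reindex_bij_witness[where i="\<lambda>q. (nat (fst q - 1), nat (snd q - 1))" and j="\<lambda>p. (int (fst p) + 1, int (snd p) + 1)"]) auto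
  have 2: "(\<Sum>p\<in>{..<N} \<times> {..<N}. c p * X (int (snd p) + 1) (int (fst p) + 1) \<omega>)
     = (\<Sum>q\<in>?S. c (nat (snd q - 1), nat (fst q - 1)) * X (fst q) (snd q) \<omega>)" for \<omega>
    by (rule sum.reindex_bij_witness[where i="\<lambda>q. (nat (snd q - 1), nat (fst q - 1))" and j="\<lambda>p. (int (snd p) + 1, int (fst p) + 1)"]) auto
  have "(\<Sum>p\<in>{..<N} \<times> {..<N}. c p * W p \<omega>) = (\<Sum>q\<in>?S. e q * X (fst q) (snd q) \<omega>)" for \<omega>
    unfolding W_def distrib_left sum.distrib 1 2 e_def distrib_right ..
  moreover have "centered_gaussian_rv M (\<lambda>\<omega>. \<Sum>q\<in>?S. e q * X (fst q) (snd q) \<omega>)"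
    by (rule gf[unfolded centered_gaussian_field_def, rule_format]) simp
  ultimately show ?thesis by simp
qed

definition Gm :: "nat \<Rightarrow> real \<Rightarrow> 'a \<Rightarrow> cmatr" where
  "Gm N \<eta> \<omega> = resolv N \<eta> (Hmat N (\<lambda>p. W p \<omega>))"

lemma Gm_measurable: "(\<lambda>\<omega>. Gm N \<eta> \<omega> i j) \<in> borel_measurable M"
  unfolding Gm_def by (rule resolv_measurable) (simp add: Hmat_def)

lemma Gm_facts:
  assumes "\<eta> > 0"
  shows "opb N (1 / \<eta>) (Gm N \<eta> \<omega>)" "Gm N \<eta> \<omega> i j = Gm N \<eta> \<omega> j i" "cmod (Gm N \<eta> \<omega> i j) \<le> 1 / \<eta>"
  unfolding Gm_def using assms Hmat_sym by (auto intro!: resolv_opb resolv_entry_le resolv_sym)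

text \<open>The directional derivative of \<open>gaussian_ibp\<close> for the coordinate
  \<open>(a, b)\<close>: the direction is the covariance vector of \<open>W (a, b)\<close>, made
  into a matrix by \<open>Hmat\<close>.\<close>

definition Phi :: "nat \<Rightarrow> real \<Rightarrow> complex \<Rightarrow> nat \<Rightarrow> nat \<Rightarrow> nat \<Rightarrow> nat \<Rightarrow> 'a \<Rightarrow> complex" where
  "Phi N \<eta> \<alpha> a b j i \<omega> = - (\<Sum>k<N. \<Sum>l<N. cx (Hmat N (\<lambda>p. \<integral>\<omega>. W (a, b) \<omega> * W p \<omega> \<partial>M) k l)
     * ibpcoef N (Gm N \<eta> \<omega>) \<alpha> b j i k l)"

lemma ibp_entry:
  assumes N: "N > 0" and eta: "\<eta> > 0" and a: "a < N" "b < N"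
  shows "integrable M (\<lambda>\<omega>. W (a, b) \<omega> *\<^sub>R (Gm N \<eta> \<omega> b j * toepdev N (Gm N \<eta> \<omega>) \<alpha> j i))"
    and "(\<integral>\<omega>. W (a, b) \<omega> *\<^sub>R (Gm N \<eta> \<omega> b j * toepdev N (Gm N \<eta> \<omega>) \<alpha> j i) \<partial>M) = (\<integral>\<omega>. Phi N \<eta> \<alpha> a b j i \<omega> \<partial>M)"
    and "integrable M (Phi N \<eta> \<alpha> a b j i)"
proof -
  let ?I = "{..<N} \<times> {..<N}"
  define C where "C p = (\<integral>\<omega>. W (a, b) \<omega> * W p \<omega> \<partial>M)" for p
  define G where "G w = resolv N \<eta> (Hmat N w)" for w
  define F where "F w = G w b j * toepdev N (G w) \<alpha> j i" for w
  define F' where "F' w = - (\<Sum>k<N. \<Sum>l<N. cx (Hmat N C k l) * ibpcoef N (G w) \<alpha> b j i k l)" for w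
  have Gb: "cmod (G w k l) \<le> 1 / \<eta>" for w k l
    unfolding G_def using eta Hmat_sym by (intro resolv_entry_le) auto
  have Gme: "(\<lambda>w. G w k l) \<in> borel_measurable (PiM ?I (\<lambda>_. borel))" for k l
    unfolding G_def
  proof (rule resolv_measurable)
    fix i j assume "i < N" "j < N"
    then have "(i, j) \<in> ?I" "(j, i) \<in> ?I" by auto
    then have "(\<lambda>w. w (i, j)) \<in> borel_measurable (PiM ?I (\<lambda>_. borel))" "(\<lambda>w. w (j, i)) \<in> borel_measurable (PiM ?I (\<lambda>_. borel))"
      by (auto intro: measurable_component_singleton)
    then show "(\<lambda>w. Hmat N w i j) \<in> borel_measurable (PiM ?I (\<lambda>_. borel))"
      unfolding Hmat_def by (intro borel_measurable_divide borel_measurable_add borel_measurable_const)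
  qed
  \<comment> \<open>The bounds \<open>c1\<close> and \<open>K\<close> may grow with
    \<open>N\<close>; they serve to make the integration by parts legitimate at fixed
    \<open>N\<close>.\<close>
  define c1 where "c1 = 1 / \<eta> * (1 / \<eta>) * (real N * (1 / \<eta>) + cmod \<alpha>) + 1 / \<eta> * (real N * (1 / \<eta> * (1 / \<eta>)))"
  define K where "K = max (1 / \<eta> * (real N * (1 / \<eta>) + cmod \<alpha>)) (\<Sum>k<N. \<Sum>l<N. \<bar>Hmat N C k l\<bar> * c1)"
  have Fb: "norm (F w) \<le> K" for w
  proof -
    have "norm (F w) \<le> 1 / \<eta> * (real N * (1 / \<eta>) + cmod \<alpha>)"
      unfolding F_def norm_mult using eta by (intro mult_mono Gb toepdev_bound N) auto
    then show ?thesis by (simp add: K_def)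
  qed
  have F'b: "norm (F' w) \<le> K" for w
  proof -
    have "cmod (cx (Hmat N C k l) * ibpcoef N (G w) \<alpha> b j i k l) \<le> \<bar>Hmat N C k l\<bar> * c1" for k l
      unfolding norm_mult norm_of_real c1_def by (intro mult_left_mono ibpcoef_bound N Gb) simp
    then have "norm (F' w) \<le> (\<Sum>k<N. \<Sum>l<N. \<bar>Hmat N C k l\<bar> * c1)"
      unfolding F'_def norm_minus_cancel by (intro order_trans[OF norm_sum] sum_mono)
    then show ?thesis by (simp add: K_def)
  qed
  have restr: "G (\<lambda>p\<in>?I. w p) = G w" for w
    unfolding G_def by (rule resolv_Hmat_cong) simp
  have line: "G (\<lambda>p\<in>?I. w p + y * C p) = resolv N \<eta> (\<lambda>i j. Hmat N w i j + y * Hmat N C i j)" for w y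
    unfolding restr unfolding G_def by (rule resolv_cong) (simp add: Hmat_def add_divide_distrib distrib_left)
  have HG: "G (\<lambda>p. W p \<omega>) = Gm N \<eta> \<omega>" for \<omega> unfolding G_def Gm_def ..
  have FW: "F (\<lambda>p\<in>?I. W p \<omega>) = Gm N \<eta> \<omega> b j * toepdev N (Gm N \<eta> \<omega>) \<alpha> j i" for \<omega>
    unfolding F_def restr HG ..
  have F'W: "F' (\<lambda>p\<in>?I. W p \<omega>) = Phi N \<eta> \<alpha> a b j i \<omega>" for \<omega>
    unfolding F'_def restr HG Phi_def C_def ..
  have Fm: "F \<in> borel_measurable (PiM ?I (\<lambda>_. borel))" "F' \<in> borel_measurable (PiM ?I (\<lambda>_. borel))"
    unfolding F_def F'_def
    by (intro borel_measurable_uminus borel_measurable_sum borel_measurable_times borel_measurable_const Gme toepdev_measurable ibpcoef_measurable)+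
  have d: "((\<lambda>y. F (\<lambda>i\<in>?I. w i + y * C i)) has_vector_derivative F' (\<lambda>i\<in>?I. w i + y * C i)) (at y)" for w y
    unfolding F_def F'_def line by (rule has_vector_derivative_ibp(1)[OF eta Hmat_sym Hmat_sym])
  have cn: "continuous_on UNIV (\<lambda>y. F' (\<lambda>i\<in>?I. w i + y * C i))" for w
    unfolding F'_def line by (intro continuous_at_imp_continuous_on ballI has_vector_derivative_ibp(2)[OF eta Hmat_sym Hmat_sym])
  note R = gaussian_ibp[where M=M and I="?I" and W=W and a="(a, b)" and C=C and F=F and F'=F' and K=K,
      OF prob_space_axioms _ W_meas gaussian_W _ _ Fm Fb F'b d cn, unfolded FW F'W]
  show "integrable M (\<lambda>\<omega>. W (a, b) \<omega> *\<^sub>R (Gm N \<eta> \<omega> b j * toepdev N (Gm N \<eta> \<omega>) \<alpha> j i))"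
    by (rule R(1)) (use a in \<open>auto simp: C_def\<close>)
  show "(\<integral>\<omega>. W (a, b) \<omega> *\<^sub>R (Gm N \<eta> \<omega> b j * toepdev N (Gm N \<eta> \<omega>) \<alpha> j i) \<partial>M) = (\<integral>\<omega>. Phi N \<eta> \<alpha> a b j i \<omega> \<partial>M)"
    by (rule R(2)) (use a in \<open>auto simp: C_def\<close>)
  show "integrable M (Phi N \<eta> \<alpha> a b j i)"
  proof (rule integrable_const_bound[where B=K])
    show "AE \<omega> in M. norm (Phi N \<eta> \<alpha> a b j i \<omega>) \<le> K" using F'b unfolding F'W[symmetric] by simp
    show "Phi N \<eta> \<alpha> a b j i \<in> borel_measurable M"
      unfolding Phi_def[abs_def]
      by (intro borel_measurable_uminus borel_measurable_sum borel_measurable_times borel_measurable_const ibpcoef_measurable Gm_measurable)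
  qed
qed

lemma integral_ibpkernel_nu:
  assumes "N > 0"
  shows "(\<integral>z. ibpkernel N G \<alpha> P (fst z) (snd z) \<partial>\<nu>) = (\<Sum>i<N. \<Sum>a<N. \<Sum>b<N. \<Sum>j<N. P i a *
     (\<Sum>k<N. \<Sum>l<N. (\<integral>z. symcov N (fst z) (snd z) a b * symcov N (- fst z) (- snd z) k l \<partial>\<nu>) * ibpcoef N G \<alpha> b j i k l))"
  unfolding ibpkernel_sum
proof ((subst Bochner_Integration.integral_sum, (intro Bochner_Integration.integrable_sum integrable_mult_right integrable_mult_left integrable_symcov assms)[1], rule sum.cong[OF refl])+)
  fix i a b j
  show "(\<integral>z. P i a * (\<Sum>k<N. \<Sum>l<N. symcov N (fst z) (snd z) a b * symcov N (- fst z) (- snd z) k l * ibpcoef N G \<alpha> b j i k l) \<partial>\<nu>)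
    = P i a * (\<Sum>k<N. \<Sum>l<N. (\<integral>z. symcov N (fst z) (snd z) a b * symcov N (- fst z) (- snd z) k l \<partial>\<nu>) * ibpcoef N G \<alpha> b j i k l)"
    unfolding integral_mult_right_zero
    by (subst Bochner_Integration.integral_sum, (intro Bochner_Integration.integrable_sum integrable_mult_left integrable_symcov assms)[1],
        rule arg_cong[where f="\<lambda>x. P i a * x"], rule sum.cong[OF refl],
        subst Bochner_Integration.integral_sum, (intro integrable_mult_left integrable_symcov assms)[1],
        simp only: integral_mult_left_zero)
qed

text \<open>The scaling is exact: \<open>1 / sqrt N\<close> from the matrix, another from the
  direction of differentiation, \<open>N^2\<close> from the covariance and \<open>1 / N\<close> from
  the normalised trace multiply to 1. The derivative of the resolvent supplies the minus sign that
  brings the kernel to the same side.\<close>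

lemma trace_ibp:
  fixes P :: cmatr and \<alpha> :: complex
  assumes N: "N > 0" and eta: "\<eta> > 0"
  defines "T \<equiv> \<lambda>\<omega>. tr N (mmul N P (mmul N (mmul N (\<lambda>i j. cx (Hmat N (\<lambda>p. W p \<omega>) i j)) (Gm N \<eta> \<omega>)) (toepdev N (Gm N \<eta> \<omega>) \<alpha>))) / of_nat N
      + (\<integral>z. ibpkernel N (Gm N \<eta> \<omega>) \<alpha> P (fst z) (snd z) \<partial>\<nu>)"
  shows "integrable M T" "(\<integral>\<omega>. T \<omega> \<partial>M) = 0"
proof -
  define s where "s = cx (sqrt (real N))"
  have ss: "s * s = of_nat N" unfolding s_def using N by (simp flip: of_real_mult)
  have s0: "s \<noteq> 0" using N by (simp add: s_def)
  define V where "V a b j i \<omega> = W (a, b) \<omega> *\<^sub>R (Gm N \<eta> \<omega> b j * toepdev N (Gm N \<eta> \<omega>) \<alpha> j i)" for a b j i \<omega>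
  have HW: "cx (Hmat N (\<lambda>p. W p \<omega>) a b) = cx (W (a, b) \<omega>) / s" for a b \<omega>
    unfolding Hmat_def s_def using W_swap[of a b] by simp
  have t: "tr N (mmul N P (mmul N (mmul N (\<lambda>i j. cx (Hmat N (\<lambda>p. W p \<omega>) i j)) (Gm N \<eta> \<omega>)) (toepdev N (Gm N \<eta> \<omega>) \<alpha>)))
    = (\<Sum>i<N. \<Sum>a<N. \<Sum>b<N. \<Sum>j<N. P i a / s * V a b j i \<omega>)" for \<omega>
  proof -
    have "tr N (mmul N P (mmul N (mmul N H G) B)) = (\<Sum>i<N. \<Sum>a<N. \<Sum>b<N. \<Sum>j<N. P i a * (H a b * (G b j * B j i)))" for H G B
      unfolding mmul_assoc unfolding tr_def mmul_def sum_distrib_left ..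
    then show ?thesis unfolding HW V_def scaleR_conv_of_real by (simp add: mult_ac)
  qed
  have k: "(\<integral>z. ibpkernel N (Gm N \<eta> \<omega>) \<alpha> P (fst z) (snd z) \<partial>\<nu>)
    = - (\<Sum>i<N. \<Sum>a<N. \<Sum>b<N. \<Sum>j<N. P i a / s * Phi N \<eta> \<alpha> a b j i \<omega>) / of_nat N" for \<omega>
  proof -
    define Y where "Y a b k l = (\<integral>z. symcov N (fst z) (snd z) a b * symcov N (- fst z) (- snd z) k l \<partial>\<nu>)" for a b k l
    have HC: "cx (Hmat N (\<lambda>p. \<integral>\<omega>. W (a, b) \<omega> * W p \<omega> \<partial>M) k l) = of_nat N * of_nat N * Y a b k l / s" for a b k l
    proof -
      have "cx (Hmat N (\<lambda>p. \<integral>\<omega>. W (a, b) \<omega> * W p \<omega> \<partial>M) k l) = cx (\<integral>\<omega>. W (a, b) \<omega> * W (k, l) \<omega> \<partial>M) / s"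
        unfolding Hmat_def s_def W_swap[of l k] by simp
      then show ?thesis unfolding cov_W[OF N] Y_def .
    qed
    have Ph: "Phi N \<eta> \<alpha> a b j i \<omega> = - (of_nat N * of_nat N / s) * (\<Sum>k<N. \<Sum>l<N. Y a b k l * ibpcoef N (Gm N \<eta> \<omega>) \<alpha> b j i k l)" for a b j i
      unfolding Phi_def HC by (simp add: sum_distrib_left mult_ac sum_negf)
    have gen: "- (p / s * (- (n * n / s) * y)) / n = p * y" if "s * s = n" "n \<noteq> 0" for p y n :: complex
      using that s0 by (simp add: field_simps)
    have g: "- (P i a / s * Phi N \<eta> \<alpha> a b j i \<omega>) / of_nat N = P i a * (\<Sum>k<N. \<Sum>l<N. Y a b k l * ibpcoef N (Gm N \<eta> \<omega>) \<alpha> b j i k l)" for i a b j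
      unfolding Ph by (rule gen[OF ss]) (use N in simp)
    have "- (\<Sum>i<N. \<Sum>a<N. \<Sum>b<N. \<Sum>j<N. P i a / s * Phi N \<eta> \<alpha> a b j i \<omega>) / of_nat N
      = (\<Sum>i<N. \<Sum>a<N. \<Sum>b<N. \<Sum>j<N. - (P i a / s * Phi N \<eta> \<alpha> a b j i \<omega>) / of_nat N)"
      by (simp only: sum_negf[symmetric] sum_divide_distrib)
    then show ?thesis unfolding integral_ibpkernel_nu[OF N] g Y_def by simp
  qed
  have T: "T \<omega> = (\<Sum>i<N. \<Sum>a<N. \<Sum>b<N. \<Sum>j<N. P i a / s * (V a b j i \<omega> - Phi N \<eta> \<alpha> a b j i \<omega>)) / of_nat N" for \<omega>
    unfolding T_def t k by (simp only: right_diff_distrib sum_subtractf diff_divide_distrib minus_divide_left[symmetric] add_uminus_conv_diff)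
  have iD: "integrable M (\<lambda>\<omega>. V a b j i \<omega> - Phi N \<eta> \<alpha> a b j i \<omega>)" "(\<integral>\<omega>. V a b j i \<omega> - Phi N \<eta> \<alpha> a b j i \<omega> \<partial>M) = 0"
    if "a < N" "b < N" for a b j i
    using ibp_entry[OF N eta that, where j=j and \<alpha>=\<alpha> and i=i] unfolding V_def by (auto simp: Bochner_Integration.integral_diff)
  show "integrable M T" unfolding T[abs_def]
    by (intro integrable_divide_zero impI Bochner_Integration.integrable_sum integrable_mult_right iD) auto
  have "(\<integral>\<omega>. T \<omega> \<partial>M) = (\<integral>\<omega>. (\<Sum>i<N. \<Sum>a<N. \<Sum>b<N. \<Sum>j<N. P i a / s * (V a b j i \<omega> - Phi N \<eta> \<alpha> a b j i \<omega>)) \<partial>M) / of_nat N"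
    unfolding T by (rule integral_divide_zero)
  also have "(\<integral>\<omega>. (\<Sum>i<N. \<Sum>a<N. \<Sum>b<N. \<Sum>j<N. P i a / s * (V a b j i \<omega> - Phi N \<eta> \<alpha> a b j i \<omega>)) \<partial>M)
    = (\<Sum>i<N. \<Sum>a<N. \<Sum>b<N. \<Sum>j<N. \<integral>\<omega>. P i a / s * (V a b j i \<omega> - Phi N \<eta> \<alpha> a b j i \<omega>) \<partial>M)"
    by ((subst Bochner_Integration.integral_sum, (intro Bochner_Integration.integrable_sum integrable_mult_right iD; simp)[1], rule sum.cong[OF refl])+) simp
  also have "\<dots> = 0"
    by (intro sum.neutral ballI) (simp only: integral_mult_right_zero iD(2) lessThan_iff mult_zero_right)
  finally show "(\<integral>\<omega>. T \<omega> \<partial>M) = 0" by simp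
qed

end

text \<open>Represents the diagonal \<open>m\<close> by a pair of indices, one of which is 0, so
  that bounds and measurability of matrix entries apply to the coefficients.\<close>

lemma toepcoef_eq: "toepcoef N G \<alpha> m = toepdev N G \<alpha> (nat m) (nat (- m))"
proof -
  have "int (nat m) - int (nat (- m)) = m" by (cases "m \<ge> 0") auto
  then show ?thesis by (simp add: toepdev_eq)
qed

lemma defect_measurable:
  assumes "\<And>k l. (\<lambda>w. G w k l) \<in> borel_measurable S"
  shows "(\<lambda>w. defect N (G w) \<alpha>) \<in> borel_measurable S"
  unfolding defect_def toepcoef_eq
  by (intro borel_measurable_sum borel_measurable_power measurable_compose[OF _ borel_measurable_norm] toepdev_measurable assms)

lemma defect_bound:
  assumes "N > 0" "\<And>k l. cmod (G k l) \<le> c"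
  shows "defect N G \<alpha> \<le> (\<Sum>m\<in>{-int N<..<int N}. (real N * c + cmod \<alpha>)^2)"
  unfolding defect_def toepcoef_eq by (intro sum_mono power_mono toepdev_bound assms) auto

text \<open>With \<open>H G = 1 + \<i> \<eta> G\<close>, the quadratic equation divided by
  \<open>\<alpha>\<close> reads \<open>\<i> \<eta> + \<gamma> \<alpha> = - 1 / \<alpha>\<close>. The
  combination on the left is therefore a multiple of \<open>G - \<alpha>\<close>, whose trace
  against the test matrix is known from \<open>tr_toepdev\<close>.\<close>

lemma tr_mmul_resolvent_toepdev:
  assumes N: "N > 0" and eta: "\<eta> > 0" and sH: "\<And>i j. H i j = H j i"
    and root: "1 + \<i> * \<eta> * \<alpha> + \<gamma> * \<alpha>^2 = 0"
  defines "G \<equiv> resolv N \<eta> H"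
  shows "tr N (mmul N (mmul N (\<lambda>i j. cx (H i j)) G) (toepdev N G \<alpha>)) + \<gamma> * \<alpha> * tr N (mmul N G (toepdev N G \<alpha>))
    = - (of_nat N * cx (defect N G \<alpha>)) / \<alpha>"
proof -
  let ?HG = "mmul N (\<lambda>i j. cx (H i j)) G" and ?B = "toepdev N G \<alpha>"
  have a0: "\<alpha> \<noteq> 0" using root by auto
  have sG: "G i j = G j i" for i j unfolding G_def using sH eta by (intro resolv_sym) auto
  have c: "\<i> * \<eta> + \<gamma> * \<alpha> = - 1 / \<alpha>"
    using root a0 by (simp add: field_simps power2_eq_square add_eq_0_iff)
  have e: "?HG i k + \<gamma> * \<alpha> * G i k = (- 1 / \<alpha>) * (G i k - (if i = k then \<alpha> else 0))" if "i < N" "k < N" for i k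
  proof -
    have "?HG i k = idm i k + \<i> * \<eta> * G i k" unfolding G_def using sH eta that by (intro resolv_eq) auto
    then have "?HG i k + \<gamma> * \<alpha> * G i k = idm i k + (\<i> * \<eta> + \<gamma> * \<alpha>) * G i k" by (simp add: algebra_simps)
    then show ?thesis unfolding c using a0 by (simp add: field_simps)
  qed
  have "tr N (mmul N ?HG ?B) + \<gamma> * \<alpha> * tr N (mmul N G ?B) = (\<Sum>i<N. \<Sum>k<N. (?HG i k + \<gamma> * \<alpha> * G i k) * ?B k i)"
    unfolding tr_def mmul_def[of N _ ?B] by (simp add: distrib_right sum.distrib sum_distrib_left mult.assoc)
  also have "\<dots> = (\<Sum>i<N. \<Sum>k<N. (- 1 / \<alpha>) * ((G i k - (if i = k then \<alpha> else 0)) * ?B k i))"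
    by (intro sum.cong refl) (simp only: e lessThan_iff mult.assoc[symmetric])
  also have "\<dots> = (- 1 / \<alpha>) * tr N (mmul N (\<lambda>i j. G i j - (if i = j then \<alpha> else 0)) ?B)"
    unfolding tr_def mmul_def by (simp only: sum_distrib_left)
  finally show ?thesis unfolding tr_toepdev[OF N sG] by simp
qed

context gaussian_matrix begin

lemma integrable_defect:
  assumes "N > 0" "\<eta> > 0" shows "integrable M (\<lambda>\<omega>. defect N (Gm N \<eta> \<omega>) \<alpha>)"
proof (rule integrable_const_bound)
  show "AE \<omega> in M. norm (defect N (Gm N \<eta> \<omega>) \<alpha>) \<le> (\<Sum>m\<in>{-int N<..<int N}. (real N * (1 / \<eta>) + cmod \<alpha>)^2)"
    using defect_bound[OF assms(1), of "Gm N \<eta> _" "1 / \<eta>" \<alpha>] Gm_facts(3)[OF assms(2)] defect_nonneg by simp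
  show "(\<lambda>\<omega>. defect N (Gm N \<eta> \<omega>) \<alpha>) \<in> borel_measurable M" by (intro defect_measurable Gm_measurable)
qed

text \<open>Taking the mean of the exact identity \<open>id\<close> below removes \<open>T\<close>
  and leaves \<open>EJ / |\<alpha>|\<close> bounded by small errors plus
  \<open>(\<gamma> / \<eta>) EJ\<close>. As \<open>|\<alpha>| \<le> 1 / \<eta>\<close>, the
  remaining coefficient of \<open>EJ\<close> is
  \<open>\<delta> = \<eta> - \<gamma> / \<eta>\<close>, positive by the gap.\<close>

lemma expected_defect:
  fixes \<alpha> :: complex
  assumes sp: "spectral_split \<nu> f D" and um: "uniform_marginals (acpart f) \<gamma>" and eta: "\<eta> > 0" and gap: "\<gamma> < \<eta>^2"
    and al: "cmod \<alpha> \<le> 1 / \<eta>" and root: "1 + \<i> * \<eta> * \<alpha> + \<gamma> * \<alpha>^2 = 0"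
  shows "(\<lambda>N. \<integral>\<omega>. defect N (Gm N \<eta> \<omega>) \<alpha> \<partial>M) \<longlonglongrightarrow> 0"
proof (rule tendstoI)
  fix e :: real assume e: "e > 0"
  interpret sp: spectral_split \<nu> f D by (rule sp)
  have a0: "\<alpha> \<noteq> 0" using root by auto
  define \<delta> where "\<delta> = \<eta> - \<gamma> / \<eta>"
  have d: "\<delta> > 0" using gap eta by (simp add: \<delta>_def field_simps power2_eq_square)
  \<comment> \<open>Two errors of size at most \<open>e1\<close> are incurred, one from the kernel
    estimate and one from \<open>c N\<close>; two thirds of \<open>\<delta> * e\<close> leave strict
    room.\<close>
  define e1 where "e1 = \<delta> * e / 3"
  have e1: "e1 > 0" using d e by (simp add: e1_def)
  obtain P r N0 where K: "\<And>N. N \<ge> N0 \<Longrightarrow> N > 0 \<and> opb N 1 (P N) \<and> hsq N (\<lambda>i j. idm i j - P N i j) \<le> r \<and>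
    (\<forall>G \<alpha>. opb N (1 / \<eta>) G \<longrightarrow> (\<forall>i j. G i j = G j i) \<longrightarrow> cmod \<alpha> \<le> 1 / \<eta> \<longrightarrow>
      cmod ((\<integral>z. ibpkernel N G \<alpha> (P N) (fst z) (snd z) \<partial>\<nu>)
        - cx \<gamma> * \<alpha> * (tr N (mmul N G (toepdev N G \<alpha>)) / of_nat N)) \<le> \<gamma> / \<eta> * defect N G \<alpha> + e1)"
    using sp.kernel_estimate[OF um eta e1] by blast
  \<comment> \<open>The cost of replacing \<open>P\<close> by the identity in the trace:
    \<open>r\<close> bounds the squared Hilbert-Schmidt norm of the difference, and
    \<open>4 / \<eta>^2\<close> comes from the operator norm bound \<open>2 / \<eta>\<close> of the
    test matrix.\<close>
  define c where "c N = (r + 4 / \<eta>^2) / 2 / sqrt (real N)" for N :: nat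
  have "c \<longlonglongrightarrow> 0" unfolding c_def[abs_def]
    by (intro tendsto_divide_0[OF tendsto_const] filterlim_at_top_imp_at_infinity filterlim_compose[OF sqrt_at_top filterlim_real_sequentially])
  then have ev: "eventually (\<lambda>N. c N < e1) sequentially" using e1 by (rule order_tendstoD(2))
  show "eventually (\<lambda>N. dist (\<integral>\<omega>. defect N (Gm N \<eta> \<omega>) \<alpha> \<partial>M) 0 < e) sequentially"
    using ev eventually_ge_at_top[of N0]
  proof eventually_elim
    case (elim N)
    have N: "N > 0" and P: "opb N 1 (P N)" and hs: "hsq N (\<lambda>i j. idm i j - P N i j) \<le> r" using K[OF elim(2)] by blast+
    define G where "G \<omega> = Gm N \<eta> \<omega>" for \<omega>
    define B where "B \<omega> = toepdev N (G \<omega>) \<alpha>" for \<omega>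
    define A where "A \<omega> = mmul N (mmul N (\<lambda>i j. cx (Hmat N (\<lambda>p. W p \<omega>) i j)) (G \<omega>)) (B \<omega>)" for \<omega>
    define J where "J \<omega> = defect N (G \<omega>) \<alpha>" for \<omega>
    define \<kappa> where "\<kappa> \<omega> = (\<integral>z. ibpkernel N (G \<omega>) \<alpha> (P N) (fst z) (snd z) \<partial>\<nu>)" for \<omega>
    define t where "t \<omega> = cx \<gamma> * \<alpha> * (tr N (mmul N (G \<omega>) (B \<omega>)) / of_nat N)" for \<omega>
    define T where "T \<omega> = tr N (mmul N (P N) (A \<omega>)) / of_nat N + \<kappa> \<omega>" for \<omega>
    define q where "q \<omega> = tr N (mmul N (\<lambda>i j. idm i j - P N i j) (A \<omega>)) / of_nat N" for \<omega>
    have iT: "integrable M T" and eT: "(\<integral>\<omega>. T \<omega> \<partial>M) = 0"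
      using trace_ibp[OF N eta, of "P N" \<alpha>] unfolding T_def[abs_def] A_def B_def G_def \<kappa>_def by auto
    have iJ: "integrable M J" unfolding J_def[abs_def] G_def by (rule integrable_defect[OF N eta])
    have Gf: "opb N (1 / \<eta>) (G \<omega>)" "\<And>i j. G \<omega> i j = G \<omega> j i" for \<omega>
      unfolding G_def using Gm_facts[OF eta] by auto
    have kt: "cmod (\<kappa> \<omega> - t \<omega>) \<le> \<gamma> / \<eta> * J \<omega> + e1" for \<omega>
      using K[OF elim(2)] Gf al unfolding \<kappa>_def t_def J_def B_def by blast
    have qb: "cmod (q \<omega>) \<le> c N" for \<omega>
    proof -
      have "hsq N (A \<omega>) \<le> 1^2 * hsq N (B \<omega>)"
        unfolding A_def G_def Gm_def by (rule hsq_mmul[OF mmul_resolv_opb]) (use Hmat_sym eta in auto)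
      moreover have "hsq N (B \<omega>) \<le> of_nat N * (2 / \<eta>)^2"
        unfolding B_def by (rule hsq_opb[OF opb_toepdev[OF N eta Gf al P]])
      ultimately have hA: "hsq N (A \<omega>) \<le> real N * (2 / \<eta>)^2" by simp
      have sN: "sqrt (real N) > 0" "sqrt (real N) * sqrt (real N) = real N" using N by auto
      have "cmod (tr N (mmul N (\<lambda>i j. idm i j - P N i j) (A \<omega>))) \<le> (sqrt (real N) * hsq N (\<lambda>i j. idm i j - P N i j) + hsq N (A \<omega>) / sqrt (real N)) / 2"
        by (rule tr_mmul_le[OF sN(1)])
      also have "\<dots> \<le> (sqrt (real N) * r + real N * (2 / \<eta>)^2 / sqrt (real N)) / 2"
        using hs hA sN by (intro divide_right_mono add_mono mult_left_mono) auto
      also have "\<dots> = real N * c N"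
      proof -
        have gen: "(s * r + n * (2 / \<eta>)^2 / s) / 2 = n * ((r + 4 / \<eta>^2) / 2 / s)" if "s > 0" "s * s = n" for s n :: real
          using that(1) unfolding that(2)[symmetric] by (simp add: field_simps power_divide)
        show ?thesis unfolding c_def by (rule gen[OF sN])
      qed
      finally show ?thesis unfolding q_def norm_divide using N by (simp add: field_simps)
    qed
    have id: "- cx (J \<omega>) / \<alpha> - T \<omega> = q \<omega> - (\<kappa> \<omega> - t \<omega>)" for \<omega>
    proof -
      have "tr N (A \<omega>) + \<gamma> * \<alpha> * tr N (mmul N (G \<omega>) (B \<omega>)) = - (of_nat N * cx (J \<omega>)) / \<alpha>"
        unfolding A_def B_def J_def G_def Gm_def
        by (rule tr_mmul_resolvent_toepdev[OF N eta Hmat_sym root])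
      then have "(tr N (A \<omega>) + \<gamma> * \<alpha> * tr N (mmul N (G \<omega>) (B \<omega>))) / of_nat N = - cx (J \<omega>) / \<alpha>"
        using N by simp
      moreover have "tr N (mmul N (\<lambda>i j. idm i j - P N i j) (A \<omega>)) = tr N (A \<omega>) - tr N (mmul N (P N) (A \<omega>))"
        unfolding tr_def mmul_def[of N _ "A \<omega>"] left_diff_distrib sum_subtractf
        by (simp add: if_distrib[of "\<lambda>x. x * _"] cong: if_cong)
      moreover have "(a + g * b) / n = j \<Longrightarrow> q = a - p \<Longrightarrow> j - (p / n + k) = q / n - (k - g * (b / n))"
        for a b g n j q p k :: complex by (auto simp: add_divide_distrib diff_divide_distrib)
      ultimately show ?thesis unfolding q_def T_def t_def by blast
    qed
    define EJ where "EJ = (\<integral>\<omega>. J \<omega> \<partial>M)"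
    have J0: "EJ \<ge> 0" unfolding EJ_def J_def by (intro integral_nonneg_AE AE_I2 defect_nonneg)
    have iJa: "integrable M (\<lambda>\<omega>. - cx (J \<omega>) / \<alpha>)" using iJ by (intro integrable_divide_zero impI integrable_minus integrable_of_real)
    have eJa: "(\<integral>\<omega>. - cx (J \<omega>) / \<alpha> \<partial>M) = - cx EJ / \<alpha>"
      unfolding EJ_def by simp
    have iR: "integrable M (\<lambda>\<omega>. - cx (J \<omega>) / \<alpha> - T \<omega>)" by (rule Bochner_Integration.integrable_diff[OF iJa iT])
    have "\<eta> * EJ \<le> EJ / cmod \<alpha>"
    proof -
      have "cmod \<alpha> * \<eta> \<le> 1" using al eta by (simp add: field_simps)
      then have "cmod \<alpha> * \<eta> * EJ \<le> 1 * EJ" using J0 by (intro mult_right_mono)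
      then show ?thesis using a0 by (simp add: field_simps)
    qed
    also have "EJ / cmod \<alpha> = cmod (\<integral>\<omega>. - cx (J \<omega>) / \<alpha> - T \<omega> \<partial>M)"
      unfolding Bochner_Integration.integral_diff[OF iJa iT] eT eJa using J0 by (simp add: norm_divide)
    also have "\<dots> \<le> (\<integral>\<omega>. (c N + e1) + \<gamma> / \<eta> * J \<omega> \<partial>M)"
    proof (rule order_trans[OF integral_norm_bound integral_mono])
      show "integrable M (\<lambda>\<omega>. norm (- cx (J \<omega>) / \<alpha> - T \<omega>))" using iR by (rule integrable_norm)
      show "integrable M (\<lambda>\<omega>. (c N + e1) + \<gamma> / \<eta> * J \<omega>)" using iJ by simp
      fix \<omega>
      have "cmod (q \<omega> - (\<kappa> \<omega> - t \<omega>)) \<le> c N + (\<gamma> / \<eta> * J \<omega> + e1)"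
        by (rule order_trans[OF norm_triangle_ineq4 add_mono[OF qb kt]])
      then show "norm (- cx (J \<omega>) / \<alpha> - T \<omega>) \<le> (c N + e1) + \<gamma> / \<eta> * J \<omega>" unfolding id by simp
    qed
    also have "\<dots> = (c N + e1) + \<gamma> / \<eta> * EJ"
      unfolding EJ_def using iJ by (simp add: prob_space)
    finally have "\<delta> * EJ \<le> c N + e1" unfolding \<delta>_def left_diff_distrib by linarith
    also have "\<dots> < \<delta> * e" using elim(1) e1 e1_def by simp
    finally have "EJ < e" using d by simp
    then show ?case using J0 unfolding EJ_def J_def G_def by simp
  qed
qed

end

section \<open>Identification of the limit\<close>

lemma closed_box_integral:
  fixes g :: "real \<times> real \<Rightarrow> 'b::{banach, second_countable_topology}"
  assumes [measurable]: "g \<in> borel_measurable borel"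
  shows "(\<integral>z. indicator ({-pi..pi} \<times> {-pi..pi}) z *\<^sub>R g z \<partial>lborel) = (\<integral>z. g z \<partial>boxm)"
proof -
  have 0: "emeasure (lborel :: (real \<times> real) measure) ({-pi} \<times> UNIV) = 0" "emeasure (lborel :: (real \<times> real) measure) (UNIV \<times> {-pi}) = 0"
    unfolding lborel_prod[symmetric] by (subst lborel.emeasure_pair_measure_Times; simp)+
  have "AE z in lborel. z \<notin> {-pi} \<times> (UNIV :: real set)" "AE z in lborel. z \<notin> (UNIV :: real set) \<times> {-pi}"
    by (rule AE_not_in; rule null_setsI[OF 0(1)]; simp add: borel_prod[symmetric]; measurable)
       (rule AE_not_in; rule null_setsI[OF 0(2)]; simp add: borel_prod[symmetric]; measurable)
  then have ae: "AE z in lborel. indicator ({-pi..pi} \<times> {-pi..pi}) z *\<^sub>R g z = indicator spec_box z *\<^sub>R g z"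
    by eventually_elim (auto simp: indicator_def spec_box_def)
  have [measurable]: "{-pi..pi} \<times> {-pi..pi} \<in> sets (borel :: (real \<times> real) measure)"
    by (intro borel_closed closed_Times) auto
  show ?thesis unfolding integral_boxm(1)[OF assms]
    by (rule integral_cong_AE[OF _ _ ae]) measurable
qed

text \<open>The two normalisations differ by a nonzero constant, which is harmless because the
  orthogonality relations are homogeneous.\<close>

lemma dcoef_eq_fcoef:
  assumes f: "\<And>z. 0 \<le> f z" "f \<in> borel_measurable borel"
  shows "dcoef f k l = cx (1 / (2 * sqrt 2 * pi) * (4 * pi^2)) * fcoef (\<lambda>z. sqrt (f z + f (snd z, fst z))) k l"
proof -
  note [measurable] = f(2)
  define g where "g z = cis (- (real_of_int k * fst z + real_of_int l * snd z)) * cx (sqrt (f z + f (snd z, fst z)))" for z :: "real \<times> real"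
  have "(\<lambda>z. cis (- (real_of_int k * fst z + real_of_int l * snd z))) \<in> borel_measurable (borel :: (real \<times> real) measure)"
    by (intro borel_measurable_continuous_onI continuous_intros)
  then have gm: "g \<in> borel_measurable borel"
    unfolding g_def[abs_def] by (intro borel_measurable_times) auto
  have "dcoef f k l = cx (1 / (2 * sqrt 2 * pi)) * (\<integral>z. indicator ({-pi..pi} \<times> {-pi..pi}) z *\<^sub>R g z \<partial>lborel)"
    unfolding dcoef_def g_def by simp
  also have "\<dots> = cx (1 / (2 * sqrt 2 * pi)) * (\<integral>z. g z \<partial>boxm)"
    unfolding closed_box_integral[OF gm] ..
  also have "(\<integral>z. g z \<partial>boxm) = cx (4 * pi^2) * fcoef (\<lambda>z. sqrt (f z + f (snd z, fst z))) k l"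
    unfolding fcoef_def g_def by simp
  finally show ?thesis by (simp only: of_real_mult mult.assoc)
qed

text \<open>The relations are applied to the square root \<open>s\<close> of \<open>f\<close> plus
  its transpose, so they concern the first marginal of this sum. Undoing the transposition turns it
  into the sum of both marginals of \<open>f\<close>, which is what the two characters integrate;
  the frequency 0 gives the mass \<open>2 * L1_norm_box f\<close>.\<close>

lemma uniform_marginals_acpart:
  fixes A :: "nat \<Rightarrow> int set"
  assumes sp: "spectral_split \<nu> f D" and sym: "AE z in lborel. z \<in> obox \<longrightarrow> f (- z) = f z"
    and A: "\<And>n. n \<ge> 1 \<Longrightarrow> finite (A n)" "\<And>n. n \<ge> 1 \<Longrightarrow> A n \<subseteq> A (Suc n)" "(\<Union>n\<in>{1..}. A n) = UNIV"
    and orth: "\<And>j n. j \<noteq> 0 \<Longrightarrow> n \<ge> 1 \<Longrightarrow>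
           (\<Sum>k\<in>A n. \<Sum>l\<in>A n. if j + k \<in> A n then dcoef f k l * dcoef f (j + k) l else 0) = 0"
  shows "uniform_marginals (acpart f) (2 * L1_norm_box f)"
proof -
  interpret sp: spectral_split \<nu> f D by (rule sp)
  note f = sp.f0 sp.fm
  note [measurable] = f(2)
  define h where "h z = f z + f (snd z, fst z)" for z
  define s where "s z = sqrt (h z)" for z
  have h0: "0 \<le> h z" for z unfolding h_def using f(1) by (intro add_nonneg_nonneg)
  have hm[measurable]: "h \<in> borel_measurable borel" unfolding h_def by measurable
  have fs: "integrable boxm (\<lambda>z. f (snd z, fst z))" by (rule boxm_swap(2)[OF f(2) sp.integrable_f])
  have ih: "integrable boxm h" unfolding h_def by (intro Bochner_Integration.integrable_add sp.integrable_f fs)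
  have ss: "(s z)^2 = h z" for z using h0 by (simp add: s_def)
  have sm: "s \<in> borel_measurable borel" unfolding s_def by measurable
  have om[measurable]: "obox \<in> sets borel" using open_obox by simp
  have symb: "AE z in boxm. s (- z) = s z"
  proof -
    have "AE z in distr lborel borel (\<lambda>z. (snd z, fst z)). z \<in> obox \<longrightarrow> f (- z) = f z"
      unfolding lborel_swap by (rule sym)
    then have sw: "AE z in lborel. (snd z, fst z) \<in> obox \<longrightarrow> f (- (snd z, fst z)) = f (snd z, fst z)"
      by (rule AE_distrD[rotated]) simp
    have "AE z in lborel. z \<in> obox \<longrightarrow> s (- z) = s z"
      using sym sw by eventually_elim (auto simp: s_def h_def obox_def)
    then have "AE z in boxm. z \<in> obox \<longrightarrow> s (- z) = s z" unfolding AE_boxm by eventually_elim simp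
    then show ?thesis using AE_boxm_obox by eventually_elim simp
  qed
  define c where "c = cx (1 / (2 * sqrt 2 * pi) * (4 * pi^2))"
  have c0: "c \<noteq> 0" unfolding c_def of_real_eq_0_iff by simp
  have dc: "dcoef f k l = c * fcoef s k l" for k l
    unfolding c_def s_def h_def by (rule dcoef_eq_fcoef[OF f])
  have orth': "(\<Sum>k\<in>A n. \<Sum>l\<in>A n. if j + k \<in> A n then fcoef s k l * fcoef s (j + k) l else 0) = 0"
    if "j \<noteq> 0" "n \<ge> 1" for j n
  proof -
    have "(c * c) * (\<Sum>k\<in>A n. \<Sum>l\<in>A n. if j + k \<in> A n then fcoef s k l * fcoef s (j + k) l else 0)
      = (\<Sum>k\<in>A n. \<Sum>l\<in>A n. if j + k \<in> A n then dcoef f k l * dcoef f (j + k) l else 0)"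
      unfolding sum_distrib_left dc by (intro sum.cong refl) (simp add: mult_ac)
    then show ?thesis using orth[OF that] c0 by simp
  qed
  have fo: "(\<integral>z. cx (h z) * cis (real_of_int j * fst z) \<partial>boxm) = 0" if "j \<noteq> 0" for j
    using fourier_square_orthogonal[OF sm _ _ symb A orth'[OF that]] h0 ih unfolding ss by (simp add: s_def)
  have cm[measurable]: "(\<lambda>z::real\<times>real. cis (real_of_int j * fst z)) \<in> borel_measurable borel"
    "(\<lambda>z::real\<times>real. cis (real_of_int j * snd z)) \<in> borel_measurable borel" for j
    by (intro borel_measurable_continuous_onI continuous_intros)+
  have marg: "(\<integral>z. cis (real_of_int j * fst z) + cis (real_of_int j * snd z) \<partial>acpart f)
     = (\<integral>z. cx (h z) * cis (real_of_int j * fst z) \<partial>boxm)" for j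
  proof -
    have g: "(\<lambda>z::real\<times>real. cis (real_of_int j * fst z) + cis (real_of_int j * snd z)) \<in> borel_measurable borel" by measurable
    have i1: "integrable boxm (\<lambda>z. cx (f z) * cis (real_of_int j * fst z))"
      by (rule Bochner_Integration.integrable_bound[OF sp.integrable_f]) (auto simp: norm_mult measurable_cong_sets[OF sets_boxm refl])
    have m2: "(\<lambda>z. cx (f z) * cis (real_of_int j * snd z)) \<in> borel_measurable borel" by measurable
    have i2: "integrable boxm (\<lambda>z. cx (f z) * cis (real_of_int j * snd z))"
      by (rule Bochner_Integration.integrable_bound[OF sp.integrable_f]) (auto simp: norm_mult measurable_cong_sets[OF sets_boxm refl])
    have i3: "integrable boxm (\<lambda>z. cx (f (snd z, fst z)) * cis (real_of_int j * fst z))"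
      using boxm_swap(2)[OF m2 i2] by simp
    have "(\<integral>z. cis (real_of_int j * fst z) + cis (real_of_int j * snd z) \<partial>acpart f)
      = (\<integral>z. cx (f z) * cis (real_of_int j * fst z) + cx (f z) * cis (real_of_int j * snd z) \<partial>boxm)"
      unfolding integral_acpart(1)[OF f g] by (simp add: scaleR_conv_of_real distrib_left)
    also have "\<dots> = (\<integral>z. cx (f z) * cis (real_of_int j * fst z) \<partial>boxm) + (\<integral>z. cx (f (snd z, fst z)) * cis (real_of_int j * fst z) \<partial>boxm)"
      unfolding Bochner_Integration.integral_add[OF i1 i2] boxm_swap(1)[OF m2] by simp
    also have "\<dots> = (\<integral>z. cx (h z) * cis (real_of_int j * fst z) \<partial>boxm)"
      unfolding Bochner_Integration.integral_add[OF i1 i3, symmetric] h_def by (simp add: distrib_right)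
    finally show ?thesis .
  qed
  have mass: "(\<integral>z. cx (h z) * cis (real_of_int 0 * fst z) \<partial>boxm) = cx (2 * L1_norm_box f)"
  proof -
    have "(\<integral>z. h z \<partial>boxm) = (\<integral>z. f z \<partial>boxm) + (\<integral>z. f (snd z, fst z) \<partial>boxm)"
      unfolding h_def by (rule Bochner_Integration.integral_add[OF sp.integrable_f fs])
    also have "\<dots> = 2 * L1_norm_box f"
      unfolding boxm_swap(1)[OF f(2), symmetric] L1_norm_box_def closed_box_integral[OF f(2), symmetric] by simp
    finally show ?thesis by simp
  qed
  interpret fin: finite_measure "acpart f" by (rule sp.finite_acpart)
  show ?thesis
  proof
    show "sets (acpart f) = sets borel" by (rule sets_acpart)
    fix j :: int
    show "(\<integral>z. cis (real_of_int j * fst z) + cis (real_of_int j * snd z) \<partial>acpart f) = (if j = 0 then cx (2 * L1_norm_box f) else 0)"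
      unfolding marg using fo[of j] mass by (cases "j = 0") simp_all
  qed
qed

text \<open>A Chebyshev argument: if \<open>c\<close> and \<open>c'\<close> differed, then at each
  \<open>\<omega>\<close> either \<open>Y\<close> is farther than \<open>d\<close> from
  \<open>c\<close>, or it is at least \<open>d\<close> away from \<open>c'\<close> and
  \<open>J\<close> is at least \<open>d^2\<close>. Hence 1 is at most a probability plus the mean of
  \<open>J\<close> over \<open>d^2\<close>, both tending to 0.\<close>

lemma (in prob_space) limit_in_probability_unique:
  fixes Y J :: "nat \<Rightarrow> 'a \<Rightarrow> real"
  assumes Y: "\<And>N. N > 0 \<Longrightarrow> Y N \<in> borel_measurable M" and J: "\<And>N. N > 0 \<Longrightarrow> integrable M (J N)"
    and le: "\<And>N \<omega>. N > 0 \<Longrightarrow> (Y N \<omega> - c')^2 \<le> J N \<omega>"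
    and lim: "(\<lambda>N. \<integral>\<omega>. J N \<omega> \<partial>M) \<longlonglongrightarrow> 0"
    and pr: "\<And>\<epsilon>. \<epsilon> > 0 \<Longrightarrow> (\<lambda>N. measure M {\<omega>\<in>space M. \<bar>Y N \<omega> - c\<bar> > \<epsilon>}) \<longlonglongrightarrow> 0"
  shows "c = c'"
proof (rule ccontr)
  assume ne: "c \<noteq> c'"
  define d where "d = \<bar>c - c'\<bar> / 2"
  have d: "d > 0" using ne by (simp add: d_def)
  let ?E = "\<lambda>N. {\<omega>\<in>space M. \<bar>Y N \<omega> - c\<bar> > d}"
  have "1 \<le> measure M (?E N) + (\<integral>\<omega>. J N \<omega> \<partial>M) / d^2" if N: "N > 0" for N
  proof -
    note [measurable] = Y[OF N]
    have E: "?E N \<in> sets M" by measurable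
    have i: "integrable M (indicat_real (?E N))"
      by (rule integrable_const_bound[where B=1]) (use E in \<open>auto simp: indicator_def\<close>)
    have "(1::real) = (\<integral>\<omega>. 1 \<partial>M)" by (simp add: prob_space)
    also have "\<dots> \<le> (\<integral>\<omega>. indicat_real (?E N) \<omega> + J N \<omega> / d^2 \<partial>M)"
    proof (rule integral_mono)
      show "integrable M (\<lambda>\<omega>. indicat_real (?E N) \<omega> + J N \<omega> / d^2)" using i J[OF N] by auto
      fix \<omega> assume w: "\<omega> \<in> space M"
      have J0: "0 \<le> J N \<omega> / d^2" using le[OF N, of \<omega>] zero_le_power2 order_trans by (intro divide_nonneg_nonneg) (blast, simp)
      show "1 \<le> indicat_real (?E N) \<omega> + J N \<omega> / d^2"
      proof (cases "\<omega> \<in> ?E N")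
        case True
        then show ?thesis using J0 by simp
      next
        case False
        then have "\<bar>Y N \<omega> - c\<bar> \<le> d" using w by simp
        moreover have "\<bar>c - c'\<bar> \<le> \<bar>Y N \<omega> - c'\<bar> + \<bar>Y N \<omega> - c\<bar>"
          using abs_triangle_ineq4[of "Y N \<omega> - c'" "Y N \<omega> - c"] by simp
        ultimately have "d \<le> \<bar>Y N \<omega> - c'\<bar>" unfolding d_def by simp
        then have "d^2 \<le> (Y N \<omega> - c')^2" using d by (simp add: abs_le_square_iff[symmetric])
        then have "1 \<le> J N \<omega> / d^2" using le[OF N, of \<omega>] d by (simp add: le_divide_eq)
        then show ?thesis by (simp add: indicator_def)
      qed
    qed simp
    also have "\<dots> = measure M (?E N) + (\<integral>\<omega>. J N \<omega> \<partial>M) / d^2"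
      using i J[OF N] E by simp
    finally show ?thesis .
  qed
  then have "eventually (\<lambda>N. 1 \<le> measure M (?E N) + (\<integral>\<omega>. J N \<omega> \<partial>M) / d^2) sequentially"
    unfolding eventually_sequentially by (intro exI[of _ 1]) auto
  moreover have "(\<lambda>N. measure M (?E N) + (\<integral>\<omega>. J N \<omega> \<partial>M) / d^2) \<longlonglongrightarrow> 0 + 0 / d^2"
    using d by (intro tendsto_add pr tendsto_divide lim tendsto_const) auto
  ultimately have "1 \<le> 0 + 0 / d^2" by (rule tendsto_lowerbound[OF _ _ trivial_limit_sequentially, rotated])
  then show False by simp
qed

text \<open>The real and imaginary parts of \<open>1 / (t - \<i> \<eta>)\<close> are the two
  kernels. Besides linking the spectrum to the trace, this supplies the measurability of the
  empirical integrals.\<close>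

lemma (in gaussian_matrix) esd_eq_trace:
  assumes N: "N > 0" and eta: "\<eta> > 0"
  shows "esd_W X N \<omega> (\<lambda>x. x / (x^2 + \<eta>^2)) = Re ((\<Sum>i<N. Gm N \<eta> \<omega> i i) / of_nat N)"
    and "esd_W X N \<omega> (\<lambda>x. \<eta> / (x^2 + \<eta>^2)) = Im ((\<Sum>i<N. Gm N \<eta> \<omega> i i) / of_nat N)"
proof -
  define B where "B = mat N N (\<lambda>(i, j). Hmat N (\<lambda>p. W p \<omega>) i j)"
  have "Hmat N (\<lambda>p. W p \<omega>) i j = (1 / sqrt (real N)) * W (i, j) \<omega>" for i j
    unfolding Hmat_def W_swap[of j i] by simp
  then have B: "(1 / sqrt (real N)) \<cdot>\<^sub>m W_mat X N \<omega> = B"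
    unfolding B_def W_mat_def by (intro eq_matI) (auto simp: W_def)
  have t: "(\<Sum>i<N. Gm N \<eta> \<omega> i i) = (\<Sum>t\<in>{t. poly (char_poly B) t = 0}. of_nat (order t (char_poly B)) / (cx t - \<i> * \<eta>))"
    unfolding Gm_def B_def by (rule trace_resolv[OF Hmat_sym eta])
  have r: "Re (of_nat n / (cx t - \<i> * \<eta>)) = real n * (t / (t^2 + \<eta>^2))"
    and i: "Im (of_nat n / (cx t - \<i> * \<eta>)) = real n * (\<eta> / (t^2 + \<eta>^2))" for n :: nat and t
    by (simp_all add: Re_divide Im_divide power2_eq_square)
  have n: "Re (x / of_nat N) = Re x / real N" "Im (x / of_nat N) = Im x / real N" for x
    by (simp_all add: Re_divide_of_nat Im_divide_of_nat)
  show "esd_W X N \<omega> (\<lambda>x. x / (x^2 + \<eta>^2)) = Re ((\<Sum>i<N. Gm N \<eta> \<omega> i i) / of_nat N)"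
    "esd_W X N \<omega> (\<lambda>x. \<eta> / (x^2 + \<eta>^2)) = Im ((\<Sum>i<N. Gm N \<eta> \<omega> i i) / of_nat N)"
    unfolding esd_W_def esd_integral_def B n t Re_sum Im_sum r i by simp_all
qed

text \<open>The value of the semicircle transform at \<open>\<i> \<eta>\<close>, written with the
  root in the denominator: this covers \<open>\<gamma> = 0\<close>, and
  \<open>r \<ge> \<eta>\<close> gives the bound \<open>1 / \<eta>\<close> directly.\<close>

lemma semicircle_root:
  assumes g: "\<gamma> \<ge> 0" and eta: "\<eta> > 0"
  defines "\<alpha> \<equiv> \<i> * cx (2 / (\<eta> + sqrt (\<eta>^2 + 4 * \<gamma>)))"
  shows "1 + \<i> * \<eta> * \<alpha> + \<gamma> * \<alpha>^2 = 0" and "cmod \<alpha> \<le> 1 / \<eta>"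
proof -
  define r where "r = sqrt (\<eta>^2 + 4 * \<gamma>)"
  define b where "b = 2 / (\<eta> + r)"
  have r: "r^2 = \<eta>^2 + 4 * \<gamma>" "r \<ge> \<eta>" unfolding r_def using g eta by (auto intro: real_le_rsqrt)
  have p: "\<eta> + r > 0" using r eta by simp
  have g4: "4 * \<gamma> = (r - \<eta>) * (r + \<eta>)" using r(1) by (simp add: power2_eq_square algebra_simps)
  have "x \<noteq> 0 \<Longrightarrow> 2 / x * x = 2" for x :: real by simp
  then have bp: "b * (\<eta> + r) = 2" unfolding b_def using p by (metis less_irrefl)
  have "4 * (\<gamma> * b^2) = (4 * \<gamma>) * b^2" by simp
  also have "\<dots> = (r - \<eta>) * b * (b * (\<eta> + r))" unfolding g4 power2_eq_square by (simp only: mult_ac add.commute)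
  finally have "4 * (\<gamma> * b^2) = (r - \<eta>) * b * (b * (\<eta> + r))" .
  then have "4 * (\<gamma> * b^2) = 2 * (r * b) - 2 * (\<eta> * b)" unfolding bp by (simp add: algebra_simps)
  moreover have "\<eta> * b + r * b = 2" using bp by (simp add: algebra_simps)
  ultimately have q: "1 - \<eta> * b - \<gamma> * b^2 = 0" by linarith
  have a: "\<alpha> = \<i> * cx b" unfolding \<alpha>_def b_def r_def ..
  have "1 + \<i> * \<eta> * \<alpha> + \<gamma> * \<alpha>^2 = cx (1 - \<eta> * b - \<gamma> * b^2)"
    unfolding a by (simp add: power_mult_distrib complex_eq_iff)
  then show "1 + \<i> * \<eta> * \<alpha> + \<gamma> * \<alpha>^2 = 0" unfolding q by simp
  have "\<bar>b\<bar> = b" using p by (simp add: b_def)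
  then show "cmod \<alpha> \<le> 1 / \<eta>" unfolding a norm_mult norm_of_real using p r(2) eta by (simp add: b_def field_simps)
qed

lemma real_distribution_WSL:
  assumes "\<gamma> \<ge> 0"
  shows "real_distribution (WSL \<gamma>)"
proof -
  have s: "sets (WSL \<gamma>) = sets borel" by (simp add: WSL_def)
  then have sp: "space (WSL \<gamma>) = UNIV" using sets_eq_imp_space_eq[of "WSL \<gamma>" borel] by simp
  have "emeasure (WSL \<gamma>) UNIV = 1"
    using WSL_integrals(1)[of \<gamma>] assms by (cases "\<gamma> = 0") (auto simp: WSL_def)
  then have "prob_space (WSL \<gamma>)" by (intro prob_spaceI) (simp add: sp)
  then show ?thesis using s by (simp add: real_distribution_def real_distribution_axioms_def)
qed

lemma WSL_stieltjes:
  assumes "\<gamma> \<ge> 0" "\<eta> > 0"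
  shows "(\<integral>x. x / (x^2 + \<eta>^2) \<partial>WSL \<gamma>) = 0"
    and "(\<integral>x. \<eta> / (x^2 + \<eta>^2) \<partial>WSL \<gamma>) = 2 / (\<eta> + sqrt (\<eta>^2 + 4 * \<gamma>))"
proof -
  have "(\<integral>x. x / (x^2 + \<eta>^2) \<partial>WSL \<gamma>) = 0 \<and> (\<integral>x. \<eta> / (x^2 + \<eta>^2) \<partial>WSL \<gamma>) = 2 / (\<eta> + sqrt (\<eta>^2 + 4 * \<gamma>))"
  proof (cases "\<gamma> = 0")
    case True
    have m: "(\<lambda>x. x / (x^2 + \<eta>^2)) \<in> borel_measurable borel" "(\<lambda>x. \<eta> / (x^2 + \<eta>^2)) \<in> borel_measurable borel" by measurable
    show ?thesis using True assms(2) m by (simp add: WSL_def integral_return power2_eq_square)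
  next
    case False
    then show ?thesis using WSL_integrals[of \<gamma>] assms by simp
  qed
  then show "(\<integral>x. x / (x^2 + \<eta>^2) \<partial>WSL \<gamma>) = 0" "(\<integral>x. \<eta> / (x^2 + \<eta>^2) \<partial>WSL \<gamma>) = 2 / (\<eta> + sqrt (\<eta>^2 + 4 * \<gamma>))" by auto
qed

lemma poisson_kernels_bounded:
  assumes "\<eta> > 0"
  shows "continuous_on UNIV (\<lambda>x::real. x / (x^2 + \<eta>^2))" "bounded (range (\<lambda>x::real. x / (x^2 + \<eta>^2)))"
    and "continuous_on UNIV (\<lambda>x::real. \<eta> / (x^2 + \<eta>^2))" "bounded (range (\<lambda>x::real. \<eta> / (x^2 + \<eta>^2)))"
proof -
  have p: "x^2 + \<eta>^2 > 0" for x using assms by (simp add: add_nonneg_pos)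
  then have nz: "x^2 + \<eta>^2 \<noteq> 0" for x by (metis less_irrefl)
  show "continuous_on UNIV (\<lambda>x::real. x / (x^2 + \<eta>^2))" "continuous_on UNIV (\<lambda>x::real. \<eta> / (x^2 + \<eta>^2))"
    by (intro continuous_intros ballI nz)+
  have "\<bar>x / (x^2 + \<eta>^2)\<bar> \<le> 1 / \<eta>" for x
  proof -
    have "0 \<le> (\<bar>x\<bar> - \<eta>)^2 + \<bar>x\<bar> * \<eta>" using assms by simp
    then have "\<bar>x\<bar> * \<eta> \<le> x^2 + \<eta>^2" by (simp add: power2_eq_square algebra_simps)
    then show ?thesis using p[of x] assms by (simp add: field_simps)
  qed
  then show "bounded (range (\<lambda>x::real. x / (x^2 + \<eta>^2)))" unfolding bounded_iff by (intro exI[of _ "1 / \<eta>"]) simp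
  have "\<bar>\<eta> / (x^2 + \<eta>^2)\<bar> \<le> 1 / \<eta>" for x
    using p[of x] assms by (simp add: field_simps power2_eq_square)
  then show "bounded (range (\<lambda>x::real. \<eta> / (x^2 + \<eta>^2)))" unfolding bounded_iff by (intro exI[of _ "1 / \<eta>"]) simp
qed

text \<open>The kernels are bounded and continuous, so their empirical integrals converge in
  probability to the integrals against \<open>\<mu>\<close>; the vanishing mean defect forces these
  to be the real and imaginary part of \<open>\<alpha>\<close>, which is purely imaginary.\<close>

lemma (in gaussian_matrix) stieltjes_of_limit:
  assumes sp: "spectral_split \<nu> f D" and um: "uniform_marginals (acpart f) \<gamma>" and eta: "\<eta> > 0" and gap: "\<gamma> < \<eta>^2"
    and lim: "esd_weak_limit_in_prob M X \<mu>"
  shows "(\<integral>x. x / (x^2 + \<eta>^2) \<partial>\<mu>) = 0" and "(\<integral>x. \<eta> / (x^2 + \<eta>^2) \<partial>\<mu>) = 2 / (\<eta> + sqrt (\<eta>^2 + 4 * \<gamma>))"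
proof -
  interpret um: uniform_marginals "acpart f" \<gamma> by (rule um)
  define \<alpha> where "\<alpha> = \<i> * cx (2 / (\<eta> + sqrt (\<eta>^2 + 4 * \<gamma>)))"
  note root = semicircle_root[OF um.gamma_nonneg eta, folded \<alpha>_def]
  define J where "J N \<omega> = defect N (Gm N \<eta> \<omega>) \<alpha>" for N \<omega>
  define \<tau> where "\<tau> N \<omega> = (\<Sum>i<N. Gm N \<eta> \<omega> i i) / of_nat N" for N \<omega>
  have J: "(\<lambda>N. \<integral>\<omega>. J N \<omega> \<partial>M) \<longlonglongrightarrow> 0"
    unfolding J_def by (rule expected_defect[OF sp um eta gap root(2,1)])
  have iJ: "integrable M (J N)" if "N > 0" for N unfolding J_def[abs_def] by (rule integrable_defect[OF that eta])
  have tJ: "(cmod (\<tau> N \<omega> - \<alpha>))^2 \<le> J N \<omega>" if "N > 0" for N \<omega>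
    unfolding \<tau>_def J_def by (rule trace_le_defect[OF that])
  have tm: "\<tau> N \<in> borel_measurable M" for N
    unfolding \<tau>_def[abs_def] by (intro borel_measurable_divide borel_measurable_sum borel_measurable_const Gm_measurable)
  have reim: "(Re w)^2 \<le> (cmod w)^2" "(Im w)^2 \<le> (cmod w)^2" for w by (simp_all add: cmod_power2)
  note pk = poisson_kernels_bounded[OF eta]
  show "(\<integral>x. x / (x^2 + \<eta>^2) \<partial>\<mu>) = 0"
  proof (rule limit_in_probability_unique[where Y="\<lambda>N \<omega>. esd_W X N \<omega> (\<lambda>x. x / (x^2 + \<eta>^2))" and J=J])
    fix N :: nat assume N: "N > 0"
    note e = esd_eq_trace(1)[OF N eta, folded \<tau>_def]
    show "(\<lambda>\<omega>. esd_W X N \<omega> (\<lambda>x. x / (x^2 + \<eta>^2))) \<in> borel_measurable M" unfolding e using tm by measurable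
    show "(esd_W X N \<omega> (\<lambda>x. x / (x^2 + \<eta>^2)) - 0)^2 \<le> J N \<omega>" for \<omega>
      using order_trans[OF reim(1) tJ[OF N, of \<omega>]] unfolding e by (simp add: \<alpha>_def)
  qed (use iJ J lim[unfolded esd_weak_limit_in_prob_def, rule_format, OF pk(1,2)] in auto)
  show "(\<integral>x. \<eta> / (x^2 + \<eta>^2) \<partial>\<mu>) = 2 / (\<eta> + sqrt (\<eta>^2 + 4 * \<gamma>))"
  proof (rule limit_in_probability_unique[where Y="\<lambda>N \<omega>. esd_W X N \<omega> (\<lambda>x. \<eta> / (x^2 + \<eta>^2))" and J=J])
    fix N :: nat assume N: "N > 0"
    note e = esd_eq_trace(2)[OF N eta, folded \<tau>_def]
    show "(\<lambda>\<omega>. esd_W X N \<omega> (\<lambda>x. \<eta> / (x^2 + \<eta>^2))) \<in> borel_measurable M" unfolding e using tm by measurable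
    have "Im \<alpha> = 2 / (\<eta> + sqrt (\<eta>^2 + 4 * \<gamma>))" unfolding \<alpha>_def by (simp del: of_real_divide)
    then show "(esd_W X N \<omega> (\<lambda>x. \<eta> / (x^2 + \<eta>^2)) - 2 / (\<eta> + sqrt (\<eta>^2 + 4 * \<gamma>)))^2 \<le> J N \<omega>" for \<omega>
      using order_trans[OF reim(2) tJ[OF N, of \<omega>]] unfolding e by simp
  qed (use iJ J lim[unfolded esd_weak_limit_in_prob_def, rule_format, OF pk(3,4)] in auto)
qed

theorem theoremt4:
  fixes M :: "'a measure" and X :: "int \<Rightarrow> int \<Rightarrow> 'a \<Rightarrow> real"
    and \<nu> :: "(real \<times> real) measure" and f :: "real \<times> real \<Rightarrow> real"
    and \<mu> :: "real measure" and A :: "nat \<Rightarrow> int set"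
  assumes "prob_space M"
    and "\<And>j k. X j k \<in> borel_measurable M"
    and "centered_gaussian_field M X"
    and "prob_space.expectation M (\<lambda>\<omega>. (X 0 0 \<omega>)^2) > 0"
    and "is_spectral_measure M X \<nu>"
    and "ac_plus_discrete \<nu> f"
    and "prob_space \<mu>" and "sets \<mu> = sets borel"
    and "esd_weak_limit_in_prob M X \<mu>"
    and "\<And>n. n \<ge> 1 \<Longrightarrow> finite (A n)"
    and "\<And>n. n \<ge> 1 \<Longrightarrow> A n \<subseteq> A (Suc n)"
    and "(\<Union>n\<in>{1..}. A n) = UNIV"
    and "\<And>j n. j \<noteq> 0 \<Longrightarrow> n \<ge> 1 \<Longrightarrow>
           (\<Sum>k\<in>A n. \<Sum>l\<in>A n. if j + k \<in> A n then dcoef f k l * dcoef f (j + k) l else 0) = 0"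
  shows "\<mu> = WSL (2 * L1_norm_box f)"
proof -
  define \<gamma> where "\<gamma> = 2 * L1_norm_box f"
  interpret gaussian_matrix M X \<nu>
    using assms(1,2,3,5) by (simp add: gaussian_matrix_def gaussian_matrix_axioms_def)
  obtain \<nu>d D where D: "sets \<nu>d = sets borel" "countable D" "emeasure \<nu>d (UNIV - D) = 0"
    and dec: "\<And>A. A \<in> sets borel \<Longrightarrow> emeasure \<nu> A =
            (\<integral>\<^sup>+z. ennreal (f z) * indicator (A \<inter> spec_box) z \<partial>lborel) + emeasure \<nu>d A"
    and f: "\<And>z. 0 \<le> f z" "f \<in> borel_measurable borel"
    using assms(6) unfolding ac_plus_discrete_def by blast
  have Dm: "D \<in> sets borel" by (rule sets.countable[OF _ D(2)]) simp
  interpret nu: finite_measure \<nu> by (rule finite_nu)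
  have sp: "spectral_split \<nu> f D"
  proof
    show "sets \<nu> = sets borel" by (rule sets_spec)
    fix B :: "(real \<times> real) set" assume B: "B \<in> sets borel" "B \<inter> D = {}"
    have "emeasure \<nu>d B \<le> emeasure \<nu>d (UNIV - D)"
      using B Dm by (intro emeasure_mono) (auto simp: D(1))
    then show "emeasure \<nu> B = (\<integral>\<^sup>+z. ennreal (f z) * indicator (B \<inter> spec_box) z \<partial>lborel)"
      using dec[OF B(1)] D(3) by simp
  qed (use f D(2) in auto)
  \<comment> \<open>The Fourier coefficients of \<open>\<nu>\<close> are covariances of a real
    field, hence real; this is what makes the density even.\<close>
  have "\<exists>r. (\<integral>z. cis (real_of_int u * fst z + real_of_int v * snd z) \<partial>\<nu>) = complex_of_real r" for u v
    using cov_X[of 0 0 u v] by (intro exI) (simp add: eq_commute)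
  then have "AE z in lborel. z \<in> obox \<longrightarrow> f (- z) = f z"
    using assms(5) unfolding is_spectral_measure_def
    by (intro density_symmetric[OF finite_nu sets_spec _ _ f D(2,1,3) dec]) auto
  then have um: "uniform_marginals (acpart f) \<gamma>"
    unfolding \<gamma>_def by (rule uniform_marginals_acpart[OF sp _ assms(10-13)])
  interpret um: uniform_marginals "acpart f" \<gamma> by (rule um)
  have g0: "\<gamma> \<ge> 0" by (rule um.gamma_nonneg)
  have mu: "real_distribution \<mu>" using assms(7,8) by (simp add: real_distribution_def real_distribution_axioms_def)
  \<comment> \<open>Beyond \<open>sqrt \<gamma>\<close> the condition for the vanishing of the
    defect holds, and agreement of the transforms on this half-line identifies the law.\<close>
  have big: "\<gamma> < \<eta>\<^sup>2" "\<eta> > 0" if "\<eta> > sqrt \<gamma>" for \<eta>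
  proof -
    show "\<eta> > 0" using that real_sqrt_ge_zero[OF g0] by linarith
    have "(sqrt \<gamma>)\<^sup>2 < \<eta>\<^sup>2" using that g0 by (intro power_strict_mono) auto
    then show "\<gamma> < \<eta>\<^sup>2" using g0 by simp
  qed
  have "\<mu> = WSL \<gamma>"
  proof (rule stieltjes_unique[OF mu real_distribution_WSL[OF g0], where ?\<eta>0.0 = "sqrt \<gamma>"])
    fix \<eta> assume e: "\<eta> > sqrt \<gamma>"
    note L = stieltjes_of_limit[OF sp um big(2)[OF e] big(1)[OF e] assms(9)]
    note R = WSL_stieltjes[OF g0 big(2)[OF e]]
    show "(\<integral>x. x / (x\<^sup>2 + \<eta>\<^sup>2) \<partial>\<mu>) = (\<integral>x. x / (x\<^sup>2 + \<eta>\<^sup>2) \<partial>WSL \<gamma>)" unfolding L(1) R(1) ..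
    show "(\<integral>x. \<eta> / (x\<^sup>2 + \<eta>\<^sup>2) \<partial>\<mu>) = (\<integral>x. \<eta> / (x\<^sup>2 + \<eta>\<^sup>2) \<partial>WSL \<gamma>)" unfolding L(2) R(2) ..
  qed
  then show ?thesis unfolding \<gamma>_def .
qed

end
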